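(* Let $p\ge 4$, let $\ell_1,\dots,\ell_{p-1}$ be integers, and consider a multilateral (polygon) of order $p$ in the plane with side lengths $\rho_1,\dots,\rho_p>0$. Then $$\int_0^\infty J_{\ell_1+\cdots+\ell_{p-1}}(\rho_p\lambda)\prod_{k=1}^{p-1}J_{\ell_k}(\rho_k\lambda)\,\lambda\,d\lambda=\frac{1}{\pi^{p-2}}\int_0^\pi\!\cdots\!\int_0^\pi\frac{\cos(\ell_1\alpha_2-\ell_2\alpha_1)}{\rho_2\kappa_1\sin\alpha_1}\,\chi(\triangle|\rho_1,\rho_2,\kappa_1)\prod_{k=2}^{p-2}\cos\Big(\alpha_{k+1}\sum_{j=1}^k\ell_j-\ell_{k+1}\beta_{k-1,2}\Big)\prod_{k=2}^{p-2}d\beta_{k-1,2},$$ where the integral on the right is over $(\beta_{1,2},\dots,\beta_{p-3,2})\in(0,\pi)^{p-3}$, and the diagonals $\kappa_k$ and angles $\alpha_k$ are the functions of $\rho_1,\dots,\rho_p$ and $\beta_{1,2},\dots,\beta_{p-3,2}$ given by the splitting of the multilateral into triangles.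
   Context: $J_\ell$ is the Bessel function of the first kind of integer order $\ell$. Integrals over $\lambda\in(0,\infty)$ are understood as improper integrals. $\chi(\triangle|a,b,c)$ equals $1$ if $a,b,c$ are the side lengths of a triangle and $0$ otherwise; the integrand on the right is $0$ where $\chi=0$. A multilateral of order $p$ has $p$ sides of lengths $\rho_1,\dots,\rho_p$ and is split by diagonals of lengths $\kappa_1,\dots,\kappa_{p-3}$ into $p-2$ triangles; put $\kappa_{p-2}=\rho_p$. The triangles have sides $(\rho_1,\rho_2,\kappa_1)$ and $(\kappa_k,\rho_{k+2},\kappa_{k+1})$ for $1\le k\le p-3$. In the triangle $(\rho_1,\rho_2,\kappa_1)$, the angles $\alpha_1,\alpha_2$ are opposite to $\rho_1,\rho_2$ respectively. In the triangle $(\kappa_k,\rho_{k+2},\kappa_{k+1})$, the angle $\alpha_{k+2}$ is opposite to $\rho_{k+2}$ and $\beta_{k,2}\in(0,\pi)$ is opposite to $\kappa_k$. Thus, given $\rho_1,\dots,\rho_p$ and $\beta_{1,2},\dots,\beta_{p-3,2}\in(0,\pi)$, the diagonals are determined recursively (downward in $k$) by $\kappa_{p-2}=\rho_p$, $\kappa_k=\sqrt{\rho_{k+2}^2+\kappa_{k+1}^2-2\rho_{k+2}\kappa_{k+1}\cos\beta_{k,2}}$ for $k=p-3,\dots,1$; then $\alpha_{k+2}\in(0,\pi)$ is given by $\cos\alpha_{k+2}=(\kappa_k^2+\kappa_{k+1}^2-\rho_{k+2}^2)/(2\kappa_k\kappa_{k+1})$, and, when $(\rho_1,\rho_2,\kappa_1)$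 forms a triangle, $\cos\alpha_1=(\rho_2^2+\kappa_1^2-\rho_1^2)/(2\rho_2\kappa_1)$, $\cos\alpha_2=(\rho_1^2+\kappa_1^2-\rho_2^2)/(2\rho_1\kappa_1)$.
   Formalization: For p = 4 the integral on the right is assumed to exist (it diverges, e.g., when all sides are 1 and all orders 0, as does the Bessel integral); the multilateral is assumed to admit a splitting into nondegenerate triangles. *)

theory Defs
  imports "HOL-Analysis.Analysis"
begin

text \<open>Bessel function of the first kind of integer order. For negative order the terms with
  \<open>m < - l\<close> vanish because \<^const>\<open>rGamma\<close> is zero at the poles of \<^const>\<open>Gamma\<close>.\<close>

definition bessel_J :: "int \<Rightarrow> real \<Rightarrow> real" where
  "bessel_J l x =
     (\<Sum>m. (-1) ^ m / fact m * rGamma (of_int (int m + l + 1)) * (x / 2) powi (2 * int m + l))"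

definition has_improper_integral :: "(real \<Rightarrow> real) \<Rightarrow> real \<Rightarrow> bool" where
  "has_improper_integral f I \<longleftrightarrow>
     (\<forall>L>0. f integrable_on {0..L}) \<and> ((\<lambda>L. integral {0..L} f) \<longlongrightarrow> I) at_top"

text \<open>Triangles are nondegenerate, matching angles in the open interval from \<open>0\<close> to \<open>\<pi>\<close>.\<close>

definition is_triangle :: "real \<Rightarrow> real \<Rightarrow> real \<Rightarrow> bool" where
  "is_triangle a b c \<longleftrightarrow>
     0 < a \<and> 0 < b \<and> 0 < c \<and> a < b + c \<and> b < a + c \<and> c < a + b"

definition tri_angle :: "real \<Rightarrow> real \<Rightarrow> real \<Rightarrow> real" where
  \<comment> \<open>the angle opposite to the first side \<open>a\<close>\<close>
  "tri_angle a b c = arccos ((b\<^sup>2 + c\<^sup>2 - a\<^sup>2) / (2 * b * c))"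

text \<open>Sides \<open>\<rho> 1, \<dots>, \<rho> p\<close> and diagonals \<open>\<kappa> 1, \<dots>, \<kappa> (p - 3)\<close>; the last side is
  also counted as \<open>\<kappa> (p - 2)\<close>.\<close>

definition is_multilateral :: "nat \<Rightarrow> (nat \<Rightarrow> real) \<Rightarrow> (nat \<Rightarrow> real) \<Rightarrow> bool" where
  "is_multilateral p \<rho> \<kappa> \<longleftrightarrow>
     \<kappa> (p - 2) = \<rho> p \<and> is_triangle (\<rho> 1) (\<rho> 2) (\<kappa> 1) \<and>
     (\<forall>k\<in>{1..p - 3}. is_triangle (\<kappa> k) (\<rho> (k + 2)) (\<kappa> (k + 1)))"

text \<open>The diagonals and angles as functions of the sides and of the angles
  \<open>\<beta> k = \<beta>\<^bsub>k,2\<^esub>\<close>, \<open>k = 1, \<dots>, p - 3\<close>.\<close>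

function diag :: "nat \<Rightarrow> (nat \<Rightarrow> real) \<Rightarrow> (nat \<Rightarrow> real) \<Rightarrow> nat \<Rightarrow> real" where
  "diag p \<rho> \<beta> k =
     (if p - 2 \<le> k then \<rho> p
      else sqrt ((\<rho> (k + 2))\<^sup>2 + (diag p \<rho> \<beta> (k + 1))\<^sup>2
                   - 2 * \<rho> (k + 2) * diag p \<rho> \<beta> (k + 1) * cos (\<beta> k)))"
  by pat_completeness auto
termination
  by (relation "Wellfounded.measure (\<lambda>(p :: nat, \<rho>, \<beta>, k). p - 2 - k)") auto

declare diag.simps [simp del]

definition alpha :: "nat \<Rightarrow> (nat \<Rightarrow> real) \<Rightarrow> (nat \<Rightarrow> real) \<Rightarrow> nat \<Rightarrow> real" where
  "alpha p \<rho> \<beta> j =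
     (if j = 1 then tri_angle (\<rho> 1) (\<rho> 2) (diag p \<rho> \<beta> 1)
      else if j = 2 then tri_angle (\<rho> 2) (\<rho> 1) (diag p \<rho> \<beta> 1)
      else tri_angle (\<rho> j) (diag p \<rho> \<beta> (j - 2)) (diag p \<rho> \<beta> (j - 1)))"

definition bessel_integrand :: "nat \<Rightarrow> (nat \<Rightarrow> int) \<Rightarrow> (nat \<Rightarrow> real) \<Rightarrow> real \<Rightarrow> real" where
  "bessel_integrand p l \<rho> x =
     bessel_J (\<Sum>k=1..p - 1. l k) (\<rho> p * x) * (\<Prod>k=1..p - 1. bessel_J (l k) (\<rho> k * x)) * x"

text \<open>For \<open>p = 4\<close> this function need not be integrable: when all sides are \<open>1\<close> and all
  orders \<open>0\<close> it grows like \<open>1 / \<beta> 1\<close> at \<open>0\<close>, and the Bessel integral diverges as well.\<close>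

definition multilateral_integrand ::
    "nat \<Rightarrow> (nat \<Rightarrow> int) \<Rightarrow> (nat \<Rightarrow> real) \<Rightarrow> (nat \<Rightarrow> real) \<Rightarrow> real" where
  "multilateral_integrand p l \<rho> \<beta> =
     (if is_triangle (\<rho> 1) (\<rho> 2) (diag p \<rho> \<beta> 1)
      then cos (l 1 * alpha p \<rho> \<beta> 2 - l 2 * alpha p \<rho> \<beta> 1)
             / (\<rho> 2 * diag p \<rho> \<beta> 1 * sin (alpha p \<rho> \<beta> 1))
           * (\<Prod>k=2..p - 2.
               cos (alpha p \<rho> \<beta> (k + 1) * (\<Sum>j=1..k. l j) - l (k + 1) * \<beta> (k - 1)))
      else 0)"

definition angle_measure :: "nat \<Rightarrow> (nat \<Rightarrow> real) measure" where
  "angle_measure p = Pi\<^sub>M {1..p - 3} (\<lambda>_. lborel)"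

definition angle_domain :: "nat \<Rightarrow> (nat \<Rightarrow> real) set" where
  "angle_domain p = (\<Pi>\<^sub>E k\<in>{1..p - 3}. {0<..<pi})"

end

theory Submission
  imports Defs "HOL-Probability.Probability"
begin

text \<open>Each product of two Bessel functions is an average of one Bessel function over the third
  side of a triangle (Graf's addition theorem). Applied \<open>p - 3\<close> times this turns
  \<open>J\<^bsub>l\<^sub>1+\<dots>\<^esub>(\<rho>\<^sub>p x)\<close> and the factors \<open>3, \<dots>, p - 1\<close> into an average of \<open>J\<^bsub>l\<^sub>1+l\<^sub>2\<^esub>(\<kappa>\<^sub>1 x)\<close>
  over the angles \<open>\<beta>\<close>, and it remains to integrate the product of three Bessel functions with
  arguments \<open>\<rho>\<^sub>1 x\<close>, \<open>\<rho>\<^sub>2 x\<close>, \<open>\<kappa>\<^sub>1 x\<close>. That integral converges only conditionally, so it is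
  regularised by \<open>exp (- \<epsilon> x\<^sup>2)\<close>. Now all integrals may be exchanged, and the same addition theorem
  expresses the regularised integral through the planar heat kernel at time \<open>\<epsilon>\<close>, averaged over
  the triangles with sides \<open>\<rho>\<^sub>1\<close> and \<open>\<rho>\<^sub>2\<close>; as \<open>\<epsilon> \<rightarrow> 0\<close> it concentrates on those whose third side is
  \<open>\<kappa>\<^sub>1\<close>, which gives the integrand on the right.

  The limit is exchanged with the integral over \<open>\<beta>\<close> by dominated convergence: uniformly in \<open>\<epsilon>\<close>
  the averages are bounded by \<open>\<kappa>\<^sub>1\<^sup>-\<^sup>1\<^sup>/\<^sup>2 \<bar>\<kappa>\<^sub>1 - q\<bar>\<^sup>-\<^sup>1\<^sup>/\<^sup>2\<close> with \<open>q = \<rho>\<^sub>1 + \<rho>\<^sub>2\<close> and \<open>q = \<bar>\<rho>\<^sub>1 - \<rho>\<^sub>2\<bar>\<close>. For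
  \<open>p \<ge> 5\<close> this bound is integrable because it is dominated by limits of the case of order \<open>0\<close> with other
  sides, where Fatou's lemma and the absolute convergence of the Bessel integral apply. For \<open>p = 4\<close>
  it is integrable unless the extreme values of \<open>\<kappa>\<^sub>1\<close> in the two triangles coincide, and this is what
  the integrability hypothesis excludes, up to one case in which the cosine cancels the singularity.
  Finally, the integrand being \<open>O(1 / x)\<close>, Karamata's Tauberian theorem removes the regularisation.\<close>

section \<open>Integral representation of the Bessel functions\<close>

text \<open>Every Bessel factor decays like the power -1/2 of \<open>x\<close>, so \<open>p\<close>
  of them against the weight \<open>x\<close> leave the power \<open>1 - p / 2\<close>: absolutely
  integrable from \<open>p = 5\<close> on, borderline for \<open>p = 4\<close>. The regularisation
  is Gaussian because the Gaussian mean of \<open>bessel_J 0\<close> is again a Gaussian, hence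
  positive. For order 0 all means are therefore nonnegative, their bounds carry over to the other
  orders, and Fatou's lemma is available. For \<open>p = 4\<close> with sides
  \<open>a, b, c, e\<close> the diagonal \<open>s\<close> runs from \<open>\<bar>c - e\<bar>\<close>
  to \<open>c + e\<close>, and the limit density contains the inverse square root of the product of
  \<open>(a + b)^2 - s^2\<close> and \<open>s^2 - (a - b)^2\<close>. At a coincidence of extreme
  values one of these factors is of order \<open>t^2\<close> in the distance \<open>t\<close> of the
  angle from its end, so the density is of order \<open>1 / t\<close> unless the cosines tend to 0.
  In a degenerate triangle with positive sides all angles are 0 or \<pi> and the cosines tend to 1
  or -1. Only when the diagonal itself shrinks to 0, that is for \<open>a = b\<close> and
  \<open>c = e\<close>, do the base angles tend to a right angle, and then an odd
  \<open>l 1 + l 2\<close> makes the cosine vanish.\<close>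

lemma cis_int_mult_has_integral:
  fixes j :: int
  shows "((\<lambda>\<theta>. cis (of_int j * \<theta>)) has_integral (if j = 0 then 2 * pi else 0)) {-pi..pi}"
proof (cases "j = 0")
  case True
  have "((\<lambda>\<theta>::real. 1::complex) has_integral (2 * pi) *\<^sub>R 1) {-pi..pi}"
    using has_integral_const_real[of "1::complex" "-pi" pi] by simp
  then show ?thesis using True by (simp add: scaleR_conv_of_real)
next
  case False
  have "((\<lambda>\<theta>. cis (of_int j * \<theta>)) has_integral
      (cis (of_int j * pi) / (\<i> * of_int j) - cis (of_int j * (-pi)) / (\<i> * of_int j))) {-pi..pi}"
  proof (rule fundamental_theorem_of_calculus)
    fix \<theta> :: real
    have e: "exp (\<theta> *\<^sub>R (\<i> * of_int j)) = cis (of_int j * \<theta>)" for \<theta>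
      unfolding cis_conv_exp by (simp add: scaleR_conv_of_real mult_ac)
    have "((\<lambda>\<theta>. exp (\<theta> *\<^sub>R (\<i> * of_int j)) / (\<i> * of_int j)) has_vector_derivative
        (exp (\<theta> *\<^sub>R (\<i> * of_int j)) * (\<i> * of_int j)) / (\<i> * of_int j)) (at \<theta> within {-pi..pi})"
      by (intro has_vector_derivative_divide exp_scaleR_has_vector_derivative_right)
    then show "((\<lambda>\<theta>. cis (of_int j * \<theta>) / (\<i> * of_int j)) has_vector_derivative cis (of_int j * \<theta>)) (at \<theta> within {-pi..pi})"
      using False by (simp add: e)
  qed simp
  moreover have "cis (of_int j * pi) = cis (of_int j * (-pi))"
    by (simp add: complex_eq_iff sin_times_pi_eq_0)
  ultimately show ?thesis using False by simp
qed

text \<open>The part of degree \<open>n\<close> in \<open>x\<close> of the Fourier coefficient of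
  \<open>exp (\<i> x sin \<theta>)\<close> at frequency \<open>l\<close>: in the binomial expansion
  of \<open>(\<i> x sin \<theta>)^n\<close> the frequencies are \<open>n - 2 k\<close>. At most one
  summand is nonzero; the sum with a condition spares a case distinction on parity and sign.\<close>

definition bessel_coeff :: "int \<Rightarrow> real \<Rightarrow> nat \<Rightarrow> real" where
  "bessel_coeff l x n =
     (\<Sum>k\<le>n. if int n = 2 * int k + l then (x / 2) ^ n / fact n * real (n choose k) * (-1) ^ k else 0)"

lemma bessel_term_has_integral:
  "((\<lambda>\<theta>. (\<i> * x * sin \<theta>) ^ n / fact n * cis (- of_int l * \<theta>)) has_integral
     complex_of_real (2 * pi * bessel_coeff l x n)) {-pi..pi}"
proof -
  have expand: "(\<i> * x * sin \<theta>) ^ n / fact n * cis (- of_int l * \<theta>) =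
      (\<Sum>k\<le>n. complex_of_real ((x / 2) ^ n / fact n * real (n choose k) * (-1) ^ k)
         * cis (of_int (int n - 2 * int k - l) * \<theta>))" for \<theta> :: real
  proof -
    have "\<i> * x * sin \<theta> = complex_of_real (x / 2) * (- cis (- \<theta>) + cis \<theta>)"
      by (simp add: complex_eq_iff)
    then have "(\<i> * x * sin \<theta>) ^ n = complex_of_real (x / 2) ^ n * (- cis (- \<theta>) + cis \<theta>) ^ n"
      by (simp only: power_mult_distrib)
    also have "(- cis (- \<theta>) + cis \<theta>) ^ n =
        (\<Sum>k\<le>n. of_nat (n choose k) * (- cis (- \<theta>)) ^ k * cis \<theta> ^ (n - k))"
      by (rule binomial_ring)
    also have "\<dots> = (\<Sum>k\<le>n. of_nat (n choose k) * (-1) ^ k * cis (of_int (int n - 2 * int k) * \<theta>))"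
    proof (rule sum.cong)
      fix k assume k: "k \<in> {..n}"
      have "(- cis (- \<theta>)) ^ k * cis \<theta> ^ (n - k) = (-1) ^ k * (cis (- \<theta>) ^ k * cis \<theta> ^ (n - k))"
        by (subst power_minus) simp
      also have "cis (- \<theta>) ^ k * cis \<theta> ^ (n - k) = cis (of_int (int n - 2 * int k) * \<theta>)"
      proof -
        have "real k * - \<theta> + real (n - k) * \<theta> = of_int (int n - 2 * int k) * \<theta>"
          using k by (simp add: of_nat_diff algebra_simps)
        then show ?thesis by (simp only: Complex.DeMoivre cis_mult)
      qed
      finally show "of_nat (n choose k) * (- cis (- \<theta>)) ^ k * cis \<theta> ^ (n - k) =
          of_nat (n choose k) * (-1) ^ k * cis (of_int (int n - 2 * int k) * \<theta>)"
        by (simp add: mult.assoc)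
    qed simp
    finally have "(\<i> * x * sin \<theta>) ^ n / fact n * cis (- of_int l * \<theta>) =
       (\<Sum>k\<le>n. complex_of_real ((x / 2) ^ n / fact n * real (n choose k) * (-1) ^ k)
         * (cis (of_int (int n - 2 * int k) * \<theta>) * cis (- of_int l * \<theta>)))"
      by (simp add: sum_distrib_left sum_distrib_right mult_ac sum_divide_distrib)
    then show ?thesis by (simp add: cis_mult algebra_simps)
  qed
  have "((\<lambda>\<theta>. \<Sum>k\<le>n. complex_of_real ((x / 2) ^ n / fact n * real (n choose k) * (-1) ^ k)
         * cis (of_int (int n - 2 * int k - l) * \<theta>)) has_integral
      (\<Sum>k\<le>n. complex_of_real ((x / 2) ^ n / fact n * real (n choose k) * (-1) ^ k)
        * (if int n - 2 * int k - l = 0 then 2 * pi else 0))) {-pi..pi}"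
    by (intro has_integral_sum has_integral_mult_right cis_int_mult_has_integral) auto
  moreover have "(\<Sum>k\<le>n. complex_of_real ((x / 2) ^ n / fact n * real (n choose k) * (-1) ^ k)
        * (if int n - 2 * int k - l = 0 then 2 * pi else 0)) = complex_of_real (2 * pi * bessel_coeff l x n)"
    unfolding bessel_coeff_def
    by (auto simp: sum_distrib_left intro!: sum.cong)
  ultimately show ?thesis by (simp only: expand)
qed

lemma bessel_coeff_eq:
  assumes "int n = 2 * int k + l" "k \<le> n"
  shows "bessel_coeff l x n = (-1) ^ k / (fact k * fact (n - k)) * (x / 2) ^ n"
proof -
  have "bessel_coeff l x n = (\<Sum>j\<le>n. if j = k then (x / 2) ^ n / fact n * real (n choose k) * (-1) ^ k else 0)"
    unfolding bessel_coeff_def using assms by (intro sum.cong) auto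
  also have "\<dots> = (x / 2) ^ n / fact n * real (n choose k) * (-1) ^ k"
    using assms by simp
  also have "real (n choose k) = fact n / (fact k * fact (n - k))"
    using assms by (simp add: binomial_fact)
  finally show ?thesis by simp
qed

lemma rGamma_of_nat_Suc: "rGamma (1 + real n) = 1 / fact n"
  using Gamma_fact[of n, where ?'a=real] by (simp add: rGamma_inverse_Gamma field_simps)

text \<open>Only the indices \<open>n = 2 k + \<bar>l\<bar>\<close> carry a nonzero coefficient. For
  negative \<open>l\<close> the series of \<open>bessel_J\<close> effectively starts at
  \<open>- l\<close>, the earlier terms being killed by the zeros of \<open>rGamma\<close>, which is
  why both series are reindexed by \<open>j + N\<close> there.\<close>

lemma bessel_coeff_sums:
  assumes S: "bessel_coeff l x sums S"
  shows "bessel_J l x = S"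
proof (cases "l \<ge> 0")
  case True
  define N where "N = nat l"
  have l: "l = int N" using True by (simp add: N_def)
  have "(\<lambda>k. bessel_coeff l x (2 * k + N)) sums S"
    using S
  proof (subst sums_mono_reindex)
    show "bessel_coeff l x n = 0" if "n \<notin> range (\<lambda>k. 2 * k + N)" for n
      unfolding bessel_coeff_def
    proof (intro sum.neutral ballI)
      fix k assume "k \<in> {..n}"
      have "int n \<noteq> 2 * int k + l"
      proof
        assume "int n = 2 * int k + l"
        then have "n = 2 * k + N" by (simp add: l)
        then show False using that by blast
      qed
      then show "(if int n = 2 * int k + l then (x / 2) ^ n / fact n * real (n choose k) * (- 1) ^ k else 0) = 0"
        by simp
    qed
  qed (auto simp: strict_mono_def)
  moreover have "bessel_coeff l x (2 * k + N) =
     (-1) ^ k / fact k * rGamma (of_int (int k + l + 1)) * (x / 2) powi (2 * int k + l)" for k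
  proof -
    have e: "2 * int k + l = int (2 * k + N)" by (simp add: l)
    have "rGamma (real_of_int (int k + l + 1)) = 1 / fact (k + N)"
      using rGamma_of_nat_Suc[of "k + N"] by (simp add: l algebra_simps)
    moreover have "bessel_coeff l x (2 * k + N) = (-1) ^ k / (fact k * fact (k + N)) * (x / 2) ^ (2 * k + N)"
      using bessel_coeff_eq[of "2 * k + N" k l x] by (simp add: l)
    ultimately show ?thesis unfolding e power_int_of_nat by simp
  qed
  ultimately show ?thesis unfolding bessel_J_def by (simp add: sums_iff)
next
  case False
  define N where "N = nat (- l)"
  have l: "l = - int N" using False by (simp add: N_def)
  have coeff: "(\<lambda>j. bessel_coeff l x (2 * j + N)) sums S"
    using S
  proof (subst sums_mono_reindex)
    show "bessel_coeff l x n = 0" if "n \<notin> range (\<lambda>k. 2 * k + N)" for n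
      unfolding bessel_coeff_def
    proof (intro sum.neutral ballI)
      fix k assume k: "k \<in> {..n}"
      have "int n \<noteq> 2 * int k + l"
      proof
        assume *: "int n = 2 * int k + l"
        then have "n = 2 * (k - N) + N" "k \<ge> N" using k by (auto simp: l)
        then show False using that by blast
      qed
      then show "(if int n = 2 * int k + l then (x / 2) ^ n / fact n * real (n choose k) * (- 1) ^ k else 0) = 0"
        by simp
    qed
  qed (auto simp: strict_mono_def)
  let ?t = "\<lambda>k::nat. (-1) ^ k / fact k * rGamma (of_int (int k + l + 1)) * (x / 2) powi (2 * int k + l)"
  have "bessel_coeff l x (2 * j + N) = ?t (j + N)" for j
  proof -
    have e: "2 * int (j + N) + l = int (2 * j + N)" by (simp add: l)
    have "rGamma (real_of_int (int (j + N) + l + 1)) = 1 / fact j"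
      using rGamma_of_nat_Suc[of j] by (simp add: l algebra_simps)
    moreover have "bessel_coeff l x (2 * j + N) = (-1) ^ (j + N) / (fact (j + N) * fact j) * (x / 2) ^ (2 * j + N)"
      using bessel_coeff_eq[of "2 * j + N" "j + N" l x] by (simp add: l)
    ultimately show ?thesis unfolding e power_int_of_nat by simp
  qed
  then have "(\<lambda>j. ?t (j + N)) sums S" using coeff by simp
  then have "?t sums S"
  proof (subst (asm) sums_mono_reindex)
    show "?t n = 0" if "n \<notin> range (\<lambda>j. j + N)" for n
    proof -
      have "n < N" using that by (metis rangeI not_le le_add_diff_inverse2)
      then have "int n + l + 1 \<le> 0" by (simp add: l)
      then have "real_of_int (int n + l + 1) \<in> \<int>\<^sub>\<le>\<^sub>0" by (intro nonpos_Ints_of_int)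
      then have "rGamma (real_of_int (int n + l + 1)) = 0" by (simp only: rGamma_eq_zero_iff)
      then show ?thesis by (simp only: mult_zero_left mult_zero_right)
    qed
  qed (auto simp: strict_mono_def)
  then show ?thesis unfolding bessel_J_def by (simp add: sums_iff)
qed

text \<open>Bessel's integral. The exponential series in \<open>\<i> x sin \<theta>\<close> is
  majorised by that of \<open>\<bar>x\<bar>\<close>, so it may be integrated termwise. The
  summability that \<open>bessel_coeff_sums\<close> asks for is not shown beforehand: it is read off
  from the convergence of the partial integrals.\<close>

lemma bessel_J_has_integral:
  "((\<lambda>\<theta>. cis (x * sin \<theta> - of_int l * \<theta>)) has_integral complex_of_real (2 * pi * bessel_J l x)) {-pi..pi}"
proof -
  let ?f = "\<lambda>n \<theta>::real. (\<i> * x * sin \<theta>) ^ n / fact n * cis (- of_int l * \<theta>)"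
  let ?g = "\<lambda>\<theta>::real. cis (x * sin \<theta> - of_int l * \<theta>)"
  have "uniform_limit (cbox (-pi) pi) (\<lambda>N \<theta>. \<Sum>n<N. ?f n \<theta>) (\<lambda>\<theta>. \<Sum>n. ?f n \<theta>) sequentially"
  proof (rule Weierstrass_m_test)
    fix n and \<theta> :: real
    have "norm (?f n \<theta>) = (\<bar>x\<bar> * \<bar>sin \<theta>\<bar>) ^ n / fact n"
      by (simp add: norm_mult norm_divide norm_power)
    also have "\<dots> \<le> \<bar>x\<bar> ^ n / fact n"
      by (intro divide_right_mono power_mono mult_left_le) auto
    finally show "norm (?f n \<theta>) \<le> \<bar>x\<bar> ^ n / fact n" .
  next
    show "summable (\<lambda>n. \<bar>x\<bar> ^ n / fact n)"
      using summable_exp[of "\<bar>x\<bar>"] by (simp add: field_simps)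
  qed
  moreover have "(\<Sum>n. ?f n \<theta>) = ?g \<theta>" for \<theta>
  proof -
    have "(\<lambda>n. (\<i> * x * sin \<theta>) ^ n /\<^sub>R fact n) sums exp (\<i> * x * sin \<theta>)"
      by (rule exp_converges)
    then have "(\<lambda>n. (\<i> * x * sin \<theta>) ^ n /\<^sub>R fact n * cis (- of_int l * \<theta>)) sums (exp (\<i> * x * sin \<theta>) * cis (- of_int l * \<theta>))"
      by (rule sums_mult2)
    moreover have "exp (\<i> * x * sin \<theta>) * cis (- of_int l * \<theta>) = ?g \<theta>"
      unfolding cis_conv_exp by (simp add: exp_add[symmetric] algebra_simps)
    ultimately show ?thesis
      by (simp add: sums_iff scaleR_conv_of_real field_simps)
  qed
  ultimately have "uniform_limit (cbox (-pi) pi) (\<lambda>N \<theta>. \<Sum>n<N. ?f n \<theta>) ?g sequentially"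
    by simp
  then obtain I J where I: "\<And>N. ((\<lambda>\<theta>. \<Sum>n<N. ?f n \<theta>) has_integral I N) (cbox (-pi) pi)"
    and J: "(?g has_integral J) (cbox (-pi) pi)" and lim: "I \<longlonglongrightarrow> J"
    by (rule uniform_limit_integral_cbox) (auto intro!: continuous_intros)
  have I_eq: "I N = complex_of_real (2 * pi * (\<Sum>n<N. bessel_coeff l x n))" for N
  proof -
    have "((\<lambda>\<theta>. \<Sum>n<N. ?f n \<theta>) has_integral (\<Sum>n<N. complex_of_real (2 * pi * bessel_coeff l x n))) (cbox (-pi) pi)"
      unfolding cbox_interval by (intro has_integral_sum bessel_term_has_integral) auto
    with I[of N] have "I N = (\<Sum>n<N. complex_of_real (2 * pi * bessel_coeff l x n))"
      by (rule has_integral_unique)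
    then show ?thesis by (simp add: sum_distrib_left)
  qed
  have "(\<lambda>N. Re (I N) / (2 * pi)) \<longlonglongrightarrow> Re J / (2 * pi)"
    by (intro tendsto_intros lim) simp
  then have "bessel_coeff l x sums (Re J / (2 * pi))"
    unfolding sums_def by (simp add: I_eq)
  then have 1: "bessel_J l x = Re J / (2 * pi)" by (rule bessel_coeff_sums)
  have "(\<lambda>N. Im (I N)) \<longlonglongrightarrow> Im J"
    by (intro tendsto_intros lim)
  then have "Im J = 0" by (simp add: I_eq LIMSEQ_const_iff)
  with 1 have "J = complex_of_real (2 * pi * bessel_J l x)"
    by (simp add: complex_eq_iff)
  with J show ?thesis by (simp add: cbox_interval)
qed

section \<open>Products of two Bessel functions\<close>

lemma integral_symmetric_interval:
  fixes f :: "real \<Rightarrow> 'b::euclidean_space"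
  assumes "continuous_on {-a..a} f" "0 \<le> a"
  shows "integral {-a..a} f = integral {0..a} (\<lambda>t. f t + f (- t))"
proof -
  have c: "continuous_on {0..a} f" "continuous_on {-a..0} f"
    using assms by (auto intro: continuous_on_subset)
  have c': "continuous_on {0..a} (\<lambda>t. f (- t))"
    by (rule continuous_on_compose2[OF c(2)]) (auto intro!: continuous_intros)
  have "integral {-a..a} f = integral {-a..0} f + integral {0..a} f"
    using assms by (intro Henstock_Kurzweil_Integration.integral_combine[symmetric] integrable_continuous_real) auto
  also have "integral {-a..0} f = integral {0..a} (\<lambda>t. f (- t))"
    using Henstock_Kurzweil_Integration.integral_reflect_real[of a 0 "\<lambda>t. f (- t)"] by simp
  also have "integral {0..a} (\<lambda>t. f (- t)) + integral {0..a} f = integral {0..a} (\<lambda>t. f (- t) + f t)"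
    by (intro integral_add[symmetric] integrable_continuous_real c c')
  finally show ?thesis by (simp add: add.commute)
qed

lemma integral_periodic_shift:
  fixes f :: "real \<Rightarrow> complex"
  assumes cont: "continuous_on UNIV f" and per: "\<And>t. f (t + 2 * pi) = f t"
    and s: "0 \<le> s" "s \<le> 2 * pi"
  shows "integral {-pi..pi} (\<lambda>t. f (t + s)) = integral {-pi..pi} f"
proof -
  have c: "continuous_on S f" for S using cont by (rule continuous_on_subset) simp
  note i = integrable_continuous_real[OF c]
  have shift: "integral {x..y} (\<lambda>t. f (t + d)) = integral {x+d..y+d} f" for x y d
    using integral_shift_real_ivl[of "x + d" d "y + d" f] by simp
  have "integral {-pi..pi} (\<lambda>t. f (t + s)) = integral {-pi+s..pi+s} f"
    by (rule shift)
  also have "\<dots> = integral {-pi+s..pi} f + integral {pi..pi+s} f"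
    using s by (intro Henstock_Kurzweil_Integration.integral_combine[symmetric] i) auto
  also have "integral {pi..pi+s} f = integral {-pi..-pi+s} (\<lambda>t. f (t + 2 * pi))"
    using shift[of "-pi" "-pi+s" "2*pi"] by (simp add: algebra_simps)
  also have "\<dots> = integral {-pi..-pi+s} f" by (simp add: per)
  also have "integral {-pi+s..pi} f + integral {-pi..-pi+s} f = integral {-pi..pi} f"
    using s by (subst add.commute) (intro Henstock_Kurzweil_Integration.integral_combine i, auto)
  finally show ?thesis .
qed

section \<open>Real form, bound, continuity and reflection of Bessel's integral\<close>

lemma integral_complex_of_real:
  assumes "f integrable_on S"
  shows "integral S (\<lambda>x. complex_of_real (f x)) = complex_of_real (integral S f)"
  using integral_linear[OF assms bounded_linear_of_real] by (simp add: o_def)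

lemma bessel_J_integral:
  "integral {-pi..pi} (\<lambda>\<theta>. cis (x * sin \<theta> - of_int l * \<theta>)) = complex_of_real (2 * pi * bessel_J l x)"
  using bessel_J_has_integral by (rule integral_unique)

lemma bessel_J_integral_cos:
  "integral {0..pi} (\<lambda>\<theta>. cos (x * sin \<theta> - of_int l * \<theta>)) = pi * bessel_J l x"
proof -
  have "integral {-pi..pi} (\<lambda>\<theta>. cis (x * sin \<theta> - of_int l * \<theta>)) =
     integral {0..pi} (\<lambda>\<theta>. cis (x * sin \<theta> - of_int l * \<theta>) + cis (x * sin (-\<theta>) - of_int l * (-\<theta>)))"
    by (intro integral_symmetric_interval) (auto intro!: continuous_intros)
  also have "(\<lambda>\<theta>. cis (x * sin \<theta> - of_int l * \<theta>) + cis (x * sin (-\<theta>) - of_int l * (-\<theta>))) =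
      (\<lambda>\<theta>. complex_of_real (2 * cos (x * sin \<theta> - of_int l * \<theta>)))"
  proof
    fix \<theta>
    have "x * sin (-\<theta>) - of_int l * (-\<theta>) = - (x * sin \<theta> - of_int l * \<theta>)" by simp
    then show "cis (x * sin \<theta> - of_int l * \<theta>) + cis (x * sin (-\<theta>) - of_int l * (-\<theta>)) =
        complex_of_real (2 * cos (x * sin \<theta> - of_int l * \<theta>))"
      by (simp only: complex_eq_iff plus_complex.sel cis.sel cos_minus sin_minus Re_complex_of_real Im_complex_of_real)
        linarith
  qed
  also have "integral {0..pi} \<dots> = complex_of_real (integral {0..pi} (\<lambda>\<theta>. 2 * cos (x * sin \<theta> - of_int l * \<theta>)))"
    by (rule integral_complex_of_real) (auto intro!: integrable_continuous_real continuous_intros)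
  finally have "complex_of_real (2 * pi * bessel_J l x) =
      complex_of_real (integral {0..pi} (\<lambda>\<theta>. 2 * cos (x * sin \<theta> - of_int l * \<theta>)))"
    by (simp only: bessel_J_integral)
  then have "2 * pi * bessel_J l x = integral {0..pi} (\<lambda>\<theta>. 2 * cos (x * sin \<theta> - of_int l * \<theta>))"
    by (simp only: of_real_eq_iff)
  also have "\<dots> = 2 * integral {0..pi} (\<lambda>\<theta>. cos (x * sin \<theta> - of_int l * \<theta>))"
    by (rule integral_mult_right)
  finally show ?thesis by simp
qed

lemma abs_bessel_J_le_1: "\<bar>bessel_J l x\<bar> \<le> 1"
proof -
  have "norm (integral {0..pi} (\<lambda>\<theta>. cos (x * sin \<theta> - of_int l * \<theta>))) \<le> 1 * (pi - 0)"
    by (rule integral_bound) (auto intro!: continuous_intros)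
  then show ?thesis by (simp add: bessel_J_integral_cos abs_mult)
qed

lemma continuous_on_bessel_J: "continuous_on UNIV (bessel_J l)"
proof -
  have "continuous_on UNIV (\<lambda>x. integral (cbox 0 pi) (\<lambda>\<theta>. cos (x * sin \<theta> - of_int l * \<theta>)))"
    by (rule integral_continuous_on_param)
      (auto intro!: continuous_intros simp: case_prod_beta)
  then have "continuous_on UNIV (\<lambda>x. integral (cbox 0 pi) (\<lambda>\<theta>. cos (x * sin \<theta> - of_int l * \<theta>)) / pi)"
    by (intro continuous_intros) auto
  moreover have "(\<lambda>x. integral (cbox 0 pi) (\<lambda>\<theta>. cos (x * sin \<theta> - of_int l * \<theta>)) / pi) = bessel_J l"
    by (simp add: fun_eq_iff bessel_J_integral_cos del: cbox_interval flip: interval_cbox)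
  ultimately show ?thesis by (simp only:)
qed

lemma continuous_on_bessel_J' [continuous_intros]:
  "continuous_on S f \<Longrightarrow> continuous_on S (\<lambda>x. bessel_J l (f x))"
  by (rule continuous_on_compose2[OF continuous_on_bessel_J]) auto

lemma borel_measurable_bessel_J [measurable]: "bessel_J l \<in> borel_measurable borel"
  by (rule borel_measurable_continuous_onI) (rule continuous_on_bessel_J)

text \<open>The substitution of \<open>pi - t\<close> for the angle in Bessel's integral exchanges
  the orders \<open>l\<close> and \<open>- l\<close> and leaves the factor
  \<open>cos (l pi)\<close>.\<close>

lemma bessel_J_minus: "bessel_J (- l) x = (-1) powi l * bessel_J l x"
proof -
  let ?f = "\<lambda>\<theta>. cos (x * sin \<theta> - of_int (- l) * \<theta>)"
  have "pi * bessel_J (- l) x = integral {0..pi} ?f"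
    by (rule bessel_J_integral_cos[symmetric])
  also have "\<dots> = integral {-pi..0} (\<lambda>t. ?f (- t))"
    using Henstock_Kurzweil_Integration.integral_reflect_real[of pi 0 ?f] by simp
  also have "\<dots> = integral {0..pi} (\<lambda>t. ?f (pi - t))"
    using integral_shift_real_ivl[of 0 pi pi "\<lambda>t. ?f (pi - t)"] by simp
  also have "(\<lambda>t. ?f (pi - t)) = (\<lambda>t. (-1) powi l * cos (x * sin t - of_int l * t))"
  proof
    fix t
    have c: "cos (of_int l * pi) = (-1) powi l"
      by (cases l rule: int_cases2) (auto simp: power_int_minus simp flip: power_inverse)
    have "?f (pi - t) = cos ((x * sin t - of_int l * t) + of_int l * pi)"
      by (simp add: algebra_simps)
    also have "\<dots> = (-1) powi l * cos (x * sin t - of_int l * t)"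
      by (simp only: cos_add c) (simp add: sin_times_pi_eq_0)
    finally show "?f (pi - t) = (-1) powi l * cos (x * sin t - of_int l * t)" .
  qed
  also have "integral {0..pi} \<dots> = (-1) powi l * (pi * bessel_J l x)"
    by (simp add: bessel_J_integral_cos)
  finally show ?thesis by simp
qed

section \<open>The triangle with two given sides and the enclosed angle\<close>

definition tri_side :: "real \<Rightarrow> real \<Rightarrow> real \<Rightarrow> real" where
  "tri_side a b t = sqrt (a\<^sup>2 + b\<^sup>2 - 2 * a * b * cos t)"

lemma tri_side_commute: "tri_side a b t = tri_side b a t"
  by (simp add: tri_side_def algebra_simps)

lemma tri_angle_commute: "tri_angle a b c = tri_angle a c b"
  by (simp add: tri_angle_def algebra_simps)

lemma tri_side_arg_nonneg: "0 \<le> a\<^sup>2 + b\<^sup>2 - 2 * a * b * cos t" for a b t :: real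
proof -
  have "a\<^sup>2 + b\<^sup>2 - 2 * a * b * cos t = (a - b * cos t)\<^sup>2 + (b * sin t)\<^sup>2"
    using sin_cos_squared_add[of t] by algebra
  then show ?thesis by simp
qed

lemma tri_side_sq: "(tri_side a b t)\<^sup>2 = a\<^sup>2 + b\<^sup>2 - 2 * a * b * cos t"
  by (simp only: tri_side_def real_sqrt_pow2[OF tri_side_arg_nonneg])

lemma tri_side_nonneg: "0 \<le> tri_side a b t"
  by (simp only: tri_side_def real_sqrt_ge_zero[OF tri_side_arg_nonneg])

lemma tri_side_pos:
  assumes "0 < a" "0 < b" "0 < t" "t < pi"
  shows "0 < tri_side a b t"
proof -
  have "a\<^sup>2 + b\<^sup>2 - 2 * a * b * cos t = (a - b * cos t)\<^sup>2 + (b * sin t)\<^sup>2"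
    using sin_cos_squared_add[of t] by algebra
  moreover have "0 < (b * sin t)\<^sup>2" using assms sin_gt_zero by fastforce
  ultimately show ?thesis unfolding tri_side_def
    by (metis add.commute add_pos_nonneg real_sqrt_gt_zero zero_le_power2)
qed

text \<open>The altitude onto the side \<open>b\<close> has length \<open>a sin t\<close>, and its
  foot is at distance \<open>a cos t\<close> from the vertex of the angle \<open>t\<close>; the
  third side is the hypotenuse over the rest of \<open>b\<close>.\<close>

lemma cos_tri_angle:
  assumes "0 < a" "0 < b" "0 < t" "t < pi"
  shows "tri_side a b t * cos (tri_angle a b (tri_side a b t)) = b - a * cos t"
    and "tri_side a b t * sin (tri_angle a b (tri_side a b t)) = a * sin t"
proof -
  let ?k = "tri_side a b t"
  have k: "0 < ?k" using tri_side_pos assms by blast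
  define q where "q = (b - a * cos t) / ?k"
  have q: "(b\<^sup>2 + ?k\<^sup>2 - a\<^sup>2) / (2 * b * ?k) = q"
    unfolding q_def tri_side_sq using k assms by (simp add: field_simps power2_eq_square)
  have e: "1 - q\<^sup>2 = (a * sin t / ?k)\<^sup>2"
  proof -
    have "(?k)\<^sup>2 - (b - a * cos t)\<^sup>2 = (a * sin t)\<^sup>2"
      unfolding tri_side_sq using sin_cos_squared_add[of t] by algebra
    then show ?thesis unfolding q_def power_divide using k
      by (metis diff_divide_distrib divide_self less_irrefl power_not_zero)
  qed
  have "q\<^sup>2 \<le> 1" using e by (metis zero_le_power2 diff_ge_0_iff_ge)
  then have q1: "-1 \<le> q" "q \<le> 1" by (auto simp: abs_square_le_1)
  show "?k * cos (tri_angle a b ?k) = b - a * cos t"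
    unfolding tri_angle_def q cos_arccos[OF q1] unfolding q_def using k by simp
  have "0 < sin t" using assms sin_gt_zero by blast
  then have "sqrt (1 - q\<^sup>2) = a * sin t / ?k"
    unfolding e using k assms by simp
  then show "?k * sin (tri_angle a b ?k) = a * sin t"
    unfolding tri_angle_def q sin_arccos[OF q1] using k by simp
qed

lemma tri_angle_range:
  assumes "0 < a" "0 < b" "0 < t" "t < pi"
  shows "0 < tri_angle a b (tri_side a b t)" "tri_angle a b (tri_side a b t) < pi"
proof -
  let ?k = "tri_side a b t" and ?A = "tri_angle a b (tri_side a b t)"
  have k: "0 < ?k" using tri_side_pos assms by blast
  define q where "q = (b - a * cos t) / ?k"
  have q: "(b\<^sup>2 + ?k\<^sup>2 - a\<^sup>2) / (2 * b * ?k) = q"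
    unfolding q_def tri_side_sq using k assms by (simp add: field_simps power2_eq_square)
  have "(?k)\<^sup>2 - (b - a * cos t)\<^sup>2 = (a * sin t)\<^sup>2"
    unfolding tri_side_sq using sin_cos_squared_add[of t] by algebra
  moreover have "0 < (a * sin t)\<^sup>2" using assms sin_gt_zero by fastforce
  ultimately have "(b - a * cos t)\<^sup>2 < ?k\<^sup>2" by linarith
  then have "q\<^sup>2 < 1" unfolding q_def using k by (simp add: power_divide)
  then have "-1 < q" "q < 1" by (auto simp: abs_square_less_1 abs_less_iff)
  then show "0 < ?A" "?A < pi"
    unfolding tri_angle_def q using arccos_lt_bounded by auto
qed

text \<open>The two projections determine cosine and sine of the sum. The positive sine excludes a
  sum of at least \<pi>, and below \<pi> the cosine is injective.\<close>

lemma tri_angle_sum: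
  assumes "0 < a" "0 < b" "0 < t" "t < pi"
  shows "tri_angle a b (tri_side a b t) + tri_angle b a (tri_side a b t) = pi - t"
proof -
  let ?k = "tri_side a b t"
  let ?A = "tri_angle a b ?k" and ?B = "tri_angle b a ?k"
  have k: "0 < ?k" using tri_side_pos assms by blast
  note A = cos_tri_angle[OF assms]
  note B = cos_tri_angle[of b a t, OF assms(2,1,3,4), unfolded tri_side_commute[of b a]]
  have rA: "0 < ?A" "?A < pi" using tri_angle_range[OF assms] by auto
  have rB: "0 < ?B" "?B < pi"
    using tri_angle_range[of b a t, OF assms(2,1,3,4)] by (auto simp: tri_side_commute[of b a])
  have "?k\<^sup>2 * cos (?A + ?B) = (?k * cos ?A) * (?k * cos ?B) - (?k * sin ?A) * (?k * sin ?B)"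
    by (simp add: cos_add power2_eq_square algebra_simps)
  also have "\<dots> = ?k\<^sup>2 * cos (pi - t)"
    unfolding A B tri_side_sq cos_pi_minus using sin_cos_squared_add[of t] by algebra
  finally have c: "cos (?A + ?B) = cos (pi - t)"
    using k by (metis mult_left_cancel less_irrefl power_not_zero)
  have "?k\<^sup>2 * sin (?A + ?B) = (?k * sin ?A) * (?k * cos ?B) + (?k * cos ?A) * (?k * sin ?B)"
    by (simp add: sin_add power2_eq_square algebra_simps)
  also have "\<dots> = ?k\<^sup>2 * sin t"
    unfolding A B tri_side_sq by (simp add: power2_eq_square algebra_simps)
  finally have s: "sin (?A + ?B) = sin t"
    using k by (metis mult_left_cancel less_irrefl power_not_zero)
  have "0 < sin t" using assms sin_gt_zero by blast
  have "?A + ?B < pi"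
  proof (rule ccontr)
    assume "\<not> ?A + ?B < pi"
    then have "0 \<le> sin (?A + ?B - pi)" using rA rB by (intro sin_ge_zero) auto
    then show False using s \<open>0 < sin t\<close> by simp
  qed
  then show ?thesis
    using cos_inj_pi[OF _ _ _ _ c] rA rB assms by simp
qed

text \<open>The product is a double integral over the angles of two phasors of lengths
  \<open>a x\<close> and \<open>b x\<close>. With the difference \<open>t\<close> of the angles held
  fixed, the phasors add up to a single one whose length is the third side times \<open>x\<close>,
  so the integral over the common angle is again a Bessel integral, now of order
  \<open>m + n\<close>; the phase of the sum accounts for the cosine.\<close>

lemma bessel_J_mult_integral:
  assumes a: "0 < a" and b: "0 < b"
  shows "((\<lambda>t. bessel_J (m + n) (tri_side a b t * x)
           * cos (of_int n * tri_angle a b (tri_side a b t) - of_int m * tri_angle b a (tri_side a b t)))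
         has_integral pi * (bessel_J m (a * x) * bessel_J n (b * x))) {0..pi}"
proof -
  \<comment> \<open>\<open>\<phi>\<close> is the angle of the factor of order \<open>n\<close>,
    \<open>\<phi> + t\<close> that of the factor of order \<open>m\<close>.\<close>
  define E where "E = (\<lambda>\<phi> t. cis (x * (a * sin (\<phi> + t) + b * sin \<phi>) - of_int m * t - of_int (m + n) * \<phi>))"
  define K where "K = (\<lambda>t. integral {-pi..pi} (\<lambda>\<phi>. E \<phi> t))"
  have cE: "continuous_on S (\<lambda>(\<phi>, t). E \<phi> t)" for S
    unfolding E_def case_prod_beta by (intro continuous_intros)
  have shift: "integral {-pi..pi} (\<lambda>t. cis (y * sin (t + s) - of_int j * (t + s))) = complex_of_real (2 * pi * bessel_J j y)"
    if "-2 * pi \<le> s" "s \<le> 2 * pi" for y s :: real and j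
  proof -
    let ?f = "\<lambda>t. cis (y * sin t - of_int j * t)"
    have per: "?f (t + 2 * pi) = ?f t" for t
    proof -
      have "?f (t + 2 * pi) = cis ((y * sin t - of_int j * t) + 2 * pi * (- of_int j))"
        by (simp only: sin_periodic) (simp add: algebra_simps)
      also have "\<dots> = ?f t"
        unfolding cis_mult[symmetric] using cis_multiple_2pi[of "- of_int j"] by simp
      finally show ?thesis .
    qed
    have c: "continuous_on UNIV ?f" by (intro continuous_intros)
    show ?thesis
    proof (cases "0 \<le> s")
      case True
      then show ?thesis using integral_periodic_shift[OF c per, of s] that
        by (simp add: bessel_J_integral)
    next
      case False
      have "?f (t + s) = ?f (t + (s + 2 * pi))" for t
        using per[of "t + s"] by (simp add: add.assoc)
      then show ?thesis using integral_periodic_shift[OF c per, of "s + 2 * pi"] that False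
        by (simp add: bessel_J_integral)
    qed
  qed
  have "complex_of_real (4 * pi\<^sup>2 * (bessel_J m (a * x) * bessel_J n (b * x))) =
     complex_of_real (2 * pi * bessel_J m (a * x)) * integral {-pi..pi} (\<lambda>\<phi>. cis (b * x * sin \<phi> - of_int n * \<phi>))"
    by (simp add: bessel_J_integral power2_eq_square)
  also have "\<dots> = integral {-pi..pi} (\<lambda>\<phi>. complex_of_real (2 * pi * bessel_J m (a * x)) * cis (b * x * sin \<phi> - of_int n * \<phi>))"
    by (simp add: integral_mult_right)
  also have "\<dots> = integral {-pi..pi} (\<lambda>\<phi>. integral {-pi..pi} (\<lambda>t. E \<phi> t))"
  proof (rule integral_cong)
    fix \<phi> :: real assume \<phi>: "\<phi> \<in> {-pi..pi}"
    have "complex_of_real (2 * pi * bessel_J m (a * x)) * cis (b * x * sin \<phi> - of_int n * \<phi>) =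
       integral {-pi..pi} (\<lambda>t. cis (a * x * sin (t + \<phi>) - of_int m * (t + \<phi>)) * cis (b * x * sin \<phi> - of_int n * \<phi>))"
      using \<phi> by (subst shift[of \<phi>, symmetric]) (auto intro!: integral_mult_left[symmetric])
    also have "\<dots> = integral {-pi..pi} (\<lambda>t. E \<phi> t)"
      unfolding E_def cis_mult by (simp add: algebra_simps)
    finally show "complex_of_real (2 * pi * bessel_J m (a * x)) * cis (b * x * sin \<phi> - of_int n * \<phi>) =
        integral {-pi..pi} (\<lambda>t. E \<phi> t)" .
  qed
  also have "\<dots> = integral {-pi..pi} K"
    unfolding K_def using integral_swap_continuous[of "-pi" "-pi" pi pi E, OF cE] by simp
  also have "\<dots> = integral {0..pi} (\<lambda>t. K t + K (- t))"
  proof (rule integral_symmetric_interval)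
    have "continuous_on UNIV (\<lambda>t. integral (cbox (-pi) pi) (\<lambda>\<phi>. E \<phi> t))"
      by (rule integral_continuous_on_param)
        (auto intro!: continuous_intros simp: case_prod_beta E_def)
    then show "continuous_on {-pi..pi} K" unfolding K_def cbox_interval
      by (rule continuous_on_subset) simp
  qed simp
  \<comment> \<open>Reversing both angles conjugates \<open>E\<close>, so \<open>K (- t)\<close> is
    the conjugate of \<open>K t\<close> and only the real part is left.\<close>
  also have "\<dots> = integral {0..pi} (\<lambda>t. complex_of_real (2 * Re (K t)))"
  proof (rule integral_cong)
    fix t :: real
    have "K (- t) = integral {-pi..pi} (\<lambda>\<phi>. E (- \<phi>) (- t))"
      unfolding K_def using Henstock_Kurzweil_Integration.integral_reflect_real[of pi "-pi" "\<lambda>\<phi>. E \<phi> (- t)"] by simp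
    also have "\<dots> = integral {-pi..pi} (\<lambda>\<phi>. cnj (E \<phi> t))"
    proof (rule integral_cong)
      fix \<phi> :: real
      have "sin (- \<phi> + - t) = - sin (\<phi> + t)" by (metis minus_add_distrib sin_minus)
      then have "x * (a * sin (- \<phi> + - t) + b * sin (- \<phi>)) - of_int m * (- t) - of_int (m + n) * (- \<phi>)
         = - (x * (a * sin (\<phi> + t) + b * sin \<phi>) - of_int m * t - of_int (m + n) * \<phi>)"
        by (simp add: algebra_simps)
      then show "E (- \<phi>) (- t) = cnj (E \<phi> t)" unfolding E_def cis_cnj by (simp only:)
    qed
    also have "\<dots> = cnj (K t)" unfolding K_def by (simp add: integral_cnj)
    finally show "K t + K (- t) = complex_of_real (2 * Re (K t))"
      by (simp add: complex_add_cnj)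
  qed
  also have "\<dots> = complex_of_real (integral {0..pi} (\<lambda>t. 2 * Re (K t)))"
  proof (rule integral_complex_of_real)
    have "continuous_on UNIV (\<lambda>t. integral (cbox (-pi) pi) (\<lambda>\<phi>. E \<phi> t))"
      by (rule integral_continuous_on_param)
        (auto intro!: continuous_intros simp: case_prod_beta E_def)
    then have "continuous_on {0..pi} K" unfolding K_def cbox_interval
      by (rule continuous_on_subset) simp
    then show "(\<lambda>t. 2 * Re (K t)) integrable_on {0..pi}"
      by (intro integrable_continuous_real continuous_intros)
  qed
  finally have tot: "4 * pi\<^sup>2 * (bessel_J m (a * x) * bessel_J n (b * x)) = integral {0..pi} (\<lambda>t. 2 * Re (K t))"
    by (simp only: of_real_eq_iff)
  have cK: "continuous_on {0..pi} K"
  proof -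
    have "continuous_on UNIV (\<lambda>t. integral (cbox (-pi) pi) (\<lambda>\<phi>. E \<phi> t))"
      by (rule integral_continuous_on_param)
        (auto intro!: continuous_intros simp: case_prod_beta E_def)
    then show ?thesis unfolding K_def cbox_interval by (rule continuous_on_subset) simp
  qed
  have "((\<lambda>t. 2 * Re (K t)) has_integral 4 * pi\<^sup>2 * (bessel_J m (a * x) * bessel_J n (b * x))) {0..pi}"
    unfolding tot by (intro integrable_integral integrable_continuous_real continuous_intros cK)
  then have "((\<lambda>t. Re (K t) / (2 * pi)) has_integral pi * (bessel_J m (a * x) * bessel_J n (b * x))) {0..pi}"
    using has_integral_mult_right[of "\<lambda>t. 2 * Re (K t)" _ "{0..pi}" "1 / (4 * pi)"]
    by (fastforce simp: power2_eq_square field_simps)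
  \<comment> \<open>The angle between the phasors is an exterior angle of the triangle that they
    span; the reflection and the shift pass to the enclosed angle \<open>pi - t\<close>.\<close>
  then have "((\<lambda>t. Re (K (- t)) / (2 * pi)) has_integral pi * (bessel_J m (a * x) * bessel_J n (b * x))) {-pi..0}"
    using Henstock_Kurzweil_Integration.has_integral_reflect_real[of "\<lambda>t. Re (K t) / (2 * pi)" _ pi 0] by simp
  then have 1: "((\<lambda>t. Re (K (pi - t)) / (2 * pi)) has_integral pi * (bessel_J m (a * x) * bessel_J n (b * x))) {0..pi}"
    using has_integral_shift_real_ivl[of "\<lambda>t. Re (K (- t)) / (2 * pi)" _ "-pi" 0 "-pi"] by simp
  show ?thesis
  \<comment> \<open>At the ends the triangle degenerates and its angles mean nothing.\<close>
  proof (rule has_integral_spike_finite[OF _ _ 1, of "{0, pi}"])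
    fix t assume "t \<in> {0..pi} - {0, pi}"
    then have t: "0 < t" "t < pi" by auto
    let ?k = "tri_side a b t"
    let ?A = "tri_angle a b ?k" and ?B = "tri_angle b a ?k"
    have "E \<phi> (pi - t) = cis ((?k * x) * sin (\<phi> + ?A) - of_int (m + n) * (\<phi> + ?A)) * cis (of_int n * ?A - of_int m * ?B)" for \<phi>
    proof -
      have "a * sin (\<phi> + (pi - t)) + b * sin \<phi> = sin \<phi> * (b - a * cos t) + cos \<phi> * (a * sin t)"
        by (simp add: sin_add cos_diff sin_diff algebra_simps)
      also have "\<dots> = ?k * sin (\<phi> + ?A)"
        unfolding cos_tri_angle[OF a b t, symmetric] by (simp add: sin_add algebra_simps)
      finally have "x * (a * sin (\<phi> + (pi - t)) + b * sin \<phi>) - of_int m * (pi - t) - of_int (m + n) * \<phi> =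
          (?k * x) * sin (\<phi> + ?A) - of_int m * (?A + ?B) - of_int (m + n) * \<phi>"
        unfolding tri_angle_sum[OF a b t] by simp
      then show ?thesis unfolding E_def cis_mult
        by (intro arg_cong[where f = cis]) (simp add: algebra_simps)
    qed
    then have "K (pi - t) = integral {-pi..pi} (\<lambda>\<phi>. cis ((?k * x) * sin (\<phi> + ?A) - of_int (m + n) * (\<phi> + ?A))) * cis (of_int n * ?A - of_int m * ?B)"
      unfolding K_def by simp
    also have "integral {-pi..pi} (\<lambda>\<phi>. cis ((?k * x) * sin (\<phi> + ?A) - of_int (m + n) * (\<phi> + ?A))) = complex_of_real (2 * pi * bessel_J (m + n) (?k * x))"
      using tri_angle_range[OF a b t] by (intro shift) auto
    finally show "bessel_J (m + n) (?k * x) * cos (of_int n * ?A - of_int m * ?B) = Re (K (pi - t)) / (2 * pi)"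
      by simp
  qed auto
qed

section \<open>Decay\<close>

text \<open>The form in which triangles are split off: only the angle opposite to \<open>a\<close>
  and the enclosed angle occur. It is the previous formula for the orders \<open>- m\<close> and
  \<open>L + m\<close>, in which the angle opposite to \<open>b\<close> is eliminated by the angle
  sum; the sign from \<open>bessel_J_minus\<close> cancels the one from \<open>m pi\<close>.\<close>

lemma bessel_J_mult_integral':
  assumes a: "0 < a" and b: "0 < b"
  shows "((\<lambda>t. bessel_J L (tri_side a b t * x) * cos (of_int L * tri_angle a b (tri_side a b t) - of_int m * t))
         has_integral pi * (bessel_J m (a * x) * bessel_J (L + m) (b * x))) {0..pi}"
proof -
  have "((\<lambda>t. (-1) powi m * (bessel_J (- m + (L + m)) (tri_side a b t * x)
           * cos (of_int (L + m) * tri_angle a b (tri_side a b t) - of_int (- m) * tri_angle b a (tri_side a b t))))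
         has_integral (-1) powi m * (pi * (bessel_J (- m) (a * x) * bessel_J (L + m) (b * x)))) {0..pi}"
    by (intro has_integral_mult_right bessel_J_mult_integral assms)
  moreover have "(-1) powi m * (pi * (bessel_J (- m) (a * x) * bessel_J (L + m) (b * x))) =
      pi * (bessel_J m (a * x) * bessel_J (L + m) (b * x))"
  proof -
    have "(-1) powi m * (-1) powi m = (1::real)"
      by (simp flip: power_int_mult_distrib)
    then show ?thesis by (simp add: bessel_J_minus[of m]) 
  qed
  ultimately have 1: "((\<lambda>t. (-1) powi m * (bessel_J (- m + (L + m)) (tri_side a b t * x)
           * cos (of_int (L + m) * tri_angle a b (tri_side a b t) - of_int (- m) * tri_angle b a (tri_side a b t))))
         has_integral pi * (bessel_J m (a * x) * bessel_J (L + m) (b * x))) {0..pi}"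
    by (simp only:)
  show ?thesis
  proof (rule has_integral_spike_finite[OF _ _ 1, of "{0, pi}"])
    fix t assume "t \<in> {0..pi} - {0, pi}"
    then have t: "0 < t" "t < pi" by auto
    let ?A = "tri_angle a b (tri_side a b t)" and ?B = "tri_angle b a (tri_side a b t)"
    have c: "cos (of_int m * pi) = (-1) powi m"
      by (cases m rule: int_cases2) (auto simp: power_int_minus simp flip: power_inverse)
    have "of_int (L + m) * ?A - of_int (- m) * ?B = (of_int L * ?A - of_int m * t) + of_int m * pi"
    proof -
      have "of_int (L + m) * ?A - of_int (- m) * ?B = of_int L * ?A + of_int m * (?A + ?B)"
        by (simp add: algebra_simps)
      then show ?thesis unfolding tri_angle_sum[OF a b t] by (simp add: algebra_simps)
    qed
    then have "cos (of_int (L + m) * ?A - of_int (- m) * ?B) = (-1) powi m * cos (of_int L * ?A - of_int m * t)"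
      by (simp only: cos_add c) (simp add: sin_times_pi_eq_0)
    moreover have "(-1) powi m * (-1) powi m = (1::real)"
      by (simp flip: power_int_mult_distrib)
    ultimately show "bessel_J L (tri_side a b t * x) * cos (of_int L * ?A - of_int m * t) =
       (-1) powi m * (bessel_J (- m + (L + m)) (tri_side a b t * x)
           * cos (of_int (L + m) * ?A - of_int (- m) * ?B))"
      by simp
  qed auto
qed

text \<open>Outside the interval from -1 to 1 the definite description behind \<open>arccos\<close>
  ranges over an empty predicate, the same one for every argument, so \<open>arccos\<close> is
  constant there and continuous inside.\<close>

lemma borel_measurable_arccos [measurable]: "(arccos :: real \<Rightarrow> real) \<in> borel_measurable borel"
proof -
  have "(\<lambda>x::real. if x \<in> {-1..1} then arccos x else (THE x. False)) \<in> borel_measurable borel"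
  proof (rule measurable_If_restrict_space_iff[THEN iffD2, OF _ conjI])
    show "arccos \<in> borel_measurable (restrict_space borel {x. x \<in> {-1..1}})"
      by (rule borel_measurable_continuous_on_restrict) (rule continuous_on_subset[OF continuous_on_arccos'], auto)
  qed auto
  moreover have "arccos x = (if x \<in> {-1..1} then arccos x else (THE x. False))" for x :: real
  proof (cases "x \<in> {-1..1}")
    case False
    then have "(\<lambda>y. 0 \<le> y \<and> y \<le> pi \<and> cos y = x) = (\<lambda>y. False)"
      using cos_le_one cos_ge_minus_one by fastforce
    then show ?thesis using False by (simp add: arccos_def)
  qed simp
  ultimately show ?thesis by (simp cong: measurable_cong)
qed

lemma borel_measurable_tri_side [measurable (raw)]:
  assumes [measurable]: "f \<in> borel_measurable M" "g \<in> borel_measurable M" "h \<in> borel_measurable M"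
  shows "(\<lambda>x. tri_side (f x) (g x) (h x)) \<in> borel_measurable M"
  unfolding tri_side_def by measurable

lemma borel_measurable_tri_angle [measurable (raw)]:
  assumes [measurable]: "f \<in> borel_measurable M" "g \<in> borel_measurable M" "h \<in> borel_measurable M"
  shows "(\<lambda>x. tri_angle (f x) (g x) (h x)) \<in> borel_measurable M"
  unfolding tri_angle_def by measurable

text \<open>The derivative of \<open>E / (\<i> x K)\<close> for
  \<open>E = cis (x sin \<theta> - l \<theta>)\<close>, \<open>K = cos \<theta>\<close>,
  \<open>S = sin \<theta>\<close> and \<open>L = l\<close>, sorted into \<open>E\<close> itself and
  a remainder.\<close>

lemma osc_primitive_identity:
  fixes x K E S L :: complex
  assumes "x \<noteq> 0" "K \<noteq> 0"
  shows "(E * (S / (x * K\<^sup>2)) + (x * K - L) * (\<i> * E) * (1 / (x * K))) / \<i> =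
    E + E * (- L / (x * K) + S / (\<i> * (x * K\<^sup>2)))"
proof -
  have 1: "(x * K - L) / (x * K) = 1 - L / (x * K)" using assms by (simp add: diff_divide_distrib)
  have "(x * K - L) * (\<i> * E) * (1 / (x * K)) / \<i> = (\<i> / \<i>) * (E * ((x * K - L) / (x * K)))"
    by (simp only: divide_inverse mult_ac mult_1_left)
  then have "(x * K - L) * (\<i> * E) * (1 / (x * K)) / \<i> = E - E * L / (x * K)"
    by (simp only: 1) (simp add: right_diff_distrib)
  moreover have "E * (S / (x * K\<^sup>2)) / \<i> = E * (S / (\<i> * (x * K\<^sup>2)))"
    by (simp add: divide_inverse mult_ac)
  ultimately show ?thesis by (simp only: add_divide_distrib) (simp add: ring_distribs)
qed

text \<open>Integration by parts away from the stationary point \<open>pi / 2\<close> of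
  \<open>sin\<close>: the derivative \<open>x cos \<theta>\<close> is at least
  \<open>x sin d\<close> on the interval. Only \<open>x sin \<theta>\<close> is treated as the
  phase, so the order \<open>l\<close> enters through the remainder \<open>g\<close> alone.\<close>

lemma osc_integral_bound:
  fixes l :: int
  assumes x: "0 < x" and d: "0 < d" "d < pi / 2"
  shows "norm (integral {0..pi/2 - d} (\<lambda>\<theta>. cis (x * sin \<theta> - of_int l * \<theta>))) \<le> (4 + 2 * \<bar>of_int l\<bar>) / (x * sin d)"
proof -
  let ?b = "pi / 2 - d" and ?m = "sin d"
  have m: "0 < ?m" using d by (intro sin_gt_zero) auto
  have cosm: "?m \<le> cos \<theta>" if "\<theta> \<in> {0..?b}" for \<theta>
  proof -
    have "cos ?b \<le> cos \<theta>" using that d by (intro cos_monotone_0_pi_le) auto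
    then show ?thesis by (simp add: cos_diff)
  qed
  let ?e = "\<lambda>\<theta>. cis (x * sin \<theta> - of_int l * \<theta>)"
  define F where "F = (\<lambda>\<theta>. ?e \<theta> / (\<i> * complex_of_real (x * cos \<theta>)))"
  define g where "g = (\<lambda>\<theta>. ?e \<theta> * (- of_int l / (x * cos \<theta>) + complex_of_real (sin \<theta>) / (\<i> * complex_of_real (x * (cos \<theta>)\<^sup>2))))"
  have F: "(F has_vector_derivative (?e \<theta> + g \<theta>)) (at \<theta> within {0..?b})" if \<theta>: "\<theta> \<in> {0..?b}" for \<theta>
  proof -
    have c0: "cos \<theta> \<noteq> 0" using cosm[OF \<theta>] m by auto
    have e: "(?e has_vector_derivative ((x * cos \<theta> - of_int l) *\<^sub>R (\<i> * ?e \<theta>))) (at \<theta> within {0..?b})"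
      unfolding has_vector_derivative_def
      by (auto intro!: derivative_eq_intros simp: algebra_simps)
    have "((\<lambda>\<theta>. complex_of_real (1 / (x * cos \<theta>))) has_vector_derivative complex_of_real (sin \<theta> / (x * (cos \<theta>)\<^sup>2))) (at \<theta> within {0..?b})"
      using c0 x by (intro has_vector_derivative_of_real)
        (auto intro!: derivative_eq_intros simp flip: has_real_derivative_iff_has_vector_derivative simp: power2_eq_square field_simps)
    then have "((\<lambda>\<theta>. ?e \<theta> * complex_of_real (1 / (x * cos \<theta>))) has_vector_derivative
        (?e \<theta> * complex_of_real (sin \<theta> / (x * (cos \<theta>)\<^sup>2)) + ((x * cos \<theta> - of_int l) *\<^sub>R (\<i> * ?e \<theta>)) * complex_of_real (1 / (x * cos \<theta>))))
        (at \<theta> within {0..?b})"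
      by (rule has_vector_derivative_mult[OF e])
    then have "((\<lambda>\<theta>. ?e \<theta> * complex_of_real (1 / (x * cos \<theta>)) / \<i>) has_vector_derivative
        (?e \<theta> * complex_of_real (sin \<theta> / (x * (cos \<theta>)\<^sup>2)) + ((x * cos \<theta> - of_int l) *\<^sub>R (\<i> * ?e \<theta>)) * complex_of_real (1 / (x * cos \<theta>))) / \<i>)
        (at \<theta> within {0..?b})"
      by (rule has_vector_derivative_divide)
    moreover have "(\<lambda>\<theta>. ?e \<theta> * complex_of_real (1 / (x * cos \<theta>)) / \<i>) = F"
      by (simp add: F_def divide_inverse mult_ac)
    moreover have "(?e \<theta> * complex_of_real (sin \<theta> / (x * (cos \<theta>)\<^sup>2)) + ((x * cos \<theta> - of_int l) *\<^sub>R (\<i> * ?e \<theta>)) * complex_of_real (1 / (x * cos \<theta>))) / \<i> = ?e \<theta> + g \<theta>"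
    proof -
      have nz: "complex_of_real x \<noteq> 0" "complex_of_real (cos \<theta>) \<noteq> 0" using c0 x by auto
      show ?thesis
        using osc_primitive_identity[OF nz, of "?e \<theta>" "complex_of_real (sin \<theta>)" "of_int l"]
        unfolding g_def scaleR_conv_of_real of_real_mult of_real_divide of_real_diff of_real_power
          of_real_minus of_real_1 of_real_of_int_eq .
    qed
    ultimately show ?thesis by simp
  qed
  have "((\<lambda>\<theta>. ?e \<theta> + g \<theta>) has_integral F ?b - F 0) {0..?b}"
    using d F by (intro fundamental_theorem_of_calculus) auto
  then have I1: "integral {0..?b} (\<lambda>\<theta>. ?e \<theta> + g \<theta>) = F ?b - F 0" by (rule integral_unique)
  have cg: "continuous_on {0..?b} g" unfolding g_def
    using cosm m x by (intro continuous_intros) (auto simp: not_le[symmetric] dest!: cosm)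
  have ig: "g integrable_on {0..?b}" by (rule integrable_continuous_real[OF cg])
  have ie: "?e integrable_on {0..?b}" by (intro integrable_continuous_real continuous_intros)
  have I2: "integral {0..?b} ?e = F ?b - F 0 - integral {0..?b} g"
    using I1 unfolding integral_add[OF ie ig] by (rule eq_diff_eq[THEN iffD2])
  have nF: "norm (F \<theta>) \<le> 1 / (x * ?m)" if "\<theta> \<in> {0..?b}" for \<theta>
  proof -
    have "norm (F \<theta>) = 1 / (x * cos \<theta>)"
      using cosm[OF that] m x by (simp add: F_def norm_divide norm_mult)
    also have "\<dots> \<le> 1 / (x * ?m)"
      using cosm[OF that] m x by (intro divide_left_mono mult_left_mono) auto
    finally show ?thesis .
  qed
  \<comment> \<open>The second summand is integrated exactly, to
    \<open>1 / (x cos \<theta>)\<close>. Its maximum is of order \<open>1 / (x d^2)\<close>, which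
    would not be small for the later choice \<open>d = 1 / sqrt x\<close>.\<close>
  have h: "((\<lambda>\<theta>. \<bar>of_int l\<bar> / (x * ?m) + sin \<theta> / (x * (cos \<theta>)\<^sup>2)) has_integral
      (\<bar>of_int l\<bar> / (x * ?m) * ?b + 1 / (x * cos ?b)) - (\<bar>of_int l\<bar> / (x * ?m) * 0 + 1 / (x * cos 0))) {0..?b}"
  proof (rule fundamental_theorem_of_calculus)
    fix \<theta> assume \<theta>: "\<theta> \<in> {0..?b}"
    have c0: "cos \<theta> \<noteq> 0" using cosm[OF \<theta>] m by auto
    show "((\<lambda>\<theta>. \<bar>of_int l\<bar> / (x * ?m) * \<theta> + 1 / (x * cos \<theta>)) has_vector_derivative
       \<bar>of_int l\<bar> / (x * ?m) + sin \<theta> / (x * (cos \<theta>)\<^sup>2)) (at \<theta> within {0..?b})"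
      unfolding has_real_derivative_iff_has_vector_derivative[symmetric]
      using c0 x m by (auto intro!: derivative_eq_intros simp: power2_eq_square field_simps)
  qed (use d in simp)
  have "norm (integral {0..?b} g) \<le> integral {0..?b} (\<lambda>\<theta>. \<bar>of_int l\<bar> / (x * ?m) + sin \<theta> / (x * (cos \<theta>)\<^sup>2))"
  proof (rule Henstock_Kurzweil_Integration.integral_norm_bound_integral[OF ig has_integral_integrable[OF h]])
    fix \<theta> assume \<theta>: "\<theta> \<in> {0..?b}"
    have s: "0 \<le> sin \<theta>" using \<theta> d by (intro sin_ge_zero) auto
    have "norm (g \<theta>) \<le> norm (complex_of_real (- of_int l / (x * cos \<theta>))) + norm (complex_of_real (sin \<theta>) / (\<i> * complex_of_real (x * (cos \<theta>)\<^sup>2)))"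
      unfolding g_def norm_mult norm_cis mult_1 by (rule order_trans[OF eq_refl norm_triangle_ineq]) simp
    also have "\<dots> = \<bar>of_int l\<bar> / (x * cos \<theta>) + sin \<theta> / (x * (cos \<theta>)\<^sup>2)"
      using cosm[OF \<theta>] m x s by (simp add: norm_divide norm_mult norm_power)
    also have "\<bar>of_int l\<bar> / (x * cos \<theta>) \<le> \<bar>of_int l\<bar> / (x * ?m)"
      using cosm[OF \<theta>] m x by (intro divide_left_mono mult_left_mono) auto
    finally show "norm (g \<theta>) \<le> \<bar>of_int l\<bar> / (x * ?m) + sin \<theta> / (x * (cos \<theta>)\<^sup>2)" by simp
  qed
  also have "\<dots> = \<bar>of_int l\<bar> / (x * ?m) * ?b + 1 / (x * ?m) - 1 / x"
    unfolding integral_unique[OF h] by (simp add: cos_diff)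
  also have "\<dots> \<le> \<bar>of_int l\<bar> / (x * ?m) * 2 + 1 / (x * ?m)"
  proof -
    have "\<bar>of_int l\<bar> / (x * ?m) * ?b \<le> \<bar>of_int l\<bar> / (x * ?m) * 2"
      using d m x pi_less_4 by (intro mult_left_mono) auto
    then show ?thesis using x by (simp add: add_increasing2) (smt (verit) divide_pos_pos)
  qed
  finally have "norm (integral {0..?b} g) \<le> \<bar>of_int l\<bar> / (x * ?m) * 2 + 1 / (x * ?m)" .
  moreover have "norm (F ?b) \<le> 1 / (x * ?m)" "norm (F 0) \<le> 1 / (x * ?m)"
    using d by (auto intro!: nF)
  moreover have "norm (integral {0..?b} ?e) \<le> norm (F ?b) + norm (F 0) + norm (integral {0..?b} g)"
    unfolding I2 by (smt (verit) norm_triangle_ineq4)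
  moreover have "3 * (1 / (x * ?m)) + \<bar>of_int l\<bar> / (x * ?m) * 2 \<le> (4 + 2 * \<bar>of_int l\<bar>) / (x * ?m)"
    using m x by (simp add: field_simps)
  ultimately show ?thesis by linarith
qed

text \<open>The difference \<open>sin t - t / 2\<close> increases up to \<open>pi / 3\<close> and
  decreases afterwards, so its minimum is attained at an end of the interval.\<close>

lemma sin_ge_half:
  fixes x :: real
  assumes "0 \<le> x" "x \<le> pi / 2"
  shows "x / 2 \<le> sin x"
proof (cases "x \<le> pi / 3")
  case True
  have "sin 0 - 0 / 2 \<le> sin x - x / 2"
  proof (rule DERIV_nonneg_imp_nondecreasing[of 0 x "\<lambda>t. sin t - t / 2"])
    fix t assume t: "0 \<le> t" "t \<le> x"
    have "cos (pi / 3) \<le> cos t" using t True assms by (intro cos_monotone_0_pi_le) auto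
    then have "0 \<le> cos t - 1 / 2" by (simp add: cos_60)
    then show "\<exists>y. ((\<lambda>t. sin t - t / 2) has_real_derivative y) (at t) \<and> 0 \<le> y"
      by (intro exI[of _ "cos t - 1 / 2"] conjI) (auto intro!: derivative_eq_intros)
  qed (use assms in auto)
  then show ?thesis by simp
next
  case False
  have "sin (pi / 2) - pi / 2 / 2 \<le> sin x - x / 2"
  proof (rule DERIV_nonpos_imp_nonincreasing[of x "pi / 2" "\<lambda>t. sin t - t / 2"])
    fix t assume t: "x \<le> t" "t \<le> pi / 2"
    have "cos t \<le> cos (pi / 3)" using t False assms by (intro cos_monotone_0_pi_le) auto
    then have "cos t - 1 / 2 \<le> 0" by (simp add: cos_60)
    then show "\<exists>y. ((\<lambda>t. sin t - t / 2) has_real_derivative y) (at t) \<and> y \<le> 0"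
      by (intro exI[of _ "cos t - 1 / 2"] conjI) (auto intro!: derivative_eq_intros)
  qed (use assms in auto)
  then show ?thesis using pi_less_4 by simp
qed

text \<open>Within distance \<open>d = 1 / sqrt x\<close> of the stationary point the integrand is
  bounded by 1, beyond it \<open>osc_integral_bound\<close> applies, and this \<open>d\<close>
  balances the two contributions. Reflection maps the interval from \<open>pi / 2\<close> to
  \<open>pi\<close> to the first half with the order \<open>- l\<close>.\<close>

lemma bessel_J_decay:
  obtains C where "0 < C" "\<And>x. 0 < x \<Longrightarrow> \<bar>bessel_J l x\<bar> \<le> C / sqrt x"
proof (rule that)
  \<comment> \<open>Twice \<open>1 + 2 (4 + 2 \<bar>l\<bar>)\<close>, once for each half of the
    interval: the 1 comes from the piece near the stationary point, the other factor 2 from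
    \<open>sin d\<close> being at least \<open>d / 2\<close>. The division by \<open>pi\<close> is
    given away.\<close>
  let ?C = "18 + 8 * \<bar>real_of_int l\<bar>"
  show "0 < ?C" by linarith
  fix x :: real assume x: "0 < x"
  show "\<bar>bessel_J l x\<bar> \<le> ?C / sqrt x"
  proof (cases "x \<le> 1")
    case True
    have "\<bar>bessel_J l x\<bar> \<le> 1" by (rule abs_bessel_J_le_1)
    also have "1 \<le> ?C / sqrt x"
    proof -
      have "sqrt x \<le> 1" using True by simp
      also have "1 \<le> ?C" by linarith
      finally show ?thesis using x by (simp only: le_divide_eq_1_pos real_sqrt_gt_zero)
    qed
    finally show ?thesis .
  next
    case False
    define d where "d = 1 / sqrt x"
    have d: "0 < d" "d < pi / 2" 
    proof -
      have "1 < sqrt x" using False by simp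
      then show "0 < d" "d < pi / 2"
        using pi_gt3 less_trans[of d 1 "pi / 2"] by (auto simp: d_def)
    qed
    let ?e = "\<lambda>l \<theta>. cis (x * sin \<theta> - of_int l * \<theta>)"
    define A where "A = (\<lambda>l. integral {0..pi/2} (?e l))"
    have sind: "d / 2 \<le> sin d" using d by (intro sin_ge_half) auto
    have xd: "x * d = sqrt x" using x by (simp add: d_def real_div_sqrt)
    have A: "norm (A l) \<le> (1 + 2 * (4 + 2 * \<bar>of_int l\<bar>)) / sqrt x" for l
    proof -
      have "A l = integral {0..pi/2 - d} (?e l) + integral {pi/2 - d..pi/2} (?e l)"
        unfolding A_def using d by (intro Henstock_Kurzweil_Integration.integral_combine[symmetric] integrable_continuous_real continuous_intros) auto
      moreover have "norm (integral {pi/2 - d..pi/2} (?e l)) \<le> 1 * (pi/2 - (pi/2 - d))"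
        by (rule integral_bound) (use d in \<open>auto intro!: continuous_intros\<close>)
      moreover have "norm (integral {0..pi/2 - d} (?e l)) \<le> (4 + 2 * \<bar>of_int l\<bar>) / (x * sin d)"
        by (rule osc_integral_bound[OF x d])
      moreover have "(4 + 2 * \<bar>of_int l\<bar>) / (x * sin d) \<le> (4 + 2 * \<bar>of_int l\<bar>) / (x * (d / 2))"
        using sind x d by (intro divide_left_mono mult_left_mono mult_pos_pos) auto
      moreover have "x * (d / 2) = sqrt x / 2" using xd by simp
      ultimately have "norm (A l) \<le> (4 + 2 * \<bar>of_int l\<bar>) / (sqrt x / 2) + d"
        by (smt (verit) norm_triangle_ineq)
      also have "\<dots> = (1 + 2 * (4 + 2 * \<bar>of_int l\<bar>)) / sqrt x"
        by (simp add: d_def add_divide_distrib)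
      finally show ?thesis .
    qed
    have cc: "cos (of_int l * pi) = (-1) powi l"
      by (cases l rule: int_cases2) (auto simp: power_int_minus simp flip: power_inverse)
    let ?c = "\<lambda>l \<theta>. cos (x * sin \<theta> - of_int l * \<theta>)"
    have ReA: "integral {0..pi/2} (?c l) = Re (A l)" for l
    proof -
      have "integral {0..pi/2} (Re \<circ> ?e l) = Re (A l)"
        unfolding A_def by (intro integral_linear integrable_continuous_real continuous_intros bounded_linear_Re)
      then show ?thesis by (simp add: o_def)
    qed
    have "pi * bessel_J l x = integral {0..pi/2} (?c l) + integral {pi/2..pi} (?c l)"
      unfolding bessel_J_integral_cos[symmetric]
      by (intro Henstock_Kurzweil_Integration.integral_combine[symmetric] integrable_continuous_real continuous_intros) auto
    also have "integral {pi/2..pi} (?c l) = integral {-pi..-(pi/2)} (\<lambda>t. ?c l (- t))"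
      by (rule Henstock_Kurzweil_Integration.integral_reflect_real[symmetric])
    also have "\<dots> = integral {0..pi/2} (\<lambda>t. ?c l (pi - t))"
      using integral_shift_real_ivl[of 0 pi "pi/2" "\<lambda>t. ?c l (pi - t)"] by simp
    also have "(\<lambda>t. ?c l (pi - t)) = (\<lambda>t. (-1) powi l * ?c (- l) t)"
    proof
      fix t
      have "x * sin (pi - t) - of_int l * (pi - t) = (x * sin t - of_int (- l) * t) - of_int l * pi"
        by (simp add: algebra_simps)
      then show "?c l (pi - t) = (-1) powi l * ?c (- l) t"
        by (simp only: cos_diff[of _ "of_int l * pi"] cc) (simp add: sin_times_pi_eq_0)
    qed
    also have "integral {0..pi/2} \<dots> = (-1) powi l * Re (A (- l))"
      by (simp only: Henstock_Kurzweil_Integration.integral_mult_right ReA)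
    finally have "pi * \<bar>bessel_J l x\<bar> = \<bar>Re (A l) + (-1) powi l * Re (A (- l))\<bar>"
      unfolding ReA by (metis abs_mult abs_of_pos pi_gt_zero)
    also have "\<dots> \<le> \<bar>Re (A l)\<bar> + \<bar>Re (A (- l))\<bar>"
      by (rule order_trans[OF abs_triangle_ineq]) (simp add: abs_mult power_int_abs)
    also have "\<dots> \<le> norm (A l) + norm (A (- l))"
      by (intro add_mono abs_Re_le_cmod)
    also have "\<dots> \<le> (1 + 2 * (4 + 2 * \<bar>real_of_int l\<bar>)) / sqrt x + (1 + 2 * (4 + 2 * \<bar>real_of_int (- l)\<bar>)) / sqrt x"
      by (intro add_mono A)
    also have "\<dots> = ?C / sqrt x"
      unfolding add_divide_distrib[symmetric] by (intro arg_cong2[where f = "(/)"] refl) simp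
    finally have "pi * \<bar>bessel_J l x\<bar> \<le> ?C / sqrt x" .
    moreover have "\<bar>bessel_J l x\<bar> \<le> pi * \<bar>bessel_J l x\<bar>"
      using pi_gt3 by (simp add: mult_le_cancel_right1)
    ultimately show ?thesis by linarith
  qed
qed

section \<open>Gaussian means of Bessel products\<close>

lemma Fubini_integral_bounded:
  fixes f :: "'a \<Rightarrow> 'b \<Rightarrow> real"
  assumes "finite_measure M" "finite_measure N"
    and [measurable]: "case_prod f \<in> borel_measurable (M \<Otimes>\<^sub>M N)"
    and "\<And>x y. \<bar>f x y\<bar> \<le> B"
  shows "(LINT x|M. LINT y|N. f x y) = (LINT y|N. LINT x|M. f x y)"
proof -
  interpret M: finite_measure M by fact
  interpret N: finite_measure N by fact
  interpret P: pair_sigma_finite M N ..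
  interpret MN: finite_measure "M \<Otimes>\<^sub>M N"
    using assms(1,2) by (intro finite_measure_pair_measure)
  have "integrable (M \<Otimes>\<^sub>M N) (case_prod f)"
    by (rule MN.integrable_const_bound[of _ B]) (auto simp: assms)
  then show ?thesis by (rule P.Fubini_integral[symmetric])
qed

text \<open>\<open>x dx\<close> is the radial part of planar Lebesgue measure. Absorbing it and the
  Gaussian into a finite measure leaves integrands bounded by 1, so that every exchange of integrals
  is an instance of \<open>Fubini_integral_bounded\<close>.\<close>

definition gauss_measure :: "real \<Rightarrow> real measure" where
  "gauss_measure \<epsilon> = density lborel (\<lambda>x. ennreal (indicator {0..} x * (x * exp (- \<epsilon> * x\<^sup>2))))"

text \<open>A density on the whole line instead of a restricted space: its measurable sets are then
  those of \<open>borel\<close>, also in products.\<close>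

definition angle_interval :: "real measure" where
  "angle_interval = density lborel (indicator {0<..<pi})"

lemma sets_gauss_measure [measurable_cong, simp]: "sets (gauss_measure \<epsilon>) = sets borel"
  by (simp add: gauss_measure_def)

lemma sets_angle_interval [measurable_cong, simp]: "sets angle_interval = sets borel"
  by (simp add: angle_interval_def)

lemma space_gauss_measure [simp]: "space (gauss_measure \<epsilon>) = UNIV"
  by (simp add: gauss_measure_def)

lemma space_angle_interval [simp]: "space angle_interval = UNIV"
  by (simp add: angle_interval_def)

text \<open>The weight \<open>x\<close> of the measure raises the even power to an odd one, whose
  Gaussian moment is scaled by \<open>sqrt \<epsilon>\<close>.\<close>

lemma gauss_moment:
  assumes "0 < \<epsilon>"
  shows "has_bochner_integral (gauss_measure \<epsilon>) (\<lambda>x. x ^ (2 * m)) (fact m / (2 * \<epsilon> ^ (m + 1)))"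
proof -
  let ?c = "sqrt \<epsilon>"
  have c: "0 < ?c" "?c\<^sup>2 = \<epsilon>" using assms by auto
  have "has_bochner_integral lborel
     (\<lambda>x. indicator {0..} (0 + ?c * x) *\<^sub>R (exp (- (0 + ?c * x)\<^sup>2) * (0 + ?c * x) ^ (2 * m + 1)))
     (fact m / 2 /\<^sub>R \<bar>?c\<bar>)"
    by (rule lborel_has_bochner_integral_real_affine_iff[THEN iffD1, OF _ gaussian_moment_odd_pos]) (use c in simp)
  moreover have "(\<lambda>x. indicator {0..} (0 + ?c * x) *\<^sub>R (exp (- (0 + ?c * x)\<^sup>2) * (0 + ?c * x) ^ (2 * m + 1))) =
     (\<lambda>x. (\<epsilon> ^ m * ?c) *\<^sub>R (indicator {0..} x * (x * exp (- \<epsilon> * x\<^sup>2)) * x ^ (2 * m)))"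
  proof
    fix x
    have "indicator {0..} (?c * x) = (indicator {0..} x :: real)"
      using c by (simp add: indicator_def zero_le_mult_iff)
    moreover have "(?c * x) ^ (2 * m + 1) = \<epsilon> ^ m * ?c * (x * x ^ (2 * m))"
    proof -
      have "?c ^ (2 * m) = \<epsilon> ^ m" by (simp only: power_mult c)
      then show ?thesis by (simp add: power_mult_distrib)
    qed
    moreover have "(?c * x)\<^sup>2 = \<epsilon> * x\<^sup>2" by (simp add: power_mult_distrib c)
    ultimately show "indicator {0..} (0 + ?c * x) *\<^sub>R (exp (- (0 + ?c * x)\<^sup>2) * (0 + ?c * x) ^ (2 * m + 1)) =
      (\<epsilon> ^ m * ?c) *\<^sub>R (indicator {0..} x * (x * exp (- \<epsilon> * x\<^sup>2)) * x ^ (2 * m))"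
      by simp
  qed
  ultimately have "has_bochner_integral lborel
     (\<lambda>x. (\<epsilon> ^ m * ?c) *\<^sub>R (indicator {0..} x * (x * exp (- \<epsilon> * x\<^sup>2)) * x ^ (2 * m)))
     (fact m / 2 /\<^sub>R \<bar>?c\<bar>)" by simp
  then have "has_bochner_integral lborel
     (\<lambda>x. inverse (\<epsilon> ^ m * ?c) *\<^sub>R (\<epsilon> ^ m * ?c) *\<^sub>R (indicator {0..} x * (x * exp (- \<epsilon> * x\<^sup>2)) * x ^ (2 * m)))
     (inverse (\<epsilon> ^ m * ?c) *\<^sub>R (fact m / 2 /\<^sub>R \<bar>?c\<bar>))"
    by (rule has_bochner_integral_scaleR_right)
  moreover have "inverse (\<epsilon> ^ m * ?c) *\<^sub>R (\<epsilon> ^ m * ?c) *\<^sub>R y = y" for y :: real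
    unfolding scaleR_scaleR using assms by (subst left_inverse) auto
  moreover have "inverse (\<epsilon> ^ m * ?c) *\<^sub>R (fact m / 2 /\<^sub>R \<bar>?c\<bar>) = fact m / (2 * \<epsilon> ^ (m + 1))"
  proof -
    have "inverse (\<epsilon> ^ m * ?c) *\<^sub>R (fact m / 2 /\<^sub>R \<bar>?c\<bar>) = fact m / (2 * (\<epsilon> ^ m * ?c\<^sup>2))"
      using c by (simp add: power2_eq_square field_simps del: real_sqrt_mult_self)
    then show ?thesis using c by (simp add: mult.commute)
  qed
  ultimately have "has_bochner_integral lborel
     (\<lambda>x. indicator {0..} x * (x * exp (- \<epsilon> * x\<^sup>2)) * x ^ (2 * m)) (fact m / (2 * \<epsilon> ^ (m + 1)))"
    by (simp only:)
  then have "has_bochner_integral lborel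
     (\<lambda>x. (indicator {0..} x * (x * exp (- \<epsilon> * x\<^sup>2))) *\<^sub>R x ^ (2 * m)) (fact m / (2 * \<epsilon> ^ (m + 1)))"
    by simp
  then show ?thesis unfolding gauss_measure_def
    by (rule has_bochner_integral_density[rotated 3]) (auto simp: indicator_def)
qed

lemma finite_measure_gauss:
  assumes "0 < \<epsilon>" shows "finite_measure (gauss_measure \<epsilon>)"
proof (rule finite_measureI)
  have "integrable (gauss_measure \<epsilon>) (\<lambda>x. 1 :: real)"
    using gauss_moment[OF assms, of 0] by (simp add: has_bochner_integral_iff)
  then show "emeasure (gauss_measure \<epsilon>) (space (gauss_measure \<epsilon>)) \<noteq> \<infinity>"
    unfolding integrable_iff_bounded by (auto simp: less_top)
qed

lemma finite_measure_angle_interval: "finite_measure angle_interval"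
proof (rule finite_measureI)
  show "emeasure angle_interval (space angle_interval) \<noteq> \<infinity>"
    unfolding angle_interval_def by (simp add: emeasure_density)
qed

lemma AE_angle_interval: "AE t in angle_interval. 0 < t \<and> t < pi"
  unfolding angle_interval_def by (subst AE_density) (auto simp: indicator_def)

lemma angle_interval_integral:
  fixes g :: "real \<Rightarrow> real"
  assumes [measurable]: "g \<in> borel_measurable borel"
    and bd: "\<And>t. \<bar>g t\<bar> \<le> B" and I: "(g has_integral I) {0..pi}"
  shows "(LINT t|angle_interval. g t) = I"
proof -
  interpret finite_measure angle_interval by (rule finite_measure_angle_interval)
  have "integrable angle_interval g"
    by (rule integrable_const_bound[of _ B]) (auto simp: bd)
  then have "set_integrable lborel {0<..<pi} g"
    unfolding angle_interval_def set_integrable_def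
    by (subst (asm) integrable_density[of _ _ "indicator {0<..<pi}", simplified ennreal_indicator]) auto
  then have "(LINT t:{0<..<pi}|lborel. g t) = integral {0<..<pi} g"
    by (rule set_borel_integral_eq_integral)
  moreover have "(LINT t|angle_interval. g t) = (LINT t:{0<..<pi}|lborel. g t)"
    unfolding angle_interval_def set_lebesgue_integral_def
    by (subst integral_density[of _ _ "indicator {0<..<pi}", simplified ennreal_indicator]) auto
  moreover have "integral {0<..<pi} g = I"
    using I by (simp add: has_integral_Icc_iff_Ioo integral_unique)
  ultimately show ?thesis by simp
qed

section \<open>Weber's exponential integral and the planar heat kernel\<close>

lemma bessel_J_0_series:
  "(\<lambda>m. (-1) ^ m / (fact m)\<^sup>2 * (x / 2) ^ (2 * m)) sums bessel_J 0 x"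
proof -
  have eq: "(-1) ^ m / fact m * rGamma (of_int (int m + 0 + 1)) * (x / 2) powi (2 * int m + 0) =
      (-1) ^ m / (fact m)\<^sup>2 * (x / 2) ^ (2 * m)" for m
  proof -
    have "(x / 2) powi (2 * int m + 0) = (x / 2) ^ (2 * m)"
      using power_int_of_nat[of "x / 2" "2 * m"] by simp
    moreover have "rGamma (real_of_int (int m + 0 + 1)) = 1 / fact m"
      using rGamma_of_nat_Suc[of m] by (simp add: add.commute)
    ultimately show ?thesis by (simp add: power2_eq_square)
  qed
  have "summable (\<lambda>m. (-1) ^ m / (fact m)\<^sup>2 * (x / 2) ^ (2 * m))"
  proof (rule summable_comparison_test'[of "\<lambda>m. ((x / 2)\<^sup>2) ^ m / fact m" 0])
    show "summable (\<lambda>m. ((x / 2)\<^sup>2) ^ m / fact m)"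
      using summable_exp[of "(x / 2)\<^sup>2"] by (simp add: field_simps)
    fix m :: nat
    have "norm ((-1) ^ m / (fact m)\<^sup>2 * (x / 2) ^ (2 * m)) = ((x / 2)\<^sup>2) ^ m / (fact m)\<^sup>2"
      by (simp add: abs_mult power_mult power_abs[symmetric] del: power_divide)
    also have "\<dots> \<le> ((x / 2)\<^sup>2) ^ m / fact m"
      by (intro divide_left_mono) (auto simp: power2_eq_square)
    finally show "norm ((-1) ^ m / (fact m)\<^sup>2 * (x / 2) ^ (2 * m)) \<le> ((x / 2)\<^sup>2) ^ m / fact m" .
  qed
  then have "(\<lambda>m. (-1) ^ m / (fact m)\<^sup>2 * (x / 2) ^ (2 * m)) sums (\<Sum>m. (-1) ^ m / (fact m)\<^sup>2 * (x / 2) ^ (2 * m))"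
    by (rule summable_sums)
  then show ?thesis unfolding bessel_J_def by (simp only: eq)
qed

text \<open>Each moment cancels one of the two factorials in the series of
  \<open>bessel_J 0\<close>, which leaves an exponential series; the series of absolute values sums
  in the same way and justifies the exchange. Up to the factor 2\<pi> the value is the planar heat
  kernel at distance \<open>\<kappa>\<close> and time \<open>\<epsilon>\<close>.\<close>

lemma gauss_bessel_J_0:
  assumes \<epsilon>: "0 < \<epsilon>"
  shows "(LINT x|gauss_measure \<epsilon>. bessel_J 0 (\<kappa> * x)) = exp (- \<kappa>\<^sup>2 / (4 * \<epsilon>)) / (2 * \<epsilon>)"
proof -
  let ?f = "\<lambda>m x. (-1) ^ m / (fact m)\<^sup>2 * (\<kappa> * x / 2) ^ (2 * m) :: real"
  let ?b = "\<lambda>m. (\<kappa>\<^sup>2 / (4 * \<epsilon>)) ^ m / fact m / (2 * \<epsilon>)"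
  have f_eq: "?f m x = (-1) ^ m / (fact m)\<^sup>2 * (\<kappa> / 2) ^ (2 * m) * x ^ (2 * m)" for m x
    by (simp add: power_mult_distrib power_divide)
  have nf_eq: "norm (?f m x) = 1 / (fact m)\<^sup>2 * (\<kappa> / 2) ^ (2 * m) * x ^ (2 * m)" for m x
  proof -
    have "0 \<le> (\<kappa> / 2) ^ (2 * m)" "0 \<le> x ^ (2 * m)" by (simp_all add: zero_le_even_power')
    then show ?thesis unfolding f_eq by (simp add: abs_mult del: power_divide)
  qed
  have val: "c / (fact m)\<^sup>2 * (\<kappa> / 2) ^ (2 * m) * (fact m / (2 * \<epsilon> ^ (m + 1))) = c * ?b m" for m :: nat and c :: real
  proof -
    have "(\<kappa> / 2) ^ (2 * m) = (\<kappa>\<^sup>2 / 4) ^ m" by (simp add: power_mult power_divide)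
    then show ?thesis using \<epsilon> by (simp add: power_divide power_mult_distrib power2_eq_square field_simps)
  qed
  have I: "has_bochner_integral (gauss_measure \<epsilon>) (?f m) ((-1) ^ m * ?b m)" for m
    unfolding f_eq val[symmetric] by (intro has_bochner_integral_mult_right gauss_moment \<epsilon>)
  have NI: "has_bochner_integral (gauss_measure \<epsilon>) (\<lambda>x. norm (?f m x)) (?b m)" for m
    unfolding nf_eq using has_bochner_integral_mult_right[OF gauss_moment[OF \<epsilon>, of m], of "1 / (fact m)\<^sup>2 * (\<kappa> / 2) ^ (2 * m)"] val[of 1 m]
    by simp
  have sb: "summable ?b"
    using summable_exp[of "\<kappa>\<^sup>2 / (4 * \<epsilon>)"] by (intro summable_divide) (simp add: field_simps)
  have "(LINT x|gauss_measure \<epsilon>. (\<Sum>m. ?f m x)) = (\<Sum>m. LINT x|gauss_measure \<epsilon>. ?f m x)"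
  proof (rule integral_suminf)
    show "integrable (gauss_measure \<epsilon>) (?f m)" for m using I by (auto simp: has_bochner_integral_iff)
    show "AE x in gauss_measure \<epsilon>. summable (\<lambda>m. norm (?f m x))"
    proof (rule AE_I2)
      fix x
      show "summable (\<lambda>m. norm (?f m x))"
      proof (rule summable_comparison_test'[of "\<lambda>m. ((\<kappa> * x / 2)\<^sup>2) ^ m / fact m" 0])
        show "summable (\<lambda>m. ((\<kappa> * x / 2)\<^sup>2) ^ m / fact m)"
          using summable_exp[of "(\<kappa> * x / 2)\<^sup>2"] by (simp add: field_simps)
        fix m :: nat
        have "norm (norm (?f m x)) = ((\<kappa> * x / 2)\<^sup>2) ^ m / (fact m)\<^sup>2"
          by (simp add: abs_mult power_mult power_abs[symmetric] del: power_divide)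
        also have "\<dots> \<le> ((\<kappa> * x / 2)\<^sup>2) ^ m / fact m"
          by (intro divide_left_mono) (auto simp: power2_eq_square)
        finally show "norm (norm (?f m x)) \<le> ((\<kappa> * x / 2)\<^sup>2) ^ m / fact m" .
      qed
    qed
    show "summable (\<lambda>m. LINT x|gauss_measure \<epsilon>. norm (?f m x))"
      using sb has_bochner_integral_integral_eq[OF NI] by simp
  qed
  also have "\<dots> = (\<Sum>m. (-1) ^ m * ?b m)"
    using has_bochner_integral_integral_eq[OF I] by simp
  also have "(\<lambda>m. (-1) ^ m * ?b m) = (\<lambda>m. ((- \<kappa>\<^sup>2 / (4 * \<epsilon>)) ^ m /\<^sub>R fact m) / (2 * \<epsilon>))"
  proof
    fix m :: nat
    have "(- \<kappa>\<^sup>2 / (4 * \<epsilon>)) ^ m = (-1) ^ m * (\<kappa>\<^sup>2 / (4 * \<epsilon>)) ^ m"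
      by (simp flip: power_mult_distrib)
    then show "(-1) ^ m * ?b m = ((- \<kappa>\<^sup>2 / (4 * \<epsilon>)) ^ m /\<^sub>R fact m) / (2 * \<epsilon>)"
      by (simp only: real_scaleR_def divide_inverse mult_ac)
  qed
  also have "(\<Sum>m. ((- \<kappa>\<^sup>2 / (4 * \<epsilon>)) ^ m /\<^sub>R fact m) / (2 * \<epsilon>)) = exp (- \<kappa>\<^sup>2 / (4 * \<epsilon>)) / (2 * \<epsilon>)"
    by (intro sums_unique[symmetric] sums_divide exp_converges)
  finally show ?thesis
    using bessel_J_0_series by (simp add: sums_iff)
qed

text \<open>The component of angular frequency \<open>\<nu>\<close> of the planar heat kernel
  between the circles of radii \<open>r\<close> and \<open>s\<close>. With the modified Bessel
  function \<open>I\<close> it equals \<open>exp (- (r^2 + s^2) / (4 \<epsilon>)) I_\<nu> (r s / (2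
  \<epsilon>)) / (2 \<epsilon>)\<close>.\<close>

definition heat_kernel :: "int \<Rightarrow> real \<Rightarrow> real \<Rightarrow> real \<Rightarrow> real" where
  "heat_kernel \<nu> \<epsilon> r s = (LINT x|gauss_measure \<epsilon>. bessel_J \<nu> (r * x) * bessel_J \<nu> (s * x))"

lemma abs_bessel_mult_le: "\<bar>a\<bar> \<le> 1 \<Longrightarrow> \<bar>b\<bar> \<le> 1 \<Longrightarrow> \<bar>a * b\<bar> \<le> 1" for a b :: real
  by (simp add: abs_mult mult_le_one)

text \<open>Two factors of equal order are a mean of \<open>bessel_J 0\<close> over the distance of
  two points on the circles, by the addition formula with \<open>L = 0\<close>; Weber's integral is
  then applied for each distance.\<close>

lemma heat_kernel_eq:
  assumes \<epsilon>: "0 < \<epsilon>" and r: "0 < r" and s: "0 < s"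
  shows "heat_kernel \<nu> \<epsilon> r s =
    (LINT t|angle_interval. exp (- (tri_side r s t)\<^sup>2 / (4 * \<epsilon>)) * cos (of_int \<nu> * t)) / (2 * pi * \<epsilon>)"
proof -
  have J: "pi * (bessel_J \<nu> (r * x) * bessel_J \<nu> (s * x)) =
     (LINT t|angle_interval. bessel_J 0 (tri_side r s t * x) * cos (of_int \<nu> * t))" for x
  proof (rule angle_interval_integral[symmetric])
    show "((\<lambda>t. bessel_J 0 (tri_side r s t * x) * cos (of_int \<nu> * t)) has_integral
        pi * (bessel_J \<nu> (r * x) * bessel_J \<nu> (s * x))) {0..pi}"
      using bessel_J_mult_integral'[OF r s, of 0 x \<nu>] by simp
    show "\<bar>bessel_J 0 (tri_side r s t * x) * cos (of_int \<nu> * t)\<bar> \<le> 1" for t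
      by (intro abs_bessel_mult_le abs_bessel_J_le_1) simp
  qed measurable
  have "pi * heat_kernel \<nu> \<epsilon> r s = (LINT x|gauss_measure \<epsilon>. pi * (bessel_J \<nu> (r * x) * bessel_J \<nu> (s * x)))"
    unfolding heat_kernel_def by simp
  also have "\<dots> = (LINT x|gauss_measure \<epsilon>. LINT t|angle_interval. bessel_J 0 (tri_side r s t * x) * cos (of_int \<nu> * t))"
    by (simp only: J)
  also have "\<dots> = (LINT t|angle_interval. LINT x|gauss_measure \<epsilon>. bessel_J 0 (tri_side r s t * x) * cos (of_int \<nu> * t))"
  proof (rule Fubini_integral_bounded[of _ _ _ 1])
    show "\<bar>bessel_J 0 (tri_side r s t * x) * cos (of_int \<nu> * t)\<bar> \<le> 1" for t x
      by (intro abs_bessel_mult_le abs_bessel_J_le_1) simp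
  qed (auto intro: finite_measure_gauss finite_measure_angle_interval \<epsilon>)
  also have "\<dots> = (LINT t|angle_interval. (exp (- (tri_side r s t)\<^sup>2 / (4 * \<epsilon>)) * cos (of_int \<nu> * t)) / (2 * \<epsilon>))"
    by (simp add: gauss_bessel_J_0[OF \<epsilon>])
  also have "\<dots> = (LINT t|angle_interval. exp (- (tri_side r s t)\<^sup>2 / (4 * \<epsilon>)) * cos (of_int \<nu> * t)) / (2 * \<epsilon>)"
    by (rule integral_divide_zero)
  finally have "heat_kernel \<nu> \<epsilon> r s * pi = (LINT t|angle_interval. exp (- (tri_side r s t)\<^sup>2 / (4 * \<epsilon>)) * cos (of_int \<nu> * t)) / (2 * \<epsilon>)"
    by (simp only: mult.commute)
  then have "heat_kernel \<nu> \<epsilon> r s = (LINT t|angle_interval. exp (- (tri_side r s t)\<^sup>2 / (4 * \<epsilon>)) * cos (of_int \<nu> * t)) / (2 * \<epsilon>) / pi"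
    by (rule eq_divide_imp[OF pi_neq_zero])
  then show ?thesis by (simp only: divide_divide_eq_left mult_ac)
qed

text \<open>The first two factors are merged into one of order \<open>m + n\<close> in the third
  side of their triangle. Two factors of equal order remain, and their Gaussian mean is
  \<open>heat_kernel\<close>.\<close>

lemma gauss_bessel_J_triple:
  assumes \<epsilon>: "0 < \<epsilon>" and a: "0 < a" and b: "0 < b"
  shows "(LINT x|gauss_measure \<epsilon>. bessel_J m (a * x) * bessel_J n (b * x) * bessel_J (m + n) (s * x)) =
    (LINT t|angle_interval. cos (of_int m * tri_angle b a (tri_side a b t) - of_int n * tri_angle a b (tri_side a b t))
        * heat_kernel (m + n) \<epsilon> (tri_side a b t) s) / pi"
proof -
  let ?k = "tri_side a b"
  let ?c = "\<lambda>t. cos (of_int m * tri_angle b a (?k t) - of_int n * tri_angle a b (?k t))"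
  have J: "pi * (bessel_J m (a * x) * bessel_J n (b * x)) = (LINT t|angle_interval. bessel_J (m + n) (?k t * x) * ?c t)" for x
  proof (rule angle_interval_integral[symmetric])
    have "?c t = cos (of_int n * tri_angle a b (?k t) - of_int m * tri_angle b a (?k t))" for t
      by (metis cos_minus minus_diff_eq)
    then show "((\<lambda>t. bessel_J (m + n) (?k t * x) * ?c t) has_integral
        pi * (bessel_J m (a * x) * bessel_J n (b * x))) {0..pi}"
      using bessel_J_mult_integral[OF a b, of m n x] by simp
    show "\<bar>bessel_J (m + n) (?k t * x) * ?c t\<bar> \<le> 1" for t
      by (intro abs_bessel_mult_le abs_bessel_J_le_1) simp
  qed measurable
  have "pi * (LINT x|gauss_measure \<epsilon>. bessel_J m (a * x) * bessel_J n (b * x) * bessel_J (m + n) (s * x)) =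
     (LINT x|gauss_measure \<epsilon>. pi * (bessel_J m (a * x) * bessel_J n (b * x)) * bessel_J (m + n) (s * x))"
    by (simp flip: integral_mult_right_zero add: mult.assoc)
  also have "\<dots> = (LINT x|gauss_measure \<epsilon>. LINT t|angle_interval. bessel_J (m + n) (?k t * x) * ?c t * bessel_J (m + n) (s * x))"
    by (simp only: J integral_mult_left_zero)
  also have "\<dots> = (LINT t|angle_interval. LINT x|gauss_measure \<epsilon>. bessel_J (m + n) (?k t * x) * ?c t * bessel_J (m + n) (s * x))"
  proof (rule Fubini_integral_bounded[of _ _ _ 1])
    show "\<bar>bessel_J (m + n) (?k t * x) * ?c t * bessel_J (m + n) (s * x)\<bar> \<le> 1" for t x
      by (intro abs_bessel_mult_le abs_bessel_J_le_1) simp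
  qed (auto intro: finite_measure_gauss finite_measure_angle_interval \<epsilon>)
  also have "\<dots> = (LINT t|angle_interval. ?c t * heat_kernel (m + n) \<epsilon> (?k t) s)"
    unfolding heat_kernel_def integral_mult_right_zero[symmetric] by (simp only: mult_ac)
  finally have "(LINT x|gauss_measure \<epsilon>. bessel_J m (a * x) * bessel_J n (b * x) * bessel_J (m + n) (s * x)) * pi =
      (LINT t|angle_interval. ?c t * heat_kernel (m + n) \<epsilon> (?k t) s)" by (simp only: mult.commute)
  then show ?thesis by (rule eq_divide_imp[OF pi_neq_zero])
qed

section \<open>Bounds for the heat kernel\<close>

lemma gaussian_half_line:
  fixes c :: real
  assumes "0 < c"
  shows "has_bochner_integral lborel (\<lambda>x. indicator {0..} x * exp (- (c * x)\<^sup>2)) (sqrt pi / (2 * c))"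
proof -
  have "has_bochner_integral lborel (\<lambda>x. indicator {0..} (0 + c * x) *\<^sub>R exp (- (0 + c * x)\<^sup>2)) (sqrt pi / 2 /\<^sub>R \<bar>c\<bar>)"
    by (rule lborel_has_bochner_integral_real_affine_iff[THEN iffD1, OF _ gaussian_moment_0]) (use assms in simp)
  moreover have "indicator {0..} (0 + c * x) *\<^sub>R exp (- (0 + c * x)\<^sup>2) = indicator {0..} x * exp (- (c * x)\<^sup>2)" for x
  proof -
    have "0 \<le> c * x \<longleftrightarrow> 0 \<le> x" using assms by (simp add: zero_le_mult_iff)
    then show ?thesis by (simp only: indicator_def atLeast_iff add_0 real_scaleR_def)
  qed
  moreover have "sqrt pi / 2 /\<^sub>R \<bar>c\<bar> = sqrt pi / (2 * c)"
    unfolding abs_of_pos[OF assms] real_scaleR_def by (simp only: divide_inverse inverse_mult_distrib mult_ac)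
  ultimately show ?thesis by (simp only:)
qed

lemma gaussian_line:
  fixes c :: real
  assumes "0 < c"
  shows "has_bochner_integral lborel (\<lambda>x. exp (- (c * x)\<^sup>2)) (sqrt pi / c)"
proof -
  have "has_bochner_integral lborel (\<lambda>x. exp (- (c * x)\<^sup>2)) (2 *\<^sub>R (sqrt pi / (2 * c)))"
  proof (rule has_bochner_integral_even_function)
    show "has_bochner_integral lborel (\<lambda>x. indicator {0..} x *\<^sub>R exp (- (c * x)\<^sup>2)) (sqrt pi / (2 * c))"
      unfolding real_scaleR_def by (rule gaussian_half_line[OF assms])
  qed simp
  then show ?thesis by simp
qed

text \<open>Separates the radial distance \<open>r - s\<close> from the angular part; this is what
  factorises the heat kernel.\<close>

lemma tri_side_sq_sin: "(tri_side r s t)\<^sup>2 = (r - s)\<^sup>2 + 4 * r * s * (sin (t / 2))\<^sup>2"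
proof -
  have "cos t = 1 - 2 * (sin (t / 2))\<^sup>2" using cos_double_sin[of "t / 2"] by simp
  then show ?thesis unfolding tri_side_sq by (simp only:) (simp add: power2_eq_square algebra_simps)
qed

lemma angle_interval_lborel:
  assumes [measurable]: "g \<in> borel_measurable borel"
  shows "(LINT t|angle_interval. g t) = (LINT t|lborel. indicator {0<..<pi} t * (g t :: real))"
  unfolding angle_interval_def
  by (subst integral_density[of _ _ "indicator {0<..<pi}", simplified ennreal_indicator]) auto

lemma integrable_angle_interval_bounded:
  fixes g :: "real \<Rightarrow> real"
  assumes "g \<in> borel_measurable borel" "\<And>t. \<bar>g t\<bar> \<le> B"
  shows "integrable angle_interval g"
proof -
  interpret finite_measure angle_interval by (rule finite_measure_angle_interval)
  show ?thesis using assms by (intro integrable_const_bound[of _ B]) auto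
qed

text \<open>The angular part of the heat kernel. It depends on the radii only through
  \<open>q = r s\<close> and equals \<open>exp (- q / (2 \<epsilon>)) I_\<nu> (q / (2 \<epsilon>)) /
  (2 \<epsilon>)\<close>.\<close>

definition heat_factor :: "int \<Rightarrow> real \<Rightarrow> real \<Rightarrow> real" where
  "heat_factor \<nu> \<epsilon> q = (LINT t|angle_interval. exp (- q / \<epsilon> * (sin (t / 2))\<^sup>2) * cos (of_int \<nu> * t)) / (2 * pi * \<epsilon>)"

lemma heat_kernel_factor:
  assumes "0 < \<epsilon>" "0 < r" "0 < s"
  shows "heat_kernel \<nu> \<epsilon> r s = exp (- (r - s)\<^sup>2 / (4 * \<epsilon>)) * heat_factor \<nu> \<epsilon> (r * s)"
proof -
  have "exp (- (tri_side r s t)\<^sup>2 / (4 * \<epsilon>)) * cos (of_int \<nu> * t) =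
    exp (- (r - s)\<^sup>2 / (4 * \<epsilon>)) * (exp (- (r * s) / \<epsilon> * (sin (t / 2))\<^sup>2) * cos (of_int \<nu> * t))" for t
  proof -
    have "- (tri_side r s t)\<^sup>2 / (4 * \<epsilon>) = - (r - s)\<^sup>2 / (4 * \<epsilon>) + - (r * s) / \<epsilon> * (sin (t / 2))\<^sup>2"
      unfolding tri_side_sq_sin using assms by (simp add: field_simps)
    then show ?thesis by (simp only: exp_add mult.assoc)
  qed
  then show ?thesis unfolding heat_kernel_eq[OF assms] heat_factor_def
    by (simp only: integral_mult_right_zero times_divide_eq_right)
qed

lemma heat_factor_abs_le:
  assumes "0 < \<epsilon>" "0 < q"
  shows "\<bar>heat_factor \<nu> \<epsilon> q\<bar> \<le> heat_factor 0 \<epsilon> q"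
proof -
  let ?g = "\<lambda>\<nu> t. exp (- q / \<epsilon> * (sin (t / 2))\<^sup>2) * cos (of_int \<nu> * t)"
  have bd: "\<bar>?g \<nu> t\<bar> \<le> 1" for \<nu> t
    using assms by (intro abs_bessel_mult_le) (auto intro!: divide_nonneg_pos)
  have "\<bar>LINT t|angle_interval. ?g \<nu> t\<bar> \<le> (LINT t|angle_interval. ?g 0 t)"
  proof (rule integral_abs_bound_integral)
    show "integrable angle_interval (?g \<nu>)" "integrable angle_interval (?g 0)"
      by (rule integrable_angle_interval_bounded[OF _ bd], measurable)+
  qed (auto simp: abs_mult mult_left_le)
  then show ?thesis unfolding heat_factor_def using assms by (simp add: divide_right_mono)
qed

lemma heat_factor_0_nonneg:
  assumes "0 < \<epsilon>"
  shows "0 \<le> heat_factor 0 \<epsilon> q"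
  unfolding heat_factor_def using assms by (intro divide_nonneg_nonneg integral_nonneg_AE) auto

text \<open>Weaker than \<open>heat_factor_le\<close> for small \<open>\<epsilon>\<close>, but
  uniform in \<open>q\<close>, so it still serves when a radius tends to 0.\<close>

lemma heat_factor_le_inverse:
  assumes "0 < \<epsilon>" "0 < q"
  shows "heat_factor 0 \<epsilon> q \<le> 1 / (2 * \<epsilon>)"
proof -
  interpret finite_measure angle_interval by (rule finite_measure_angle_interval)
  let ?g = "\<lambda>t. exp (- q / \<epsilon> * (sin (t / 2))\<^sup>2) * cos (of_int 0 * t)"
  have bd: "\<bar>?g t\<bar> \<le> 1" for t
    using assms by (intro abs_bessel_mult_le) (auto intro!: divide_nonneg_pos)
  have "(LINT t|angle_interval. ?g t) \<le> (LINT t|angle_interval. 1)"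
  proof (rule integral_mono)
    show "integrable angle_interval ?g"
      by (rule integrable_angle_interval_bounded[OF _ bd], measurable)
    show "?g t \<le> 1" for t using bd[of t] by simp
  qed simp
  also have "\<dots> = pi" by (subst angle_interval_lborel) auto
  finally show ?thesis unfolding heat_factor_def using assms by (simp add: field_simps)
qed

lemma heat_factor_le:
  assumes \<epsilon>: "0 < \<epsilon>" and q: "0 < q"
  shows "heat_factor 0 \<epsilon> q \<le> 1 / sqrt (\<epsilon> * q)"
proof -
  \<comment> \<open>Then \<open>(c t)^2\<close> is the exponent with \<open>sin (t / 2)\<close>
    replaced by its lower bound \<open>t / 4\<close>.\<close>
  define c where "c = sqrt (q / \<epsilon>) / 4"
  have c: "0 < c" "c\<^sup>2 = q / \<epsilon> / 16" using assms by (auto simp: c_def power_divide)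
  let ?g = "\<lambda>t. exp (- q / \<epsilon> * (sin (t / 2))\<^sup>2) * cos (of_int 0 * t)"
  have bd: "\<bar>?g t\<bar> \<le> 1" for t
    using assms by (intro abs_bessel_mult_le) (auto intro!: divide_nonneg_pos)
  have "(LINT t|angle_interval. ?g t) = (LINT t|lborel. indicator {0<..<pi} t * ?g t)"
    by (rule angle_interval_lborel) measurable
  also have "\<dots> \<le> (LINT t|lborel. indicator {0..} t * exp (- (c * t)\<^sup>2))"
  proof (rule integral_mono)
    have "integrable angle_interval ?g"
      by (rule integrable_angle_interval_bounded[OF _ bd]) measurable
    then have "set_integrable lborel {0<..<pi} ?g"
      unfolding angle_interval_def set_integrable_def
      by (subst (asm) integrable_density[of _ _ "indicator {0<..<pi}", simplified ennreal_indicator]) auto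
    then show "integrable lborel (\<lambda>t. indicator {0<..<pi} t * ?g t)"
      by (simp add: set_integrable_def)
    show "integrable lborel (\<lambda>t. indicator {0..} t * exp (- (c * t)\<^sup>2))"
      using gaussian_half_line[OF c(1)] by (auto simp: has_bochner_integral_iff)
    fix t :: real
    show "indicator {0<..<pi} t * ?g t \<le> indicator {0..} t * exp (- (c * t)\<^sup>2)"
    proof (cases "0 < t \<and> t < pi")
      case True
      then have "t / 4 \<le> sin (t / 2)" using sin_ge_half[of "t / 2"] by simp
      then have "(t / 4)\<^sup>2 \<le> (sin (t / 2))\<^sup>2" using True by (intro power_mono) auto
      then have "q / \<epsilon> * (t / 4)\<^sup>2 \<le> q / \<epsilon> * (sin (t / 2))\<^sup>2"
        using assms by (intro mult_left_mono) auto
      moreover have "(c * t)\<^sup>2 = q / \<epsilon> * (t / 4)\<^sup>2"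
        by (simp add: power_mult_distrib c power_divide)
      ultimately show ?thesis using True by simp
    qed (auto simp: indicator_def)
  qed
  also have "\<dots> = sqrt pi / (2 * c)"
    using gaussian_half_line[OF c(1)] by (rule has_bochner_integral_integral_eq)
  finally have "heat_factor 0 \<epsilon> q \<le> sqrt pi / (2 * c) / (2 * pi * \<epsilon>)"
    unfolding heat_factor_def using \<epsilon> by (intro divide_right_mono) auto
  also have "\<dots> = (sqrt pi / pi) * (1 / (sqrt (q / \<epsilon>) * \<epsilon>))"
    by (simp add: c_def)
  also have "\<dots> \<le> 1 * (1 / (sqrt (q / \<epsilon>) * \<epsilon>))"
  proof (rule mult_right_mono)
    have "sqrt pi \<le> pi" using pi_ge_two real_le_lsqrt[of pi pi] self_le_power[of pi 2] by (simp add: power2_eq_square)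
    then show "sqrt pi / pi \<le> 1" by simp
  qed (use assms in auto)
  also have "sqrt (q / \<epsilon>) * \<epsilon> = sqrt (\<epsilon> * q)"
  proof -
    have "sqrt (q / \<epsilon>) * sqrt \<epsilon> = sqrt q" using \<epsilon> by (simp flip: real_sqrt_mult)
    then have "sqrt (q / \<epsilon>) * (sqrt \<epsilon> * sqrt \<epsilon>) = sqrt q * sqrt \<epsilon>" by (simp only: mult.assoc[symmetric])
    then show ?thesis using \<epsilon> by (simp add: real_sqrt_mult mult.commute)
  qed
  finally show ?thesis by simp
qed

lemma heat_kernel_0_nonneg:
  assumes "0 < \<epsilon>" "0 < r" "0 < s"
  shows "0 \<le> heat_kernel 0 \<epsilon> r s"
  unfolding heat_kernel_factor[OF assms] using heat_factor_0_nonneg assms by simp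

lemma heat_kernel_bound:
  assumes "0 < \<epsilon>" "0 < r" "0 < s"
  shows "\<bar>heat_kernel \<nu> \<epsilon> r s\<bar> \<le> exp (- (r - s)\<^sup>2 / (4 * \<epsilon>)) / sqrt (\<epsilon> * (r * s))"
proof -
  have "\<bar>heat_kernel \<nu> \<epsilon> r s\<bar> = exp (- (r - s)\<^sup>2 / (4 * \<epsilon>)) * \<bar>heat_factor \<nu> \<epsilon> (r * s)\<bar>"
    unfolding heat_kernel_factor[OF assms] by (simp add: abs_mult)
  also have "\<dots> \<le> exp (- (r - s)\<^sup>2 / (4 * \<epsilon>)) * (1 / sqrt (\<epsilon> * (r * s)))"
    using assms by (intro mult_left_mono order_trans[OF heat_factor_abs_le heat_factor_le]) auto
  finally show ?thesis by simp
qed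

text \<open>The factor \<open>1 / sqrt r\<close> of \<open>heat_kernel_bound\<close> is harmless for
  \<open>r\<close> above \<open>s / 2\<close>. Below, only the bound
  \<open>1 / (2 \<epsilon>)\<close> is at hand, but there the distance to \<open>s\<close> exceeds
  \<open>s / 2\<close>: half of the Gaussian exponent is spent on the missing power of
  \<open>\<epsilon>\<close>, and hence the 8 in place of 4.\<close>

lemma heat_kernel_bound':
  assumes \<epsilon>: "0 < \<epsilon>" and r: "0 < r" and s: "0 < s"
  shows "\<bar>heat_kernel \<nu> \<epsilon> r s\<bar> \<le> 2 / (s * sqrt \<epsilon>) * exp (- (r - s)\<^sup>2 / (8 * \<epsilon>))"
proof (cases "s / 2 \<le> r")
  case True
  have "\<bar>heat_kernel \<nu> \<epsilon> r s\<bar> \<le> exp (- (r - s)\<^sup>2 / (4 * \<epsilon>)) / sqrt (\<epsilon> * (r * s))"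
    by (rule heat_kernel_bound[OF assms])
  also have "\<dots> \<le> exp (- (r - s)\<^sup>2 / (8 * \<epsilon>)) / (s / 2 * sqrt \<epsilon>)"
  proof (rule frac_le)
    have "(r - s)\<^sup>2 / (8 * \<epsilon>) \<le> (r - s)\<^sup>2 / (4 * \<epsilon>)"
      using \<epsilon> by (intro divide_left_mono) auto
    then show "exp (- (r - s)\<^sup>2 / (4 * \<epsilon>)) \<le> exp (- (r - s)\<^sup>2 / (8 * \<epsilon>))" by simp
    have "(s / 2)\<^sup>2 \<le> r * s"
    proof -
      have "s / 2 * s \<le> r * s" using True s by (intro mult_right_mono) auto
      moreover have "(s / 2)\<^sup>2 \<le> s / 2 * s" by (simp add: power2_eq_square)
      ultimately show ?thesis by linarith
    qed
    then have "s / 2 \<le> sqrt (r * s)" by (rule real_le_rsqrt)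
    then have "s / 2 * sqrt \<epsilon> \<le> sqrt (r * s) * sqrt \<epsilon>" using \<epsilon> by (intro mult_right_mono) auto
    also have "\<dots> = sqrt (\<epsilon> * (r * s))" by (simp add: real_sqrt_mult)
    finally show "s / 2 * sqrt \<epsilon> \<le> sqrt (\<epsilon> * (r * s))" .
  qed (use assms in auto)
  also have "\<dots> = 2 / (s * sqrt \<epsilon>) * exp (- (r - s)\<^sup>2 / (8 * \<epsilon>))" by simp
  finally show ?thesis .
next
  case False
  \<comment> \<open>The radial distance in units of the width \<open>sqrt \<epsilon>\<close>; it is
    at least \<open>s / (2 sqrt \<epsilon>)\<close>, and \<open>exp (- X^2 / 8)\<close> absorbs one
    such factor.\<close>
  define X where "X = (s - r) / sqrt \<epsilon>"
  have se: "0 < sqrt \<epsilon>" "(sqrt \<epsilon>)\<^sup>2 = \<epsilon>" using \<epsilon> by auto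
  have X2: "X\<^sup>2 = (r - s)\<^sup>2 / \<epsilon>" by (simp add: X_def power_divide se power2_commute)
  have X: "s / (2 * sqrt \<epsilon>) \<le> X" unfolding X_def using False se by (simp add: field_simps)
  have "\<bar>heat_kernel \<nu> \<epsilon> r s\<bar> = exp (- (r - s)\<^sup>2 / (4 * \<epsilon>)) * \<bar>heat_factor \<nu> \<epsilon> (r * s)\<bar>"
    unfolding heat_kernel_factor[OF assms] by (simp add: abs_mult)
  also have "\<dots> \<le> exp (- (r - s)\<^sup>2 / (4 * \<epsilon>)) * (1 / (2 * \<epsilon>))"
    using assms by (intro mult_left_mono order_trans[OF heat_factor_abs_le heat_factor_le_inverse]) auto
  also have "exp (- (r - s)\<^sup>2 / (4 * \<epsilon>)) = exp (- (r - s)\<^sup>2 / (8 * \<epsilon>)) * exp (- X\<^sup>2 / 8)"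
  proof -
    have "- (r - s)\<^sup>2 / (4 * \<epsilon>) = - (r - s)\<^sup>2 / (8 * \<epsilon>) + - X\<^sup>2 / 8"
      unfolding X2 using \<epsilon> by (simp add: field_simps)
    then show ?thesis by (simp only: exp_add)
  qed
  also have "exp (- (r - s)\<^sup>2 / (8 * \<epsilon>)) * exp (- X\<^sup>2 / 8) * (1 / (2 * \<epsilon>)) \<le>
      exp (- (r - s)\<^sup>2 / (8 * \<epsilon>)) * (2 / (s * sqrt \<epsilon>))"
  proof -
    have "s / (2 * sqrt \<epsilon>) \<le> 2 * exp (X\<^sup>2 / 8)"
    proof -
      have "X \<le> 2 * (1 + X\<^sup>2 / 8)"
      proof -
        have "0 \<le> (X / 2 - 1)\<^sup>2" by simp
        then show ?thesis by (simp add: power2_eq_square field_simps)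
      qed
      also have "\<dots> \<le> 2 * exp (X\<^sup>2 / 8)" by (intro mult_left_mono exp_ge_add_one_self) simp
      finally show ?thesis using X by linarith
    qed
    then have "s / (2 * sqrt \<epsilon>) * exp (- X\<^sup>2 / 8) \<le> 2 * exp (X\<^sup>2 / 8) * exp (- X\<^sup>2 / 8)"
      by (intro mult_right_mono) auto
    also have "\<dots> = 2" by (simp add: exp_minus)
    finally have "s / (2 * sqrt \<epsilon>) * exp (- X\<^sup>2 / 8) \<le> 2" .
    then have "s * exp (- X\<^sup>2 / 8) \<le> 4 * sqrt \<epsilon>" using se by (simp add: field_simps)
    then have "s * exp (- X\<^sup>2 / 8) * sqrt \<epsilon> \<le> 4 * sqrt \<epsilon> * sqrt \<epsilon>" using se by (intro mult_right_mono) auto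
    then have "s * exp (- X\<^sup>2 / 8) * sqrt \<epsilon> \<le> 4 * \<epsilon>" using \<epsilon> by (simp add: mult.assoc)
    then have "exp (- X\<^sup>2 / 8) * (1 / (2 * \<epsilon>)) \<le> 2 / (s * sqrt \<epsilon>)"
    proof (intro mult_imp_le_div_pos)
      have "exp (- X\<^sup>2 / 8) * (1 / (2 * \<epsilon>)) * (s * sqrt \<epsilon>) = s * exp (- X\<^sup>2 / 8) * sqrt \<epsilon> * (1 / (2 * \<epsilon>))"
        by (simp only: mult_ac)
      also have "\<dots> \<le> 4 * \<epsilon> * (1 / (2 * \<epsilon>))"
        using \<open>s * exp (- X\<^sup>2 / 8) * sqrt \<epsilon> \<le> 4 * \<epsilon>\<close> \<epsilon> by (intro mult_right_mono) auto
      also have "\<dots> = 2" using \<epsilon> by simp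
      finally show "exp (- X\<^sup>2 / 8) * (1 / (2 * \<epsilon>)) * (s * sqrt \<epsilon>) \<le> 2" .
    qed (use s se in simp)
    then show ?thesis unfolding mult.assoc by (intro mult_left_mono) auto
  qed
  finally show ?thesis by (simp add: mult.commute)
qed

section \<open>Concentration of the heat kernel\<close>

lemma tendsto_difference_quotient:
  fixes f :: "real \<Rightarrow> real"
  assumes "(f has_real_derivative D) (at 0)" and d: "d \<longlonglongrightarrow> 0" "\<And>n. 0 < d n"
  shows "(\<lambda>n. (f (d n) - f 0) / d n) \<longlonglongrightarrow> D"
proof -
  have "((\<lambda>y. (f y - f 0) / (y - 0)) \<longlongrightarrow> D) (at 0)"
    using assms(1) by (simp only: has_field_derivative_iff)
  moreover have "filterlim d (at 0) sequentially"
    using d by (auto simp: filterlim_at less_imp_neq[symmetric])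
  ultimately have "((\<lambda>n. (f (d n) - f 0) / (d n - 0)) \<longlongrightarrow> D) sequentially"
    by (rule filterlim_compose)
  then show ?thesis by simp
qed

text \<open>Laplace's method at the angle 0. The time is \<open>d^2\<close>, so \<open>d\<close> is
  the length scale and the angle is \<open>d y\<close>; then \<open>sin (d y / 2) / d\<close> tends
  to \<open>y / 2\<close> and the cosine to 1, which removes the order \<open>\<nu>\<close> from the
  limit. The lower bound on \<open>q\<close> provides one Gaussian that dominates for every
  \<open>n\<close>.\<close>

lemma heat_factor_tendsto_aux:
  assumes d: "d \<longlonglongrightarrow> 0" "\<And>n. 0 < d n" and q: "q \<longlonglongrightarrow> Q" "0 < Q" and lb: "\<And>n. Q / 2 \<le> q n"
  shows "(\<lambda>n. d n * heat_factor \<nu> ((d n)\<^sup>2) (q n)) \<longlonglongrightarrow> 1 / (2 * sqrt (pi * Q))"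
proof -
  let ?g = "\<lambda>n t. exp (- q n / (d n)\<^sup>2 * (sin (t / 2))\<^sup>2) * cos (of_int \<nu> * t)"
  let ?h = "\<lambda>n y. indicator {0<..<pi} (d n * y) * ?g n (d n * y)"
  have eq: "d n * heat_factor \<nu> ((d n)\<^sup>2) (q n) = (LINT y|lborel. ?h n y) / (2 * pi)" for n
  proof -
    have "(LINT t|angle_interval. ?g n t) = (LINT t|lborel. indicator {0<..<pi} t * ?g n t)"
      by (rule angle_interval_lborel) measurable
    also have "\<dots> = \<bar>d n\<bar> *\<^sub>R (LINT y|lborel. indicator {0<..<pi} (0 + d n * y) * ?g n (0 + d n * y))"
      by (rule lborel_integral_real_affine) (use d(2)[of n] in simp)
    also have "\<dots> = d n * (LINT y|lborel. ?h n y)" using d(2)[of n] by simp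
    finally have *: "(LINT t|angle_interval. ?g n t) = d n * (LINT y|lborel. ?h n y)" .
    show ?thesis unfolding heat_factor_def * using d(2)[of n] by (simp add: power2_eq_square)
  qed
  define c where "c = sqrt Q / 2"
  define c' where "c' = sqrt (Q / 2) / 4"
  have c: "0 < c" "0 < c'" using q by (auto simp: c_def c'_def)
  have "(\<lambda>n. LINT y|lborel. ?h n y) \<longlonglongrightarrow> (LINT y|lborel. indicator {0<..} y * exp (- (c * y)\<^sup>2))"
  proof (rule integral_dominated_convergence)
    show "integrable lborel (\<lambda>y. indicator {0..} y * exp (- (c' * y)\<^sup>2))"
      using gaussian_half_line[OF c(2)] by (auto simp: has_bochner_integral_iff)
    show "AE y in lborel. (\<lambda>n. ?h n y) \<longlonglongrightarrow> indicator {0<..} y * exp (- (c * y)\<^sup>2)"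
    proof (rule AE_I2)
      fix y :: real
      show "(\<lambda>n. ?h n y) \<longlonglongrightarrow> indicator {0<..} y * exp (- (c * y)\<^sup>2)"
      proof (cases "0 < y")
        case False
        then have "d n * y \<le> 0" for n using d(2)[of n] by (simp add: mult_le_0_iff)
        then have "indicator {0<..<pi} (d n * y) = (0::real)" for n by (simp add: indicator_def not_less)
        then have h0: "?h n y = 0" for n by (simp only: mult_zero_left)
        have i0: "indicator {0<..} y = (0::real)" using False by simp
        show ?thesis unfolding h0 i0 mult_zero_left by (rule tendsto_const)
      next
        case True
        have dy: "(\<lambda>n. d n * y) \<longlonglongrightarrow> 0" using tendsto_mult_left_zero[OF d(1)] by simp
        have "(\<lambda>n. (sin (d n * y / 2) - sin (0 * y / 2)) / d n) \<longlonglongrightarrow> y / 2"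
          by (rule tendsto_difference_quotient[OF _ d]) (auto intro!: derivative_eq_intros)
        then have s: "(\<lambda>n. sin (d n * y / 2) / d n) \<longlonglongrightarrow> y / 2" by simp
        have "(\<lambda>n. exp (- q n * (sin (d n * y / 2) / d n)\<^sup>2) * cos (of_int \<nu> * (d n * y))) \<longlonglongrightarrow>
            exp (- Q * (y / 2)\<^sup>2) * cos (of_int \<nu> * 0)"
          by (intro tendsto_intros q s dy)
        moreover have "- Q * (y / 2)\<^sup>2 = - (c * y)\<^sup>2"
          using q by (simp add: c_def power_mult_distrib power_divide)
        ultimately have "(\<lambda>n. exp (- q n * (sin (d n * y / 2) / d n)\<^sup>2) * cos (of_int \<nu> * (d n * y))) \<longlonglongrightarrow>
            indicator {0<..} y * exp (- (c * y)\<^sup>2)"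
          using True by simp
        then show ?thesis
        proof (rule Lim_transform_eventually)
          have "\<forall>\<^sub>F n in sequentially. d n * y < pi"
            using order_tendstoD(2)[OF dy pi_gt_zero] .
          then show "\<forall>\<^sub>F n in sequentially. exp (- q n * (sin (d n * y / 2) / d n)\<^sup>2) * cos (of_int \<nu> * (d n * y)) = ?h n y"
          proof eventually_elim
            case (elim n)
            then have "indicator {0<..<pi} (d n * y) = (1::real)" using True d(2)[of n] by simp
            moreover have "- q n / (d n)\<^sup>2 * (sin (d n * y / 2))\<^sup>2 = - q n * (sin (d n * y / 2) / d n)\<^sup>2"
              by (simp add: power_divide)
            ultimately show ?case by (simp only: mult_1)
          qed
        qed
      qed
    qed
    fix n
    show "AE y in lborel. norm (?h n y) \<le> indicator {0..} y * exp (- (c' * y)\<^sup>2)"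
    proof (rule AE_I2)
      fix y :: real
      show "norm (?h n y) \<le> indicator {0..} y * exp (- (c' * y)\<^sup>2)"
      proof (cases "0 < d n * y \<and> d n * y < pi")
        case True
        then have y: "0 < y" using d(2)[of n] by (simp add: zero_less_mult_iff)
        have "d n * y / 4 \<le> sin (d n * y / 2)" using sin_ge_half[of "d n * y / 2"] True by simp
        then have "(d n * y / 4)\<^sup>2 \<le> (sin (d n * y / 2))\<^sup>2" using True by (intro power_mono) auto
        then have "(Q / 2) / (d n)\<^sup>2 * (d n * y / 4)\<^sup>2 \<le> q n / (d n)\<^sup>2 * (sin (d n * y / 2))\<^sup>2"
          using lb[of n] q by (intro mult_mono divide_right_mono) auto
        moreover have "(Q / 2) / (d n)\<^sup>2 * (d n * y / 4)\<^sup>2 = (c' * y)\<^sup>2"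
          using d(2)[of n] q by (simp add: c'_def power_mult_distrib power_divide)
        ultimately have "exp (- q n / (d n)\<^sup>2 * (sin (d n * y / 2))\<^sup>2) \<le> exp (- (c' * y)\<^sup>2)" by simp
        with _ have "norm (?h n y) \<le> exp (- (c' * y)\<^sup>2)"
        proof (rule order_trans)
          show "norm (?h n y) \<le> exp (- q n / (d n)\<^sup>2 * (sin (d n * y / 2))\<^sup>2)"
            using True by (simp add: abs_mult mult_left_le)
        qed
        moreover have "indicator {0..} y = (1::real)" using y by simp
        ultimately show ?thesis by (simp only: mult_1)
      qed (auto simp: indicator_def)
    qed
  qed measurable
  also have "(LINT y|lborel. indicator {0<..} y * exp (- (c * y)\<^sup>2)) = (LINT y|lborel. indicator {0..} y * exp (- (c * y)\<^sup>2))"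
  proof (rule integral_cong_AE)
    show "AE y in lborel. indicator {0<..} y * exp (- (c * y)\<^sup>2) = indicator {0..} y * exp (- (c * y)\<^sup>2)"
      using AE_lborel_singleton[of "0::real"] by eventually_elim (simp add: indicator_def)
  qed measurable
  also have "\<dots> = sqrt pi / (2 * c)"
    using gaussian_half_line[OF c(1)] by (rule has_bochner_integral_integral_eq)
  finally have "(\<lambda>n. (LINT y|lborel. ?h n y) / (2 * pi)) \<longlonglongrightarrow> sqrt pi / (2 * c) / (2 * pi)"
    by (intro tendsto_intros) auto
  moreover have "sqrt pi / (2 * c) / (2 * pi) = 1 / (2 * sqrt (pi * Q))"
  proof -
    have "sqrt pi / (2 * c) / (2 * pi) = sqrt pi / (sqrt Q * (2 * (sqrt pi * sqrt pi)))"
      by (simp add: c_def)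
    also have "\<dots> = 1 / (2 * (sqrt pi * sqrt Q))" by (simp del: real_sqrt_mult_self real_sqrt_mult_self)
    finally show ?thesis by (simp add: real_sqrt_mult)
  qed
  ultimately show ?thesis unfolding eq by simp
qed

lemma heat_factor_tendsto:
  assumes d: "d \<longlonglongrightarrow> 0" "\<And>n. 0 < d n" and q: "q \<longlonglongrightarrow> Q" "0 < Q"
  shows "(\<lambda>n. d n * heat_factor \<nu> ((d n)\<^sup>2) (q n)) \<longlonglongrightarrow> 1 / (2 * sqrt (pi * Q))"
proof -
  have "\<forall>\<^sub>F n in sequentially. Q / 2 < q n" using order_tendstoD(1)[OF q(1), of "Q / 2"] q by simp
  then obtain N where N: "\<And>n. n \<ge> N \<Longrightarrow> Q / 2 < q n" unfolding eventually_sequentially by blast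
  have "(\<lambda>n. d (n + N) * heat_factor \<nu> ((d (n + N))\<^sup>2) (q (n + N))) \<longlonglongrightarrow> 1 / (2 * sqrt (pi * Q))"
    by (rule heat_factor_tendsto_aux)
      (use d q N in \<open>auto intro: LIMSEQ_ignore_initial_segment less_imp_le\<close>)
  then show ?thesis by (rule LIMSEQ_offset)
qed

section \<open>Dependence of the third side on the enclosed angle\<close>

lemma borel_measurable_tri_side' [measurable]: "tri_side a b \<in> borel_measurable borel"
  by (rule borel_measurable_tri_side) auto

lemma tri_side_has_derivative:
  assumes "0 < a" "0 < b" "0 < t" "t < pi"
  shows "(tri_side a b has_real_derivative a * b * sin t / tri_side a b t) (at t)"
proof -
  have pos: "0 < a\<^sup>2 + b\<^sup>2 - 2 * a * b * cos t"
    using tri_side_pos[OF assms] by (simp add: tri_side_def)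
  have "((\<lambda>t. sqrt (a\<^sup>2 + b\<^sup>2 - 2 * a * b * cos t)) has_real_derivative
      a * b * sin t / sqrt (a\<^sup>2 + b\<^sup>2 - 2 * a * b * cos t)) (at t)"
  proof (rule DERIV_cong[OF DERIV_chain2[where f = sqrt and g = "\<lambda>t. a\<^sup>2 + b\<^sup>2 - 2 * a * b * cos t", OF DERIV_real_sqrt[OF pos]]])
    show "((\<lambda>t. a\<^sup>2 + b\<^sup>2 - 2 * a * b * cos t) has_real_derivative 2 * a * b * sin t) (at t)"
      by (auto intro!: derivative_eq_intros)
  qed (simp add: inverse_eq_divide)
  then show ?thesis unfolding tri_side_def[abs_def] .
qed

lemma tri_side_range:
  assumes "0 < a" "0 < b" "0 < t" "t < pi"
  shows "\<bar>a - b\<bar> < tri_side a b t" "tri_side a b t < a + b"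
proof -
  have c: "-1 < cos t" "cos t < 1"
    using cos_monotone_0_pi[of t pi] cos_monotone_0_pi[of 0 t] assms by auto
  have ab: "0 < a * b" using assms by simp
  have "a * b * cos t < a * b * 1" "a * b * (-1) < a * b * cos t"
    using c ab by (intro mult_strict_left_mono; simp)+
  then have sq: "\<bar>a - b\<bar>\<^sup>2 < (tri_side a b t)\<^sup>2" "(tri_side a b t)\<^sup>2 < (a + b)\<^sup>2"
    unfolding tri_side_sq by (auto simp: power2_eq_square algebra_simps)
  show "\<bar>a - b\<bar> < tri_side a b t"
    by (rule power_less_imp_less_base[OF sq(1) tri_side_nonneg])
  show "tri_side a b t < a + b"
    by (rule power_less_imp_less_base[OF sq(2)]) (use assms in simp)
qed

text \<open>The difference of the squared sides is \<open>2 a b (cos t0 - cos t)\<close>, a product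
  of sines of the half sum and the half difference of the angles. A mean value argument would not
  reach the ends of the interval, where the derivative of the side may vanish. The estimate provides
  the Gaussian majorant in \<open>heat_kernel_concentrates\<close>.\<close>

lemma tri_side_expanding:
  assumes ab: "0 < a" "0 < b" and t0: "0 < t0" "t0 < pi"
  obtains \<eta> where "0 < \<eta>" "\<And>t. 0 < t \<Longrightarrow> t < pi \<Longrightarrow> \<eta> * \<bar>t - t0\<bar> \<le> \<bar>tri_side a b t - tri_side a b t0\<bar>"
proof (rule that)
  \<comment> \<open>A lower bound for \<open>sin ((t + t0) / 2)\<close> by the addition formula,
    because \<open>sin (t / 2) + cos (t / 2)\<close> is at least 1.\<close>
  define m where "m = min (sin (t0 / 2)) (cos (t0 / 2))"
  have m: "0 < m" unfolding m_def using t0 by (auto intro!: sin_gt_zero cos_gt_zero)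
  show "0 < a * b * m / (2 * (a + b))" using ab m by simp
  fix t assume t: "0 < t" "t < pi"
  let ?s = "tri_side a b t0" and ?k = "tri_side a b t"
  have "m \<le> sin ((t + t0) / 2)"
  proof -
    have n: "0 \<le> sin (t / 2)" "0 \<le> cos (t / 2)" using t by (auto intro!: sin_ge_zero cos_ge_zero)
    have "1 = (sin (t / 2))\<^sup>2 + (cos (t / 2))\<^sup>2" by simp
    also have "\<dots> \<le> sin (t / 2) + cos (t / 2)"
      using n by (intro add_mono) (auto simp: power2_eq_square mult_left_le)
    finally have "m * 1 \<le> m * (sin (t / 2) + cos (t / 2))" using m by (intro mult_left_mono) auto
    also have "\<dots> = sin (t / 2) * m + cos (t / 2) * m" by (simp add: algebra_simps)
    also have "\<dots> \<le> sin (t / 2) * cos (t0 / 2) + cos (t / 2) * sin (t0 / 2)"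
      using n by (intro add_mono mult_left_mono) (auto simp: m_def)
    also have "\<dots> = sin ((t + t0) / 2)" by (simp add: sin_add add_divide_distrib)
    finally show ?thesis by simp
  qed
  moreover have "\<bar>t - t0\<bar> / 4 \<le> \<bar>sin ((t - t0) / 2)\<bar>"
  proof -
    have "\<bar>t - t0\<bar> / 2 / 2 \<le> sin (\<bar>t - t0\<bar> / 2)"
      using t t0 by (intro sin_ge_half) (auto simp: abs_if)
    moreover have "sin (\<bar>t - t0\<bar> / 2) = \<bar>sin ((t - t0) / 2)\<bar>"
    proof (cases "t0 \<le> t")
      case True
      then have "0 \<le> sin ((t - t0) / 2)" using t t0 by (intro sin_ge_zero) auto
      then show ?thesis using True by simp
    next
      case False
      then have "0 \<le> sin ((t0 - t) / 2)" using t t0 by (intro sin_ge_zero) auto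
      moreover have "sin ((t - t0) / 2) = - sin ((t0 - t) / 2)"
        by (metis minus_diff_eq minus_divide_left sin_minus)
      ultimately show ?thesis using False by simp
    qed
    ultimately show ?thesis by simp
  qed
  ultimately have "m * (\<bar>t - t0\<bar> / 4) \<le> \<bar>sin ((t + t0) / 2)\<bar> * \<bar>sin ((t - t0) / 2)\<bar>"
    using m by (intro mult_mono) auto
  then have "m * (\<bar>t - t0\<bar> / 4) \<le> \<bar>sin ((t + t0) / 2) * sin ((t - t0) / 2)\<bar>"
    by (simp only: abs_mult)
  moreover have "cos t0 - cos t = 2 * (sin ((t + t0) / 2) * sin ((t - t0) / 2))"
    using cos_diff_cos[of t0 t] by (simp add: add.commute)
  ultimately have 1: "m * \<bar>t - t0\<bar> / 2 \<le> \<bar>cos t0 - cos t\<bar>" by (simp add: abs_mult)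
  have "a * b * m * \<bar>t - t0\<bar> = 2 * a * b * (m * \<bar>t - t0\<bar> / 2)" by simp
  also have "\<dots> \<le> 2 * a * b * \<bar>cos t0 - cos t\<bar>" using ab by (intro mult_left_mono 1) auto
  also have "\<dots> = \<bar>2 * a * b * (cos t0 - cos t)\<bar>" using ab by (simp add: abs_mult)
  also have "2 * a * b * (cos t0 - cos t) = ?k\<^sup>2 - ?s\<^sup>2"
    unfolding tri_side_sq by (simp add: algebra_simps)
  also have "\<bar>?k\<^sup>2 - ?s\<^sup>2\<bar> = \<bar>?k - ?s\<bar> * (?k + ?s)"
    using tri_side_nonneg[of a b t] tri_side_nonneg[of a b t0]
    by (simp add: power2_eq_square square_diff_square_factored abs_mult mult.commute)
  also have "\<dots> \<le> \<bar>?k - ?s\<bar> * (2 * (a + b))"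
    using tri_side_range(2)[OF ab t] tri_side_range(2)[OF ab t0] by (intro mult_left_mono) auto
  finally have *: "a * b * m * \<bar>t - t0\<bar> \<le> \<bar>?k - ?s\<bar> * (2 * (a + b))" .
  have "a * b * m / (2 * (a + b)) * \<bar>t - t0\<bar> = (a * b * m * \<bar>t - t0\<bar>) / (2 * (a + b))" by simp
  also have "\<dots> \<le> \<bar>?k - ?s\<bar>"
    by (rule mult_imp_div_pos_le[OF _ *]) (use ab in simp)
  finally show "a * b * m / (2 * (a + b)) * \<bar>t - t0\<bar> \<le> \<bar>?k - ?s\<bar>" .
qed

lemma borel_measurable_heat_kernel [measurable]:
  "(\<lambda>r. heat_kernel \<nu> \<epsilon> r s) \<in> borel_measurable borel" if "0 < \<epsilon>"
proof -
  interpret finite_measure "gauss_measure \<epsilon>" by (rule finite_measure_gauss[OF that])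
  show ?thesis unfolding heat_kernel_def by measurable
qed

text \<open>With \<open>t = t0 + d u\<close> the radial Gaussian tends to
  \<open>exp (- (\<gamma> u / 2)^2)\<close>, where \<open>\<gamma>\<close> is the derivative of the
  side at \<open>t0\<close>, and the angular factor to \<open>1 / (2 s sqrt pi)\<close>. The
  Gaussian has mass \<open>2 sqrt pi / \<gamma>\<close>, which leaves
  \<open>1 / (s \<gamma>)\<close>; here \<open>s \<gamma>\<close> is twice the area of the
  triangle.\<close>

lemma heat_kernel_concentrates:
  fixes c :: "real \<Rightarrow> real"
  assumes ab: "0 < a" "0 < b" and t0: "0 < t0" "t0 < pi"
    and d: "d \<longlonglongrightarrow> 0" "\<And>n. 0 < d n"
    and c: "c \<in> borel_measurable borel" "\<And>t. \<bar>c t\<bar> \<le> 1" "isCont c t0"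
  shows "(\<lambda>n. LINT t|angle_interval. c t * heat_kernel \<nu> ((d n)\<^sup>2) (tri_side a b t) (tri_side a b t0))
     \<longlonglongrightarrow> c t0 / (a * b * sin t0)"
proof -
  let ?k = "tri_side a b"
  define s where "s = ?k t0"
  have s: "0 < s" unfolding s_def using tri_side_pos[OF ab t0] .
  have kpos: "0 < ?k t" if "0 < t" "t < pi" for t using tri_side_pos[OF ab that] .
  note [measurable] = c(1)
  obtain \<eta> where \<eta>: "0 < \<eta>" "\<And>t. 0 < t \<Longrightarrow> t < pi \<Longrightarrow> \<eta> * \<bar>t - t0\<bar> \<le> \<bar>?k t - s\<bar>"
    unfolding s_def using tri_side_expanding[OF ab t0] by blast
  define \<gamma> where "\<gamma> = a * b * sin t0 / s"
  have sint0: "0 < sin t0" using t0 sin_gt_zero by blast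
  have \<gamma>: "0 < \<gamma>" using ab s sint0 by (simp add: \<gamma>_def)
  let ?g = "\<lambda>n t. c t * heat_kernel \<nu> ((d n)\<^sup>2) (?k t) s"
  let ?h = "\<lambda>n u. indicator {0<..<pi} (t0 + d n * u) * (d n * ?g n (t0 + d n * u))"
  have mk [measurable]: "(\<lambda>t. heat_kernel \<nu> ((d n)\<^sup>2) (?k t) s) \<in> borel_measurable borel" for n
    by (rule measurable_compose[OF borel_measurable_tri_side' borel_measurable_heat_kernel])
      (use d(2)[of n] in simp)
  have eq: "(LINT t|angle_interval. ?g n t) = (LINT u|lborel. ?h n u)" for n
  proof -
    have "(LINT t|angle_interval. ?g n t) = (LINT t|lborel. indicator {0<..<pi} t * ?g n t)"
      by (rule angle_interval_lborel) measurable
    also have "\<dots> = \<bar>d n\<bar> *\<^sub>R (LINT u|lborel. indicator {0<..<pi} (t0 + d n * u) * ?g n (t0 + d n * u))"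
      by (rule lborel_integral_real_affine) (use d(2)[of n] in simp)
    also have "\<dots> = d n * (LINT u|lborel. indicator {0<..<pi} (t0 + d n * u) * ?g n (t0 + d n * u))"
      using d(2)[of n] by simp
    also have "\<dots> = (LINT u|lborel. d n * (indicator {0<..<pi} (t0 + d n * u) * ?g n (t0 + d n * u)))"
      by (rule integral_mult_right_zero[symmetric])
    finally show ?thesis by (simp only: mult_ac)
  qed
  \<comment> \<open>Matches the exponent \<open>(r - s)^2 / (8 d^2)\<close> of
    \<open>heat_kernel_bound'\<close> at radial distance \<open>\<eta> d u\<close>.\<close>
  define e where "e = \<eta> / sqrt 8"
  have e: "0 < e" "e\<^sup>2 = \<eta>\<^sup>2 / 8" using \<eta> by (auto simp: e_def power_divide)
  let ?L = "c t0 * (1 / (2 * (sqrt pi * s)))"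
  have "(\<lambda>n. LINT u|lborel. ?h n u) \<longlonglongrightarrow> (LINT u|lborel. ?L * exp (- (\<gamma> / 2 * u)\<^sup>2))"
  proof (rule integral_dominated_convergence)
    show "integrable lborel (\<lambda>u. 2 / s * exp (- (e * u)\<^sup>2))"
      using gaussian_line[OF e(1)] by (auto simp: has_bochner_integral_iff)
    show "AE u in lborel. (\<lambda>n. ?h n u) \<longlonglongrightarrow> ?L * exp (- (\<gamma> / 2 * u)\<^sup>2)"
    proof (rule AE_I2)
      fix u :: real
      have t: "(\<lambda>n. t0 + d n * u) \<longlonglongrightarrow> t0"
        using tendsto_add[OF tendsto_const tendsto_mult_left_zero[OF d(1)], of t0 u] by simp
      have ct: "(\<lambda>n. c (t0 + d n * u)) \<longlonglongrightarrow> c t0"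
        by (rule isCont_tendsto_compose[OF c(3) t])
      have kd: "(?k has_real_derivative \<gamma>) (at t0)"
        unfolding \<gamma>_def s_def by (rule tri_side_has_derivative[OF ab t0])
      have kt: "(\<lambda>n. ?k (t0 + d n * u)) \<longlonglongrightarrow> s"
        unfolding s_def by (rule isCont_tendsto_compose[OF DERIV_isCont[OF kd] t])
      have q: "(\<lambda>n. ?k (t0 + d n * u) * s) \<longlonglongrightarrow> s * s" by (intro tendsto_intros kt)
      have hf: "(\<lambda>n. d n * heat_factor \<nu> ((d n)\<^sup>2) (?k (t0 + d n * u) * s)) \<longlonglongrightarrow> 1 / (2 * sqrt (pi * (s * s)))"
        by (rule heat_factor_tendsto[OF d q]) (use s in simp)
      have "((\<lambda>x. ?k (t0 + x * u)) has_real_derivative \<gamma> * u) (at 0)"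
      proof (rule DERIV_chain2[where f = ?k and g = "\<lambda>x. t0 + x * u"])
        show "(?k has_real_derivative \<gamma>) (at (t0 + 0 * u))" using kd by simp
        show "((\<lambda>x. t0 + x * u) has_real_derivative u) (at 0)" by (auto intro!: derivative_eq_intros)
      qed
      then have "(\<lambda>n. (?k (t0 + d n * u) - ?k (t0 + 0 * u)) / d n) \<longlonglongrightarrow> \<gamma> * u"
        by (rule tendsto_difference_quotient[OF _ d])
      then have diff: "(\<lambda>n. (?k (t0 + d n * u) - s) / d n) \<longlonglongrightarrow> \<gamma> * u" by (simp add: s_def)
      have "(\<lambda>n. c (t0 + d n * u) * (d n * heat_factor \<nu> ((d n)\<^sup>2) (?k (t0 + d n * u) * s)) * exp (- (((?k (t0 + d n * u) - s) / d n)\<^sup>2 / 4)))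
         \<longlonglongrightarrow> c t0 * (1 / (2 * sqrt (pi * (s * s)))) * exp (- ((\<gamma> * u)\<^sup>2 / 4))"
        by (intro tendsto_intros ct hf diff) simp
      also have "c t0 * (1 / (2 * sqrt (pi * (s * s)))) * exp (- ((\<gamma> * u)\<^sup>2 / 4)) = ?L * exp (- (\<gamma> / 2 * u)\<^sup>2)"
        using s by (simp add: real_sqrt_mult power_mult_distrib power_divide)
      finally show "(\<lambda>n. ?h n u) \<longlonglongrightarrow> ?L * exp (- (\<gamma> / 2 * u)\<^sup>2)"
      proof (rule Lim_transform_eventually)
        have "\<forall>\<^sub>F n in sequentially. 0 < t0 + d n * u" "\<forall>\<^sub>F n in sequentially. t0 + d n * u < pi"
          using order_tendstoD[OF t] t0 by auto
        then show "\<forall>\<^sub>F n in sequentially. c (t0 + d n * u) * (d n * heat_factor \<nu> ((d n)\<^sup>2) (?k (t0 + d n * u) * s)) * exp (- (((?k (t0 + d n * u) - s) / d n)\<^sup>2 / 4)) = ?h n u"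
        proof eventually_elim
          case (elim n)
          have "indicator {0<..<pi} (t0 + d n * u) = (1::real)" using elim by simp
          moreover have "heat_kernel \<nu> ((d n)\<^sup>2) (?k (t0 + d n * u)) s =
              exp (- (?k (t0 + d n * u) - s)\<^sup>2 / (4 * (d n)\<^sup>2)) * heat_factor \<nu> ((d n)\<^sup>2) (?k (t0 + d n * u) * s)"
            by (rule heat_kernel_factor) (use d(2)[of n] kpos elim s in auto)
          moreover have "- (?k (t0 + d n * u) - s)\<^sup>2 / (4 * (d n)\<^sup>2) = - (((?k (t0 + d n * u) - s) / d n)\<^sup>2 / 4)"
            by (simp add: power_divide)
          ultimately show ?case by (simp only: mult_1 mult_ac)
        qed
      qed
    qed
    fix n
    show "AE u in lborel. norm (?h n u) \<le> 2 / s * exp (- (e * u)\<^sup>2)"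
    proof (rule AE_I2)
      fix u :: real
      show "norm (?h n u) \<le> 2 / s * exp (- (e * u)\<^sup>2)"
      proof (cases "0 < t0 + d n * u \<and> t0 + d n * u < pi")
        case True
        let ?t = "t0 + d n * u"
        have dn: "0 < d n" by (rule d(2))
        have "\<bar>heat_kernel \<nu> ((d n)\<^sup>2) (?k ?t) s\<bar> \<le> 2 / (s * sqrt ((d n)\<^sup>2)) * exp (- (?k ?t - s)\<^sup>2 / (8 * (d n)\<^sup>2))"
          by (rule heat_kernel_bound') (use kpos True s dn in auto)
        also have "\<dots> \<le> 2 / (s * d n) * exp (- (e * u)\<^sup>2)"
        proof -
          have "\<eta> * \<bar>?t - t0\<bar> \<le> \<bar>?k ?t - s\<bar>" using \<eta>(2) True by blast
          then have "(\<eta> * \<bar>?t - t0\<bar>)\<^sup>2 \<le> \<bar>?k ?t - s\<bar>\<^sup>2" using \<eta>(1) by (intro power_mono) auto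
          then have "(\<eta> * (d n * u))\<^sup>2 \<le> (?k ?t - s)\<^sup>2" by (simp add: power_mult_distrib)
          then have "(\<eta> * (d n * u))\<^sup>2 / (8 * (d n)\<^sup>2) \<le> (?k ?t - s)\<^sup>2 / (8 * (d n)\<^sup>2)"
            by (intro divide_right_mono) auto
          moreover have "(\<eta> * (d n * u))\<^sup>2 / (8 * (d n)\<^sup>2) = (e * u)\<^sup>2"
            using dn by (simp add: power_mult_distrib e)
          ultimately have "exp (- (?k ?t - s)\<^sup>2 / (8 * (d n)\<^sup>2)) \<le> exp (- (e * u)\<^sup>2)" by simp
          moreover have "sqrt ((d n)\<^sup>2) = d n" using dn by simp
          ultimately show ?thesis using s dn by (simp only:) (intro mult_left_mono, auto)
        qed
        finally have hk: "\<bar>heat_kernel \<nu> ((d n)\<^sup>2) (?k ?t) s\<bar> \<le> 2 / (s * d n) * exp (- (e * u)\<^sup>2)" .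
        have "norm (?h n u) = d n * (\<bar>c ?t\<bar> * \<bar>heat_kernel \<nu> ((d n)\<^sup>2) (?k ?t) s\<bar>)"
          using True dn by (simp add: abs_mult)
        also have "\<dots> \<le> d n * (1 * (2 / (s * d n) * exp (- (e * u)\<^sup>2)))"
          using dn hk c(2) s by (intro mult_left_mono mult_mono) auto
        also have "\<dots> = 2 / s * exp (- (e * u)\<^sup>2)" using dn s by simp
        finally show ?thesis .
      qed (use s in \<open>auto simp: indicator_def\<close>)
    qed
  qed measurable
  also have "(LINT u|lborel. ?L * exp (- (\<gamma> / 2 * u)\<^sup>2)) = ?L * (LINT u|lborel. exp (- (\<gamma> / 2 * u)\<^sup>2))"
    by (rule integral_mult_right_zero)
  also have "(LINT u|lborel. exp (- (\<gamma> / 2 * u)\<^sup>2)) = sqrt pi / (\<gamma> / 2)"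
    by (rule has_bochner_integral_integral_eq[OF gaussian_line]) (use \<gamma> in simp)
  also have "?L * (sqrt pi / (\<gamma> / 2)) = c t0 / (s * \<gamma>)" by simp
  also have "s * \<gamma> = a * b * sin t0" using s by (simp add: \<gamma>_def)
  finally have "(\<lambda>n. LINT t|angle_interval. ?g n t) \<longlonglongrightarrow> c t0 / (a * b * sin t0)"
    by (simp only: eq)
  then show ?thesis by (simp only: s_def)
qed

text \<open>The side keeps a distance \<open>\<eta>\<close> from \<open>s\<close>, and
  \<open>exp (- z)\<close> is at most \<open>1 / z\<close> for \<open>z\<close> of order
  \<open>1 / d^2\<close>, which beats the factor \<open>1 / d\<close> of the kernel.\<close>

lemma heat_kernel_vanishes:
  fixes c :: "real \<Rightarrow> real"
  assumes ab: "0 < a" "0 < b" and s: "0 < s" "s < \<bar>a - b\<bar> \<or> a + b < s"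
    and d: "d \<longlonglongrightarrow> 0" "\<And>n. 0 < d n"
    and c: "c \<in> borel_measurable borel" "\<And>t. \<bar>c t\<bar> \<le> 1"
  shows "(\<lambda>n. LINT t|angle_interval. c t * heat_kernel \<nu> ((d n)\<^sup>2) (tri_side a b t) s) \<longlonglongrightarrow> 0"
proof -
  let ?k = "tri_side a b"
  note [measurable] = c(1)
  have mk [measurable]: "(\<lambda>t. heat_kernel \<nu> ((d n)\<^sup>2) (?k t) s) \<in> borel_measurable borel" for n
    by (rule measurable_compose[OF borel_measurable_tri_side' borel_measurable_heat_kernel])
      (use d(2)[of n] in simp)
  obtain \<eta> where \<eta>: "0 < \<eta>" "\<And>t. 0 < t \<Longrightarrow> t < pi \<Longrightarrow> \<eta> \<le> \<bar>?k t - s\<bar>"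
  proof (cases "s < \<bar>a - b\<bar>")
    case True
    then show ?thesis using tri_side_range(1)[OF ab]
      by (intro that[of "\<bar>a - b\<bar> - s"]) (auto, smt (verit))
  next
    case False
    then show ?thesis using tri_side_range(2)[OF ab] s
      by (intro that[of "s - (a + b)"]) (auto, smt (verit))
  qed
  have bound: "norm (LINT t|angle_interval. c t * heat_kernel \<nu> ((d n)\<^sup>2) (?k t) s) \<le> pi * (16 / (s * \<eta>\<^sup>2)) * d n" for n
  proof -
    interpret finite_measure angle_interval by (rule finite_measure_angle_interval)
    have dn: "0 < d n" by (rule d(2))
    let ?B = "16 / (s * \<eta>\<^sup>2) * d n"
    have bd: "\<bar>c t * heat_kernel \<nu> ((d n)\<^sup>2) (?k t) s\<bar> \<le> ?B" if t: "0 < t" "t < pi" for t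
    proof -
      have "\<bar>heat_kernel \<nu> ((d n)\<^sup>2) (?k t) s\<bar> \<le> 2 / (s * sqrt ((d n)\<^sup>2)) * exp (- (?k t - s)\<^sup>2 / (8 * (d n)\<^sup>2))"
        by (rule heat_kernel_bound') (use tri_side_pos[OF ab t] s dn in auto)
      moreover have "sqrt ((d n)\<^sup>2) = d n" using dn by simp
      moreover have "exp (- (?k t - s)\<^sup>2 / (8 * (d n)\<^sup>2)) \<le> 8 * (d n)\<^sup>2 / \<eta>\<^sup>2"
      proof -
        let ?z = "\<eta>\<^sup>2 / (8 * (d n)\<^sup>2)"
        have z: "0 < ?z" using \<eta> dn by simp
        have "\<eta>\<^sup>2 \<le> \<bar>?k t - s\<bar>\<^sup>2" using \<eta> t by (intro power_mono) auto
        then have "?z \<le> (?k t - s)\<^sup>2 / (8 * (d n)\<^sup>2)" by (intro divide_right_mono) auto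
        then have "exp (- (?k t - s)\<^sup>2 / (8 * (d n)\<^sup>2)) \<le> exp (- ?z)" by simp
        also have "\<dots> = 1 / exp ?z" by (simp only: exp_minus inverse_eq_divide)
        also have "\<dots> \<le> 1 / ?z"
        proof (rule divide_left_mono)
          show "?z \<le> exp ?z" using exp_ge_add_one_self[of ?z] by linarith
          show "0 < exp ?z * ?z" using z by (intro mult_pos_pos exp_gt_zero)
        qed simp
        also have "1 / ?z = 8 * (d n)\<^sup>2 / \<eta>\<^sup>2" by simp
        finally show ?thesis .
      qed
      then have "2 / (s * d n) * exp (- (?k t - s)\<^sup>2 / (8 * (d n)\<^sup>2)) \<le> 2 / (s * d n) * (8 * (d n)\<^sup>2 / \<eta>\<^sup>2)"
        by (rule mult_left_mono) (use s dn in simp)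
      ultimately have "\<bar>heat_kernel \<nu> ((d n)\<^sup>2) (?k t) s\<bar> \<le> 2 / (s * d n) * (8 * (d n)\<^sup>2 / \<eta>\<^sup>2)"
        by (simp only:)
      also have "\<dots> = ?B" using dn s by (simp add: power2_eq_square)
      finally have "\<bar>heat_kernel \<nu> ((d n)\<^sup>2) (?k t) s\<bar> \<le> ?B" .
      then have "\<bar>c t\<bar> * \<bar>heat_kernel \<nu> ((d n)\<^sup>2) (?k t) s\<bar> \<le> 1 * ?B"
        using c(2) by (intro mult_mono) auto
      then show ?thesis by (simp add: abs_mult)
    qed
    have i: "integrable angle_interval (\<lambda>t. c t * heat_kernel \<nu> ((d n)\<^sup>2) (?k t) s)"
    proof (rule integrable_const_bound)
      show "AE t in angle_interval. norm (c t * heat_kernel \<nu> ((d n)\<^sup>2) (?k t) s) \<le> ?B"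
        using AE_angle_interval by eventually_elim (use bd in simp)
    qed measurable
    have "norm (LINT t|angle_interval. c t * heat_kernel \<nu> ((d n)\<^sup>2) (?k t) s) \<le>
        (LINT t|angle_interval. norm (c t * heat_kernel \<nu> ((d n)\<^sup>2) (?k t) s))"
      by (rule integral_norm_bound)
    also have "\<dots> \<le> (LINT t|angle_interval. ?B)"
    proof (rule integral_mono_AE)
      show "AE t in angle_interval. norm (c t * heat_kernel \<nu> ((d n)\<^sup>2) (?k t) s) \<le> ?B"
        using AE_angle_interval by eventually_elim (use bd in simp)
    qed (use i in \<open>auto intro: integrable_norm\<close>)
    also have "\<dots> = (LINT t|lborel. indicator {0<..<pi} t * ?B)" by (rule angle_interval_lborel) measurable
    also have "\<dots> = pi * ?B" by simp
    finally show ?thesis by simp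
  qed
  have "(\<lambda>n. pi * (16 / (s * \<eta>\<^sup>2)) * d n) \<longlonglongrightarrow> pi * (16 / (s * \<eta>\<^sup>2)) * 0"
    by (intro tendsto_intros d)
  then have "(\<lambda>n. pi * (16 / (s * \<eta>\<^sup>2)) * d n) \<longlonglongrightarrow> 0" by simp
  then show ?thesis by (rule Lim_null_comparison[rotated]) (use bound in simp)
qed

section \<open>Singularities of the side density\<close>

text \<open>The shape of the singularities at degenerate triangles. At the singular point itself
  division by zero gives the value 0.\<close>

definition isq :: "real \<Rightarrow> real" where "isq x = 1 / sqrt \<bar>x\<bar>"

lemma isq_nonneg: "0 \<le> isq x"
  by (simp add: isq_def)

lemma borel_measurable_isq [measurable]: "isq \<in> borel_measurable borel"
  unfolding isq_def[abs_def] by measurable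

lemma isq_minus: "isq (- x) = isq x"
  by (simp add: isq_def)

lemma isq_mono: "0 < \<bar>x\<bar> \<Longrightarrow> \<bar>x\<bar> \<le> \<bar>y\<bar> \<Longrightarrow> isq y \<le> isq x"
  unfolding isq_def by (intro divide_left_mono mult_pos_pos) auto

text \<open>One of the two arguments is at least \<open>m / 2\<close> in absolute value: inverse
  roots at distinct points never blow up together.\<close>

lemma isq_mult_le:
  assumes "0 < m" "m \<le> \<bar>x\<bar> + \<bar>y\<bar>"
  shows "isq x * isq y \<le> isq (m / 2) * (isq x + isq y)"
proof (cases "m / 2 \<le> \<bar>x\<bar>")
  case True
  then have "isq x \<le> isq (m / 2)" using assms by (intro isq_mono) auto
  then have "isq x * isq y \<le> isq (m / 2) * isq y" by (intro mult_right_mono isq_nonneg)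
  also have "\<dots> \<le> isq (m / 2) * (isq x + isq y)" by (intro mult_left_mono) (auto simp: isq_nonneg)
  finally show ?thesis .
next
  case False
  then have "isq y \<le> isq (m / 2)" using assms by (intro isq_mono) auto
  then have "isq x * isq y \<le> isq x * isq (m / 2)" by (intro mult_left_mono isq_nonneg)
  also have "\<dots> = isq (m / 2) * isq x" by simp
  also have "\<dots> \<le> isq (m / 2) * (isq x + isq y)" by (intro mult_left_mono) (auto simp: isq_nonneg)
  finally show ?thesis .
qed

lemma nn_integral_isq_0:
  assumes "0 \<le> R"
  shows "(\<integral>\<^sup>+x. ennreal (isq x) * indicator {0..R} x \<partial>lborel) = ennreal (2 * sqrt R)"
proof (rule nn_integral_has_integral_lebesgue')
  have "((\<lambda>x. x powr (- 1 / 2)) has_integral (R powr (- 1 / 2 + 1) / (- 1 / 2 + 1))) {0..R}"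
    by (rule has_integral_powr_from_0) (use assms in auto)
  moreover have "R powr (- 1 / 2 + 1) / (- 1 / 2 + 1) = 2 * sqrt R"
    using assms by (simp add: powr_half_sqrt)
  ultimately have "((\<lambda>x. x powr (- 1 / 2)) has_integral (2 * sqrt R)) {0..R}" by (simp only:)
  moreover have "x powr (- 1 / 2) = isq x" if "x \<in> {0..R}" for x
  proof -
    have "x powr (- 1 / 2) = inverse (x powr (1 / 2))" by (simp flip: powr_minus)
    then show ?thesis using that by (simp add: isq_def powr_half_sqrt inverse_eq_divide)
  qed
  ultimately show "(isq has_integral 2 * sqrt R) {0..R}"
    by (rule has_integral_eq[rotated])
qed (rule isq_nonneg)

lemma nn_integral_isq:
  assumes "0 \<le> R"
  shows "(\<integral>\<^sup>+x. ennreal (isq (x - c)) * indicator {c - R..c + R} x \<partial>lborel) \<le> ennreal (4 * sqrt R)"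
proof -
  have "(\<integral>\<^sup>+x. ennreal (isq (x - c)) * indicator {c - R..c + R} x \<partial>lborel) \<le>
     (\<integral>\<^sup>+x. ennreal (isq (x - c)) * indicator {c..c + R} x + ennreal (isq (x - c)) * indicator {c - R..c} x \<partial>lborel)"
    by (intro nn_integral_mono) (auto simp: indicator_def)
  also have "\<dots> = (\<integral>\<^sup>+x. ennreal (isq (x - c)) * indicator {c..c + R} x \<partial>lborel) +
      (\<integral>\<^sup>+x. ennreal (isq (x - c)) * indicator {c - R..c} x \<partial>lborel)"
    by (intro nn_integral_add) auto
  also have "(\<integral>\<^sup>+x. ennreal (isq (x - c)) * indicator {c..c + R} x \<partial>lborel) =
     (\<integral>\<^sup>+x. ennreal (isq x) * indicator {0..R} x \<partial>lborel)"
    by (subst nn_integral_real_affine[where c = 1 and t = c])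
      (auto simp: indicator_def intro!: nn_integral_cong)
  also have "(\<integral>\<^sup>+x. ennreal (isq (x - c)) * indicator {c - R..c} x \<partial>lborel) =
     (\<integral>\<^sup>+x. ennreal (isq x) * indicator {0..R} x \<partial>lborel)"
    by (subst nn_integral_real_affine[where c = "-1" and t = c])
      (auto simp: indicator_def isq_minus intro!: nn_integral_cong)
  also have "(\<integral>\<^sup>+x. ennreal (isq x) * indicator {0..R} x \<partial>lborel) + (\<integral>\<^sup>+x. ennreal (isq x) * indicator {0..R} x \<partial>lborel) =
      ennreal (4 * sqrt R)"
    unfolding nn_integral_isq_0[OF assms] using assms by (simp flip: ennreal_plus)
  finally show ?thesis .
qed

lemma nn_integral_isq_finite:
  "(\<integral>\<^sup>+x. ennreal (isq (x - c)) * indicator {u..v} x \<partial>lborel) < \<infinity>"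
proof -
  define R where "R = \<bar>u - c\<bar> + \<bar>v - c\<bar>"
  have R: "0 \<le> R" by (simp add: R_def)
  have "(\<integral>\<^sup>+x. ennreal (isq (x - c)) * indicator {u..v} x \<partial>lborel) \<le>
      (\<integral>\<^sup>+x. ennreal (isq (x - c)) * indicator {c - R..c + R} x \<partial>lborel)"
    by (intro nn_integral_mono mult_left_mono) (auto simp: indicator_def R_def)
  also have "\<dots> \<le> ennreal (4 * sqrt R)" by (rule nn_integral_isq[OF R])
  also have "\<dots> < \<infinity>" by simp
  finally show ?thesis .
qed

lemma nn_integral_isq_mult_finite:
  assumes "c \<noteq> d"
  shows "(\<integral>\<^sup>+x. ennreal (isq (x - c) * isq (x - d)) * indicator {u..v} x \<partial>lborel) < \<infinity>"
proof -
  let ?m = "\<bar>c - d\<bar>"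
  have "(\<integral>\<^sup>+x. ennreal (isq (x - c) * isq (x - d)) * indicator {u..v} x \<partial>lborel) \<le>
     (\<integral>\<^sup>+x. ennreal (isq (?m / 2)) * (ennreal (isq (x - c)) * indicator {u..v} x + ennreal (isq (x - d)) * indicator {u..v} x) \<partial>lborel)"
  proof (rule nn_integral_mono)
    fix x
    have "isq (x - c) * isq (x - d) \<le> isq (?m / 2) * (isq (x - c) + isq (x - d))"
      by (rule isq_mult_le) (use assms in auto)
    then have "ennreal (isq (x - c) * isq (x - d)) \<le> ennreal (isq (?m / 2)) * (ennreal (isq (x - c)) + ennreal (isq (x - d)))"
      by (simp add: isq_nonneg flip: ennreal_plus ennreal_mult)
    then show "ennreal (isq (x - c) * isq (x - d)) * indicator {u..v} x \<le>
        ennreal (isq (?m / 2)) * (ennreal (isq (x - c)) * indicator {u..v} x + ennreal (isq (x - d)) * indicator {u..v} x)"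
      by (simp add: indicator_def)
  qed
  also have "\<dots> = ennreal (isq (?m / 2)) * ((\<integral>\<^sup>+x. ennreal (isq (x - c)) * indicator {u..v} x \<partial>lborel) + (\<integral>\<^sup>+x. ennreal (isq (x - d)) * indicator {u..v} x \<partial>lborel))"
    by (subst nn_integral_cmult) (auto simp: nn_integral_add)
  also have "\<dots> < \<infinity>"
    using nn_integral_isq_finite[of c u v] nn_integral_isq_finite[of d u v]
    by (simp add: ennreal_mult_less_top)
  finally show ?thesis .
qed

text \<open>Averaging the singularity over a Gaussian around \<open>s\<close> costs a constant
  factor, uniformly in the width. With \<open>a\<close> the distance from \<open>s\<close> to
  \<open>c\<close>, the singular factor is at most \<open>isq (a / 2)\<close> outside the interval
  of radius \<open>a / 2\<close> around \<open>c\<close>; inside it the Gaussian density is at most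
  \<open>4 / a\<close>, whatever \<open>d\<close> is.\<close>

lemma nn_integral_gaussian_isq:
  assumes d: "0 < d" and sc: "s \<noteq> c"
  shows "(\<integral>\<^sup>+r. ennreal (exp (- (r - s)\<^sup>2 / (4 * d\<^sup>2)) / d * isq (r - c)) \<partial>lborel) \<le> ennreal (24 * isq (s - c))"
proof -
  define a where "a = \<bar>s - c\<bar>"
  have a: "0 < a" using sc by (simp add: a_def)
  let ?G = "\<lambda>r. exp (- (r - s)\<^sup>2 / (4 * d\<^sup>2)) / d"
  have "(\<integral>\<^sup>+r. ennreal (?G r * isq (r - c)) \<partial>lborel) \<le>
     (\<integral>\<^sup>+r. ennreal (isq (a / 2)) * ennreal (?G r) + ennreal (4 / a) * (ennreal (isq (r - c)) * indicator {c - a / 2..c + a / 2} r) \<partial>lborel)"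
  proof (rule nn_integral_mono)
    fix r
    show "ennreal (?G r * isq (r - c)) \<le> ennreal (isq (a / 2)) * ennreal (?G r) + ennreal (4 / a) * (ennreal (isq (r - c)) * indicator {c - a / 2..c + a / 2} r)"
    proof (cases "a / 2 \<le> \<bar>r - c\<bar>")
      case True
      then have "isq (r - c) \<le> isq (a / 2)" using a by (intro isq_mono) auto
      then have "?G r * isq (r - c) \<le> ?G r * isq (a / 2)" using d by (intro mult_left_mono) auto
      then have "ennreal (?G r * isq (r - c)) \<le> ennreal (isq (a / 2)) * ennreal (?G r)"
        using d by (simp add: isq_nonneg mult.commute flip: ennreal_mult)
      then show ?thesis by (rule add_increasing2[OF zero_le])
    next
      case False
      have rs: "a / 2 \<le> \<bar>r - s\<bar>" using False a_def by linarith
      have "?G r \<le> 4 / a"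
      proof -
        \<comment> \<open>The exponent is at most \<open>- X^2\<close>, and
          \<open>exp (- X^2)\<close> is at most \<open>1 / X\<close>, which cancels the
          normalisation \<open>1 / d\<close>.\<close>
        define X where "X = a / (4 * d)"
        have X: "0 < X" using a d by (simp add: X_def)
        have "(a / 2)\<^sup>2 \<le> \<bar>r - s\<bar>\<^sup>2" using rs a by (intro power_mono) auto
        then have "(a / 2)\<^sup>2 / (4 * d\<^sup>2) \<le> (r - s)\<^sup>2 / (4 * d\<^sup>2)" by (intro divide_right_mono) auto
        moreover have "(a / 2)\<^sup>2 / (4 * d\<^sup>2) = X\<^sup>2" by (simp add: X_def power_divide power_mult_distrib)
        ultimately have "exp (- (r - s)\<^sup>2 / (4 * d\<^sup>2)) \<le> exp (- X\<^sup>2)" by simp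
        also have "\<dots> = 1 / exp (X\<^sup>2)" by (simp only: exp_minus inverse_eq_divide)
        also have "\<dots> \<le> 1 / X"
        proof (rule divide_left_mono)
          have "0 \<le> (X - 1)\<^sup>2 + X\<^sup>2 + 1" by simp
          then have "X \<le> 1 + X\<^sup>2" by (simp add: power2_eq_square algebra_simps)
          also have "\<dots> \<le> exp (X\<^sup>2)" by (rule exp_ge_add_one_self)
          finally show "X \<le> exp (X\<^sup>2)" .
          show "0 < exp (X\<^sup>2) * X" using X by (intro mult_pos_pos exp_gt_zero)
        qed simp
        finally have "?G r \<le> 1 / X / d" using d by (intro divide_right_mono) auto
        also have "\<dots> = 4 / a" using d by (simp add: X_def)
        finally show ?thesis .
      qed
      then have "?G r * isq (r - c) \<le> 4 / a * isq (r - c)" by (intro mult_right_mono isq_nonneg)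
      then have "ennreal (?G r * isq (r - c)) \<le> ennreal (4 / a) * ennreal (isq (r - c))"
        using a by (simp add: isq_nonneg flip: ennreal_mult)
      moreover have "indicator {c - a / 2..c + a / 2} r = (1 :: ennreal)"
      proof -
        have "c - a / 2 \<le> r" "r \<le> c + a / 2" using False by linarith+
        then show ?thesis by simp
      qed
      ultimately show ?thesis by (simp add: add_increasing)
    qed
  qed
  also have "\<dots> = ennreal (isq (a / 2)) * (\<integral>\<^sup>+r. ennreal (?G r) \<partial>lborel) +
      ennreal (4 / a) * (\<integral>\<^sup>+r. ennreal (isq (r - c)) * indicator {c - a / 2..c + a / 2} r \<partial>lborel)"
    by (subst nn_integral_add) (auto simp: nn_integral_cmult)
  also have "\<dots> \<le> ennreal (isq (a / 2)) * ennreal (2 * sqrt pi) + ennreal (4 / a) * ennreal (4 * sqrt (a / 2))"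
  proof (intro add_mono mult_left_mono)
    have "(\<integral>\<^sup>+r. ennreal (?G r) \<partial>lborel) = \<bar>d\<bar> * (\<integral>\<^sup>+u. ennreal (?G (s + d * u)) \<partial>lborel)"
      by (rule nn_integral_real_affine) (use d in auto)
    also have "\<dots> = ennreal d * (\<integral>\<^sup>+u. ennreal (1 / d) * ennreal (exp (- (1 / 2 * u)\<^sup>2)) \<partial>lborel)"
    proof -
      have "?G (s + d * u) = 1 / d * exp (- (1 / 2 * u)\<^sup>2)" for u
      proof -
        have "- (s + d * u - s)\<^sup>2 / (4 * d\<^sup>2) = - (1 / 2 * u)\<^sup>2"
          using d by (simp add: power_mult_distrib power_divide)
        then show ?thesis by (simp only:) simp
      qed
      then have "ennreal (?G (s + d * u)) = ennreal (1 / d) * ennreal (exp (- (1 / 2 * u)\<^sup>2))" for u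
        by (simp only:) (rule ennreal_mult, use d in auto)
      then show ?thesis using d by (simp only: abs_of_pos)
    qed
    also have "\<dots> = ennreal d * (ennreal (1 / d) * (\<integral>\<^sup>+u. ennreal (exp (- (1 / 2 * u)\<^sup>2)) \<partial>lborel))"
      by (subst nn_integral_cmult) auto
    also have "(\<integral>\<^sup>+u. ennreal (exp (- (1 / 2 * u)\<^sup>2)) \<partial>lborel) = ennreal (sqrt pi / (1 / 2))"
      using gaussian_line[of "1 / 2"] by (subst nn_integral_eq_integral) (auto simp: has_bochner_integral_iff)
    also have "ennreal d * (ennreal (1 / d) * ennreal (sqrt pi / (1 / 2))) = ennreal (2 * sqrt pi)"
      using d by (simp flip: ennreal_mult)
    finally show "(\<integral>\<^sup>+r. ennreal (?G r) \<partial>lborel) \<le> ennreal (2 * sqrt pi)" by simp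
  qed (use a nn_integral_isq[of "a / 2" c] in auto)
  also have "\<dots> = ennreal (isq (a / 2) * (2 * sqrt pi) + 4 / a * (4 * sqrt (a / 2)))"
    using a by (simp add: isq_nonneg flip: ennreal_mult ennreal_plus)
  also have "\<dots> \<le> ennreal (24 * isq (s - c))"
  proof (rule ennreal_leI)
    have half: "isq (a / 2) = sqrt 2 * isq a" using a by (simp add: isq_def real_sqrt_divide)
    have "sqrt (a / 2) / a = isq a / sqrt 2"
    proof -
      have "sqrt a / a = 1 / sqrt a" using a by (simp add: field_simps)
      moreover have "sqrt (a / 2) / a = sqrt a / a / sqrt 2" by (simp add: real_sqrt_divide)
      moreover have "isq a = 1 / sqrt a" using a by (simp add: isq_def)
      ultimately show ?thesis by (simp only:)
    qed
    have e: "4 / a * (4 * sqrt (a / 2)) = 16 / sqrt 2 * isq a"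
    proof -
      have "4 / a * (4 * sqrt (a / 2)) = 16 * (sqrt (a / 2) / a)" by simp
      also have "\<dots> = 16 * (isq a / sqrt 2)"
        by (simp only: \<open>sqrt (a / 2) / a = isq a / sqrt 2\<close>)
      finally show ?thesis by simp
    qed
    \<comment> \<open>The estimates add up to 6 + 12, which is below 24.\<close>
    have r2: "sqrt 2 \<le> 3 / 2" by (rule real_le_lsqrt) (auto simp: power2_eq_square)
    have rpi: "sqrt pi \<le> 2" by (rule real_le_lsqrt) (use pi_less_4 in auto)
    have x: "sqrt 2 * (2 * sqrt pi) \<le> 3 / 2 * (2 * 2)"
      by (intro mult_mono r2) (use rpi in auto)
    have "16 / sqrt 2 = 8 * sqrt 2" by (simp add: divide_eq_eq mult.assoc)
    also have "\<dots> \<le> 8 * (3 / 2)" by (intro mult_left_mono r2) simp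
    finally have y: "16 / sqrt 2 \<le> 8 * (3 / 2)" .
    have "sqrt 2 * (2 * sqrt pi) + 16 / sqrt 2 \<le> 24"
      using add_mono[OF x y] by (rule order_trans) simp
    then have "(sqrt 2 * (2 * sqrt pi) + 16 / sqrt 2) * isq a \<le> 24 * isq a"
      by (intro mult_right_mono isq_nonneg)
    moreover have "isq a = isq (s - c)" by (simp add: isq_def a_def)
    ultimately show "isq (a / 2) * (2 * sqrt pi) + 4 / a * (4 * sqrt (a / 2)) \<le> 24 * isq (s - c)"
      unfolding half e by (simp add: algebra_simps)
  qed
  finally show ?thesis .
qed

text \<open>The density of the third side when the enclosed angle is uniform:
  \<open>dt / dr = r / (a b sin t)\<close>, with the area expressed through the sides by Heron's
  formula.\<close>

definition side_density :: "real \<Rightarrow> real \<Rightarrow> real \<Rightarrow> real" where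
  "side_density a b r = 2 * r / sqrt (((a + b)\<^sup>2 - r\<^sup>2) * (r\<^sup>2 - (a - b)\<^sup>2))"

lemma borel_measurable_side_density [measurable]: "side_density a b \<in> borel_measurable borel"
  unfolding side_density_def[abs_def] by measurable

text \<open>The substitution goes through the squared side, which is smooth in the angle also at the
  degenerate triangles, and only then to the side itself.\<close>

lemma nn_integral_tri_side:
  fixes \<Phi> :: "real \<Rightarrow> real"
  assumes ab: "0 < a" "0 < b" and \<Phi> [measurable]: "\<Phi> \<in> borel_measurable borel" and nn: "\<And>r. 0 \<le> \<Phi> r"
  shows "(\<integral>\<^sup>+t. ennreal (\<Phi> (tri_side a b t)) * indicator {0<..<pi} t \<partial>lborel) \<le>
     (\<integral>\<^sup>+r. ennreal (\<Phi> r * side_density a b r) * indicator {\<bar>a - b\<bar>..a + b} r \<partial>lborel)"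
proof -
  let ?g = "\<lambda>t. a\<^sup>2 + b\<^sup>2 - 2 * a * b * cos t"
  define f where "f = (\<lambda>x. ennreal (\<Phi> (sqrt x) / sqrt (((a + b)\<^sup>2 - x) * (x - (a - b)\<^sup>2))))"
  have [measurable]: "f \<in> borel_measurable borel" unfolding f_def by measurable
  have "(\<integral>\<^sup>+t. ennreal (\<Phi> (tri_side a b t)) * indicator {0<..<pi} t \<partial>lborel) \<le>
     (\<integral>\<^sup>+t. f (?g t) * ennreal (2 * a * b * sin t) * indicator {0..pi} t \<partial>lborel)"
  proof (rule nn_integral_mono)
    fix t
    show "ennreal (\<Phi> (tri_side a b t)) * indicator {0<..<pi} t \<le> f (?g t) * ennreal (2 * a * b * sin t) * indicator {0..pi} t"
    proof (cases "0 < t \<and> t < pi")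
      case True
      then have s: "0 < 2 * a * b * sin t" using ab sin_gt_zero[of t] by simp
      have "((a + b)\<^sup>2 - ?g t) * (?g t - (a - b)\<^sup>2) = (2 * a * b * sin t)\<^sup>2"
      proof -
        have "((a + b)\<^sup>2 - ?g t) * (?g t - (a - b)\<^sup>2) = (2 * a * b)\<^sup>2 * (1 - (cos t)\<^sup>2)"
          by (simp add: power2_eq_square algebra_simps)
        also have "1 - (cos t)\<^sup>2 = (sin t)\<^sup>2" by (simp add: sin_squared_eq)
        finally show ?thesis by (simp add: power_mult_distrib)
      qed
      then have "sqrt (((a + b)\<^sup>2 - ?g t) * (?g t - (a - b)\<^sup>2)) = 2 * a * b * sin t"
        using s by (simp only: real_sqrt_abs abs_of_pos)
      then have "f (?g t) = ennreal (\<Phi> (tri_side a b t) / (2 * a * b * sin t))"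
        unfolding f_def tri_side_def by (simp only:)
      then have "f (?g t) * ennreal (2 * a * b * sin t) = ennreal (\<Phi> (tri_side a b t) / (2 * a * b * sin t) * (2 * a * b * sin t))"
        using s nn by (simp only:) (rule ennreal_mult[symmetric], auto)
      also have "\<dots> = ennreal (\<Phi> (tri_side a b t))"
      proof -
        have "x / S * S = x" if "0 < S" for x S :: real using that by simp
        from this[OF s] show ?thesis by (simp only:)
      qed
      finally show ?thesis using True by simp
    qed (auto simp: indicator_def)
  qed
  also have "\<dots> = (\<integral>\<^sup>+x. f x * indicator {?g 0..?g pi} x \<partial>lborel)"
  proof (rule nn_integral_substitution_aux[symmetric])
    show "(?g has_real_derivative 2 * a * b * sin t) (at t)" for t by (auto intro!: derivative_eq_intros)
    show "continuous_on {0..pi} (\<lambda>t. 2 * a * b * sin t)" by (intro continuous_intros)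
    show "0 \<le> 2 * a * b * sin t" if "t \<in> {0..pi}" for t using ab that sin_ge_zero[of t] by simp
  qed auto
  also have "\<dots> = (\<integral>\<^sup>+x. f x * indicator {\<bar>a - b\<bar>\<^sup>2..(a + b)\<^sup>2} x \<partial>lborel)"
    by (simp add: power2_eq_square algebra_simps)
  also have "\<dots> = (\<integral>\<^sup>+r. f (r\<^sup>2) * ennreal (2 * r) * indicator {\<bar>a - b\<bar>..a + b} r \<partial>lborel)"
  proof (rule nn_integral_substitution_aux)
    show "((\<lambda>r. r\<^sup>2) has_real_derivative 2 * r) (at r)" for r :: real by (auto intro!: derivative_eq_intros)
    show "continuous_on {\<bar>a - b\<bar>..a + b} (\<lambda>r. 2 * r)" by (intro continuous_intros)
    show "\<bar>a - b\<bar> < a + b" using ab by linarith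
  qed auto
  also have "\<dots> = (\<integral>\<^sup>+r. ennreal (\<Phi> r * side_density a b r) * indicator {\<bar>a - b\<bar>..a + b} r \<partial>lborel)"
  proof (rule nn_integral_cong)
    fix r
    show "f (r\<^sup>2) * ennreal (2 * r) * indicator {\<bar>a - b\<bar>..a + b} r = ennreal (\<Phi> r * side_density a b r) * indicator {\<bar>a - b\<bar>..a + b} r"
    proof (cases "r \<in> {\<bar>a - b\<bar>..a + b}")
      case True
      then have r: "0 \<le> r" by auto
      have "(a - b)\<^sup>2 \<le> r\<^sup>2" "r\<^sup>2 \<le> (a + b)\<^sup>2"
        using True power_mono[of "\<bar>a - b\<bar>" r 2] power_mono[of r "a + b" 2] r by auto
      then have "0 \<le> sqrt (((a + b)\<^sup>2 - r\<^sup>2) * (r\<^sup>2 - (a - b)\<^sup>2))" by simp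
      then have "f (r\<^sup>2) * ennreal (2 * r) = ennreal (\<Phi> r / sqrt (((a + b)\<^sup>2 - r\<^sup>2) * (r\<^sup>2 - (a - b)\<^sup>2)) * (2 * r))"
        unfolding f_def using r nn by (subst ennreal_mult[symmetric]) (auto intro!: divide_nonneg_nonneg)
      also have "\<Phi> r / sqrt (((a + b)\<^sup>2 - r\<^sup>2) * (r\<^sup>2 - (a - b)\<^sup>2)) * (2 * r) = \<Phi> r * side_density a b r"
        by (simp add: side_density_def)
      finally show ?thesis by simp
    qed simp
  qed
  finally show ?thesis .
qed

text \<open>Of the four linear factors under Heron's root, \<open>a + b + r\<close> is at least
  \<open>a + b\<close> and \<open>r + \<bar>a - b\<bar>\<close> at least \<open>r\<close>. The other
  two vanish at distinct points, so \<open>isq_mult_le\<close> separates them. The factor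
  \<open>sqrt r\<close> is kept because it cancels \<open>isq r\<close> of the heat kernel.\<close>

lemma side_density_le:
  assumes ab: "0 < a" "0 < b"
  obtains K where "0 < K"
    "\<And>r. r \<in> {\<bar>a - b\<bar>..a + b} \<Longrightarrow> side_density a b r \<le> K * sqrt r * (isq (r - (a + b)) + isq (r - \<bar>a - b\<bar>))"
proof (rule that)
  let ?c1 = "a + b" and ?c2 = "\<bar>a - b\<bar>"
  let ?m = "?c1 - ?c2"
  have m: "0 < ?m" using ab by linarith
  let ?K = "2 / sqrt ?c1 * isq (?m / 2)"
  show "0 < ?K" using ab m by (simp add: isq_def)
  fix r assume r: "r \<in> {?c2..?c1}"
  show "side_density a b r \<le> ?K * sqrt r * (isq (r - ?c1) + isq (r - ?c2))"
  proof (cases "?c2 < r \<and> r < ?c1")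
    \<comment> \<open>At both ends the density is 0 by division by zero.\<close>
    case False
    then have "r = ?c1 \<or> r = ?c2" using r by auto
    then have "side_density a b r = 0"
      by (auto simp: side_density_def)
    moreover have "0 \<le> ?K * sqrt r * (isq (r - ?c1) + isq (r - ?c2))"
      using ab r by (intro mult_nonneg_nonneg add_nonneg_nonneg isq_nonneg) auto
    ultimately show ?thesis by simp
  next
    case True
    then have rp: "0 < r" by auto
    let ?x = "?c1 - r" and ?y = "r - ?c2"
    have xy: "0 < ?x" "0 < ?y" using True by auto
    have c2: "(a - b)\<^sup>2 = ?c2\<^sup>2" by simp
    have "(?c1 * r) * (?x * ?y) \<le> ((?c1 + r) * (r + ?c2)) * (?x * ?y)"
      using xy rp ab by (intro mult_right_mono mult_mono) auto
    also have "\<dots> = (?c1\<^sup>2 - r\<^sup>2) * (r\<^sup>2 - (a - b)\<^sup>2)"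
      proof -
      have "q\<^sup>2 - q'\<^sup>2 = (q - q') * (q + q')" for q q' :: real
        by (simp add: power2_eq_square algebra_simps)
      then show ?thesis unfolding c2 by (simp only: mult_ac)
    qed
    finally have le: "sqrt ((?c1 * r) * (?x * ?y)) \<le> sqrt ((?c1\<^sup>2 - r\<^sup>2) * (r\<^sup>2 - (a - b)\<^sup>2))" by simp
    have P: "0 < sqrt ((?c1 * r) * (?x * ?y))" using rp xy ab by simp
    have "side_density a b r \<le> 2 * r / sqrt ((?c1 * r) * (?x * ?y))"
      unfolding side_density_def
      by (rule divide_left_mono[OF le _ mult_pos_pos[OF less_le_trans[OF P le] P]]) (use rp in simp)
    also have "\<dots> = 2 * (r / sqrt r) / sqrt ?c1 * (1 / sqrt ?x * (1 / sqrt ?y))"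
      by (simp add: real_sqrt_mult)
    also have "r / sqrt r = sqrt r" using rp by (simp add: real_div_sqrt)
    also have "1 / sqrt ?x = isq (r - ?c1)" using xy by (simp add: isq_def)
    also have "1 / sqrt ?y = isq (r - ?c2)" using xy by (simp add: isq_def)
    also have "2 * sqrt r / sqrt ?c1 * (isq (r - ?c1) * isq (r - ?c2)) \<le>
        2 * sqrt r / sqrt ?c1 * (isq (?m / 2) * (isq (r - ?c1) + isq (r - ?c2)))"
      using m rp ab xy by (intro mult_left_mono isq_mult_le) auto
    also have "\<dots> = ?K * sqrt r * (isq (r - ?c1) + isq (r - ?c2))" by simp
    finally show ?thesis .
  qed
qed

section \<open>Domination of the Gaussian means\<close>

lemma nn_integral_angle_interval:
  assumes [measurable]: "f \<in> borel_measurable borel"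
  shows "(\<integral>\<^sup>+t. f t \<partial>angle_interval) = (\<integral>\<^sup>+t. f t * indicator {0<..<pi} t \<partial>lborel)"
  unfolding angle_interval_def by (subst nn_integral_density) (auto simp: mult.commute)

lemma integrable_heat_kernel_tri_side:
  fixes c :: "real \<Rightarrow> real"
  assumes ab: "0 < a" "0 < b" and d: "0 < d" and s: "0 < s"
    and c: "c \<in> borel_measurable borel" "\<And>t. \<bar>c t\<bar> \<le> 1"
  shows "integrable angle_interval (\<lambda>t. c t * heat_kernel \<nu> (d\<^sup>2) (tri_side a b t) s)"
proof -
  interpret finite_measure angle_interval by (rule finite_measure_angle_interval)
  note [measurable] = c(1)
  have [measurable]: "(\<lambda>t. heat_kernel \<nu> (d\<^sup>2) (tri_side a b t) s) \<in> borel_measurable borel"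
    by (rule measurable_compose[OF borel_measurable_tri_side' borel_measurable_heat_kernel])
      (use d in simp)
  show ?thesis
  proof (rule integrable_const_bound)
    show "AE t in angle_interval. norm (c t * heat_kernel \<nu> (d\<^sup>2) (tri_side a b t) s) \<le> 1 * (2 / (s * sqrt (d\<^sup>2)) * 1)"
      using AE_angle_interval
    proof eventually_elim
      case (elim t)
      have "\<bar>heat_kernel \<nu> (d\<^sup>2) (tri_side a b t) s\<bar> \<le> 2 / (s * sqrt (d\<^sup>2)) * exp (- (tri_side a b t - s)\<^sup>2 / (8 * d\<^sup>2))"
        by (rule heat_kernel_bound') (use elim tri_side_pos[OF ab] s d in auto)
      also have "\<dots> \<le> 2 / (s * sqrt (d\<^sup>2)) * 1"
        using s by (intro mult_left_mono) auto
      finally show ?case unfolding real_norm_def abs_mult using c(2) by (intro mult_mono) auto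
    qed
  qed measurable
qed

text \<open>The common core of the two dominations below. In the side variable \<open>r\<close> the
  integrand consists of the weight, \<open>side_density\<close>, the factor
  \<open>isq r isq s\<close> of \<open>heat_kernel_bound\<close> and a Gaussian around
  \<open>s\<close>; the last one averages the singularities at the points of \<open>S\<close>. The
  majorant \<open>w\<close> allows a weight that vanishes at a degenerate triangle to remove that
  triangle from \<open>S\<close>.\<close>

lemma heat_kernel_integral_bound:
  fixes c w :: "real \<Rightarrow> real"
  assumes ab: "0 < a" "0 < b" and d: "0 < d" and s: "0 < s" "s \<notin> S" and S: "finite S" and K: "0 \<le> K"
    and c: "c \<in> borel_measurable borel" "\<And>t. \<bar>c t\<bar> \<le> 1"
    and w: "w \<in> borel_measurable borel" "\<And>r. 0 \<le> r \<Longrightarrow> 0 \<le> w r"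
    and cw: "\<And>t. 0 < t \<Longrightarrow> t < pi \<Longrightarrow> \<bar>c t\<bar> \<le> w (tri_side a b t)"
    and le: "\<And>r. r \<in> {\<bar>a - b\<bar>..a + b} \<Longrightarrow> w r * side_density a b r * isq r \<le> K * (\<Sum>q\<in>S. isq (r - q))"
  shows "\<bar>LINT t|angle_interval. c t * heat_kernel \<nu> (d\<^sup>2) (tri_side a b t) s\<bar> \<le> 24 * K * isq s * (\<Sum>q\<in>S. isq (s - q))"
proof -
  let ?k = "tri_side a b"
  note [measurable] = c(1) w(1)
  have [measurable]: "(\<lambda>t. heat_kernel \<nu> (d\<^sup>2) (?k t) s) \<in> borel_measurable borel"
    by (rule measurable_compose[OF borel_measurable_tri_side' borel_measurable_heat_kernel])
      (use d in simp)
  let ?f = "\<lambda>t. c t * heat_kernel \<nu> (d\<^sup>2) (?k t) s"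
  let ?G = "\<lambda>r. exp (- (r - s)\<^sup>2 / (4 * d\<^sup>2)) / d"
  \<comment> \<open>The sign of \<open>w\<close> is known on nonnegative arguments only, whereas
    \<open>nn_integral_tri_side\<close> asks for a function nonnegative everywhere.\<close>
  define \<Phi> where "\<Phi> = (\<lambda>r. \<bar>w r\<bar> * isq r * isq s * ?G r)"
  have [measurable]: "\<Phi> \<in> borel_measurable borel" unfolding \<Phi>_def by measurable
  have \<Phi>: "0 \<le> \<Phi> r" for r unfolding \<Phi>_def using d by (intro mult_nonneg_nonneg isq_nonneg) auto
  have "ennreal (norm (LINT t|angle_interval. ?f t)) \<le> (\<integral>\<^sup>+t. ennreal (norm (?f t)) \<partial>angle_interval)"
    by (rule integral_norm_bound_ennreal[OF integrable_heat_kernel_tri_side[OF ab d s(1) c]])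
  also have "\<dots> = (\<integral>\<^sup>+t. ennreal (norm (?f t)) * indicator {0<..<pi} t \<partial>lborel)"
    by (rule nn_integral_angle_interval) measurable
  also have "\<dots> \<le> (\<integral>\<^sup>+t. ennreal (\<Phi> (?k t)) * indicator {0<..<pi} t \<partial>lborel)"
  proof (rule nn_integral_mono)
    fix t
    show "ennreal (norm (?f t)) * indicator {0<..<pi} t \<le> ennreal (\<Phi> (?k t)) * indicator {0<..<pi} t"
    proof (cases "0 < t \<and> t < pi")
      case True
      then have k: "0 < ?k t" using tri_side_pos[OF ab] by simp
      have "\<bar>heat_kernel \<nu> (d\<^sup>2) (?k t) s\<bar> \<le> exp (- (?k t - s)\<^sup>2 / (4 * d\<^sup>2)) / sqrt (d\<^sup>2 * (?k t * s))"
        by (rule heat_kernel_bound) (use k s d in auto)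
      also have "\<dots> = isq (?k t) * isq s * ?G (?k t)"
        using k s d by (simp add: isq_def real_sqrt_mult)
      finally have "\<bar>c t\<bar> * \<bar>heat_kernel \<nu> (d\<^sup>2) (?k t) s\<bar> \<le> \<bar>w (?k t)\<bar> * (isq (?k t) * isq s * ?G (?k t))"
        using cw[of t] True by (intro mult_mono) auto
      then have "norm (?f t) \<le> \<Phi> (?k t)" by (simp add: \<Phi>_def abs_mult mult.assoc)
      then show ?thesis by (intro mult_right_mono ennreal_leI) auto
    qed (auto simp: indicator_def)
  qed
  also have "\<dots> \<le> (\<integral>\<^sup>+r. ennreal (\<Phi> r * side_density a b r) * indicator {\<bar>a - b\<bar>..a + b} r \<partial>lborel)"
    by (rule nn_integral_tri_side[OF ab _ \<Phi>]) measurable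
  also have "\<dots> \<le> (\<integral>\<^sup>+r. (\<Sum>q\<in>S. ennreal (K * isq s) * ennreal (?G r * isq (r - q))) \<partial>lborel)"
  proof (rule nn_integral_mono)
    fix r
    show "ennreal (\<Phi> r * side_density a b r) * indicator {\<bar>a - b\<bar>..a + b} r \<le>
       (\<Sum>q\<in>S. ennreal (K * isq s) * ennreal (?G r * isq (r - q)))"
    proof (cases "r \<in> {\<bar>a - b\<bar>..a + b}")
      case True
      then have r: "0 \<le> r" by auto
      have "\<Phi> r * side_density a b r = (isq s * ?G r) * (w r * side_density a b r * isq r)"
        using w(2)[OF r] by (simp add: \<Phi>_def)
      also have "\<dots> \<le> (isq s * ?G r) * (K * (\<Sum>q\<in>S. isq (r - q)))"
        using d isq_nonneg by (intro mult_left_mono le True) auto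
      also have "\<dots> = (\<Sum>q\<in>S. (K * isq s) * (?G r * isq (r - q)))"
        unfolding sum_distrib_left by (intro sum.cong refl) (simp only: mult_ac)
      finally have "ennreal (\<Phi> r * side_density a b r) \<le> ennreal (\<Sum>q\<in>S. (K * isq s) * (?G r * isq (r - q)))"
        by (rule ennreal_leI)
      also have "\<dots> = (\<Sum>q\<in>S. ennreal ((K * isq s) * (?G r * isq (r - q))))"
        using K d isq_nonneg by (intro sum_ennreal[symmetric] mult_nonneg_nonneg) auto
      also have "\<dots> = (\<Sum>q\<in>S. ennreal (K * isq s) * ennreal (?G r * isq (r - q)))"
        using K d isq_nonneg by (intro sum.cong refl ennreal_mult mult_nonneg_nonneg) auto
      finally show ?thesis using True by simp
    qed simp
  qed
  also have "\<dots> = (\<Sum>q\<in>S. ennreal (K * isq s) * (\<integral>\<^sup>+r. ennreal (?G r * isq (r - q)) \<partial>lborel))"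
    by (subst nn_integral_sum) (auto simp: nn_integral_cmult)
  also have "\<dots> \<le> (\<Sum>q\<in>S. ennreal (K * isq s) * ennreal (24 * isq (s - q)))"
    using s by (intro sum_mono mult_left_mono nn_integral_gaussian_isq d) auto
  also have "\<dots> = (\<Sum>q\<in>S. ennreal ((K * isq s) * (24 * isq (s - q))))"
    using K isq_nonneg by (intro sum.cong refl ennreal_mult[symmetric] mult_nonneg_nonneg) auto
  also have "\<dots> = ennreal (\<Sum>q\<in>S. (K * isq s) * (24 * isq (s - q)))"
    using K isq_nonneg by (intro sum_ennreal mult_nonneg_nonneg) auto
  also have "(\<Sum>q\<in>S. (K * isq s) * (24 * isq (s - q))) = 24 * K * isq s * (\<Sum>q\<in>S. isq (s - q))"
    by (simp add: sum_distrib_left mult_ac)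
  finally show ?thesis
    using K isq_nonneg by (subst (asm) ennreal_le_iff) (auto intro!: mult_nonneg_nonneg sum_nonneg)
qed

text \<open>With \<open>w = 1\<close> the factor \<open>isq r\<close> of the kernel is cancelled by
  the \<open>sqrt r\<close> in \<open>side_density_le\<close>, so exactly the two degenerate lengths
  remain as singular points.\<close>

lemma heat_kernel_dominated:
  assumes ab: "0 < a" "0 < b"
  obtains C where "0 \<le> C"
    "\<And>c \<nu> d s. c \<in> borel_measurable borel \<Longrightarrow> (\<And>t. \<bar>c t\<bar> \<le> 1) \<Longrightarrow> 0 < d \<Longrightarrow> 0 < s \<Longrightarrow> s \<notin> {a + b, \<bar>a - b\<bar>} \<Longrightarrow>
      \<bar>LINT t|angle_interval. c t * heat_kernel \<nu> (d\<^sup>2) (tri_side a b t) s\<bar> \<le> C * (isq s * (isq (s - (a + b)) + isq (s - \<bar>a - b\<bar>)))"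
proof -
  obtain K where K: "0 < K" "\<And>r. r \<in> {\<bar>a - b\<bar>..a + b} \<Longrightarrow> side_density a b r \<le> K * sqrt r * (isq (r - (a + b)) + isq (r - \<bar>a - b\<bar>))"
    using side_density_le[OF ab] by blast
  have ne: "a + b \<noteq> \<bar>a - b\<bar>" using ab by linarith
  show ?thesis
  proof (rule that[of "24 * K"])
    show "0 \<le> 24 * K" using K by simp
    fix c :: "real \<Rightarrow> real" and \<nu> :: int and d s :: real
    assume c: "c \<in> borel_measurable borel" "\<And>t. \<bar>c t\<bar> \<le> 1" and d: "0 < d" and s: "0 < s" "s \<notin> {a + b, \<bar>a - b\<bar>}"
    have "\<bar>LINT t|angle_interval. c t * heat_kernel \<nu> (d\<^sup>2) (tri_side a b t) s\<bar> \<le> 24 * K * isq s * (\<Sum>q\<in>{a + b, \<bar>a - b\<bar>}. isq (s - q))"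
    proof (rule heat_kernel_integral_bound[OF ab d s, where w = "\<lambda>_. 1"])
      fix r assume r: "r \<in> {\<bar>a - b\<bar>..a + b}"
      let ?T = "isq (r - (a + b)) + isq (r - \<bar>a - b\<bar>)"
      have T: "0 \<le> ?T" by (intro add_nonneg_nonneg isq_nonneg)
      have "side_density a b r * isq r \<le> K * sqrt r * ?T * isq r"
        by (intro mult_right_mono K(2) r isq_nonneg)
      also have "\<dots> = K * ?T * (sqrt r * isq r)" by simp
      also have "\<dots> \<le> K * ?T * 1"
      proof (rule mult_left_mono)
        have "0 \<le> r" using r by auto
        then show "sqrt r * isq r \<le> 1" by (simp add: isq_def)
      qed (use K T in simp)
      finally show "1 * side_density a b r * isq r \<le> K * (\<Sum>q\<in>{a + b, \<bar>a - b\<bar>}. isq (r - q))"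
        using ne by simp
    qed (use K c in auto)
    also have "\<dots> = 24 * K * (isq s * (isq (s - (a + b)) + isq (s - \<bar>a - b\<bar>)))" using ne by simp
    finally show "\<bar>LINT t|angle_interval. c t * heat_kernel \<nu> (d\<^sup>2) (tri_side a b t) s\<bar> \<le> 24 * K * (isq s * (isq (s - (a + b)) + isq (s - \<bar>a - b\<bar>)))" .
  qed
qed

text \<open>For \<open>a = b\<close> the singularity at \<open>\<bar>a - b\<bar> = 0\<close> disappears when \<open>c\<close> vanishes there to first order.\<close>

lemma heat_kernel_dominated_isosceles:
  assumes a: "0 < a" and M: "0 \<le> M"
  obtains C where "0 \<le> C"
    "\<And>c \<nu> d s. c \<in> borel_measurable borel \<Longrightarrow> (\<And>t. \<bar>c t\<bar> \<le> 1) \<Longrightarrow>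
      (\<And>t. 0 < t \<Longrightarrow> t < pi \<Longrightarrow> \<bar>c t\<bar> \<le> M * tri_side a a t) \<Longrightarrow> 0 < d \<Longrightarrow> 0 < s \<Longrightarrow> s \<noteq> a + a \<Longrightarrow>
      \<bar>LINT t|angle_interval. c t * heat_kernel \<nu> (d\<^sup>2) (tri_side a a t) s\<bar> \<le> C * (isq s * isq (s - (a + a)))"
proof -
  obtain K where K: "0 < K" "\<And>r. r \<in> {\<bar>a - a\<bar>..a + a} \<Longrightarrow> side_density a a r \<le> K * sqrt r * (isq (r - (a + a)) + isq (r - \<bar>a - a\<bar>))"
    using side_density_le[OF a a] by blast
  \<comment> \<open>Both \<open>r isq r\<close> and \<open>r isq (r - 2 a)\<close> are at most
    \<open>2 a isq (r - 2 a)\<close>.\<close>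
  let ?K = "M * K * (4 * a)"
  show ?thesis
  proof (rule that[of "24 * ?K"])
    show "0 \<le> 24 * ?K" using K M a by simp
    fix c :: "real \<Rightarrow> real" and \<nu> :: int and d s :: real
    assume c: "c \<in> borel_measurable borel" "\<And>t. \<bar>c t\<bar> \<le> 1"
      and cM: "\<And>t. 0 < t \<Longrightarrow> t < pi \<Longrightarrow> \<bar>c t\<bar> \<le> M * tri_side a a t"
      and d: "0 < d" and s: "0 < s" "s \<noteq> a + a"
    have "\<bar>LINT t|angle_interval. c t * heat_kernel \<nu> (d\<^sup>2) (tri_side a a t) s\<bar> \<le> 24 * ?K * isq s * (\<Sum>q\<in>{a + a}. isq (s - q))"
    proof (rule heat_kernel_integral_bound[OF a a d s(1), where w = "\<lambda>r. M * r"])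
      fix r assume r: "r \<in> {\<bar>a - a\<bar>..a + a}"
      then have r0: "0 \<le> r" "r \<le> 2 * a" by auto
      let ?T = "isq (r - (a + a)) + isq r"
      have T: "0 \<le> ?T" by (intro add_nonneg_nonneg isq_nonneg)
      have "M * r * side_density a a r * isq r \<le> M * K * (4 * a * isq (r - (a + a)))"
      \<comment> \<open>At the singular point both sides are 0 by division by zero, while
        \<open>isq_mono\<close> needs a positive distance.\<close>
      proof (cases "r = a + a")
        case True
        then show ?thesis using K M a by (simp add: side_density_def isq_def)
      next
        case False
        have "M * r * side_density a a r * isq r \<le> M * r * (K * sqrt r * ?T) * isq r"
          using K(2)[OF r] M r0 by (intro mult_right_mono mult_left_mono isq_nonneg) auto
        also have "\<dots> = M * K * (r * ?T) * (sqrt r * isq r)" by simp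
        also have "\<dots> \<le> M * K * (r * ?T) * 1"
        proof (rule mult_left_mono)
          show "sqrt r * isq r \<le> 1" using r0 by (simp add: isq_def)
        qed (use K T M r0 in simp)
        also have "\<dots> = M * K * (r * ?T)" by simp
        also have "\<dots> \<le> M * K * (4 * a * isq (r - (a + a)))"
        proof (rule mult_left_mono)
          have "r * isq r = sqrt r" using r0 by (simp add: isq_def real_div_sqrt)
          also have "\<dots> \<le> sqrt (2 * a)" using r0 by simp
          also have "\<dots> = 2 * a * isq (2 * a)" using a by (simp add: isq_def real_div_sqrt)
          also have "\<dots> \<le> 2 * a * isq (r - (a + a))"
            using a r0 False by (intro mult_left_mono isq_mono) auto
          finally have "r * isq r \<le> 2 * a * isq (r - (a + a))" .
          moreover have "r * isq (r - (a + a)) \<le> 2 * a * isq (r - (a + a))"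
            using r0 by (intro mult_right_mono isq_nonneg)
          ultimately show "r * ?T \<le> 4 * a * isq (r - (a + a))" by (simp add: distrib_left)
        qed (use K M in simp)
        finally show ?thesis .
      qed
      also have "\<dots> = ?K * isq (r - (a + a))" by simp
      finally show "M * r * side_density a a r * isq r \<le> ?K * (\<Sum>q\<in>{a + a}. isq (r - q))"
        by simp
    qed (use K M a c cM s in auto)
    also have "\<dots> = 24 * ?K * (isq s * isq (s - (a + a)))" by simp
    finally show "\<bar>LINT t|angle_interval. c t * heat_kernel \<nu> (d\<^sup>2) (tri_side a a t) s\<bar> \<le> 24 * ?K * (isq s * isq (s - (a + a)))" .
  qed
qed

text \<open>In the side variable there are inverse roots at \<open>q\<close>, at
  \<open>a + b\<close> and at \<open>\<bar>a - b\<bar>\<close>. Two of them at the same point would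
  multiply to a reciprocal, which diverges logarithmically; the conditions on \<open>q\<close> keep
  them apart.\<close>

lemma nn_integral_tri_side_isq_finite:
  assumes ab: "0 < a" "0 < b" and q: "q \<noteq> a + b" "q \<noteq> \<bar>a - b\<bar>"
  shows "(\<integral>\<^sup>+t. ennreal (isq (tri_side a b t) * isq (tri_side a b t - q)) * indicator {0<..<pi} t \<partial>lborel) < \<infinity>"
proof -
  obtain K where K: "0 < K" "\<And>r. r \<in> {\<bar>a - b\<bar>..a + b} \<Longrightarrow> side_density a b r \<le> K * sqrt r * (isq (r - (a + b)) + isq (r - \<bar>a - b\<bar>))"
    using side_density_le[OF ab] by blast
  let ?I = "indicator {\<bar>a - b\<bar>..a + b} :: real \<Rightarrow> ennreal"
  have "(\<integral>\<^sup>+t. ennreal (isq (tri_side a b t) * isq (tri_side a b t - q)) * indicator {0<..<pi} t \<partial>lborel) \<le>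
     (\<integral>\<^sup>+r. ennreal (isq r * isq (r - q) * side_density a b r) * ?I r \<partial>lborel)"
    by (rule nn_integral_tri_side[OF ab, where \<Phi> = "\<lambda>r. isq r * isq (r - q)"]) (auto intro: mult_nonneg_nonneg isq_nonneg)
  also have "\<dots> \<le> (\<integral>\<^sup>+r. ennreal K * (ennreal (isq (r - q) * isq (r - (a + b))) * ?I r + ennreal (isq (r - q) * isq (r - \<bar>a - b\<bar>)) * ?I r) \<partial>lborel)"
  proof (rule nn_integral_mono)
    fix r
    show "ennreal (isq r * isq (r - q) * side_density a b r) * ?I r \<le>
      ennreal K * (ennreal (isq (r - q) * isq (r - (a + b))) * ?I r + ennreal (isq (r - q) * isq (r - \<bar>a - b\<bar>)) * ?I r)"
    proof (cases "r \<in> {\<bar>a - b\<bar>..a + b}")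
      case True
      let ?T = "isq (r - (a + b)) + isq (r - \<bar>a - b\<bar>)"
      have T: "0 \<le> ?T" by (intro add_nonneg_nonneg isq_nonneg)
      have "isq r * isq (r - q) * side_density a b r \<le> isq r * isq (r - q) * (K * sqrt r * ?T)"
        by (intro mult_left_mono K(2) True mult_nonneg_nonneg isq_nonneg)
      also have "\<dots> = K * (isq (r - q) * ?T) * (sqrt r * isq r)" by simp
      also have "\<dots> \<le> K * (isq (r - q) * ?T) * 1"
      proof (rule mult_left_mono)
        have "0 \<le> r" using True by auto
        then show "sqrt r * isq r \<le> 1" by (simp add: isq_def)
      qed (use K T isq_nonneg in simp)
      also have "\<dots> = K * (isq (r - q) * isq (r - (a + b)) + isq (r - q) * isq (r - \<bar>a - b\<bar>))"
        by (simp add: distrib_left)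
      finally have "ennreal (isq r * isq (r - q) * side_density a b r) \<le>
          ennreal (K * (isq (r - q) * isq (r - (a + b)) + isq (r - q) * isq (r - \<bar>a - b\<bar>)))"
        by (rule ennreal_leI)
      also have "\<dots> = ennreal K * (ennreal (isq (r - q) * isq (r - (a + b))) + ennreal (isq (r - q) * isq (r - \<bar>a - b\<bar>)))"
        using K by (subst ennreal_mult, simp, intro add_nonneg_nonneg mult_nonneg_nonneg isq_nonneg)
          (subst ennreal_plus, auto intro: mult_nonneg_nonneg isq_nonneg)
      finally show ?thesis using True by simp
    qed simp
  qed
  also have "\<dots> = ennreal K * ((\<integral>\<^sup>+r. ennreal (isq (r - q) * isq (r - (a + b))) * ?I r \<partial>lborel) + (\<integral>\<^sup>+r. ennreal (isq (r - q) * isq (r - \<bar>a - b\<bar>)) * ?I r \<partial>lborel))"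
    by (subst nn_integral_cmult) (auto simp: nn_integral_add)
  also have "\<dots> < \<infinity>"
    using nn_integral_isq_mult_finite[OF q(1), of "\<bar>a - b\<bar>" "a + b"] nn_integral_isq_mult_finite[OF q(2), of "\<bar>a - b\<bar>" "a + b"]
    by (simp add: ennreal_mult_less_top)
  finally show ?thesis .
qed

section \<open>A Tauberian theorem\<close>

text \<open>Karamata's method: the indicator of an initial segment is approximated by
  \<open>t + t (1 - t) p(t)\<close> with a polynomial \<open>p\<close>, evaluated at \<open>t = exp (- \<epsilon> x\<^sup>2)\<close>.\<close>

lemma integrable_exp_neg_square_bound:
  fixes f :: "real \<Rightarrow> real" and \<epsilon> :: real
  assumes f: "f \<in> borel_measurable borel" and bd: "\<And>x. \<bar>f x\<bar> \<le> B * \<bar>x\<bar>" and \<epsilon>: "0 < \<epsilon>"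
  shows "integrable lborel (\<lambda>x. indicator {0..} x * (exp (- \<epsilon> * x\<^sup>2) * f x))"
proof -
  note [measurable] = f
  have "integrable (gauss_measure \<epsilon>) (\<lambda>x. 1 :: real)"
    using gauss_moment[OF \<epsilon>, of 0] by (simp add: has_bochner_integral_iff)
  then have "integrable lborel (\<lambda>x. (indicator {0..} x * (x * exp (- \<epsilon> * x\<^sup>2))) *\<^sub>R (1 :: real))"
    unfolding gauss_measure_def by (subst (asm) integrable_density) (auto simp: indicator_def)
  then have i: "integrable lborel (\<lambda>x. \<bar>B\<bar> * (indicator {0..} x * (x * exp (- \<epsilon> * x\<^sup>2))))"
    by simp
  show ?thesis
  proof (rule Bochner_Integration.integrable_bound[OF i])
    show "AE x in lborel. norm (indicator {0..} x * (exp (- \<epsilon> * x\<^sup>2) * f x)) \<le> norm (\<bar>B\<bar> * (indicator {0..} x * (x * exp (- \<epsilon> * x\<^sup>2))))"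
    proof (rule AE_I2)
      fix x :: real
      show "norm (indicator {0..} x * (exp (- \<epsilon> * x\<^sup>2) * f x)) \<le> norm (\<bar>B\<bar> * (indicator {0..} x * (x * exp (- \<epsilon> * x\<^sup>2))))"
      proof (cases "0 \<le> x")
        case True
        have "\<bar>f x\<bar> \<le> \<bar>B\<bar> * x" using bd[of x] True by (smt (verit) mult_right_mono)
        then have "exp (- \<epsilon> * x\<^sup>2) * \<bar>f x\<bar> \<le> exp (- \<epsilon> * x\<^sup>2) * (\<bar>B\<bar> * x)" by (intro mult_left_mono) auto
        then show ?thesis using True by (simp add: abs_mult mult_ac)
      qed simp
    qed
  qed measurable
qed

text \<open>\<open>q\<close> is a weight in the variable \<open>t = exp (- \<epsilon> x^2)\<close>
  of Karamata's method; the identity yields the Gaussian mean itself.\<close>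

definition gauss_sum :: "(real \<Rightarrow> real) \<Rightarrow> (real \<Rightarrow> real) \<Rightarrow> real \<Rightarrow> real" where
  "gauss_sum f q \<epsilon> = (LINT x|lborel. indicator {0..} x * (q (exp (- \<epsilon> * x\<^sup>2)) * f x))"

text \<open>The power \<open>t^(k + 1)\<close> is the Gaussian at \<open>(k + 1) \<epsilon>\<close>,
  so each monomial has the same limit \<open>I\<close>, and a polynomial without constant term gets
  its value at \<open>t = 1\<close> as factor.\<close>

lemma gauss_sum_polynomial:
  fixes f :: "real \<Rightarrow> real" and \<epsilon> :: real and a :: "nat \<Rightarrow> real"
  assumes f: "f \<in> borel_measurable borel" and bd: "\<And>x. \<bar>f x\<bar> \<le> B * \<bar>x\<bar>"
    and lim: "((\<lambda>\<epsilon>. gauss_sum f (\<lambda>t. t) \<epsilon>) \<longlongrightarrow> I) (at_right 0)"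
  shows "((\<lambda>\<epsilon>. gauss_sum f (\<lambda>t. \<Sum>i\<in>A. a i * t ^ Suc (n i)) \<epsilon>) \<longlongrightarrow> (\<Sum>i\<in>A. a i) * I) (at_right 0)"
    and "0 < \<epsilon> \<Longrightarrow> integrable lborel (\<lambda>x. indicator {0..} x * ((\<Sum>i\<in>A. a i * exp (- \<epsilon> * x\<^sup>2) ^ Suc (n i)) * f x))"
proof -
  have pw: "exp (- \<epsilon> * x\<^sup>2) ^ Suc k = exp (- (real (Suc k) * \<epsilon>) * x\<^sup>2)" for \<epsilon> x :: real and k
  proof -
    have "exp (- \<epsilon> * x\<^sup>2) ^ Suc k = exp (of_nat (Suc k) * (- \<epsilon> * x\<^sup>2))" by (rule exp_of_nat_mult[symmetric])
    also have "of_nat (Suc k) * (- \<epsilon> * x\<^sup>2) = - (real (Suc k) * \<epsilon>) * x\<^sup>2" by (simp only: mult_minus_left mult_minus_right mult.assoc)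
    finally show ?thesis .
  qed
  have term_eq: "indicator {0..} x * ((\<Sum>i\<in>A. a i * exp (- \<epsilon> * x\<^sup>2) ^ Suc (n i)) * f x) =
     (\<Sum>i\<in>A. a i * (indicator {0..} x * (exp (- (real (Suc (n i)) * \<epsilon>) * x\<^sup>2) * f x)))" for \<epsilon> x
    unfolding pw sum_distrib_left sum_distrib_right by (intro sum.cong refl) (simp only: mult_ac)
  have int: "integrable lborel (\<lambda>x. a i * (indicator {0..} x * (exp (- (real (Suc (n i)) * \<epsilon>) * x\<^sup>2) * f x)))" if "0 < \<epsilon>" for \<epsilon> i
    using that by (intro integrable_mult_right integrable_exp_neg_square_bound[OF f bd]) simp
  show "0 < \<epsilon> \<Longrightarrow> integrable lborel (\<lambda>x. indicator {0..} x * ((\<Sum>i\<in>A. a i * exp (- \<epsilon> * x\<^sup>2) ^ Suc (n i)) * f x))"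
    unfolding term_eq by (intro Bochner_Integration.integrable_sum int)
  have ev: "gauss_sum f (\<lambda>t. \<Sum>i\<in>A. a i * t ^ Suc (n i)) \<epsilon> = (\<Sum>i\<in>A. a i * gauss_sum f (\<lambda>t. t) (real (Suc (n i)) * \<epsilon>))"
    if "0 < \<epsilon>" for \<epsilon>
  proof -
    have "gauss_sum f (\<lambda>t. \<Sum>i\<in>A. a i * t ^ Suc (n i)) \<epsilon> = (\<Sum>i\<in>A. LINT x|lborel. a i * (indicator {0..} x * (exp (- (real (Suc (n i)) * \<epsilon>) * x\<^sup>2) * f x)))"
      unfolding gauss_sum_def term_eq by (intro Bochner_Integration.integral_sum int that)
    then show ?thesis unfolding gauss_sum_def by (simp only: integral_mult_right_zero)
  qed
  have "((\<lambda>\<epsilon>. \<Sum>i\<in>A. a i * gauss_sum f (\<lambda>t. t) (real (Suc (n i)) * \<epsilon>)) \<longlongrightarrow> (\<Sum>i\<in>A. a i * I)) (at_right 0)"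
  proof (intro tendsto_sum tendsto_mult tendsto_const)
    fix i
    have "filterlim (\<lambda>\<epsilon>. real (Suc (n i)) * \<epsilon>) (at_right 0) (at_right 0)"
    proof (rule filterlim_at_withinI)
      show "((\<lambda>\<epsilon>. real (Suc (n i)) * \<epsilon>) \<longlongrightarrow> 0) (at_right 0)"
        by (rule tendsto_mult_right_zero) (rule tendsto_ident_at)
      show "\<forall>\<^sub>F \<epsilon> in at_right 0. real (Suc (n i)) * \<epsilon> \<in> {0<..} - {0}"
        using eventually_at_right_less[of "0::real"] by eventually_elim (simp add: add_pos_nonneg)
    qed
    then show "((\<lambda>\<epsilon>. gauss_sum f (\<lambda>t. t) (real (Suc (n i)) * \<epsilon>)) \<longlongrightarrow> I) (at_right 0)"
      by (rule filterlim_compose[OF lim])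
  qed
  then have "((\<lambda>\<epsilon>. \<Sum>i\<in>A. a i * gauss_sum f (\<lambda>t. t) (real (Suc (n i)) * \<epsilon>)) \<longlongrightarrow> (\<Sum>i\<in>A. a i) * I) (at_right 0)"
    by (simp only: sum_distrib_right)
  then show "((\<lambda>\<epsilon>. gauss_sum f (\<lambda>t. \<Sum>i\<in>A. a i * t ^ Suc (n i)) \<epsilon>) \<longlongrightarrow> (\<Sum>i\<in>A. a i) * I) (at_right 0)"
  proof (rule Lim_transform_eventually)
    show "\<forall>\<^sub>F \<epsilon> in at_right 0. (\<Sum>i\<in>A. a i * gauss_sum f (\<lambda>t. t) (real (Suc (n i)) * \<epsilon>)) = gauss_sum f (\<lambda>t. \<Sum>i\<in>A. a i * t ^ Suc (n i)) \<epsilon>"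
      using eventually_at_right_less[of "0::real"] by eventually_elim (rule ev[symmetric])
  qed
qed

lemma gauss_weight_integral:
  fixes \<epsilon> :: real
  assumes "0 < \<epsilon>"
  shows "has_bochner_integral lborel (\<lambda>x. indicator {0..} x * (\<epsilon> * x * exp (- \<epsilon> * x\<^sup>2))) (1 / 2)"
proof -
  have "has_bochner_integral (gauss_measure \<epsilon>) (\<lambda>x. 1 :: real) (1 / (2 * \<epsilon>))"
    using gauss_moment[OF assms, of 0] by simp
  then have "has_bochner_integral lborel (\<lambda>x. (indicator {0..} x * (x * exp (- \<epsilon> * x\<^sup>2))) *\<^sub>R (1 :: real)) (1 / (2 * \<epsilon>))"
    unfolding gauss_measure_def has_bochner_integral_iff
    by (subst (asm) integrable_density integral_density; (subst (asm) integral_density)?) (auto simp: indicator_def)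
  then have "has_bochner_integral lborel (\<lambda>x. \<epsilon> * ((indicator {0..} x * (x * exp (- \<epsilon> * x\<^sup>2))) *\<^sub>R (1 :: real))) (\<epsilon> * (1 / (2 * \<epsilon>)))"
    by (rule has_bochner_integral_mult_right)
  moreover have "\<epsilon> * (1 / (2 * \<epsilon>)) = 1 / 2" using assms by simp
  moreover have "\<epsilon> * ((indicator {0..} x * (x * exp (- \<epsilon> * x\<^sup>2))) *\<^sub>R (1 :: real)) = indicator {0..} x * (\<epsilon> * x * exp (- \<epsilon> * x\<^sup>2))" for x
    by simp
  ultimately show ?thesis by (simp only:)
qed

text \<open>For \<open>\<epsilon> = 1 / L^2\<close> the condition that \<open>x\<close> is at most
  \<open>L\<close> reads \<open>exp (- 1) \<le> t\<close>. Its indicator is replaced by a continuous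
  ramp \<open>w\<close>, at the cost of the integral of \<open>C / x\<close> over the ramp, and
  \<open>w\<close> by a polynomial with an error of at most \<open>\<eta> t (1 - t)\<close>. Since
  \<open>1 - t\<close> is at most \<open>\<epsilon> x^2\<close> and \<open>\<bar>f x\<bar>\<close>
  at most \<open>C / x\<close>, the second error is \<open>\<eta> C\<close> times a Gaussian weight
  of mass 1/2.\<close>

theorem gauss_summable_imp_improper_integral:
  fixes f :: "real \<Rightarrow> real"
  assumes f: "f \<in> borel_measurable borel" and bd: "\<And>x. \<bar>f x\<bar> \<le> B * \<bar>x\<bar>"
    and C: "0 < C" "\<And>x. 0 < x \<Longrightarrow> \<bar>f x\<bar> \<le> C / x"
    and lim: "((\<lambda>\<epsilon>. gauss_sum f (\<lambda>t. t) \<epsilon>) \<longlongrightarrow> I) (at_right 0)"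
  shows "((\<lambda>L. LINT x|lborel. indicator {0..L} x * f x) \<longlongrightarrow> I) at_top"
proof (rule tendstoI)
  fix e :: real assume e: "0 < e"
  note [measurable] = f
  \<comment> \<open>The ramp between \<open>L\<close> and \<open>r L\<close> costs
    \<open>C (r - 1) = e / 4\<close>.\<close>
  define r where "r = 1 + e / (4 * C)"
  have r: "1 < r" using e C by (simp add: r_def)
  \<comment> \<open>The values of \<open>t\<close> at \<open>x = r L\<close> and at
    \<open>x = L\<close>.\<close>
  define a b where "a = exp (- r\<^sup>2)" and "b = exp (- 1 :: real)"
  have r2: "1 < r\<^sup>2" using r by (simp add: one_less_power)
  have ab: "0 < a" "a < b" "b < 1" using r2 by (auto simp: a_def b_def)
  define w where "w = (\<lambda>t. min 1 (max 0 ((t - a) / (b - a))))"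
  \<comment> \<open>The quotient of \<open>w t - t\<close> by \<open>t (1 - t)\<close> in partial
    fractions. \<open>max\<close> and \<open>min\<close> alter the denominators only where the
    numerators vanish and keep them away from 0, so \<open>G\<close> is continuous up to both
    ends.\<close>
  define G where "G = (\<lambda>t. w t / max t a - (1 - w t) / (1 - min t b))"
  have w01: "0 \<le> w t" "w t \<le> 1" for t by (auto simp: w_def)
  have w0: "w t = 0" if "t \<le> a" for t
  proof -
    have "(t - a) / (b - a) \<le> 0" using that ab by (intro divide_nonpos_pos) auto
    then show ?thesis by (simp add: w_def)
  qed
  have w1: "w t = 1" if "b \<le> t" for t using that ab by (simp add: w_def)
  have cG: "continuous_on {0..1} G"
    unfolding G_def w_def using ab by (intro continuous_intros) (auto simp: max_def min_def)
  have wG: "w t = t + t * (1 - t) * G t" if t: "0 \<le> t" "t \<le> 1" for t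
  proof -
    consider "t \<le> a" | "a < t" "t < b" | "b \<le> t" by linarith
    then show ?thesis
    proof cases
      case 1
      then have m: "min t b = t" "max t a = a" using ab by auto
      have "1 - t \<noteq> 0" using 1 ab by simp
      then show ?thesis by (simp add: G_def w0[OF 1] m)
    next
      case 2
      then have m: "min t b = t" "max t a = t" by auto
      have nz: "1 - t \<noteq> 0" "t \<noteq> 0" using 2 ab by auto
      have "t * (1 - t) * G t = (t / t) * ((1 - t) * w t) - ((1 - t) / (1 - t)) * (t * (1 - w t))"
      proof -
        have "x * y * (u / x - v / y) = (x / x) * (y * u) - (y / y) * (x * v)" for x y u v :: real
          by (simp only: right_diff_distrib divide_inverse mult_ac)
        then show ?thesis unfolding G_def m .
      qed
      also have "\<dots> = w t - t" using nz by (simp add: algebra_simps)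
      finally show ?thesis by simp
    next
      case 3
      then have m: "max t a = t" using ab by auto
      have "t \<noteq> 0" using 3 ab by simp
      then show ?thesis by (simp add: G_def w1[OF 3] m)
    qed
  qed
  \<comment> \<open>The polynomial error \<open>\<eta> C / 2\<close> is then \<open>e / 4\<close> as
    well.\<close>
  define \<eta> where "\<eta> = e / (2 * C)"
  have \<eta>: "0 < \<eta>" using e C by (simp add: \<eta>_def)
  obtain Q where Q: "real_polynomial_function Q" "\<And>t. t \<in> {0..1} \<Longrightarrow> \<bar>G t - Q t\<bar> < \<eta>"
    using Stone_Weierstrass_real_polynomial_function[OF _ cG \<eta>] by auto
  have "real_polynomial_function (\<lambda>t. 1 + (1 - t) * Q t)"
    by (intro real_polynomial_function.intros(2-4) real_polynomial_function_diff Q(1)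
        real_polynomial_function.intros(1)[OF bounded_linear_ident])
  then obtain c n where cn: "(\<lambda>t. 1 + (1 - t) * Q t) = (\<lambda>t. \<Sum>i\<le>n. c i * t ^ i)"
    using real_polynomial_function_iff_sum by metis
  let ?P = "\<lambda>t::real. \<Sum>i\<le>n. c i * t ^ Suc i"
  have P: "?P t = t + t * (1 - t) * Q t" for t
  proof -
    have "?P t = t * (\<Sum>i\<le>n. c i * t ^ i)" by (simp add: sum_distrib_left mult_ac)
    also have "(\<Sum>i\<le>n. c i * t ^ i) = 1 + (1 - t) * Q t" using fun_cong[OF cn, of t] by simp
    finally show ?thesis by (simp add: algebra_simps)
  qed
  \<comment> \<open>At \<open>t = 1\<close> the factor \<open>1 - t\<close> removes the
    approximating polynomial, so the limit remains \<open>I\<close>.\<close>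
  have c1: "(\<Sum>i\<le>n. c i) = 1" using fun_cong[OF cn, of 1] by simp
  have limP: "((\<lambda>\<epsilon>. gauss_sum f ?P \<epsilon>) \<longlongrightarrow> I) (at_right 0)"
    using gauss_sum_polynomial(1)[OF f bd lim, where A = "{..n}" and a = c and n = "\<lambda>i. i"] by (simp only: c1 mult_1)
  have fl: "filterlim (\<lambda>L::real. 1 / L\<^sup>2) (at_right 0) at_top"
  proof (rule filterlim_at_withinI)
    show "((\<lambda>L::real. 1 / L\<^sup>2) \<longlongrightarrow> 0) at_top"
      by (intro tendsto_divide_0[OF tendsto_const] filterlim_at_top_imp_at_infinity filterlim_pow_at_top filterlim_ident) simp
    show "\<forall>\<^sub>F L in at_top. 1 / (L::real)\<^sup>2 \<in> {0<..} - {0}"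
      using eventually_gt_at_top[of "0::real"] by eventually_elim simp
  qed
  have "\<forall>\<^sub>F L in at_top. dist (gauss_sum f ?P (1 / L\<^sup>2)) I < e / 2"
    by (rule tendstoD[OF filterlim_compose[OF limP fl]]) (use e in simp)
  then show "\<forall>\<^sub>F L in at_top. dist (LINT x|lborel. indicator {0..L} x * f x) I < e"
    using eventually_gt_at_top[of "0::real"]
  proof eventually_elim
    case (elim L)
    define \<epsilon> where "\<epsilon> = 1 / L\<^sup>2"
    have \<epsilon>: "0 < \<epsilon>" using elim by (simp add: \<epsilon>_def)
    let ?t = "\<lambda>x. exp (- \<epsilon> * x\<^sup>2)"
    let ?D = "\<lambda>x. indicator {0..L} x * f x - indicator {0..} x * (?P (?t x) * f x)"
    let ?W = "\<lambda>x. indicator {0..} x * (\<epsilon> * x * ?t x)"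
    let ?b = "\<lambda>x. C / L * indicator {L..r * L} x + \<eta> * C * ?W x"
    have i1: "integrable lborel (\<lambda>x. indicator {0..L} x * f x)"
    proof (rule Bochner_Integration.integrable_bound[of _ "\<lambda>x. indicator {0..L} x * (\<bar>B\<bar> * L)"])
      show "AE x in lborel. norm (indicator {0..L} x * f x) \<le> norm (indicator {0..L} x * (\<bar>B\<bar> * L))"
      proof (rule AE_I2)
        fix x
        show "norm (indicator {0..L} x * f x) \<le> norm (indicator {0..L} x * (\<bar>B\<bar> * L))"
        proof (cases "x \<in> {0..L}")
          case True
          have "\<bar>f x\<bar> \<le> B * \<bar>x\<bar>" by (rule bd)
          also have "\<dots> \<le> \<bar>B\<bar> * L" using True by (intro mult_mono) auto
          finally show ?thesis using True elim by (simp add: abs_mult)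
        qed simp
      qed
    qed (auto intro!: integrable_mult_left integrable_real_indicator simp: emeasure_lborel_Icc_eq)
    have i2: "integrable lborel (\<lambda>x. indicator {0..} x * (?P (?t x) * f x))"
      by (rule gauss_sum_polynomial(2)[OF f bd lim \<epsilon>])
    have W: "has_bochner_integral lborel ?W (1 / 2)" by (rule gauss_weight_integral[OF \<epsilon>])
    have ind: "integrable lborel (indicat_real {L..r * L})"
      by (auto intro!: integrable_real_indicator simp: emeasure_lborel_Icc_eq)
    have i3: "integrable lborel ?b"
      using W ind by (intro Bochner_Integration.integrable_add integrable_mult_right) (auto simp: has_bochner_integral_iff)
    have "norm (LINT x|lborel. ?D x) \<le> (LINT x|lborel. norm (?D x))" by (rule integral_norm_bound)
    also have "\<dots> \<le> (LINT x|lborel. ?b x)"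
    proof (rule integral_mono_AE)
      show "AE x in lborel. norm (?D x) \<le> ?b x"
        using AE_lborel_singleton[of "0::real"]
      proof eventually_elim
        case (elim x)
        show ?case
        proof (cases "0 < x")
          case False
          then have "x < 0" using elim by simp
          then show ?thesis using \<open>0 < L\<close> by simp
        next
          case True
          have t: "0 \<le> ?t x" "?t x \<le> 1" using \<epsilon> by auto
          have fx: "\<bar>f x\<bar> \<le> C / x" by (rule C(2)[OF True])
          have L: "0 < L" by fact
          have e1: "\<bar>indicator {0..L} x - w (?t x)\<bar> * \<bar>f x\<bar> \<le> C / L * indicator {L..r * L} x"
          proof -
            consider "x < L" | "L \<le> x" "x \<le> r * L" | "r * L < x" by linarith
            then show ?thesis
            proof cases
              case 1
              have "x\<^sup>2 \<le> L\<^sup>2" using 1 True by (intro power_mono) auto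
              then have "\<epsilon> * x\<^sup>2 \<le> 1" using L by (simp add: \<epsilon>_def)
              then have "w (?t x) = 1" by (intro w1) (simp add: b_def)
              then show ?thesis using 1 True C L by simp
            next
              case 2
              have "\<bar>indicator {0..L} x - w (?t x)\<bar> \<le> 1"
                using w01[of "?t x"] by (auto simp: indicator_def)
              then have "\<bar>indicator {0..L} x - w (?t x)\<bar> * \<bar>f x\<bar> \<le> 1 * (C / x)"
                using fx by (intro mult_mono) auto
              also have "\<dots> \<le> C / L" using 2 L C True by (simp add: divide_left_mono)
              finally show ?thesis using 2 by simp
            next
              case 3
              have "L \<le> r * L" using r L by simp
              have "(r * L)\<^sup>2 \<le> x\<^sup>2" using 3 L r by (intro power_mono) auto
              then have "r\<^sup>2 \<le> \<epsilon> * x\<^sup>2" using L by (simp add: \<epsilon>_def power_mult_distrib pos_le_divide_eq)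
              then have "w (?t x) = 0" by (intro w0) (simp add: a_def)
              then show ?thesis using 3 \<open>L \<le> r * L\<close> by simp
            qed
          qed
          have e2: "\<bar>w (?t x) - ?P (?t x)\<bar> * \<bar>f x\<bar> \<le> \<eta> * C * ?W x"
          proof -
            have "w (?t x) - ?P (?t x) = ?t x * (1 - ?t x) * (G (?t x) - Q (?t x))"
              unfolding P wG[OF t] by (simp add: right_diff_distrib)
            then have "\<bar>w (?t x) - ?P (?t x)\<bar> = ?t x * (1 - ?t x) * \<bar>G (?t x) - Q (?t x)\<bar>"
              using t by (simp add: abs_mult)
            also have "\<dots> \<le> ?t x * (\<epsilon> * x\<^sup>2) * \<eta>"
            proof (intro mult_mono mult_nonneg_nonneg)
              show "1 - ?t x \<le> \<epsilon> * x\<^sup>2" using exp_ge_add_one_self[of "- \<epsilon> * x\<^sup>2"] by linarith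
              show "\<bar>G (?t x) - Q (?t x)\<bar> \<le> \<eta>" using Q(2)[of "?t x"] t by (simp add: less_imp_le)
            qed (use t \<epsilon> in auto)
            finally have "\<bar>w (?t x) - ?P (?t x)\<bar> * \<bar>f x\<bar> \<le> (?t x * (\<epsilon> * x\<^sup>2) * \<eta>) * (C / x)"
              using fx \<epsilon> \<eta> by (intro mult_mono) auto
            also have "\<dots> = \<eta> * C * (\<epsilon> * x * ?t x)" using True by (simp add: power2_eq_square)
            finally show ?thesis using True by simp
          qed
          have "?D x = (indicator {0..L} x - w (?t x)) * f x + (w (?t x) - ?P (?t x)) * f x"
            using True by (simp add: left_diff_distrib)
          then have "norm (?D x) \<le> \<bar>indicator {0..L} x - w (?t x)\<bar> * \<bar>f x\<bar> + \<bar>w (?t x) - ?P (?t x)\<bar> * \<bar>f x\<bar>"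
            unfolding real_norm_def abs_mult[symmetric] by (simp only: abs_triangle_ineq)
          also have "\<dots> \<le> ?b x" by (rule add_mono[OF e1 e2])
          finally show ?thesis .
        qed
      qed
    qed (use i1 i2 i3 in \<open>auto intro: Bochner_Integration.integrable_diff integrable_norm\<close>)
    also have "\<dots> = C / L * (r * L - L) + \<eta> * C * (1 / 2)"
    proof -
      have "L \<le> r * L" using r elim by simp
      then have "(LINT x|lborel. indicator {L..r * L} x :: real) = r * L - L" by simp
      moreover have "(LINT x|lborel. ?W x) = 1 / 2" using W by (rule has_bochner_integral_integral_eq)
      moreover have "(LINT x|lborel. ?b x) = (LINT x|lborel. C / L * indicator {L..r * L} x) + (LINT x|lborel. \<eta> * C * ?W x)"
        using W ind by (intro Bochner_Integration.integral_add integrable_mult_right) (auto simp: has_bochner_integral_iff)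
      ultimately show ?thesis by (simp only: integral_mult_right_zero)
    qed
    also have "\<dots> = e / 2"
    proof -
      have "C / L * (r * L - L) = C * (r - 1) * (L / L)" by (simp add: algebra_simps)
      also have "\<dots> = e / 4" using elim C by (simp add: r_def)
      finally have quarter: "C / L * (r * L - L) = e / 4" .
      show ?thesis unfolding quarter \<eta>_def using C by simp
    qed
    finally have "norm (LINT x|lborel. ?D x) \<le> e / 2" .
    moreover have "(LINT x|lborel. ?D x) = (LINT x|lborel. indicator {0..L} x * f x) - gauss_sum f ?P \<epsilon>"
      unfolding gauss_sum_def by (rule Bochner_Integration.integral_diff[OF i1 i2])
    ultimately have "dist (LINT x|lborel. indicator {0..L} x * f x) (gauss_sum f ?P \<epsilon>) \<le> e / 2"
      by (simp add: dist_norm)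
    moreover have "dist (gauss_sum f ?P \<epsilon>) I < e / 2" using elim(1) by (simp only: \<epsilon>_def)
    ultimately show ?case
      using dist_triangle[of "LINT x|lborel. indicator {0..L} x * f x" I "gauss_sum f ?P \<epsilon>"] by linarith
  qed
qed

section \<open>Splitting off triangles\<close>

abbreviation angle_cube :: "nat set \<Rightarrow> (nat \<Rightarrow> real) measure" where
  "angle_cube I \<equiv> Pi\<^sub>M I (\<lambda>_. angle_interval)"

lemma product_sigma_finite_angle: "product_sigma_finite (\<lambda>_::nat. angle_interval)"
proof -
  interpret finite_measure angle_interval by (rule finite_measure_angle_interval)
  show ?thesis by standard
qed

lemma sets_angle_cube: "sets (angle_cube I) = sets (Pi\<^sub>M I (\<lambda>_. lborel))"
  by (rule sets_PiM_cong) auto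

lemma space_angle_cube [simp]: "space (angle_cube I) = extensional I"
  by (simp add: space_PiM PiE_UNIV_domain PiE_def)

text \<open>Turns the integral over the open cube into one over a finite product measure, from which
  single coordinates can be split off.\<close>

lemma density_angle_cube:
  assumes I: "finite I"
  shows "density (Pi\<^sub>M I (\<lambda>_. lborel)) (indicator (\<Pi>\<^sub>E k\<in>I. {0<..<pi})) = angle_cube I"
proof -
  interpret A: product_sigma_finite "\<lambda>_::nat. angle_interval" by (rule product_sigma_finite_angle)
  interpret L: product_sigma_finite "\<lambda>_::nat. lborel :: real measure" by standard
  have D [measurable]: "(\<Pi>\<^sub>E k\<in>I. {0<..<pi}) \<in> sets (Pi\<^sub>M I (\<lambda>_. lborel))"
    by (rule sets_PiM_I_finite[OF I]) auto
  show ?thesis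
  proof (rule A.PiM_eqI[OF I])
    show "sets (density (Pi\<^sub>M I (\<lambda>_. lborel)) (indicator (\<Pi>\<^sub>E k\<in>I. {0<..<pi}))) = sets (angle_cube I)"
      by (simp add: sets_angle_cube)
    fix A :: "nat \<Rightarrow> real set" assume A: "\<And>i. i \<in> I \<Longrightarrow> A i \<in> sets angle_interval"
    then have A': "Pi\<^sub>E I A \<in> sets (Pi\<^sub>M I (\<lambda>_. lborel))"
      by (intro sets_PiM_I_finite[OF I]) auto
    have "emeasure (density (Pi\<^sub>M I (\<lambda>_. lborel)) (indicator (\<Pi>\<^sub>E k\<in>I. {0<..<pi}))) (Pi\<^sub>E I A) =
        (\<integral>\<^sup>+x. indicator (\<Pi>\<^sub>E k\<in>I. {0<..<pi}) x * indicator (Pi\<^sub>E I A) x \<partial>Pi\<^sub>M I (\<lambda>_. lborel))"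
      by (rule emeasure_density[OF _ A']) measurable
    also have "\<dots> = (\<integral>\<^sup>+x. indicator (Pi\<^sub>E I (\<lambda>i. A i \<inter> {0<..<pi})) x \<partial>Pi\<^sub>M I (\<lambda>_. lborel))"
      by (rule nn_integral_cong) (auto simp: indicator_def PiE_iff)
    also have "\<dots> = emeasure (Pi\<^sub>M I (\<lambda>_. lborel)) (Pi\<^sub>E I (\<lambda>i. A i \<inter> {0<..<pi}))"
      using A by (intro nn_integral_indicator sets_PiM_I_finite[OF I]) auto
    also have "\<dots> = (\<Prod>i\<in>I. emeasure lborel (A i \<inter> {0<..<pi}))"
      using A by (intro L.emeasure_PiM[OF I]) auto
    also have "\<dots> = (\<Prod>i\<in>I. emeasure angle_interval (A i))"
    proof (rule prod.cong[OF refl])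
      fix i assume "i \<in> I"
      then have Ai: "A i \<in> sets lborel" using A by simp
      have "emeasure angle_interval (A i) = (\<integral>\<^sup>+x. indicator {0<..<pi} x * indicator (A i) x \<partial>lborel)"
        unfolding angle_interval_def by (rule emeasure_density[OF _ Ai]) measurable
      also have "\<dots> = (\<integral>\<^sup>+x. indicator (A i \<inter> {0<..<pi}) x \<partial>lborel)"
        by (rule nn_integral_cong) (auto simp: indicator_def)
      also have "\<dots> = emeasure lborel (A i \<inter> {0<..<pi})"
        using Ai by (intro nn_integral_indicator) auto
      finally show "emeasure lborel (A i \<inter> {0<..<pi}) = emeasure angle_interval (A i)" by simp
    qed
    finally show "emeasure (density (Pi\<^sub>M I (\<lambda>_. lborel)) (indicator (\<Pi>\<^sub>E k\<in>I. {0<..<pi}))) (Pi\<^sub>E I A) =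
        (\<Prod>i\<in>I. emeasure angle_interval (A i))" .
  qed
qed

lemma finite_measure_angle_cube:
  assumes I: "finite I" shows "finite_measure (angle_cube I)"
proof (rule finite_measureI)
  interpret A: product_sigma_finite "\<lambda>_::nat. angle_interval" by (rule product_sigma_finite_angle)
  interpret finite_measure angle_interval by (rule finite_measure_angle_interval)
  have "space (angle_cube I) = (\<Pi>\<^sub>E k\<in>I. UNIV)" by (simp add: PiE_UNIV_domain PiE_def)
  then have "emeasure (angle_cube I) (space (angle_cube I)) = (\<Prod>i\<in>I. emeasure angle_interval UNIV)"
    by (simp only:) (rule A.emeasure_PiM[OF I], simp)
  also have "\<dots> < \<infinity>"
  proof -
    have "emeasure angle_interval UNIV = ennreal pi"
      unfolding angle_interval_def by (subst emeasure_density) auto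
    then show ?thesis by (simp add: ennreal_power)
  qed
  finally show "emeasure (angle_cube I) (space (angle_cube I)) \<noteq> \<infinity>" by simp
qed

lemma AE_angle_cube:
  assumes I: "finite I"
  shows "AE \<beta> in angle_cube I. \<forall>i\<in>I. 0 < \<beta> i \<and> \<beta> i < pi"
proof -
  have D [measurable]: "(\<Pi>\<^sub>E k\<in>I. {0<..<pi}) \<in> sets (Pi\<^sub>M I (\<lambda>_. lborel))"
    by (rule sets_PiM_I_finite[OF I]) auto
  show ?thesis unfolding density_angle_cube[OF I, symmetric]
    by (subst AE_density) (auto simp: indicator_def PiE_iff)
qed

section \<open>The diagonals as functions of the angles\<close>

lemma diag_last: "p - 2 \<le> k \<Longrightarrow> diag p \<rho> \<beta> k = \<rho> p"
  by (subst diag.simps) simp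

lemma diag_step: "k < p - 2 \<Longrightarrow> diag p \<rho> \<beta> k = tri_side (\<rho> (k + 2)) (diag p \<rho> \<beta> (k + 1)) (\<beta> k)"
  by (subst diag.simps) (simp add: tri_side_def)

text \<open>The diagonal \<open>k\<close> sees only the angles from index \<open>k\<close> on. Hence
  the angle of lowest index can be integrated while the later diagonals are held fixed.\<close>

lemma diag_cong:
  assumes "\<And>i. k \<le> i \<Longrightarrow> i \<le> p - 3 \<Longrightarrow> \<beta> i = \<beta>' i"
  shows "diag p \<rho> \<beta> k = diag p \<rho> \<beta>' k"
  using assms
proof (induction "p - 2 - k" arbitrary: k)
  case 0
  then show ?case by (simp add: diag_last)
next
  case (Suc m)
  then have k: "k < p - 2" by simp
  have "diag p \<rho> \<beta> (k + 1) = diag p \<rho> \<beta>' (k + 1)"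
    by (rule Suc.hyps(1)) (use Suc in auto)
  moreover have "\<beta> k = \<beta>' k" using Suc.prems[of k] k by simp
  ultimately show ?case by (simp add: diag_step[OF k])
qed

lemma diag_pos:
  assumes "\<And>i. i \<in> {1..p} \<Longrightarrow> 0 < \<rho> i" "4 \<le> p" "\<And>i. i \<in> {k..p - 3} \<Longrightarrow> 0 < \<beta> i \<and> \<beta> i < pi"
  shows "0 < diag p \<rho> \<beta> k"
  using assms(3)
proof (induction "p - 2 - k" arbitrary: k)
  case 0
  then show ?case using assms(1)[of p] assms(2) by (simp add: diag_last)
next
  case (Suc m)
  then have k: "k < p - 2" by simp
  have "0 < diag p \<rho> \<beta> (k + 1)" by (rule Suc.hyps(1)) (use Suc in auto)
  moreover have "0 < \<beta> k \<and> \<beta> k < pi" by (rule Suc.prems) (use k in auto)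
  ultimately show ?case using assms(1)[of "k + 2"] k by (simp add: diag_step[OF k] tri_side_pos)
qed

lemma measurable_angle_component:
  "i \<in> I \<Longrightarrow> (\<lambda>\<beta>. \<beta> i) \<in> borel_measurable (angle_cube I)"
  using measurable_component_singleton[of i I "\<lambda>_. angle_interval"] by (simp cong: measurable_cong_sets)

lemma borel_measurable_diag:
  assumes "{k..p - 3} \<subseteq> I"
  shows "(\<lambda>\<beta>. diag p \<rho> \<beta> k) \<in> borel_measurable (angle_cube I)"
  using assms
proof (induction "p - 2 - k" arbitrary: k)
  case 0
  then show ?case by (simp add: diag_last)
next
  case (Suc m)
  then have k: "k < p - 2" by simp
  have [measurable]: "(\<lambda>\<beta>. diag p \<rho> \<beta> (k + 1)) \<in> borel_measurable (angle_cube I)"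
    by (rule Suc.hyps(1)) (use Suc in auto)
  have [measurable]: "(\<lambda>\<beta>. \<beta> k) \<in> borel_measurable (angle_cube I)"
    by (rule measurable_angle_component) (use Suc.prems k in auto)
  show ?case unfolding diag_step[OF k] by measurable
qed

text \<open>The cosines that belong to the triangles between the diagonal \<open>j\<close> and the
  last side: the full product of the integrand for \<open>j = 1\<close>, the empty one for
  \<open>j = p - 2\<close>.\<close>

definition angle_factor :: "nat \<Rightarrow> (nat \<Rightarrow> int) \<Rightarrow> (nat \<Rightarrow> real) \<Rightarrow> nat \<Rightarrow> (nat \<Rightarrow> real) \<Rightarrow> real" where
  "angle_factor p l \<rho> j \<beta> =
     (\<Prod>k=j + 1..p - 2. cos (tri_angle (\<rho> (k + 1)) (diag p \<rho> \<beta> (k - 1)) (diag p \<rho> \<beta> k) * of_int (\<Sum>i=1..k. l i)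
        - of_int (l (k + 1)) * \<beta> (k - 1)))"

lemma borel_measurable_angle_factor:
  assumes "{j..p - 3} \<subseteq> I"
  shows "angle_factor p l \<rho> j \<in> borel_measurable (angle_cube I)"
proof -
  have m: "(\<lambda>\<beta>. diag p \<rho> \<beta> k) \<in> borel_measurable (angle_cube I)" if "j \<le> k" for k
    by (rule borel_measurable_diag) (use that assms in auto)
  have "(\<lambda>\<beta>. cos (tri_angle (\<rho> (k + 1)) (diag p \<rho> \<beta> (k - 1)) (diag p \<rho> \<beta> k) * of_int (\<Sum>i=1..k. l i)
        - of_int (l (k + 1)) * \<beta> (k - 1))) \<in> borel_measurable (angle_cube I)" if k: "k \<in> {j + 1..p - 2}" for k
  proof -
    have [measurable]: "(\<lambda>\<beta>. diag p \<rho> \<beta> k) \<in> borel_measurable (angle_cube I)"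
      "(\<lambda>\<beta>. diag p \<rho> \<beta> (k - 1)) \<in> borel_measurable (angle_cube I)"
      using k by (auto intro!: m)
    have [measurable]: "(\<lambda>\<beta>. \<beta> (k - 1)) \<in> borel_measurable (angle_cube I)"
    proof (rule measurable_angle_component)
      have "k - 1 \<in> {j..p - 3}" using k by auto
      then show "k - 1 \<in> I" using assms by blast
    qed
    show ?thesis by measurable
  qed
  then show ?thesis unfolding angle_factor_def[abs_def] by (rule borel_measurable_prod)
qed

lemma abs_angle_factor_le_1: "\<bar>angle_factor p l \<rho> j \<beta>\<bar> \<le> 1"
  unfolding angle_factor_def abs_prod by (rule prod_le_1) auto

lemma angle_factor_Suc:
  assumes "j \<le> p - 3" "4 \<le> p"
  shows "angle_factor p l \<rho> j \<beta> =
    cos (of_int (\<Sum>i=1..j + 1. l i) * tri_angle (\<rho> (j + 2)) (diag p \<rho> \<beta> (j + 1)) (diag p \<rho> \<beta> j) - of_int (l (j + 2)) * \<beta> j)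
      * angle_factor p l \<rho> (j + 1) \<beta>"
proof -
  have "{j + 1..p - 2} = insert (j + 1) {j + 1 + 1..p - 2}" using assms by auto
  then have "angle_factor p l \<rho> j \<beta> =
    cos (tri_angle (\<rho> (j + 1 + 1)) (diag p \<rho> \<beta> (j + 1 - 1)) (diag p \<rho> \<beta> (j + 1)) * of_int (\<Sum>i=1..j + 1. l i) - of_int (l (j + 1 + 1)) * \<beta> (j + 1 - 1))
      * angle_factor p l \<rho> (j + 1) \<beta>"
    unfolding angle_factor_def by (simp only:) (rule prod.insert, auto)
  then show ?thesis
    by (simp add: mult.commute tri_angle_commute[of _ "diag p \<rho> \<beta> j"] numeral_2_eq_2)
qed

lemma angle_factor_cong:
  assumes "\<And>i. j \<le> i \<Longrightarrow> i \<le> p - 3 \<Longrightarrow> \<beta> i = \<beta>' i"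
  shows "angle_factor p l \<rho> j \<beta> = angle_factor p l \<rho> j \<beta>'"
  unfolding angle_factor_def
proof (rule prod.cong[OF refl])
  fix k assume k: "k \<in> {j + 1..p - 2}"
  have "diag p \<rho> \<beta> k = diag p \<rho> \<beta>' k" "diag p \<rho> \<beta> (k - 1) = diag p \<rho> \<beta>' (k - 1)"
    by (rule diag_cong; use k assms in auto)+
  moreover have "\<beta> (k - 1) = \<beta>' (k - 1)" by (rule assms) (use k in auto)
  ultimately show "cos (tri_angle (\<rho> (k + 1)) (diag p \<rho> \<beta> (k - 1)) (diag p \<rho> \<beta> k) * of_int (\<Sum>i=1..k. l i) - of_int (l (k + 1)) * \<beta> (k - 1)) =
    cos (tri_angle (\<rho> (k + 1)) (diag p \<rho> \<beta>' (k - 1)) (diag p \<rho> \<beta>' k) * of_int (\<Sum>i=1..k. l i) - of_int (l (k + 1)) * \<beta>' (k - 1))"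
    by (simp only:)
qed

text \<open>Integration over \<open>\<beta> j\<close> alone splits the Bessel function of the
  diagonal \<open>j\<close> into the factor of the side \<open>j + 2\<close> and the Bessel function
  of the diagonal \<open>j + 1\<close>, by \<open>bessel_J_mult_integral'\<close> with
  \<open>L\<close> the sum of the first \<open>j + 1\<close> orders and
  \<open>m = l (j + 2)\<close>. Each angle contributes one factor \<pi>.\<close>

lemma angle_cube_bessel_J:
  assumes \<rho>: "\<And>i. i \<in> {1..p} \<Longrightarrow> 0 < \<rho> i" and p: "4 \<le> p" and j: "j \<le> p - 2"
  shows "(LINT \<beta>|angle_cube {j..p - 3}. bessel_J (\<Sum>i=1..j + 1. l i) (diag p \<rho> \<beta> j * x) * angle_factor p l \<rho> j \<beta>) =
    pi ^ (p - 2 - j) * (bessel_J (\<Sum>i=1..p - 1. l i) (\<rho> p * x) * (\<Prod>k=j + 2..p - 1. bessel_J (l k) (\<rho> k * x)))"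
  using j
proof (induction "p - 2 - j" arbitrary: j)
  case 0
  then have j: "j = p - 2" by simp
  \<comment> \<open>The cube over the empty index set is a single point of mass 1.\<close>
  have e: "{j..p - 3} = {}" "{j + 2..p - 1} = {}" "j + 1 = p - 1" using j p by auto
  have f: "angle_factor p l \<rho> j \<beta> = 1" for \<beta> using j by (simp add: angle_factor_def)
  show ?case unfolding f e using j by (simp add: PiM_empty diag_last lebesgue_integral_count_space_finite)
next
  case (Suc m)
  interpret A: product_sigma_finite "\<lambda>_::nat. angle_interval" by (rule product_sigma_finite_angle)
  have j: "j < p - 2" using Suc by simp
  then have jp: "j \<le> p - 3" by simp
  let ?f = "\<lambda>\<beta>. bessel_J (\<Sum>i=1..j + 1. l i) (diag p \<rho> \<beta> j * x) * angle_factor p l \<rho> j \<beta>"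
  let ?a = "\<rho> (j + 2)" and ?b = "\<lambda>\<beta>. diag p \<rho> \<beta> (j + 1)"
  let ?L = "\<Sum>i=1..j + 1. l i"
  have a: "0 < ?a" by (rule \<rho>) (use j p in auto)
  have ins: "{j..p - 3} = insert j {j + 1..p - 3}" using jp by auto
  interpret F: finite_measure "angle_cube {j..p - 3}" by (rule finite_measure_angle_cube) simp
  have int: "integrable (angle_cube {j..p - 3}) ?f"
  proof (rule F.integrable_const_bound[of _ 1])
    show "AE \<beta> in angle_cube {j..p - 3}. norm (?f \<beta>) \<le> 1"
      using abs_bessel_mult_le[OF abs_bessel_J_le_1 abs_angle_factor_le_1] by simp
    have [measurable]: "(\<lambda>\<beta>. diag p \<rho> \<beta> j) \<in> borel_measurable (angle_cube {j..p - 3})"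
      "angle_factor p l \<rho> j \<in> borel_measurable (angle_cube {j..p - 3})"
      by (auto intro: borel_measurable_diag borel_measurable_angle_factor)
    show "?f \<in> borel_measurable (angle_cube {j..p - 3})" by measurable
  qed
  have "(LINT \<beta>|angle_cube {j..p - 3}. ?f \<beta>) = (LINT \<beta>|angle_cube {j + 1..p - 3}. LINT y|angle_interval. ?f (\<beta>(j := y)))"
    unfolding ins by (rule A.product_integral_insert) (use int ins in auto)
  also have "\<dots> = (LINT \<beta>|angle_cube {j + 1..p - 3}. pi * bessel_J (l (j + 2)) (?a * x) *
      (bessel_J (\<Sum>i=1..(j + 1) + 1. l i) (diag p \<rho> \<beta> (j + 1) * x) * angle_factor p l \<rho> (j + 1) \<beta>))"
  proof (rule integral_cong_AE)
    have m [measurable]: "?b \<in> borel_measurable (angle_cube {j + 1..p - 3})"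
      "angle_factor p l \<rho> (j + 1) \<in> borel_measurable (angle_cube {j + 1..p - 3})"
      by (auto intro: borel_measurable_diag borel_measurable_angle_factor)
    show "(\<lambda>\<beta>. pi * bessel_J (l (j + 2)) (?a * x) *
      (bessel_J (\<Sum>i=1..(j + 1) + 1. l i) (diag p \<rho> \<beta> (j + 1) * x) * angle_factor p l \<rho> (j + 1) \<beta>)) \<in> borel_measurable (angle_cube {j + 1..p - 3})"
      by measurable
    have eq: "?f (\<beta>(j := y)) = (bessel_J ?L (tri_side ?a (?b \<beta>) y * x) * cos (of_int ?L * tri_angle ?a (?b \<beta>) (tri_side ?a (?b \<beta>) y) - of_int (l (j + 2)) * y))
         * angle_factor p l \<rho> (j + 1) \<beta>" for \<beta> y
    proof -
      have b: "diag p \<rho> (\<beta>(j := y)) (j + 1) = ?b \<beta>" by (rule diag_cong) auto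
      have f: "angle_factor p l \<rho> (j + 1) (\<beta>(j := y)) = angle_factor p l \<rho> (j + 1) \<beta>" by (rule angle_factor_cong) auto
      show ?thesis unfolding angle_factor_Suc[OF jp p] f b diag_step[OF j] by (simp add: mult.assoc)
    qed
    show "(\<lambda>\<beta>. LINT y|angle_interval. ?f (\<beta>(j := y))) \<in> borel_measurable (angle_cube {j + 1..p - 3})"
    proof -
      interpret sigma_finite_measure angle_interval
        using finite_measure_angle_interval by (simp add: finite_measure_def)
      show ?thesis unfolding eq by measurable
    qed
    show "AE \<beta> in angle_cube {j + 1..p - 3}. (LINT y|angle_interval. ?f (\<beta>(j := y))) = pi * bessel_J (l (j + 2)) (?a * x) *
      (bessel_J (\<Sum>i=1..(j + 1) + 1. l i) (diag p \<rho> \<beta> (j + 1) * x) * angle_factor p l \<rho> (j + 1) \<beta>)"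
      using AE_angle_cube[of "{j + 1..p - 3}", simplified]
    proof eventually_elim
      case (elim \<beta>)
      have b: "0 < ?b \<beta>" by (rule diag_pos[OF \<rho> p]) (use elim in auto)
      have "(LINT y|angle_interval. ?f (\<beta>(j := y))) =
        (LINT y|angle_interval. bessel_J ?L (tri_side ?a (?b \<beta>) y * x) * cos (of_int ?L * tri_angle ?a (?b \<beta>) (tri_side ?a (?b \<beta>) y) - of_int (l (j + 2)) * y))
           * angle_factor p l \<rho> (j + 1) \<beta>"
        unfolding eq by (rule integral_mult_left_zero)
      also have "(LINT y|angle_interval. bessel_J ?L (tri_side ?a (?b \<beta>) y * x) * cos (of_int ?L * tri_angle ?a (?b \<beta>) (tri_side ?a (?b \<beta>) y) - of_int (l (j + 2)) * y)) =
         pi * (bessel_J (l (j + 2)) (?a * x) * bessel_J (?L + l (j + 2)) (?b \<beta> * x))"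
      proof (rule angle_interval_integral[OF _ _ bessel_J_mult_integral'[OF a b]])
        show "\<bar>bessel_J ?L (tri_side ?a (?b \<beta>) y * x) * cos (of_int ?L * tri_angle ?a (?b \<beta>) (tri_side ?a (?b \<beta>) y) - of_int (l (j + 2)) * y)\<bar> \<le> 1" for y
          by (intro abs_bessel_mult_le abs_bessel_J_le_1) simp
      qed measurable
      also have "?L + l (j + 2) = (\<Sum>i=1..(j + 1) + 1. l i)" by simp
      finally show ?case by (simp only: mult_ac)
    qed
  qed
  also have "\<dots> = pi * bessel_J (l (j + 2)) (?a * x) * (LINT \<beta>|angle_cube {j + 1..p - 3}.
      bessel_J (\<Sum>i=1..(j + 1) + 1. l i) (diag p \<rho> \<beta> (j + 1) * x) * angle_factor p l \<rho> (j + 1) \<beta>)"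
    by (rule integral_mult_right_zero)
  also have "\<dots> = pi * bessel_J (l (j + 2)) (?a * x) * (pi ^ (p - 2 - (j + 1)) * (bessel_J (\<Sum>i=1..p - 1. l i) (\<rho> p * x) * (\<Prod>k=j + 1 + 2..p - 1. bessel_J (l k) (\<rho> k * x))))"
    by (subst Suc.hyps(1)) (use Suc j in auto)
  also have "\<dots> = pi ^ (p - 2 - j) * (bessel_J (\<Sum>i=1..p - 1. l i) (\<rho> p * x) * (\<Prod>k=j + 2..p - 1. bessel_J (l k) (\<rho> k * x)))"
  proof -
    have "p - 2 - j = Suc (p - 2 - (j + 1))" using j by simp
    moreover have "{j + 2..p - 1} = insert (j + 2) {j + 1 + 2..p - 1}" using j by auto
    ultimately show ?thesis by simp
  qed
  finally show ?case .
qed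

section \<open>Gaussian means of three Bessel functions\<close>

definition triple_mean :: "int \<Rightarrow> int \<Rightarrow> real \<Rightarrow> real \<Rightarrow> real \<Rightarrow> real \<Rightarrow> real" where
  "triple_mean m n a b \<epsilon> s = (LINT x|gauss_measure \<epsilon>. bessel_J m (a * x) * bessel_J n (b * x) * bessel_J (m + n) (s * x))"

text \<open>The first factor of the integrand as a function of the diagonal \<open>s\<close> alone;
  it is \<pi> times the limit of \<open>triple_mean\<close>. The denominator is twice the area of
  the triangle.\<close>

definition tri_density :: "int \<Rightarrow> int \<Rightarrow> real \<Rightarrow> real \<Rightarrow> real \<Rightarrow> real" where
  "tri_density m n a b s =
     (if is_triangle a b s then cos (of_int m * tri_angle b a s - of_int n * tri_angle a b s) / (b * s * sin (tri_angle a b s)) else 0)"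

lemma is_triangle_iff:
  assumes "0 < a" "0 < b"
  shows "is_triangle a b s \<longleftrightarrow> \<bar>a - b\<bar> < s \<and> s < a + b"
  using assms by (auto simp: is_triangle_def)

lemma borel_measurable_tri_density [measurable]: "tri_density m n a b \<in> borel_measurable borel"
  unfolding tri_density_def[abs_def] is_triangle_def by measurable

text \<open>Heron's formula: both expressions are twice the area.\<close>

lemma tri_density_sides:
  assumes ab: "0 < a" "0 < b" and s: "is_triangle a b s"
  shows "b * s * sin (tri_angle a b s) = sqrt (((a + b)\<^sup>2 - s\<^sup>2) * (s\<^sup>2 - (a - b)\<^sup>2)) / 2"
    and "0 < b * s * sin (tri_angle a b s)"
proof -
  have s': "0 < s" "\<bar>a - b\<bar> < s" "s < a + b" using s ab by (auto simp: is_triangle_iff)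
  let ?q = "(b\<^sup>2 + s\<^sup>2 - a\<^sup>2) / (2 * b * s)"
  let ?P = "((a + b)\<^sup>2 - s\<^sup>2) * (s\<^sup>2 - (a - b)\<^sup>2)"
  have "(a - b)\<^sup>2 < s\<^sup>2" "s\<^sup>2 < (a + b)\<^sup>2"
    using s' power_strict_mono[of "\<bar>a - b\<bar>" s 2] power_strict_mono[of s "a + b" 2] by auto
  then have P: "0 < ?P" by simp
  have e: "1 - ?q\<^sup>2 = ?P / (2 * b * s)\<^sup>2"
  proof -
    have "1 - (x / y)\<^sup>2 = (y\<^sup>2 - x\<^sup>2) / y\<^sup>2" if "y \<noteq> 0" for x y :: real
      using that by (simp add: power_divide diff_divide_distrib)
    then have "1 - ?q\<^sup>2 = ((2 * b * s)\<^sup>2 - (b\<^sup>2 + s\<^sup>2 - a\<^sup>2)\<^sup>2) / (2 * b * s)\<^sup>2"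
      using ab s' by simp
    also have "(2 * b * s)\<^sup>2 - (b\<^sup>2 + s\<^sup>2 - a\<^sup>2)\<^sup>2 = ?P"
      by (simp add: power2_eq_square algebra_simps)
    finally show ?thesis .
  qed
  have "0 < ?P / (2 * b * s)\<^sup>2" using P ab s' by simp
  then have "?q\<^sup>2 < 1" using e by linarith
  then have "\<bar>?q\<bar> < 1" by (simp only: abs_square_less_1)
  then have q: "-1 \<le> ?q" "?q \<le> 1" by linarith+
  have "sin (tri_angle a b s) = sqrt (1 - ?q\<^sup>2)" unfolding tri_angle_def by (rule sin_arccos[OF q])
  also have "\<dots> = sqrt ?P / (2 * b * s)"
    unfolding e using ab s' by (simp add: real_sqrt_divide)
  finally have "sin (tri_angle a b s) = sqrt ?P / (2 * b * s)" .
  then show 1: "b * s * sin (tri_angle a b s) = sqrt ?P / 2" using ab s' by simp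
  show "0 < b * s * sin (tri_angle a b s)" unfolding 1 using P by simp
qed

lemma tri_density_0: "0 < a \<Longrightarrow> 0 < b \<Longrightarrow> is_triangle a b s \<Longrightarrow> tri_density 0 0 a b s = 2 / sqrt (((a + b)\<^sup>2 - s\<^sup>2) * (s\<^sup>2 - (a - b)\<^sup>2))"
  by (simp add: tri_density_def tri_density_sides(1))

lemma tri_density_0_nonneg: "0 < a \<Longrightarrow> 0 < b \<Longrightarrow> 0 \<le> tri_density 0 0 a b s"
  using tri_density_sides(2)[of a b s] by (auto simp: tri_density_def)

text \<open>Heron's product has a factor \<open>\<bar>s - q\<bar>\<close> for each degenerate length
  \<open>q\<close>, and the remaining factors are at most a multiple of \<open>s\<close>. Thus
  finiteness of an integral of the order 0 density passes to the singular majorants.\<close>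

lemma isq_le_tri_density:
  assumes ab: "0 < a" "0 < b" and s: "\<bar>a - b\<bar> < s" "s < a + b"
  shows "isq s * isq (s - (a + b)) \<le> (a + b) * tri_density 0 0 a b s"
    and "isq s * isq (s - \<bar>a - b\<bar>) \<le> (a + b) * tri_density 0 0 a b s"
proof -
  let ?c1 = "a + b" and ?c2 = "\<bar>a - b\<bar>"
  let ?P = "((a + b)\<^sup>2 - s\<^sup>2) * (s\<^sup>2 - (a - b)\<^sup>2)"
  have c1: "0 < ?c1" and s0: "0 < s" using ab s by auto
  have tri: "is_triangle a b s" using ab s by (simp add: is_triangle_iff)
  have c2: "(a - b)\<^sup>2 = ?c2\<^sup>2" by simp
  have sqd: "q\<^sup>2 - q'\<^sup>2 = (q - q') * (q + q')" for q q' :: real by (simp add: power2_eq_square algebra_simps)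
  have "?P = (?c1 - s) * (?c1 + s) * ((s - ?c2) * (s + ?c2))" unfolding c2 sqd ..
  also have "\<dots> > 0" using s s0 c1 by (intro mult_pos_pos) auto
  finally have P0: "0 < ?P" .
  \<comment> \<open>The constant is rounded up: \<open>sqrt 2\<close> is replaced by 2 to match the
    numerator of \<open>tri_density_0\<close>.\<close>
  have key: "isq s * isq (s - q) \<le> ?c1 * tri_density 0 0 a b s"
    if q: "s \<noteq> q" and le: "?P \<le> ?c1\<^sup>2 * (2 * (s * \<bar>s - q\<bar>))" for q
  proof -
    have "sqrt ?P \<le> sqrt (?c1\<^sup>2 * (2 * (s * \<bar>s - q\<bar>)))" using le by simp
    also have "\<dots> = ?c1 * (sqrt 2 * (sqrt s * sqrt \<bar>s - q\<bar>))" using c1 by (simp add: real_sqrt_mult)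
    also have "\<dots> \<le> ?c1 * (2 * (sqrt s * sqrt \<bar>s - q\<bar>))"
      using c1 s0 sqrt2_less_2 by (intro mult_left_mono mult_right_mono) auto
    finally have le2: "sqrt ?P \<le> ?c1 * (2 * (sqrt s * sqrt \<bar>s - q\<bar>))" .
    have pos: "0 < sqrt s * sqrt \<bar>s - q\<bar>" using s0 q by simp
    have scale: "1 / Y = x * 2 / (x * (2 * Y))" if "0 < x" for x Y :: real using that by simp
    have "isq s * isq (s - q) = 1 / (sqrt s * sqrt \<bar>s - q\<bar>)" using s0 by (simp add: isq_def)
    also have "\<dots> = ?c1 * 2 / (?c1 * (2 * (sqrt s * sqrt \<bar>s - q\<bar>)))" by (rule scale[OF c1])
    also have "\<dots> \<le> ?c1 * 2 / sqrt ?P"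
      by (rule divide_left_mono[OF le2]) (use c1 P0 pos in \<open>auto intro!: mult_pos_pos\<close>)
    also have "\<dots> = ?c1 * tri_density 0 0 a b s" unfolding tri_density_0[OF ab tri] by simp
    finally show ?thesis .
  qed
  show "isq s * isq (s - ?c1) \<le> ?c1 * tri_density 0 0 a b s"
  proof (rule key)
    have "?P = (?c1 - s) * ((?c1 + s) * ((s - ?c2) * (s + ?c2)))" unfolding c2 sqd by (simp only: mult.assoc)
    also have "\<dots> \<le> (?c1 - s) * ((2 * ?c1) * (s * ?c1))"
    proof (rule mult_left_mono, rule mult_mono)
      have "(s - ?c2) * (s + ?c2) = s * s - ?c2\<^sup>2" by (simp add: sqd[symmetric] power2_eq_square[of s])
      also have "\<dots> \<le> s * s" by simp
      also have "\<dots> \<le> s * ?c1" using s s0 by (intro mult_left_mono) auto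
      finally show "(s - ?c2) * (s + ?c2) \<le> s * ?c1" .
    qed (use s s0 c1 in \<open>auto intro!: mult_nonneg_nonneg\<close>)
    also have "\<dots> = ?c1\<^sup>2 * (2 * (s * (?c1 - s)))" by (simp only: power2_eq_square mult_ac)
    also have "?c1 - s = \<bar>s - ?c1\<bar>" using s by simp
    finally show "?P \<le> ?c1\<^sup>2 * (2 * (s * \<bar>s - ?c1\<bar>))" .
  qed (use s in simp)
  show "isq s * isq (s - ?c2) \<le> ?c1 * tri_density 0 0 a b s"
  proof (rule key)
    have "?P = (?c1\<^sup>2 - s\<^sup>2) * ((s + ?c2) * (s - ?c2))" unfolding c2 sqd by (simp only: mult_ac)
    also have "\<dots> \<le> ?c1\<^sup>2 * ((2 * s) * (s - ?c2))"
      using s s0 c1 by (intro mult_mono) auto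
    also have "\<dots> = ?c1\<^sup>2 * (2 * (s * (s - ?c2)))" by (simp only: mult_ac)
    also have "s - ?c2 = \<bar>s - ?c2\<bar>" using s by simp
    finally show "?P \<le> ?c1\<^sup>2 * (2 * (s * \<bar>s - ?c2\<bar>))" by simp
  qed (use s in auto)
qed

lemma triple_mean_eq:
  assumes "0 < \<epsilon>" "0 < a" "0 < b"
  shows "triple_mean m n a b \<epsilon> s =
    (LINT t|angle_interval. cos (of_int m * tri_angle b a (tri_side a b t) - of_int n * tri_angle a b (tri_side a b t))
        * heat_kernel (m + n) \<epsilon> (tri_side a b t) s) / pi"
  unfolding triple_mean_def by (rule gauss_bessel_J_triple[OF assms])

lemma obtain_tri_side:
  assumes ab: "0 < a" "0 < b" and s: "\<bar>a - b\<bar> < s" "s < a + b"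
  obtains t where "0 < t" "t < pi" "tri_side a b t = s"
proof
  let ?q = "(a\<^sup>2 + b\<^sup>2 - s\<^sup>2) / (2 * a * b)"
  have "0 \<le> s" using s by auto
  then have "(a - b)\<^sup>2 < s\<^sup>2" "s\<^sup>2 < (a + b)\<^sup>2"
    using s power_strict_mono[of "\<bar>a - b\<bar>" s 2] power_strict_mono[of s "a + b" 2] by auto
  then have "a\<^sup>2 + b\<^sup>2 - s\<^sup>2 < 2 * a * b" "- (2 * a * b) < a\<^sup>2 + b\<^sup>2 - s\<^sup>2"
    by (auto simp: power2_eq_square algebra_simps)
  then have q: "-1 < ?q" "?q < 1" using ab by (auto simp: pos_less_divide_eq pos_divide_less_eq)
  show "0 < arccos ?q" "arccos ?q < pi" using arccos_lt_bounded[OF q] by auto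
  have "cos (arccos ?q) = ?q" using q by (intro cos_arccos) auto
  then have "(tri_side a b (arccos ?q))\<^sup>2 = s\<^sup>2" unfolding tri_side_sq using ab by simp
  then show "tri_side a b (arccos ?q) = s" by (rule power2_eq_imp_eq[OF _ tri_side_nonneg \<open>0 \<le> s\<close>])
qed

lemma isCont_tri_angle_tri_side:
  assumes ab: "0 < a" "0 < b" and t: "0 < t" "t < pi"
  shows "isCont (\<lambda>t. tri_angle a b (tri_side a b t)) t"
proof -
  let ?s = "tri_side a b t"
  let ?q = "\<lambda>t. (b\<^sup>2 + (tri_side a b t)\<^sup>2 - a\<^sup>2) / (2 * b * tri_side a b t)"
  have s: "0 < ?s" using tri_side_pos[OF ab t] .
  have k: "isCont (tri_side a b) t" by (rule DERIV_isCont[OF tri_side_has_derivative[OF ab t]])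
  have q: "isCont ?q t" using s ab by (intro continuous_intros k) auto
  have eq: "?q t = (b - a * cos t) / ?s"
    unfolding tri_side_sq using s ab by (simp add: field_simps power2_eq_square)
  have "(?s)\<^sup>2 - (b - a * cos t)\<^sup>2 = (a * sin t)\<^sup>2"
    unfolding tri_side_sq using sin_cos_squared_add[of t] by algebra
  moreover have "0 < (a * sin t)\<^sup>2" using ab t sin_gt_zero by fastforce
  ultimately have "(b - a * cos t)\<^sup>2 < ?s\<^sup>2" by linarith
  then have "(?q t)\<^sup>2 < 1" unfolding eq using s by (simp add: power_divide)
  then have "\<bar>?q t\<bar> < 1" by (simp only: abs_square_less_1)
  then have "-1 < ?q t" "?q t < 1" by linarith+
  then have "isCont arccos (?q t)" by (intro isCont_arccos)
  then have "isCont (\<lambda>t. arccos (?q t)) t" by (rule isCont_o2[OF q])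
  then show ?thesis by (simp only: tri_angle_def)
qed

text \<open>Concentration if \<open>s\<close> closes a triangle with \<open>a\<close> and
  \<open>b\<close>, rapid decay otherwise. The two degenerate values of \<open>s\<close>, where
  neither argument applies, are avoided by almost every diagonal
  (\<open>AE_diag_neq\<close>).\<close>

lemma triple_mean_tendsto:
  assumes ab: "0 < a" "0 < b" and s: "0 < s" "s \<noteq> a + b" "s \<noteq> \<bar>a - b\<bar>"
    and d: "d \<longlonglongrightarrow> 0" "\<And>i. 0 < d i"
  shows "(\<lambda>i. triple_mean m n a b ((d i)\<^sup>2) s) \<longlonglongrightarrow> tri_density m n a b s / pi"
proof -
  let ?k = "tri_side a b"
  let ?c = "\<lambda>t. cos (of_int m * tri_angle b a (?k t) - of_int n * tri_angle a b (?k t))"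
  have e: "triple_mean m n a b ((d i)\<^sup>2) s = (LINT t|angle_interval. ?c t * heat_kernel (m + n) ((d i)\<^sup>2) (?k t) s) / pi" for i
    by (rule triple_mean_eq) (use ab d(2)[of i] in auto)
  have "(\<lambda>i. LINT t|angle_interval. ?c t * heat_kernel (m + n) ((d i)\<^sup>2) (?k t) s) \<longlonglongrightarrow> tri_density m n a b s"
  proof (cases "is_triangle a b s")
    case True
    then have "\<bar>a - b\<bar> < s" "s < a + b" using ab by (auto simp: is_triangle_iff)
    then obtain t where t: "0 < t" "t < pi" "?k t = s" by (rule obtain_tri_side[OF ab])
    have "isCont (\<lambda>t. tri_angle b a (?k t)) t"
      using isCont_tri_angle_tri_side[OF ab(2,1) t(1,2)] by (simp only: tri_side_commute[of b a])
    then have c: "isCont ?c t" by (intro continuous_intros isCont_tri_angle_tri_side ab t)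
    have "(\<lambda>i. LINT t|angle_interval. ?c t * heat_kernel (m + n) ((d i)\<^sup>2) (?k t) (?k t')) \<longlonglongrightarrow> ?c t' / (a * b * sin t')" if "t' = t" for t'
      using that t by (intro heat_kernel_concentrates ab d c) (auto simp: c)
    from this[OF refl] have "(\<lambda>i. LINT t|angle_interval. ?c t * heat_kernel (m + n) ((d i)\<^sup>2) (?k t) s) \<longlonglongrightarrow> ?c t / (a * b * sin t)"
      by (simp only: t(3))
    \<comment> \<open>Twice the area, from two different angles.\<close>
    moreover have E: "b * s * sin (tri_angle a b s) = a * b * sin t"
      using cos_tri_angle(2)[OF ab t(1,2)] by (simp add: t(3) mult.assoc mult.left_commute)
    ultimately show ?thesis using True by (simp only: tri_density_def if_True t(3) E)
  next
    case False
    then have "s < \<bar>a - b\<bar> \<or> a + b < s" using ab s by (auto simp: is_triangle_iff)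
    then show ?thesis using False
      by (simp only: tri_density_def if_False) (intro heat_kernel_vanishes ab s(1) d; measurable?; simp)
  qed
  then show ?thesis unfolding e by (rule tendsto_divide[OF _ tendsto_const]) simp
qed

text \<open>The product of the three Bessel functions oscillates, but for order 0 its Gaussian mean
  is an average of the positive heat kernel. This sign is what allows Fatou's lemma.\<close>

lemma triple_mean_0_nonneg:
  assumes "0 < \<epsilon>" "0 < a" "0 < b" "0 < s"
  shows "0 \<le> triple_mean 0 0 a b \<epsilon> s"
proof -
  have "0 \<le> (LINT t|angle_interval. heat_kernel 0 \<epsilon> (tri_side a b t) s)"
  proof (rule integral_nonneg_AE)
    show "AE t in angle_interval. 0 \<le> heat_kernel 0 \<epsilon> (tri_side a b t) s"
      using AE_angle_interval
      by eventually_elim (use assms in \<open>auto intro!: heat_kernel_0_nonneg tri_side_pos\<close>)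
  qed
  then show ?thesis by (simp add: triple_mean_eq[OF assms(1-3)])
qed

lemma abs_triple_mean_le:
  assumes "0 < \<epsilon>"
  shows "\<bar>triple_mean m n a b \<epsilon> s\<bar> \<le> 1 / (2 * \<epsilon>)"
proof -
  interpret finite_measure "gauss_measure \<epsilon>" by (rule finite_measure_gauss[OF assms])
  let ?f = "\<lambda>x. bessel_J m (a * x) * bessel_J n (b * x) * bessel_J (m + n) (s * x)"
  have bd: "\<bar>?f x\<bar> \<le> 1" for x by (intro abs_bessel_mult_le abs_bessel_J_le_1)
  have "\<bar>triple_mean m n a b \<epsilon> s\<bar> \<le> (LINT x|gauss_measure \<epsilon>. 1)"
    unfolding triple_mean_def
  proof (rule integral_abs_bound_integral)
    show "integrable (gauss_measure \<epsilon>) ?f"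
      by (rule integrable_const_bound[of _ 1]) (simp only: real_norm_def bd eventually_True, measurable)
  qed (use bd in auto)
  also have "\<dots> = 1 / (2 * \<epsilon>)"
    using has_bochner_integral_integral_eq[OF gauss_moment[OF assms, of 0]] by simp
  finally show ?thesis .
qed

lemma borel_measurable_triple_mean:
  assumes "0 < \<epsilon>"
  shows "triple_mean m n a b \<epsilon> \<in> borel_measurable borel"
proof -
  interpret finite_measure "gauss_measure \<epsilon>" by (rule finite_measure_gauss[OF assms])
  show ?thesis unfolding triple_mean_def[abs_def] by measurable
qed

text \<open>Fubini for an integrand bounded by 1, and \<open>angle_cube_bessel_J\<close> inside. The
  lengths \<open>a\<close>, \<open>b\<close> are independent of the sides of the multilateral, so
  that auxiliary triangles can be put on the diagonal.\<close>

lemma gauss_angle_cube: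
  assumes \<rho>: "\<And>i. i \<in> {1..p} \<Longrightarrow> 0 < \<rho> i" and p: "4 \<le> p" and \<epsilon>: "0 < \<epsilon>"
    and mn: "m + n = (\<Sum>i=1..2. l i)"
  shows "(LINT \<beta>|angle_cube {1..p - 3}. triple_mean m n a b \<epsilon> (diag p \<rho> \<beta> 1) * angle_factor p l \<rho> 1 \<beta>) =
    pi ^ (p - 3) * (LINT x|gauss_measure \<epsilon>. bessel_J m (a * x) * bessel_J n (b * x) *
      (bessel_J (\<Sum>i=1..p - 1. l i) (\<rho> p * x) * (\<Prod>k=3..p - 1. bessel_J (l k) (\<rho> k * x))))"
proof -
  let ?J = "\<lambda>x. bessel_J m (a * x) * bessel_J n (b * x)"
  let ?k = "\<lambda>\<beta>. diag p \<rho> \<beta> 1"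
  let ?T = "angle_factor p l \<rho> 1"
  have [measurable]: "?k \<in> borel_measurable (angle_cube {1..p - 3})" by (rule borel_measurable_diag) simp
  have [measurable]: "?T \<in> borel_measurable (angle_cube {1..p - 3})" by (rule borel_measurable_angle_factor) simp
  have s: "(\<Sum>i=1..1 + 1. l i) = m + n" using mn by (simp add: numeral_2_eq_2)
  have in1: "(LINT \<beta>|angle_cube {1..p - 3}. bessel_J (m + n) (?k \<beta> * x) * ?T \<beta>) =
     pi ^ (p - 3) * (bessel_J (\<Sum>i=1..p - 1. l i) (\<rho> p * x) * (\<Prod>k=3..p - 1. bessel_J (l k) (\<rho> k * x)))" for x
    using angle_cube_bessel_J[of p \<rho> 1 l x, OF \<rho> p] p unfolding s by (simp add: numeral_3_eq_3)
  have "(LINT \<beta>|angle_cube {1..p - 3}. triple_mean m n a b \<epsilon> (?k \<beta>) * ?T \<beta>) =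
    (LINT \<beta>|angle_cube {1..p - 3}. LINT x|gauss_measure \<epsilon>. ?J x * bessel_J (m + n) (?k \<beta> * x) * ?T \<beta>)"
    unfolding triple_mean_def by (simp only: integral_mult_left_zero)
  also have "\<dots> = (LINT x|gauss_measure \<epsilon>. LINT \<beta>|angle_cube {1..p - 3}. ?J x * bessel_J (m + n) (?k \<beta> * x) * ?T \<beta>)"
  proof (rule Fubini_integral_bounded[of _ _ _ 1])
    show "finite_measure (angle_cube {1..p - 3})" by (rule finite_measure_angle_cube) simp
    show "finite_measure (gauss_measure \<epsilon>)" by (rule finite_measure_gauss[OF \<epsilon>])
    show "(\<lambda>(\<beta>, x). ?J x * bessel_J (m + n) (?k \<beta> * x) * ?T \<beta>) \<in> borel_measurable (angle_cube {1..p - 3} \<Otimes>\<^sub>M gauss_measure \<epsilon>)"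
      by measurable
    show "\<bar>?J x * bessel_J (m + n) (?k \<beta> * x) * ?T \<beta>\<bar> \<le> 1" for \<beta> x
      by (intro abs_bessel_mult_le abs_bessel_J_le_1 abs_angle_factor_le_1)
  qed
  also have "\<dots> = (LINT x|gauss_measure \<epsilon>. ?J x * (pi ^ (p - 3) * (bessel_J (\<Sum>i=1..p - 1. l i) (\<rho> p * x) * (\<Prod>k=3..p - 1. bessel_J (l k) (\<rho> k * x)))))"
    unfolding in1[symmetric] by (simp only: mult.assoc integral_mult_right_zero)
  also have "\<dots> = (LINT x|gauss_measure \<epsilon>. pi ^ (p - 3) * (?J x * (bessel_J (\<Sum>i=1..p - 1. l i) (\<rho> p * x) * (\<Prod>k=3..p - 1. bessel_J (l k) (\<rho> k * x)))))"
    by (simp only: mult_ac)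
  finally show ?thesis by (simp only: integral_mult_right_zero)
qed

section \<open>Integrability for at least five sides\<close>

lemma AE_angle_interval_neq: "AE t in angle_interval. t \<noteq> c"
  unfolding angle_interval_def using AE_lborel_singleton[of c]
  by (subst AE_density) (auto elim: eventually_mono)

lemma AE_tri_side_neq:
  assumes ab: "0 < a" "0 < b"
  shows "AE t in angle_interval. tri_side a b t \<noteq> c"
proof (cases "\<exists>t0. 0 < t0 \<and> t0 < pi \<and> tri_side a b t0 = c")
  case True
  then obtain t0 where t0: "0 < t0" "t0 < pi" "tri_side a b t0 = c" by blast
  show ?thesis using AE_angle_interval AE_angle_interval_neq[of t0]
  proof eventually_elim
    case (elim t)
    show ?case
    proof
      assume "tri_side a b t = c"
      then have "(tri_side a b t)\<^sup>2 = (tri_side a b t0)\<^sup>2" using t0 by simp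
      then have "cos t = cos t0" unfolding tri_side_sq using ab by simp
      then have "t = t0" by (rule cos_inj_pi[rotated 4]) (use elim t0 in auto)
      then show False using elim by simp
    qed
  qed
next
  case False
  show ?thesis using AE_angle_interval by eventually_elim (use False in blast)
qed

text \<open>With the other angles fixed, the diagonal is the third side of a triangle with enclosed
  angle \<open>\<beta> 1\<close>; it is injective in that angle and takes a given value at most
  once.\<close>

lemma AE_diag_neq:
  assumes \<rho>: "\<And>i. i \<in> {1..p} \<Longrightarrow> 0 < \<rho> i" and p: "4 \<le> p"
  shows "AE \<beta> in angle_cube {1..p - 3}. diag p \<rho> \<beta> 1 \<noteq> c"
proof -
  interpret A: product_sigma_finite "\<lambda>_::nat. angle_interval" by (rule product_sigma_finite_angle)
  have ins: "{1..p - 3} = insert 1 {2..p - 3}" using p by auto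
  let ?f = "\<lambda>\<beta>. if diag p \<rho> \<beta> 1 = c then 1 else (0::ennreal)"
  have [measurable]: "(\<lambda>\<beta>. diag p \<rho> \<beta> 1) \<in> borel_measurable (angle_cube {1..p - 3})"
    by (rule borel_measurable_diag) simp
  have m: "?f \<in> borel_measurable (angle_cube {1..p - 3})" by measurable
  have "(\<integral>\<^sup>+\<beta>. ?f \<beta> \<partial>angle_cube {1..p - 3}) = (\<integral>\<^sup>+\<beta>. \<integral>\<^sup>+y. ?f (\<beta>(1 := y)) \<partial>angle_interval \<partial>angle_cube {2..p - 3})"
    unfolding ins by (rule A.product_nn_integral_insert) (use m ins in auto)
  also have "\<dots> = (\<integral>\<^sup>+\<beta>. 0 \<partial>angle_cube {2..p - 3})"
  proof (rule nn_integral_cong_AE)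
    show "AE \<beta> in angle_cube {2..p - 3}. (\<integral>\<^sup>+y. ?f (\<beta>(1 := y)) \<partial>angle_interval) = 0"
      using AE_angle_cube[of "{2..p - 3}", simplified]
    proof eventually_elim
      case (elim \<beta>)
      have b: "0 < diag p \<rho> \<beta> 2" by (rule diag_pos[OF \<rho> p]) (use elim in auto)
      have a: "0 < \<rho> 3" by (rule \<rho>) (use p in auto)
      have e: "diag p \<rho> (\<beta>(1 := y)) 1 = tri_side (\<rho> 3) (diag p \<rho> \<beta> 2) y" for y
      proof -
        have "diag p \<rho> (\<beta>(1 := y)) 2 = diag p \<rho> \<beta> 2" by (rule diag_cong) auto
        then show ?thesis using p diag_step[of 1 p \<rho> "\<beta>(1 := y)"] by (simp add: numeral_2_eq_2 numeral_3_eq_3)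
      qed
      have "(\<integral>\<^sup>+y. ?f (\<beta>(1 := y)) \<partial>angle_interval) = (\<integral>\<^sup>+y. 0 \<partial>angle_interval)"
      proof (rule nn_integral_cong_AE)
        show "AE y in angle_interval. ?f (\<beta>(1 := y)) = 0"
          unfolding e using AE_tri_side_neq[OF a b, of c] by eventually_elim simp
      qed
      then show ?case by simp
    qed
  qed
  finally have "(\<integral>\<^sup>+\<beta>. ?f \<beta> \<partial>angle_cube {1..p - 3}) = 0" by simp
  then have "AE \<beta> in angle_cube {1..p - 3}. ?f \<beta> = 0" using nn_integral_0_iff_AE[OF m] by simp
  then show ?thesis by eventually_elim (simp split: if_splits)
qed

text \<open>Provides an auxiliary triangle whose sides \<open>a'\<close>, \<open>b'\<close> have a
  sum beyond all diagonals.\<close>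

lemma diag_bounded: obtains R where "\<And>\<beta>. \<bar>diag p \<rho> \<beta> k\<bar> \<le> R"
proof -
  have "\<exists>R. \<forall>\<beta>. \<bar>diag p \<rho> \<beta> k\<bar> \<le> R"
  proof (induction "p - 2 - k" arbitrary: k)
    case 0
    then show ?case by (auto simp: diag_last)
  next
    case (Suc m)
    then have k: "k < p - 2" by simp
    have "m = p - 2 - (k + 1)" using Suc.hyps(2) by simp
    then have "\<exists>R. \<forall>\<beta>. \<bar>diag p \<rho> \<beta> (k + 1)\<bar> \<le> R" by (rule Suc.hyps(1))
    then obtain R where R: "\<And>\<beta>. \<bar>diag p \<rho> \<beta> (k + 1)\<bar> \<le> R" by blast
    have "\<bar>diag p \<rho> \<beta> k\<bar> \<le> \<bar>\<rho> (k + 2)\<bar> + R" for \<beta>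
    proof -
      have side: "tri_side a b t \<le> \<bar>a\<bar> + \<bar>b\<bar>" for a b t
      proof -
        have "\<bar>a * b * cos t\<bar> \<le> \<bar>a * b\<bar>" by (simp add: abs_mult mult_left_le)
        then have "a\<^sup>2 + b\<^sup>2 - 2 * a * b * cos t \<le> a\<^sup>2 + b\<^sup>2 + 2 * \<bar>a * b\<bar>" by linarith
        also have "\<dots> = (\<bar>a\<bar> + \<bar>b\<bar>)\<^sup>2" by (simp add: power2_sum abs_mult)
        finally show ?thesis unfolding tri_side_def by (intro real_le_lsqrt) (auto simp: tri_side_arg_nonneg)
      qed
      show ?thesis unfolding diag_step[OF k] using side[of "\<rho> (k + 2)" "diag p \<rho> \<beta> (k + 1)" "\<beta> k"] R[of \<beta>] tri_side_nonneg
        by (smt (verit))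
    qed
    then show ?case by blast
  qed
  then show ?thesis using that by blast
qed

section \<open>Decay of products of Bessel functions\<close>

lemma bessel_J_scaled_decay:
  assumes "0 < r"
  obtains K where "0 < K" "\<And>x. 0 < x \<Longrightarrow> \<bar>bessel_J l (r * x)\<bar> \<le> K * (1 / sqrt x)"
proof -
  obtain C where C: "0 < C" "\<And>x. 0 < x \<Longrightarrow> \<bar>bessel_J l x\<bar> \<le> C / sqrt x" using bessel_J_decay[of l] by blast
  show ?thesis
  proof (rule that[of "C / sqrt r"])
    show "0 < C / sqrt r" using C assms by simp
    fix x :: real assume x: "0 < x"
    then have "0 < r * x" using assms by simp
    then have "\<bar>bessel_J l (r * x)\<bar> \<le> C / sqrt (r * x)" by (rule C(2))
    also have "\<dots> = C / sqrt r * (1 / sqrt x)" by (simp add: real_sqrt_mult)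
    finally show "\<bar>bessel_J l (r * x)\<bar> \<le> C / sqrt r * (1 / sqrt x)" .
  qed
qed

lemma bessel_J_prod_decay:
  assumes B: "finite B" and r: "\<And>k. k \<in> B \<Longrightarrow> 0 < r k"
  obtains K where "0 < K" "\<And>x. 0 < x \<Longrightarrow> \<bar>\<Prod>k\<in>B. bessel_J (l k) (r k * x)\<bar> \<le> K * (1 / sqrt x) ^ card B"
proof -
  have "\<exists>K>0. \<forall>x>0. \<bar>\<Prod>k\<in>B. bessel_J (l k) (r k * x)\<bar> \<le> K * (1 / sqrt x) ^ card B"
    using B r
  proof (induction B)
    case empty
    then show ?case by (intro exI[of _ 1]) simp
  next
    case (insert b B)
    obtain K where K: "0 < K" "\<And>x. 0 < x \<Longrightarrow> \<bar>\<Prod>k\<in>B. bessel_J (l k) (r k * x)\<bar> \<le> K * (1 / sqrt x) ^ card B"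
      using insert by auto
    obtain K' where K': "0 < K'" "\<And>x. 0 < x \<Longrightarrow> \<bar>bessel_J (l b) (r b * x)\<bar> \<le> K' * (1 / sqrt x)"
      using bessel_J_scaled_decay[of "r b" "l b"] insert.prems by auto
    show ?case
    proof (intro exI[of _ "K' * K"] conjI allI impI)
      show "0 < K' * K" using K K' by simp
      fix x :: real assume x: "0 < x"
      have "\<bar>\<Prod>k\<in>insert b B. bessel_J (l k) (r k * x)\<bar> = \<bar>bessel_J (l b) (r b * x)\<bar> * \<bar>\<Prod>k\<in>B. bessel_J (l k) (r k * x)\<bar>"
        using insert.hyps by (simp add: abs_mult)
      also have "\<dots> \<le> (K' * (1 / sqrt x)) * (K * (1 / sqrt x) ^ card B)"
        using K K' x by (intro mult_mono K(2) K'(2)) auto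
      also have "\<dots> = K' * K * (1 / sqrt x) ^ card (insert b B)"
        by (simp only: card_insert_disjoint[OF insert.hyps(1) insert.hyps(2)] power_Suc mult_ac)
      finally show "\<bar>\<Prod>k\<in>insert b B. bessel_J (l k) (r k * x)\<bar> \<le> K' * K * (1 / sqrt x) ^ card (insert b B)" .
    qed
  qed
  then show ?thesis using that by blast
qed

lemma abs_bessel_J_prod_le_subset:
  assumes "finite A" "B \<subseteq> A"
  shows "\<bar>\<Prod>k\<in>A. bessel_J (l k) (r k * x)\<bar> \<le> \<bar>\<Prod>k\<in>B. bessel_J (l k) (r k * x)\<bar>"
proof -
  have "(\<Prod>k\<in>A. bessel_J (l k) (r k * x)) = (\<Prod>k\<in>A - B. bessel_J (l k) (r k * x)) * (\<Prod>k\<in>B. bessel_J (l k) (r k * x))"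
    by (rule prod.subset_diff[OF assms(2,1)])
  moreover have "\<bar>\<Prod>k\<in>A - B. bessel_J (l k) (r k * x)\<bar> \<le> 1"
    unfolding abs_prod by (rule prod_le_1) (auto simp: abs_bessel_J_le_1)
  ultimately show ?thesis by (simp add: abs_mult mult_left_le_one_le)
qed

text \<open>Five decaying factors against the weight \<open>x\<close> leave the power -3/2, whose
  integral from 1 on is 2; the unit interval contributes at most 1. The bound does not depend on
  \<open>\<epsilon>\<close>.\<close>

lemma gauss_integral_bound:
  fixes g :: "real \<Rightarrow> real"
  assumes \<epsilon>: "0 < \<epsilon>" and g: "g \<in> borel_measurable borel" and g1: "\<And>x. \<bar>g x\<bar> \<le> 1"
    and K: "0 \<le> K" "\<And>x. 0 < x \<Longrightarrow> \<bar>g x\<bar> \<le> K * (1 / sqrt x) ^ 5"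
  shows "\<bar>LINT x|gauss_measure \<epsilon>. g x\<bar> \<le> 1 + 2 * K"
proof -
  interpret finite_measure "gauss_measure \<epsilon>" by (rule finite_measure_gauss[OF \<epsilon>])
  note [measurable] = g
  have i: "integrable (gauss_measure \<epsilon>) g" by (rule integrable_const_bound[of _ 1]) (use g1 in auto)
  have "ennreal (norm (LINT x|gauss_measure \<epsilon>. g x)) \<le> (\<integral>\<^sup>+x. ennreal (norm (g x)) \<partial>gauss_measure \<epsilon>)"
    by (rule integral_norm_bound_ennreal[OF i])
  also have "\<dots> = (\<integral>\<^sup>+x. ennreal (indicator {0..} x * (x * exp (- \<epsilon> * x\<^sup>2))) * ennreal (norm (g x)) \<partial>lborel)"
    unfolding gauss_measure_def by (rule nn_integral_density) auto
  also have "\<dots> \<le> (\<integral>\<^sup>+x. indicator {0..1} x + ennreal K * (ennreal (x powr (- 3 / 2)) * indicator {1..} x) \<partial>lborel)"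
  proof (rule nn_integral_mono)
    fix x :: real
    show "ennreal (indicator {0..} x * (x * exp (- \<epsilon> * x\<^sup>2))) * ennreal (norm (g x)) \<le> indicator {0..1} x + ennreal K * (ennreal (x powr (- 3 / 2)) * indicator {1..} x)"
    proof (cases "0 \<le> x")
      case False
      then show ?thesis by simp
    next
      case x: True
      have ex: "exp (- \<epsilon> * x\<^sup>2) \<le> 1" using \<epsilon> by simp
      have "ennreal (indicator {0..} x * (x * exp (- \<epsilon> * x\<^sup>2))) * ennreal (norm (g x)) = ennreal (x * exp (- \<epsilon> * x\<^sup>2) * \<bar>g x\<bar>)"
        using x by (simp add: ennreal_mult)
      also have "\<dots> \<le> indicator {0..1} x + ennreal K * (ennreal (x powr (- 3 / 2)) * indicator {1..} x)"
      proof (cases "x \<le> 1")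
        case True
        have "x * exp (- \<epsilon> * x\<^sup>2) * \<bar>g x\<bar> \<le> 1 * 1 * 1" using True x ex g1[of x] by (intro mult_mono) auto
        then have "ennreal (x * exp (- \<epsilon> * x\<^sup>2) * \<bar>g x\<bar>) \<le> ennreal 1" by (intro ennreal_leI) simp
        also have "\<dots> = indicator {0..1} x" using True x by simp
        finally show ?thesis by (rule add_increasing2[OF zero_le])
      next
        case False
        then have x0: "0 < x" by simp
        have "x * exp (- \<epsilon> * x\<^sup>2) * \<bar>g x\<bar> \<le> x * 1 * (K * (1 / sqrt x) ^ 5)"
          using x0 ex K by (intro mult_mono) auto
        also have "\<dots> = K * x powr (- 3 / 2)"
        proof -
          have "1 / sqrt x = x powr (- 1 / 2)"
          proof -
            have "x powr (- 1 / 2) = inverse (x powr (1 / 2))" by (simp flip: powr_minus)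
            then show ?thesis using x0 by (simp add: powr_half_sqrt inverse_eq_divide)
          qed
          moreover have "(x powr (- 1 / 2)) ^ 5 = x powr (- 1 / 2 * 5)"
            using x0 by (simp only: powr_powr[symmetric] powr_realpow[symmetric] powr_gt_zero) (simp add: powr_realpow)
          moreover have "x * x powr (- 1 / 2 * 5) = x powr (1 + - 1 / 2 * 5)" using x0 by (simp only: powr_add powr_one)
          ultimately show ?thesis by (simp only: mult_1_right mult.left_commute[of x]) simp
        qed
        finally have "ennreal (x * exp (- \<epsilon> * x\<^sup>2) * \<bar>g x\<bar>) \<le> ennreal (K * x powr (- 3 / 2))" by (rule ennreal_leI)
        also have "\<dots> = ennreal K * ennreal (x powr (- 3 / 2))" using K by (simp add: ennreal_mult)
        finally show ?thesis using False by (simp add: add_increasing)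
      qed
      finally show ?thesis .
    qed
  qed
  also have "\<dots> = (\<integral>\<^sup>+x. indicator {0..1::real} x \<partial>lborel) + ennreal K * (\<integral>\<^sup>+x. ennreal (x powr (- 3 / 2)) * indicator {1..} x \<partial>lborel)"
    by (subst nn_integral_add) (auto simp: nn_integral_cmult)
  also have "(\<integral>\<^sup>+x. ennreal (x powr (- 3 / 2)) * indicator {1..} x \<partial>lborel) = ennreal 2"
  proof (rule nn_integral_has_integral_lebesgue')
    have "((\<lambda>x::real. x powr (- 3 / 2)) has_integral - (1 powr (- 3 / 2 + 1)) / (- 3 / 2 + 1)) {1..}"
      by (rule has_integral_powr_to_inf) auto
    then show "((\<lambda>x::real. x powr (- 3 / 2)) has_integral 2) {1..}" by simp
  qed simp
  also have "(\<integral>\<^sup>+x. indicator {0..1::real} x \<partial>lborel) = ennreal 1" by simp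
  also have "ennreal K * ennreal 2 = ennreal (2 * K)"
    using K by (subst ennreal_mult[symmetric]) (auto simp: mult.commute)
  also have "ennreal 1 + ennreal (2 * K) = ennreal (1 + 2 * K)"
    using K by (intro ennreal_plus[symmetric]) auto
  finally show ?thesis using K by (subst (asm) ennreal_le_iff) auto
qed

lemma angle_factor_0: "angle_factor p (\<lambda>_. 0) \<rho> j \<beta> = 1"
  by (simp add: angle_factor_def)

text \<open>The means of order 0 integrate over the cube to a Gaussian mean of at least five Bessel
  functions, which is bounded uniformly in \<open>\<epsilon>\<close>. They are nonnegative, so
  Fatou's lemma passes the bound to their limit.\<close>

lemma nn_integral_tri_density_finite:
  assumes \<rho>: "\<And>i. i \<in> {1..p} \<Longrightarrow> 0 < \<rho> i" and p: "5 \<le> p" and ab: "0 < a" "0 < b"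
  shows "(\<integral>\<^sup>+\<beta>. ennreal (tri_density 0 0 a b (diag p \<rho> \<beta> 1)) \<partial>angle_cube {1..p - 3}) < \<infinity>"
proof -
  have p4: "4 \<le> p" using p by simp
  let ?M = "angle_cube {1..p - 3}"
  let ?k = "\<lambda>\<beta>. diag p \<rho> \<beta> 1"
  define d where "d = (\<lambda>i. 1 / real (Suc i))"
  have d: "d \<longlonglongrightarrow> 0" "\<And>i. 0 < d i"
    using LIMSEQ_inverse_real_of_nat by (auto simp: d_def inverse_eq_divide)
  have [measurable]: "?k \<in> borel_measurable ?M" by (rule borel_measurable_diag) simp
  have tm: "triple_mean 0 0 a b ((d i)\<^sup>2) \<in> borel_measurable borel" for i
    by (rule borel_measurable_triple_mean) (use d(2)[of i] in simp)
  have [measurable]: "(\<lambda>\<beta>. triple_mean 0 0 a b ((d i)\<^sup>2) (?k \<beta>)) \<in> borel_measurable ?M" for i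
    by (rule measurable_compose[OF _ tm]) measurable
  interpret finite_measure ?M by (rule finite_measure_angle_cube) simp
  have neq: "AE \<beta> in ?M. ?k \<beta> \<noteq> c" for c by (rule AE_diag_neq[OF \<rho> p4])
  let ?V = "\<lambda>i \<beta>. triple_mean 0 0 a b ((d i)\<^sup>2) (?k \<beta>)"
  let ?g = "\<lambda>x. bessel_J 0 (a * x) * bessel_J 0 (b * x) * (bessel_J 0 (\<rho> p * x) * (\<Prod>k=3..p - 1. bessel_J 0 (\<rho> k * x)))"
  obtain Ka where Ka: "0 < Ka" "\<And>x. 0 < x \<Longrightarrow> \<bar>bessel_J 0 (a * x)\<bar> \<le> Ka * (1 / sqrt x)"
    using bessel_J_scaled_decay[OF ab(1), of 0] by blast
  obtain Kb where Kb: "0 < Kb" "\<And>x. 0 < x \<Longrightarrow> \<bar>bessel_J 0 (b * x)\<bar> \<le> Kb * (1 / sqrt x)"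
    using bessel_J_scaled_decay[OF ab(2), of 0] by blast
  have "0 < \<rho> p" by (rule \<rho>) (use p in auto)
  then obtain Kp where Kp: "0 < Kp" "\<And>x. 0 < x \<Longrightarrow> \<bar>bessel_J 0 (\<rho> p * x)\<bar> \<le> Kp * (1 / sqrt x)"
    using bessel_J_scaled_decay[of "\<rho> p" 0] by blast
  \<comment> \<open>Together with the factors of \<open>a\<close>, \<open>b\<close> and the last
    side these two make five.\<close>
  obtain K3 where K3: "0 < K3" "\<And>x. 0 < x \<Longrightarrow> \<bar>\<Prod>k\<in>{3, 4}. bessel_J 0 (\<rho> k * x)\<bar> \<le> K3 * (1 / sqrt x) ^ card {3, 4 :: nat}"
  proof -
    have r: "\<And>k. k \<in> {3, 4 :: nat} \<Longrightarrow> 0 < \<rho> k" using \<rho> p by auto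
    have "finite {3, 4 :: nat}" by simp
    from bessel_J_prod_decay[where r = \<rho> and l = "\<lambda>_. 0", OF this r] show ?thesis using that by blast
  qed
  let ?K = "Ka * Kb * (Kp * K3)"
  have g1: "\<bar>?g x\<bar> \<le> 1" for x
  proof -
    have "\<bar>\<Prod>k=3..p - 1. bessel_J 0 (\<rho> k * x)\<bar> \<le> 1"
      unfolding abs_prod by (rule prod_le_1) (auto simp: abs_bessel_J_le_1)
    then show ?thesis by (intro abs_bessel_mult_le abs_bessel_J_le_1)
  qed
  have gK: "\<bar>?g x\<bar> \<le> ?K * (1 / sqrt x) ^ 5" if x: "0 < x" for x
  proof -
    have "\<bar>\<Prod>k=3..p - 1. bessel_J 0 (\<rho> k * x)\<bar> \<le> \<bar>\<Prod>k\<in>{3, 4}. bessel_J 0 (\<rho> k * x)\<bar>"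
      by (rule abs_bessel_J_prod_le_subset) (use p in auto)
    also have "\<dots> \<le> K3 * (1 / sqrt x) ^ card {3, 4 :: nat}" by (rule K3(2)[OF x])
    finally have P: "\<bar>\<Prod>k=3..p - 1. bessel_J 0 (\<rho> k * x)\<bar> \<le> K3 * (1 / sqrt x)\<^sup>2" by (simp add: power2_eq_square)
    have "\<bar>?g x\<bar> \<le> (Ka * (1 / sqrt x)) * (Kb * (1 / sqrt x)) * ((Kp * (1 / sqrt x)) * (K3 * (1 / sqrt x)\<^sup>2))"
      unfolding abs_mult using x Ka Kb Kp K3 P by (intro mult_mono) auto
    also have "\<dots> = ?K * (1 / sqrt x) ^ 5"
    proof -
      have "(A * y) * (B * y) * ((C * y) * (D * y\<^sup>2)) = A * B * (C * D) * y ^ 5" for A B C D y :: real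
        by (simp add: power_numeral_reduce)
      then show ?thesis .
    qed
    finally show ?thesis .
  qed
  have V0: "0 \<le> ?V i \<beta>" if "0 < ?k \<beta>" for i \<beta>
    by (rule triple_mean_0_nonneg) (use ab d(2)[of i] that in auto)
  have pos: "AE \<beta> in ?M. 0 < ?k \<beta>"
    using AE_angle_cube[of "{1..p - 3}", simplified]
    by eventually_elim (rule diag_pos[OF \<rho> p4], auto)
  have bound: "(\<integral>\<^sup>+\<beta>. ennreal (?V i \<beta>) \<partial>?M) \<le> ennreal (pi ^ (p - 3) * (1 + 2 * ?K))" for i
  proof -
    have di: "0 < (d i)\<^sup>2" using d(2)[of i] by simp
    have "(\<integral>\<^sup>+\<beta>. ennreal (?V i \<beta>) \<partial>?M) = ennreal (LINT \<beta>|?M. ?V i \<beta>)"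
    proof (rule nn_integral_eq_integral)
      show "integrable ?M (?V i)"
        by (rule integrable_const_bound[of _ "1 / (2 * (d i)\<^sup>2)"]) (use abs_triple_mean_le[OF di] in simp, measurable)
      show "AE \<beta> in ?M. 0 \<le> ?V i \<beta>" using pos by eventually_elim (rule V0)
    qed
    also have "(LINT \<beta>|?M. ?V i \<beta>) = (LINT \<beta>|?M. ?V i \<beta> * angle_factor p (\<lambda>_. 0) \<rho> 1 \<beta>)"
      by (simp add: angle_factor_0)
    also have "\<dots> = pi ^ (p - 3) * (LINT x|gauss_measure ((d i)\<^sup>2). ?g x)"
      using gauss_angle_cube[where \<rho> = \<rho> and m = 0 and n = 0 and l = "\<lambda>_. 0" and a = a and b = b, OF \<rho> p4 di] by simp
    also have "\<dots> \<le> pi ^ (p - 3) * (1 + 2 * ?K)"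
    proof (rule mult_left_mono)
      have "\<bar>LINT x|gauss_measure ((d i)\<^sup>2). ?g x\<bar> \<le> 1 + 2 * ?K"
        by (rule gauss_integral_bound[OF di _ g1 _ gK]) (use Ka Kb Kp K3 in auto)
      then show "(LINT x|gauss_measure ((d i)\<^sup>2). ?g x) \<le> 1 + 2 * ?K" by linarith
    qed simp
    finally show ?thesis by (simp add: ennreal_leI)
  qed
  have lim: "AE \<beta> in ?M. ennreal (tri_density 0 0 a b (?k \<beta>) / pi) = liminf (\<lambda>i. ennreal (?V i \<beta>))"
    using pos neq[of "a + b"] neq[of "\<bar>a - b\<bar>"]
  proof eventually_elim
    case (elim \<beta>)
    have "(\<lambda>i. ?V i \<beta>) \<longlonglongrightarrow> tri_density 0 0 a b (?k \<beta>) / pi"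
      by (rule triple_mean_tendsto[OF ab _ _ _ d]) (use elim in auto)
    then have "(\<lambda>i. ennreal (?V i \<beta>)) \<longlonglongrightarrow> ennreal (tri_density 0 0 a b (?k \<beta>) / pi)"
      by (rule tendsto_ennrealI)
    then show ?case by (rule lim_imp_Liminf[OF trivial_limit_sequentially, symmetric])
  qed
  have "(\<integral>\<^sup>+\<beta>. ennreal (tri_density 0 0 a b (?k \<beta>) / pi) \<partial>?M) = (\<integral>\<^sup>+\<beta>. liminf (\<lambda>i. ennreal (?V i \<beta>)) \<partial>?M)"
    by (rule nn_integral_cong_AE[OF lim])
  also have "\<dots> \<le> liminf (\<lambda>i. \<integral>\<^sup>+\<beta>. ennreal (?V i \<beta>) \<partial>?M)" by (rule nn_integral_liminf) measurable
  also have "\<dots> \<le> limsup (\<lambda>i. \<integral>\<^sup>+\<beta>. ennreal (?V i \<beta>) \<partial>?M)" by (rule Liminf_le_Limsup) simp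
  also have "\<dots> \<le> ennreal (pi ^ (p - 3) * (1 + 2 * ?K))"
    by (intro Limsup_bounded always_eventually allI bound)
  also have "\<dots> < \<infinity>" by simp
  finally have fin: "(\<integral>\<^sup>+\<beta>. ennreal (tri_density 0 0 a b (?k \<beta>) / pi) \<partial>?M) < \<infinity>" .
  have "(\<integral>\<^sup>+\<beta>. ennreal (tri_density 0 0 a b (?k \<beta>)) \<partial>?M) = (\<integral>\<^sup>+\<beta>. ennreal pi * ennreal (tri_density 0 0 a b (?k \<beta>) / pi) \<partial>?M)"
  proof (rule nn_integral_cong)
    fix \<beta>
    have "tri_density 0 0 a b (?k \<beta>) = pi * (tri_density 0 0 a b (?k \<beta>) / pi)" by simp
    then show "ennreal (tri_density 0 0 a b (?k \<beta>)) = ennreal pi * ennreal (tri_density 0 0 a b (?k \<beta>) / pi)"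
      using tri_density_0_nonneg[OF ab, of "?k \<beta>"] by (metis ennreal_mult divide_nonneg_pos pi_ge_zero pi_gt_zero)
  qed
  also have "\<dots> = ennreal pi * (\<integral>\<^sup>+\<beta>. ennreal (tri_density 0 0 a b (?k \<beta>) / pi) \<partial>?M)"
    by (rule nn_integral_cmult) measurable
  also have "\<dots> < \<infinity>" using fin by (simp add: ennreal_mult_less_top)
  finally show ?thesis .
qed

lemma nn_integral_combination:
  fixes A B C :: ennreal
  assumes "f \<in> borel_measurable M" "g \<in> borel_measurable M" "h \<in> borel_measurable M"
  shows "(\<integral>\<^sup>+x. A * f x + B * g x + C * h x \<partial>M) = A * (\<integral>\<^sup>+x. f x \<partial>M) + B * (\<integral>\<^sup>+x. g x \<partial>M) + C * (\<integral>\<^sup>+x. h x \<partial>M)"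
  using assms by (simp add: nn_integral_add nn_integral_cmult)

definition side_majorant :: "real \<Rightarrow> real \<Rightarrow> real \<Rightarrow> real" where
  "side_majorant a b s = isq s * (isq (s - (a + b)) + isq (s - \<bar>a - b\<bar>))"

lemma borel_measurable_side_majorant [measurable]: "side_majorant a b \<in> borel_measurable borel"
  unfolding side_majorant_def[abs_def] by measurable

text \<open>The majorant is singular on both sides of \<open>a + b\<close> and of
  \<open>\<bar>a - b\<bar>\<close>, while the density of \<open>a\<close>, \<open>b\<close> covers
  only the range between them. Below that range the density of an isosceles triangle is used whose
  greatest third side is \<open>\<bar>a - b\<bar>\<close>, above it that of a triangle whose least
  third side is \<open>a + b\<close>. In each range the two singular terms are comparable to
  densities, whence the factors 2.\<close>

lemma nn_integral_side_majorant_finite: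
  assumes \<rho>: "\<And>i. i \<in> {1..p} \<Longrightarrow> 0 < \<rho> i" and p: "5 \<le> p" and ab: "0 < a" "0 < b"
  shows "(\<integral>\<^sup>+\<beta>. ennreal (side_majorant a b (diag p \<rho> \<beta> 1)) \<partial>angle_cube {1..p - 3}) < \<infinity>"
proof -
  have p4: "4 \<le> p" using p by simp
  let ?M = "angle_cube {1..p - 3}"
  let ?k = "\<lambda>\<beta>. diag p \<rho> \<beta> 1"
  have [measurable]: "?k \<in> borel_measurable ?M" by (rule borel_measurable_diag) simp
  obtain R where R: "\<And>\<beta>. \<bar>?k \<beta>\<bar> \<le> R" using diag_bounded by blast
  have R0: "0 \<le> R" using R[of undefined] by linarith
  let ?c1 = "a + b" and ?c2 = "\<bar>a - b\<bar>"
  \<comment> \<open>The difference is \<open>a + b\<close> and the sum exceeds every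
    diagonal.\<close>
  define a' b' where "a' = ?c1 + (R + 1) / 2" and "b' = (R + 1) / 2"
  have ab': "0 < a'" "0 < b'" "a' + b' = ?c1 + R + 1" "\<bar>a' - b'\<bar> = ?c1"
    using ab R0 by (auto simp: a'_def b'_def field_simps)
  \<comment> \<open>For \<open>\<bar>a - b\<bar> = 0\<close> no diagonal lies below, and any
    positive value will do.\<close>
  define e where "e = (if ?c2 = 0 then 1 else ?c2 / 2)"
  have e: "0 < e" by (auto simp: e_def)
  let ?H = "\<lambda>a b \<beta>. ennreal (tri_density 0 0 a b (?k \<beta>))"
  have neq: "AE \<beta> in ?M. ?k \<beta> \<noteq> c" for c by (rule AE_diag_neq[OF \<rho> p4])
  have fin: "(\<integral>\<^sup>+\<beta>. ?H a b \<beta> \<partial>?M) < \<infinity>" if "0 < a" "0 < b" for a b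
    by (rule nn_integral_tri_density_finite[OF \<rho> p that])
  have "AE \<beta> in ?M. ennreal (side_majorant a b (?k \<beta>)) \<le>
      ennreal (2 * (a + b)) * ?H a b \<beta> + ennreal (2 * (a' + b')) * ?H a' b' \<beta> + ennreal (2 * (e + e)) * ?H e e \<beta>"
    using AE_angle_cube[of "{1..p - 3}", simplified] neq[of ?c1] neq[of ?c2]
  proof eventually_elim
    case (elim \<beta>)
    let ?s = "?k \<beta>"
    have s: "0 < ?s" by (rule diag_pos[OF \<rho> p4]) (use elim in auto)
    have sR: "?s \<le> R" using R[of \<beta>] by linarith
    have to_enn: "ennreal y \<le> ennreal (2 * c) * ennreal h" if "y \<le> 2 * (c * h)" "0 \<le> c" "0 \<le> h" for y c h :: real
      using that by (simp add: ennreal_mult[symmetric] ennreal_leI mult.assoc)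
    consider "?s < ?c2" | "?c2 < ?s" "?s < ?c1" | "?c1 < ?s" using elim by linarith
    then show ?case
    proof cases
      case 1
      then have e2: "e = ?c2 / 2" using s by (auto simp: e_def)
      have "isq (?s - ?c1) \<le> isq (?s - ?c2)" using 1 s ab by (intro isq_mono) auto
      then have "side_majorant a b ?s \<le> 2 * (isq ?s * isq (?s - ?c2))"
        unfolding side_majorant_def using isq_nonneg[of ?s] by (simp add: distrib_left mult_left_mono)
      also have "isq ?s * isq (?s - ?c2) \<le> (e + e) * tri_density 0 0 e e ?s"
      proof -
        have ee: "e + e = ?c2" using e2 by simp
        have "isq ?s * isq (?s - (e + e)) \<le> (e + e) * tri_density 0 0 e e ?s"
          by (rule isq_le_tri_density(1)[OF e e]) (use 1 s ee in auto)
        then show ?thesis by (simp only: ee)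
      qed
      finally have "side_majorant a b ?s \<le> 2 * ((e + e) * tri_density 0 0 e e ?s)" by simp
      then have "ennreal (side_majorant a b ?s) \<le> ennreal (2 * (e + e)) * ?H e e \<beta>"
        using e tri_density_0_nonneg[OF e e] by (intro to_enn) auto
      then show ?thesis by (rule add_increasing[OF zero_le])
    next
      case 2
      have "side_majorant a b ?s \<le> 2 * ((a + b) * tri_density 0 0 a b ?s)"
        using isq_le_tri_density[OF ab 2] by (simp add: side_majorant_def distrib_left)
      then have "ennreal (side_majorant a b ?s) \<le> ennreal (2 * (a + b)) * ?H a b \<beta>"
        using ab tri_density_0_nonneg[OF ab] by (intro to_enn) auto
      then show ?thesis by (intro add_increasing2[OF zero_le])
    next
      case 3
      have "isq (?s - ?c2) \<le> isq (?s - ?c1)" using 3 s ab by (intro isq_mono) auto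
      then have "side_majorant a b ?s \<le> 2 * (isq ?s * isq (?s - ?c1))"
        unfolding side_majorant_def using isq_nonneg[of ?s] by (simp add: distrib_left mult_left_mono)
      also have "isq ?s * isq (?s - ?c1) \<le> (a' + b') * tri_density 0 0 a' b' ?s"
        using isq_le_tri_density(2)[OF ab'(1,2), of ?s] 3 sR ab ab'(3,4) by simp
      finally have "side_majorant a b ?s \<le> 2 * ((a' + b') * tri_density 0 0 a' b' ?s)" by simp
      then have "ennreal (side_majorant a b ?s) \<le> ennreal (2 * (a' + b')) * ?H a' b' \<beta>"
        using ab' tri_density_0_nonneg[OF ab'(1,2)] by (intro to_enn) auto
      then show ?thesis by (intro add_increasing2[OF zero_le] add_increasing[OF zero_le])
    qed
  qed
  then have "(\<integral>\<^sup>+\<beta>. ennreal (side_majorant a b (?k \<beta>)) \<partial>?M) \<le>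
     (\<integral>\<^sup>+\<beta>. ennreal (2 * (a + b)) * ?H a b \<beta> + ennreal (2 * (a' + b')) * ?H a' b' \<beta> + ennreal (2 * (e + e)) * ?H e e \<beta> \<partial>?M)"
    by (rule nn_integral_mono_AE)
  also have "\<dots> = ennreal (2 * (a + b)) * (\<integral>\<^sup>+\<beta>. ?H a b \<beta> \<partial>?M) + ennreal (2 * (a' + b')) * (\<integral>\<^sup>+\<beta>. ?H a' b' \<beta> \<partial>?M)
      + ennreal (2 * (e + e)) * (\<integral>\<^sup>+\<beta>. ?H e e \<beta> \<partial>?M)"
    by (rule nn_integral_combination) measurable
  also have "\<dots> < \<infinity>"
    using fin[OF ab] fin[OF ab'(1,2)] fin[OF e e]
    by (simp add: ennreal_mult_less_top)
  finally show ?thesis .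
qed

section \<open>Degenerate quadrilaterals\<close>

lemma nn_integral_reciprocal:
  fixes \<eta> :: real
  assumes "0 < \<eta>"
  shows "(\<integral>\<^sup>+t. ennreal (1 / t) * indicator {0<..<\<eta>} t \<partial>lborel) = \<infinity>"
proof (rule ccontr)
  let ?I = "\<integral>\<^sup>+t. ennreal (1 / t) * indicator {0<..<\<eta>} t \<partial>lborel"
  assume "?I \<noteq> \<infinity>"
  then obtain r where r: "0 \<le> r" "?I = ennreal r" by (cases ?I) auto
  \<comment> \<open>The integral of the reciprocal from \<open>a\<close> to \<open>b\<close> is then
    \<open>r + 1\<close>, more than the supposed total.\<close>
  define a where "a = \<eta> * exp (- (r + 2))"
  define b where "b = \<eta> * exp (- 1)"
  have ab: "0 < a" "a \<le> b" "b < \<eta>" using assms r by (auto simp: a_def b_def)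
  have "((\<lambda>t. 1 / t) has_integral (ln b - ln a)) {a..b}"
  proof (rule fundamental_theorem_of_calculus[OF ab(2)])
    fix t assume "t \<in> {a..b}"
    then have "0 < t" using ab by auto
    then show "(ln has_vector_derivative 1 / t) (at t within {a..b})"
      unfolding has_real_derivative_iff_has_vector_derivative[symmetric]
      by (auto intro!: derivative_eq_intros)
  qed
  then have "(\<integral>\<^sup>+t. ennreal (1 / t) * indicator {a..b} t \<partial>lborel) = ennreal (ln b - ln a)"
    by (intro nn_integral_has_integral_lebesgue') (use ab in auto)
  moreover have "ln b - ln a = r + 1" unfolding a_def b_def using assms by (simp add: ln_mult)
  moreover have "(\<integral>\<^sup>+t. ennreal (1 / t) * indicator {a..b} t \<partial>lborel) \<le> ?I"
    by (rule nn_integral_mono) (use ab in \<open>auto simp: indicator_def\<close>)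
  ultimately have "ennreal (r + 1) \<le> ennreal r" using r by simp
  then show False using r by (simp add: ennreal_le_iff2)
qed

lemma not_integrable_reciprocal_lower_bound:
  fixes f :: "real \<Rightarrow> real"
  assumes f: "integrable angle_interval f" and C: "0 < C" and \<eta>: "0 < \<eta>" "\<eta> \<le> pi"
    and le: "\<And>t. 0 < t \<Longrightarrow> t < \<eta> \<Longrightarrow> C / t \<le> \<bar>f t\<bar>"
  shows False
proof -
  have [measurable]: "f \<in> borel_measurable borel"
    using borel_measurable_integrable[OF f] by (simp cong: measurable_cong_sets)
  have "(\<integral>\<^sup>+t. ennreal C * (ennreal (1 / t) * indicator {0<..<\<eta>} t) \<partial>lborel) \<le>
     (\<integral>\<^sup>+t. ennreal (norm (f t)) * indicator {0<..<pi} t \<partial>lborel)"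
  proof (rule nn_integral_mono)
    fix t
    show "ennreal C * (ennreal (1 / t) * indicator {0<..<\<eta>} t) \<le> ennreal (norm (f t)) * indicator {0<..<pi} t"
    proof (cases "0 < t \<and> t < \<eta>")
      case True
      have "ennreal C * ennreal (1 / t) = ennreal (C / t)" using C True by (simp flip: ennreal_mult)
      also have "\<dots> \<le> ennreal (norm (f t))" using le True by (intro ennreal_leI) simp
      finally show ?thesis using True \<eta> by simp
    qed (auto simp: indicator_def)
  qed
  also have "\<dots> = (\<integral>\<^sup>+t. ennreal (norm (f t)) \<partial>angle_interval)"
    by (rule nn_integral_angle_interval[symmetric]) measurable
  also have "\<dots> < \<infinity>" using f by (simp add: integrable_iff_bounded)
  finally have "(\<integral>\<^sup>+t. ennreal C * (ennreal (1 / t) * indicator {0<..<\<eta>} t) \<partial>lborel) < \<infinity>" .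
  moreover have "(\<integral>\<^sup>+t. ennreal C * (ennreal (1 / t) * indicator {0<..<\<eta>} t) \<partial>lborel) =
      ennreal C * (\<integral>\<^sup>+t. ennreal (1 / t) * indicator {0<..<\<eta>} t \<partial>lborel)"
    by (rule nn_integral_cmult) measurable
  ultimately show False using C by (simp add: nn_integral_reciprocal[OF \<eta>(1)] ennreal_mult_top)
qed

lemma integrable_angle_interval_reflect:
  fixes f :: "real \<Rightarrow> real"
  assumes f: "integrable angle_interval f"
  shows "integrable angle_interval (\<lambda>t. f (pi - t))"
proof -
  have [measurable]: "f \<in> borel_measurable borel"
    using borel_measurable_integrable[OF f] by (simp cong: measurable_cong_sets)
  have "(\<integral>\<^sup>+t. ennreal (norm (f t)) \<partial>angle_interval) = (\<integral>\<^sup>+t. ennreal (norm (f t)) * indicator {0<..<pi} t \<partial>lborel)"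
    by (rule nn_integral_angle_interval) measurable
  also have "\<dots> = ennreal \<bar>-1\<bar> * (\<integral>\<^sup>+t. ennreal (norm (f (pi + - 1 * t))) * indicator {0<..<pi} (pi + - 1 * t) \<partial>lborel)"
    by (rule nn_integral_real_affine) auto
  also have "\<dots> = (\<integral>\<^sup>+t. ennreal (norm (f (pi - t))) * indicator {0<..<pi} t \<partial>lborel)"
    by (simp, intro nn_integral_cong) (auto simp: indicator_def)
  also have "\<dots> = (\<integral>\<^sup>+t. ennreal (norm (f (pi - t))) \<partial>angle_interval)"
    by (rule nn_integral_angle_interval[symmetric]) measurable
  finally show ?thesis using f unfolding integrable_iff_bounded by auto
qed

lemma not_integrable_at_0:
  fixes f :: "real \<Rightarrow> real"
  assumes f: "integrable angle_interval f" and C: "0 < C" and ev: "\<forall>\<^sub>F t in at_right 0. C / t \<le> \<bar>f t\<bar>"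
  shows False
proof -
  obtain b where b: "0 < b" "\<And>t. 0 < t \<Longrightarrow> t < b \<Longrightarrow> C / t \<le> \<bar>f t\<bar>"
    using ev unfolding eventually_at_right_field by blast
  show False
    by (rule not_integrable_reciprocal_lower_bound[OF f C, of "min b pi"]) (use b in auto)
qed

lemma not_integrable_at_pi:
  fixes f :: "real \<Rightarrow> real"
  assumes f: "integrable angle_interval f" and C: "0 < C" and ev: "\<forall>\<^sub>F t in at_left pi. C / (pi - t) \<le> \<bar>f t\<bar>"
  shows False
proof -
  obtain b where b: "b < pi" "\<And>t. b < t \<Longrightarrow> t < pi \<Longrightarrow> C / (pi - t) \<le> \<bar>f t\<bar>"
    using ev unfolding eventually_at_left_field by blast
  show False
  proof (rule not_integrable_reciprocal_lower_bound[OF integrable_angle_interval_reflect[OF f] C, of "min (pi - b) pi"])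
    fix t assume "0 < t" "t < min (pi - b) pi"
    then show "C / t \<le> \<bar>f (pi - t)\<bar>" using b(2)[of "pi - t"] by simp
  qed (use b in auto)
qed

section \<open>Behaviour of triangles near degeneration\<close>

lemma tri_angle_arg_bounds:
  assumes "is_triangle a b s"
  shows "(b\<^sup>2 + s\<^sup>2 - a\<^sup>2) / (2 * b * s) \<in> {-1..1}"
proof -
  have p: "0 < b" "0 < s" using assms by (auto simp: is_triangle_def)
  have t: "a < b + s" "\<bar>b - s\<bar> < a" using assms by (auto simp: is_triangle_def)
  have "a\<^sup>2 \<le> (b + s)\<^sup>2" using assms t by (intro power_mono) (auto simp: is_triangle_def)
  moreover have "(b - s)\<^sup>2 \<le> a\<^sup>2" using t power_mono[of "\<bar>b - s\<bar>" a 2] by simp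
  ultimately have "- (2 * b * s) \<le> b\<^sup>2 + s\<^sup>2 - a\<^sup>2" "b\<^sup>2 + s\<^sup>2 - a\<^sup>2 \<le> 2 * b * s"
    by (auto simp: power2_eq_square algebra_simps)
  then show ?thesis using p by (simp add: pos_le_divide_eq pos_divide_le_eq)
qed

text \<open>\<open>arccos\<close> is continuous on the closed interval only from within. Since the
  approaching lengths close triangles, the argument stays inside, and the limit may be
  degenerate.\<close>

lemma tendsto_tri_angle:
  assumes lim: "(g \<longlongrightarrow> s) F" and F: "F \<noteq> bot" and s: "0 < s" and b: "0 < b"
    and tri: "\<forall>\<^sub>F t in F. is_triangle a b (g t)"
  shows "((\<lambda>t. tri_angle a b (g t)) \<longlongrightarrow> tri_angle a b s) F"
proof -
  let ?q = "\<lambda>s. (b\<^sup>2 + s\<^sup>2 - a\<^sup>2) / (2 * b * s)"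
  have q: "((\<lambda>t. ?q (g t)) \<longlongrightarrow> ?q s) F" by (intro tendsto_intros lim) (use s b in simp)
  have ev: "\<forall>\<^sub>F t in F. ?q (g t) \<in> {-1..1}" using tri by eventually_elim (rule tri_angle_arg_bounds)
  have "?q s \<in> {-1..1}" by (rule Lim_in_closed_set[OF _ ev F q]) simp
  from continuous_on_tendsto_compose[OF continuous_on_arccos' q this ev]
  show ?thesis by (simp only: tri_angle_def)
qed

lemma tri_angle_degenerate:
  assumes "0 < b" "0 < s" "s = a + b \<or> s = \<bar>a - b\<bar>"
  shows "tri_angle a b s \<in> {0, pi}"
proof -
  let ?q = "(b\<^sup>2 + s\<^sup>2 - a\<^sup>2) / (2 * b * s)"
  have "(b\<^sup>2 + s\<^sup>2 - a\<^sup>2)\<^sup>2 = (2 * b * s)\<^sup>2"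
  proof -
    have "(2 * b * s)\<^sup>2 - (b\<^sup>2 + s\<^sup>2 - a\<^sup>2)\<^sup>2 = ((a + b)\<^sup>2 - s\<^sup>2) * (s\<^sup>2 - (a - b)\<^sup>2)"
      by (simp add: power2_eq_square algebra_simps)
    also have "\<dots> = 0" using assms(3) by auto
    finally show ?thesis by simp
  qed
  then have "b\<^sup>2 + s\<^sup>2 - a\<^sup>2 = 2 * b * s \<or> b\<^sup>2 + s\<^sup>2 - a\<^sup>2 = - (2 * b * s)"
    by (simp only: power2_eq_iff)
  then have "?q = 1 \<or> ?q = - 1" using assms by auto
  then show ?thesis unfolding tri_angle_def by (auto simp: arccos_1 arccos_minus_1)
qed

lemma abs_cos_int_pi: "\<bar>cos (of_int k * pi)\<bar> = 1"
proof -
  have "cos (of_int k * pi) = (-1) powi k"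
    by (cases k rule: int_cases2) (auto simp: power_int_minus simp flip: power_inverse)
  then show ?thesis by (simp add: power_int_abs)
qed

lemma abs_cos_multiples:
  assumes "x \<in> {0, pi}" "y \<in> {0, pi}"
  shows "\<bar>cos (of_int m * x - of_int n * y)\<bar> = 1"
proof -
  consider "x = 0" "y = 0" | "x = 0" "y = pi" | "x = pi" "y = 0" | "x = pi" "y = pi" using assms by blast
  then show ?thesis
  proof cases
    case 4
    then show ?thesis using abs_cos_int_pi[of "m - n"] by (simp add: left_diff_distrib)
  qed (auto simp: abs_cos_int_pi)
qed

text \<open>\<open>u\<close> is going to be the distance of the angle from its end. If the area is
  at most of order \<open>u\<close> and the cosines stay away from 0, the density is at least a
  multiple of \<open>1 / u\<close>.\<close>

lemma tri_density_lower_bound: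
  assumes ab: "0 < a" "0 < b" and tri: "is_triangle a b s" and q: "0 < q" and u: "0 < u"
    and P: "((a + b)\<^sup>2 - s\<^sup>2) * (s\<^sup>2 - (a - b)\<^sup>2) \<le> (a + b)\<^sup>2 * (q * u\<^sup>2)"
    and N: "1 / 2 \<le> \<bar>cos (of_int m * tri_angle b a s - of_int n * tri_angle a b s) * x\<bar>"
  shows "1 / ((a + b) * sqrt q) / u \<le> \<bar>tri_density m n a b s * x\<bar>"
proof -
  let ?D = "b * s * sin (tri_angle a b s)"
  let ?N = "cos (of_int m * tri_angle b a s - of_int n * tri_angle a b s)"
  have D: "0 < ?D" by (rule tri_density_sides(2)[OF ab tri])
  have "?D \<le> sqrt ((a + b)\<^sup>2 * (q * u\<^sup>2)) / 2"
    unfolding tri_density_sides(1)[OF ab tri] using P by simp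
  also have "\<dots> = (a + b) * sqrt q * u / 2" using ab u by (simp add: real_sqrt_mult)
  finally have Dle: "?D \<le> (a + b) * sqrt q * u / 2" .
  have "1 / ((a + b) * sqrt q) / u = (1 / 2) / ((a + b) * sqrt q * u / 2)" by simp
  also have "\<dots> \<le> \<bar>?N * x\<bar> / ?D" by (rule frac_le) (use N D Dle in auto)
  also have "\<dots> = \<bar>tri_density m n a b s * x\<bar>"
  proof -
    have "tri_density m n a b s * x = ?N * x / ?D" using tri by (simp add: tri_density_def)
    then show ?thesis by (simp only: abs_divide abs_of_pos[OF D])
  qed
  finally show ?thesis .
qed

text \<open>Squared sides differ from their extreme values by a quantity of second order in the
  angle. When extreme values coincide, Heron's product for \<open>a\<close>, \<open>b\<close> is
  thus of second order as well and its root cancels only one power of the distance, so that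
  integrability forces the cosines to lose their limit of modulus 1. The bounds \<open>quad\<close>
  ensure that near the end in question the diagonal does close a triangle with \<open>a\<close> and
  \<open>b\<close>.\<close>

lemma quadrilateral_coincidence:
  fixes m n j :: int
  defines "f \<equiv> \<lambda>a b c e t. tri_density m n a b (tri_side c e t) * cos (of_int (m + n) * tri_angle c e (tri_side c e t) - of_int j * t)"
  assumes pos: "0 < a" "0 < b" "0 < c" "0 < e"
    and int: "integrable angle_interval (f a b c e)"
    and quad: "\<bar>c - e\<bar> < a + b" "\<bar>a - b\<bar> < c + e"
  shows "a + b \<noteq> c + e" and "\<bar>a - b\<bar> \<noteq> \<bar>c - e\<bar> \<or> a = b \<and> c = e \<and> odd (m + n)"
proof -
  let ?k = "tri_side c e"
  let ?C = "1 / ((a + b) * sqrt (c * e))"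
  have C: "0 < ?C" using pos by simp
  let ?N = "\<lambda>t. cos (of_int m * tri_angle b a (?k t) - of_int n * tri_angle a b (?k t)) * cos (of_int (m + n) * tri_angle c e (?k t) - of_int j * t)"
  have k_cont: "continuous_on UNIV ?k" unfolding tri_side_def[abs_def] by (intro continuous_intros)
  have k0: "?k 0 = \<bar>c - e\<bar>"
  proof -
    have "c\<^sup>2 + e\<^sup>2 - 2 * c * e * cos 0 = (c - e)\<^sup>2" by (simp add: power2_eq_square algebra_simps)
    then show ?thesis by (simp only: tri_side_def real_sqrt_abs)
  qed
  have kpi: "?k pi = c + e"
  proof -
    have "c\<^sup>2 + e\<^sup>2 - 2 * c * e * cos pi = (c + e)\<^sup>2" by (simp add: power2_eq_square algebra_simps)
    then show ?thesis using pos by (simp only: tri_side_def real_sqrt_abs)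
  qed
  have lim0: "(?k \<longlongrightarrow> \<bar>c - e\<bar>) (at_right 0)"
    using k_cont k0 by (metis continuous_on_eq_continuous_at open_UNIV UNIV_I isCont_def filterlim_at_split)
  have limpi: "(?k \<longlongrightarrow> c + e) (at_left pi)"
    using k_cont kpi by (metis continuous_on_eq_continuous_at open_UNIV UNIV_I isCont_def filterlim_at_split)
  have ev0: "\<forall>\<^sub>F t in at_right 0. 0 < t \<and> t < pi"
    using eventually_at_right_less[of "0::real"] eventually_at_right_real[OF pi_gt_zero] by eventually_elim auto
  have evpi: "\<forall>\<^sub>F t in at_left pi. 0 < t \<and> t < pi"
    using eventually_at_left_real[OF pi_gt_zero] by eventually_elim auto
  \<comment> \<open>Serves both ends: \<open>F\<close> approaches 0 or \<pi>, and the product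
    \<open>?N\<close> of the two cosines has a limit of modulus 1, hence eventually exceeds
    1/2.\<close>
  have key: False
    if F: "F \<noteq> bot" and k: "(?k \<longlongrightarrow> s) F" and ev: "\<forall>\<^sub>F t in F. 0 < t \<and> t < pi \<and> is_triangle a b (?k t)"
      and N: "(?N \<longlongrightarrow> N0) F" "\<bar>N0\<bar> = 1"
      and F0: "F = at_right 0 \<and> \<bar>a - b\<bar> = \<bar>c - e\<bar> \<or> F = at_left pi \<and> a + b = c + e" for F s N0
  proof -
    have "((\<lambda>t. \<bar>?N t\<bar>) \<longlongrightarrow> \<bar>N0\<bar>) F" by (intro tendsto_intros N)
    then have evN: "\<forall>\<^sub>F t in F. 1 / 2 < \<bar>?N t\<bar>" using N(2) by (intro order_tendstoD) auto
    from F0 show False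
    proof
      assume F0: "F = at_right 0 \<and> \<bar>a - b\<bar> = \<bar>c - e\<bar>"
      have "\<forall>\<^sub>F t in at_right 0. ?C / t \<le> \<bar>f a b c e t\<bar>"
        using ev evN unfolding conjunct1[OF F0]
      proof eventually_elim
        case (elim t)
        have s: "(?k t)\<^sup>2 - (a - b)\<^sup>2 \<le> c * e * t\<^sup>2"
        proof -
          have "(a - b)\<^sup>2 = (c - e)\<^sup>2" using F0 by (metis power2_abs)
          then have "(?k t)\<^sup>2 - (a - b)\<^sup>2 = c * e * (4 * (sin (t / 2))\<^sup>2)"
            unfolding tri_side_sq_sin by simp
          also have "\<dots> \<le> c * e * (4 * (t / 2)\<^sup>2)"
          proof (intro mult_left_mono)
            have "\<bar>sin (t / 2)\<bar> \<le> \<bar>t / 2\<bar>" by (rule abs_sin_x_le_abs_x)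
            then show "(sin (t / 2))\<^sup>2 \<le> (t / 2)\<^sup>2" by (simp only: abs_le_square_iff)
          qed (use pos in auto)
          finally show ?thesis by (simp add: power_divide)
        qed
        have tr: "\<bar>a - b\<bar> < ?k t" "?k t < a + b" using elim pos by (auto simp: is_triangle_iff)
        have "((a + b)\<^sup>2 - (?k t)\<^sup>2) * ((?k t)\<^sup>2 - (a - b)\<^sup>2) \<le> (a + b)\<^sup>2 * (c * e * t\<^sup>2)"
        proof (intro mult_mono s)
          show "0 \<le> (?k t)\<^sup>2 - (a - b)\<^sup>2" using tr power_mono[of "\<bar>a - b\<bar>" "?k t" 2] by simp
        qed auto
        then show ?case unfolding f_def
          by (intro tri_density_lower_bound) (use elim pos in auto)
      qed
      then show False by (rule not_integrable_at_0[OF int C])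
    next
      assume F0: "F = at_left pi \<and> a + b = c + e"
      have "\<forall>\<^sub>F t in at_left pi. ?C / (pi - t) \<le> \<bar>f a b c e t\<bar>"
        using ev evN unfolding conjunct1[OF F0]
      proof eventually_elim
        case (elim t)
        have s: "(a + b)\<^sup>2 - (?k t)\<^sup>2 \<le> c * e * (pi - t)\<^sup>2"
        proof -
          have "(a + b)\<^sup>2 - (?k t)\<^sup>2 = c * e * (2 * (1 + cos t))"
            unfolding conjunct2[OF F0] tri_side_sq by (simp add: power2_eq_square algebra_simps)
          also have "2 * (1 + cos t) = 4 * (sin ((pi - t) / 2))\<^sup>2"
          proof -
            have h: "2 * ((pi - t) / 2) = pi - t" by simp
            have "cos (pi - t) = 1 - 2 * (sin ((pi - t) / 2))\<^sup>2"
              using cos_double_sin[of "(pi - t) / 2"] by (simp only: h)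
            moreover have "2 * (1 + x) = 4 * y" if "- x = 1 - 2 * y" for x y :: real
            proof -
              have "2 * (1 + x) = 2 - 2 * (- x)" by (simp add: algebra_simps)
              also have "\<dots> = 4 * y" unfolding that by (simp add: algebra_simps)
              finally show ?thesis .
            qed
            ultimately show ?thesis unfolding cos_pi_minus by blast
          qed
          also have "c * e * (4 * (sin ((pi - t) / 2))\<^sup>2) \<le> c * e * (4 * ((pi - t) / 2)\<^sup>2)"
          proof (intro mult_left_mono)
            have "\<bar>sin ((pi - t) / 2)\<bar> \<le> \<bar>(pi - t) / 2\<bar>" by (rule abs_sin_x_le_abs_x)
            then show "(sin ((pi - t) / 2))\<^sup>2 \<le> ((pi - t) / 2)\<^sup>2" by (simp only: abs_le_square_iff)
          qed (use pos in auto)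
          finally show ?thesis by (simp add: power_divide)
        qed
        have tr: "\<bar>a - b\<bar> < ?k t" "?k t < a + b" using elim pos by (auto simp: is_triangle_iff)
        have k2: "(a - b)\<^sup>2 \<le> (?k t)\<^sup>2" using tr power_mono[of "\<bar>a - b\<bar>" "?k t" 2] by simp
        have "(?k t)\<^sup>2 \<le> (a + b)\<^sup>2" using tr tri_side_nonneg by (intro power_mono) auto
        then have "(?k t)\<^sup>2 - (a - b)\<^sup>2 \<le> (a + b)\<^sup>2" using zero_le_power2[of "a - b"] by linarith
        then have "((a + b)\<^sup>2 - (?k t)\<^sup>2) * ((?k t)\<^sup>2 - (a - b)\<^sup>2) \<le> (c * e * (pi - t)\<^sup>2) * (a + b)\<^sup>2"
          using k2 pos by (intro mult_mono s) auto
        then show ?case unfolding f_def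
          by (intro tri_density_lower_bound) (use elim pos in \<open>auto simp: mult.commute\<close>)
      qed
      then show False by (rule not_integrable_at_pi[OF int C])
    qed
  qed
  have tri_ce: "is_triangle c e (?k t)" if "0 < t" "t < pi" for t
    using tri_side_range[OF pos(3,4) that] pos by (simp add: is_triangle_iff)
  have commute: "is_triangle b a s = is_triangle a b s" for s by (auto simp: is_triangle_def)
  \<comment> \<open>The diagonal tends to a positive degenerate length, so every angle in the
    cosines tends to 0 or \<pi>.\<close>
  have degenerate: False
    if F: "F \<noteq> bot" and k: "(?k \<longlongrightarrow> s) F" and s: "0 < s" "s = a + b \<or> s = \<bar>a - b\<bar>" "s = c + e \<or> s = \<bar>c - e\<bar>"
      and id: "((\<lambda>t. t) \<longlongrightarrow> y) F" and y: "y \<in> {0, pi}"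
      and ev: "\<forall>\<^sub>F t in F. 0 < t \<and> t < pi \<and> is_triangle a b (?k t)"
      and F0: "F = at_right 0 \<and> \<bar>a - b\<bar> = \<bar>c - e\<bar> \<or> F = at_left pi \<and> a + b = c + e" for F s y
  proof (rule key[OF F k ev _ _ F0])
    have t1: "((\<lambda>t. tri_angle a b (?k t)) \<longlongrightarrow> tri_angle a b s) F"
      by (rule tendsto_tri_angle[OF k F s(1) pos(2)]) (use ev in \<open>auto elim: eventually_mono\<close>)
    have t2: "((\<lambda>t. tri_angle b a (?k t)) \<longlongrightarrow> tri_angle b a s) F"
      by (rule tendsto_tri_angle[OF k F s(1) pos(1)]) (use ev in \<open>auto elim: eventually_mono simp: commute\<close>)
    have t3: "((\<lambda>t. tri_angle c e (?k t)) \<longlongrightarrow> tri_angle c e s) F"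
      by (rule tendsto_tri_angle[OF k F s(1) pos(4)]) (use ev in \<open>auto elim: eventually_mono intro: tri_ce\<close>)
    show "(?N \<longlongrightarrow> cos (of_int m * tri_angle b a s - of_int n * tri_angle a b s) * cos (of_int (m + n) * tri_angle c e s - of_int j * y)) F"
      by (intro tendsto_intros t1 t2 t3 id)
    have s': "s = b + a \<or> s = \<bar>b - a\<bar>" using s(2) by (auto simp: add.commute abs_minus_commute)
    have A1: "tri_angle a b s \<in> {0, pi}" by (rule tri_angle_degenerate[OF pos(2) s(1) s(2)])
    have A2: "tri_angle b a s \<in> {0, pi}" by (rule tri_angle_degenerate[OF pos(1) s(1) s'])
    have A3: "tri_angle c e s \<in> {0, pi}" by (rule tri_angle_degenerate[OF pos(4) s(1) s(3)])
    show "\<bar>cos (of_int m * tri_angle b a s - of_int n * tri_angle a b s) * cos (of_int (m + n) * tri_angle c e s - of_int j * y)\<bar> = 1"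
      unfolding abs_mult using abs_cos_multiples[OF A2 A1, of m n] abs_cos_multiples[OF A3 y, of "m + n" j]
      by (simp only: mult_1)
  qed
  show "a + b \<noteq> c + e"
  proof
    assume eq: "a + b = c + e"
    have "\<forall>\<^sub>F t in at_left pi. \<bar>a - b\<bar> < ?k t" using limpi quad by (intro order_tendstoD) auto
    then have ev: "\<forall>\<^sub>F t in at_left pi. 0 < t \<and> t < pi \<and> is_triangle a b (?k t)"
      using evpi
    proof eventually_elim
      case (elim t)
      then show ?case using tri_side_range(2)[OF pos(3,4), of t] eq pos by (simp add: is_triangle_iff)
    qed
    show False
      by (rule degenerate[OF _ limpi _ _ _ tendsto_ident_at _ ev]) (use eq pos in auto)
  qed
  show "\<bar>a - b\<bar> \<noteq> \<bar>c - e\<bar> \<or> a = b \<and> c = e \<and> odd (m + n)"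
  proof (rule ccontr)
    assume "\<not> ?thesis"
    then have eq: "\<bar>a - b\<bar> = \<bar>c - e\<bar>" and ne: "\<not> (a = b \<and> c = e \<and> odd (m + n))" by auto
    have "\<forall>\<^sub>F t in at_right 0. ?k t < a + b" using lim0 quad by (intro order_tendstoD) auto
    then have ev: "\<forall>\<^sub>F t in at_right 0. 0 < t \<and> t < pi \<and> is_triangle a b (?k t)"
      using ev0
    proof eventually_elim
      case (elim t)
      then show ?case using tri_side_range(1)[OF pos(3,4), of t] eq pos by (simp add: is_triangle_iff)
    qed
    show False
    proof (cases "c = e")
      case False
      show False
        by (rule degenerate[OF _ lim0 _ _ _ tendsto_ident_at _ ev]) (use eq pos False in auto)
    next
      \<comment> \<open>Both triangles are isosceles and their common base shrinks to 0. The base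
        angles \<open>arccos (k / (2 r))\<close> tend to a right angle, and parity decides.\<close>
      case True
      then have ab: "a = b" and evn: "even (m + n)" using eq ne by auto
      have kz: "(?k \<longlongrightarrow> 0) (at_right 0)" using lim0 True by simp
      have half: "((\<lambda>t. tri_angle r r (?k t)) \<longlongrightarrow> pi / 2) (at_right 0)" if r: "0 < r" for r
      proof -
        have "((\<lambda>t. ?k t / (2 * r)) \<longlongrightarrow> 0 / (2 * r)) (at_right 0)" by (intro tendsto_intros kz) (use r in simp)
        then have "((\<lambda>t. ?k t / (2 * r)) \<longlongrightarrow> 0) (at_right 0)" by simp
        moreover have "isCont arccos (0::real)" by (rule isCont_arccos) auto
        ultimately have "((\<lambda>t. arccos (?k t / (2 * r))) \<longlongrightarrow> arccos 0) (at_right 0)"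
          by (rule isCont_tendsto_compose[rotated])
        then have "((\<lambda>t. arccos (?k t / (2 * r))) \<longlongrightarrow> pi / 2) (at_right 0)" by simp
        then show ?thesis
        proof (rule Lim_transform_eventually)
          show "\<forall>\<^sub>F t in at_right 0. arccos (?k t / (2 * r)) = tri_angle r r (?k t)"
            using ev0
          proof eventually_elim
            case (elim t)
            then have "0 < ?k t" using tri_side_pos[OF pos(3,4)] by simp
            then show ?case using r by (simp add: tri_angle_def power2_eq_square)
          qed
        qed
      qed
      \<comment> \<open>Even sum and difference turn the multiples of \<open>pi / 2\<close> into
        integer multiples of \<open>pi\<close>, where the cosine has modulus 1.\<close>
      have "even (m - n)" using evn by simp
      then obtain i where i: "m - n = 2 * i" by (elim evenE)
      obtain i' where i': "m + n = 2 * i'" using evn by (elim evenE)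
      have mn: "of_int m * (pi / 2) - of_int n * (pi / 2) = of_int i * pi"
      proof -
        have "of_int m * (pi / 2) - of_int n * (pi / 2) = of_int (m - n) * (pi / 2)" by (simp add: left_diff_distrib)
        then show ?thesis unfolding i by simp
      qed
      have mn': "of_int (m + n) * (pi / 2) - of_int j * 0 = of_int i' * pi" unfolding i' by simp
      show False
      proof (rule key[OF _ kz ev])
        show "(?N \<longlongrightarrow> cos (of_int m * (pi / 2) - of_int n * (pi / 2)) * cos (of_int (m + n) * (pi / 2) - of_int j * 0)) (at_right 0)"
          unfolding ab True by (intro tendsto_intros half[unfolded True] pos)
        show "\<bar>cos (of_int m * (pi / 2) - of_int n * (pi / 2)) * cos (of_int (m + n) * (pi / 2) - of_int j * 0)\<bar> = 1"
          unfolding mn mn' abs_mult by (simp add: abs_cos_int_pi)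
      qed (use eq in auto)
    qed
  qed
qed

section \<open>The multilateral formula\<close>

lemma multilateral_integrand_eq:
  "multilateral_integrand p l \<rho> \<beta> =
     tri_density (l 1) (l 2) (\<rho> 1) (\<rho> 2) (diag p \<rho> \<beta> 1) * angle_factor p l \<rho> 1 \<beta>"
proof -
  have "(\<Prod>k=2..p - 2. cos (alpha p \<rho> \<beta> (k + 1) * (\<Sum>j=1..k. l j) - l (k + 1) * \<beta> (k - 1))) = angle_factor p l \<rho> 1 \<beta>"
    unfolding angle_factor_def by (intro prod.cong) (auto simp: alpha_def)
  then show ?thesis
    by (simp add: multilateral_integrand_def tri_density_def alpha_def)
qed

lemma borel_measurable_multilateral_integrand:
  "multilateral_integrand p l \<rho> \<in> borel_measurable (angle_cube {1..p - 3})"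
proof -
  have [measurable]: "(\<lambda>\<beta>. diag p \<rho> \<beta> 1) \<in> borel_measurable (angle_cube {1..p - 3})"
    "angle_factor p l \<rho> 1 \<in> borel_measurable (angle_cube {1..p - 3})"
    by (auto intro: borel_measurable_diag borel_measurable_angle_factor)
  show ?thesis unfolding multilateral_integrand_eq[abs_def] by measurable
qed

lemma multilateral_integrand_angle_cube:
  shows "set_integrable (angle_measure p) (angle_domain p) (multilateral_integrand p l \<rho>) \<longleftrightarrow>
      integrable (angle_cube {1..p - 3}) (multilateral_integrand p l \<rho>)"
    and "set_lebesgue_integral (angle_measure p) (angle_domain p) (multilateral_integrand p l \<rho>) =
      (LINT \<beta>|angle_cube {1..p - 3}. multilateral_integrand p l \<rho> \<beta>)"
proof -
  let ?D = "\<Pi>\<^sub>E k\<in>{1..p - 3}. {0<..<pi}"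
  have m: "multilateral_integrand p l \<rho> \<in> borel_measurable (Pi\<^sub>M {1..p - 3} (\<lambda>_. lborel))"
    using borel_measurable_multilateral_integrand[of p l \<rho>]
    by (simp only: measurable_cong_sets[OF sets_angle_cube refl])
  have D: "?D \<in> sets (Pi\<^sub>M {1..p - 3} (\<lambda>_. lborel))"
    by (rule sets_PiM_I_finite) auto
  have c: "angle_cube {1..p - 3} = density (Pi\<^sub>M {1..p - 3} (\<lambda>_. lborel)) (\<lambda>x. ennreal (indicator ?D x))"
    unfolding density_angle_cube[OF finite_atLeastAtMost, symmetric] ennreal_indicator ..
  show "set_integrable (angle_measure p) (angle_domain p) (multilateral_integrand p l \<rho>) \<longleftrightarrow>
      integrable (angle_cube {1..p - 3}) (multilateral_integrand p l \<rho>)"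
    unfolding c set_integrable_def angle_measure_def angle_domain_def
    by (rule integrable_density[OF m borel_measurable_indicator[OF D], symmetric]) simp
  show "set_lebesgue_integral (angle_measure p) (angle_domain p) (multilateral_integrand p l \<rho>) =
      (LINT \<beta>|angle_cube {1..p - 3}. multilateral_integrand p l \<rho> \<beta>)"
    unfolding c set_lebesgue_integral_def angle_measure_def angle_domain_def
    by (rule integral_density[OF m borel_measurable_indicator[OF D], symmetric]) simp
qed

lemma bessel_integrand_eq:
  assumes p: "4 \<le> p"
  shows "bessel_integrand p l \<rho> x = x * (bessel_J (l 1) (\<rho> 1 * x) * bessel_J (l 2) (\<rho> 2 * x) *
     (bessel_J (\<Sum>i=1..p - 1. l i) (\<rho> p * x) * (\<Prod>k=3..p - 1. bessel_J (l k) (\<rho> k * x))))"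
proof -
  have "{1..p - 1} = insert 1 (insert 2 {3..p - 1})" using p by auto
  then have "(\<Prod>k=1..p - 1. bessel_J (l k) (\<rho> k * x)) =
      bessel_J (l 1) (\<rho> 1 * x) * (bessel_J (l 2) (\<rho> 2 * x) * (\<Prod>k=3..p - 1. bessel_J (l k) (\<rho> k * x)))"
    by simp
  then show ?thesis unfolding bessel_integrand_def by (simp only: mult_ac)
qed

lemma gauss_sum_bessel_integrand:
  assumes p: "4 \<le> p"
  shows "gauss_sum (bessel_integrand p l \<rho>) (\<lambda>t. t) \<epsilon> =
    (LINT x|gauss_measure \<epsilon>. bessel_J (l 1) (\<rho> 1 * x) * bessel_J (l 2) (\<rho> 2 * x) *
     (bessel_J (\<Sum>i=1..p - 1. l i) (\<rho> p * x) * (\<Prod>k=3..p - 1. bessel_J (l k) (\<rho> k * x))))"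
    (is "_ = (LINT x|_. ?g x)")
proof -
  have "(LINT x|gauss_measure \<epsilon>. ?g x) = (LINT x|lborel. (indicator {0..} x * (x * exp (- \<epsilon> * x\<^sup>2))) *\<^sub>R ?g x)"
    unfolding gauss_measure_def by (rule integral_density) (auto simp: indicator_def)
  also have "\<dots> = gauss_sum (bessel_integrand p l \<rho>) (\<lambda>t. t) \<epsilon>"
    unfolding gauss_sum_def bessel_integrand_eq[OF p] real_scaleR_def by (simp only: mult_ac)
  finally show ?thesis ..
qed

text \<open>Dominated convergence with an unspecified majorant \<open>D\<close>, because different
  majorants are needed in different cases. Integrability of the limit comes out of the same
  argument.\<close>

lemma gauss_sum_tendsto_multilateral:
  assumes \<rho>: "\<And>i. i \<in> {1..p} \<Longrightarrow> 0 < \<rho> i" and p: "4 \<le> p" and C: "0 \<le> C"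
    and D [measurable]: "D \<in> borel_measurable borel" and D0: "\<And>s. 0 \<le> D s"
    and fin: "(\<integral>\<^sup>+\<beta>. ennreal (D (diag p \<rho> \<beta> 1)) \<partial>angle_cube {1..p - 3}) < \<infinity>"
    and bd: "\<And>d s. 0 < d \<Longrightarrow> 0 < s \<Longrightarrow> s \<noteq> \<rho> 1 + \<rho> 2 \<Longrightarrow> s \<noteq> \<bar>\<rho> 1 - \<rho> 2\<bar> \<Longrightarrow>
      \<bar>triple_mean (l 1) (l 2) (\<rho> 1) (\<rho> 2) (d\<^sup>2) s\<bar> \<le> C * D s"
  shows "integrable (angle_cube {1..p - 3}) (multilateral_integrand p l \<rho>)"
    and "((\<lambda>\<epsilon>. gauss_sum (bessel_integrand p l \<rho>) (\<lambda>t. t) \<epsilon>) \<longlongrightarrow>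
      1 / pi ^ (p - 2) * (LINT \<beta>|angle_cube {1..p - 3}. multilateral_integrand p l \<rho> \<beta>)) (at_right 0)"
proof -
  let ?M = "angle_cube {1..p - 3}" and ?a = "\<rho> 1" and ?b = "\<rho> 2"
  let ?k = "\<lambda>\<beta>. diag p \<rho> \<beta> 1"
  let ?T = "angle_factor p l \<rho> 1"
  let ?F = "multilateral_integrand p l \<rho>"
  have ab: "0 < ?a" "0 < ?b" by (rule \<rho>; use p in auto)+
  have km [measurable]: "?k \<in> borel_measurable ?M" by (rule borel_measurable_diag) simp
  have [measurable]: "?T \<in> borel_measurable ?M" by (rule borel_measurable_angle_factor) simp
  have [measurable]: "?F \<in> borel_measurable ?M" by (rule borel_measurable_multilateral_integrand)
  have neq: "AE \<beta> in ?M. ?k \<beta> \<noteq> c" for c by (rule AE_diag_neq[OF \<rho> p])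
  have pos: "AE \<beta> in ?M. 0 < ?k \<beta>"
    using AE_angle_cube[of "{1..p - 3}", simplified]
    by eventually_elim (rule diag_pos[OF \<rho> p], auto)
  have iD: "integrable ?M (\<lambda>\<beta>. C * D (?k \<beta>))"
  proof -
    have "(\<lambda>\<beta>. D (?k \<beta>)) \<in> borel_measurable ?M" by measurable
    then have "integrable ?M (\<lambda>\<beta>. D (?k \<beta>))" using fin D0 by (simp add: integrable_iff_bounded)
    then show ?thesis by (rule integrable_mult_right)
  qed
  have main: "integrable ?M (\<lambda>\<beta>. ?F \<beta> / pi) \<and>
     (\<lambda>i. gauss_sum (bessel_integrand p l \<rho>) (\<lambda>t. t) ((d i)\<^sup>2)) \<longlonglongrightarrow> (LINT \<beta>|?M. ?F \<beta> / pi) / pi ^ (p - 3)"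
    if d: "d \<longlonglongrightarrow> 0" "\<And>i. 0 < d i" for d
  proof -
    let ?V = "\<lambda>i \<beta>. triple_mean (l 1) (l 2) ?a ?b ((d i)\<^sup>2) (?k \<beta>) * ?T \<beta>"
    have tm: "triple_mean (l 1) (l 2) ?a ?b ((d i)\<^sup>2) \<in> borel_measurable borel" for i
      by (rule borel_measurable_triple_mean) (use d(2)[of i] in simp)
    have [measurable]: "(\<lambda>\<beta>. triple_mean (l 1) (l 2) ?a ?b ((d i)\<^sup>2) (?k \<beta>)) \<in> borel_measurable ?M" for i
      by (rule measurable_compose[OF km tm])
    have m1: "(\<lambda>\<beta>. ?F \<beta> / pi) \<in> borel_measurable ?M" "?V i \<in> borel_measurable ?M" for i by measurable
    have lim: "AE \<beta> in ?M. (\<lambda>i. ?V i \<beta>) \<longlonglongrightarrow> ?F \<beta> / pi"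
      using pos neq[of "?a + ?b"] neq[of "\<bar>?a - ?b\<bar>"]
    proof eventually_elim
      case (elim \<beta>)
      have "(\<lambda>i. triple_mean (l 1) (l 2) ?a ?b ((d i)\<^sup>2) (?k \<beta>)) \<longlonglongrightarrow> tri_density (l 1) (l 2) ?a ?b (?k \<beta>) / pi"
        by (rule triple_mean_tendsto[OF ab _ _ _ d]) (use elim in auto)
      from tendsto_mult_right[OF this, of "?T \<beta>"] show ?case
        unfolding multilateral_integrand_eq by simp
    qed
    have dom: "AE \<beta> in ?M. norm (?V i \<beta>) \<le> C * D (?k \<beta>)" for i
      using pos neq[of "?a + ?b"] neq[of "\<bar>?a - ?b\<bar>"]
    proof eventually_elim
      case (elim \<beta>)
      have "\<bar>triple_mean (l 1) (l 2) ?a ?b ((d i)\<^sup>2) (?k \<beta>)\<bar> * \<bar>?T \<beta>\<bar> \<le> C * D (?k \<beta>) * 1"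
        using elim d(2) C D0 abs_angle_factor_le_1 by (intro mult_mono bd) auto
      then show ?case by (simp add: abs_mult)
    qed
    have "integrable ?M (\<lambda>\<beta>. ?F \<beta> / pi)"
      by (rule integrable_dominated_convergence[OF m1 iD lim dom])
    moreover have "(\<lambda>i. LINT \<beta>|?M. ?V i \<beta>) \<longlonglongrightarrow> (LINT \<beta>|?M. ?F \<beta> / pi)"
      by (rule integral_dominated_convergence[OF m1 iD lim dom])
    moreover have "gauss_sum (bessel_integrand p l \<rho>) (\<lambda>t. t) ((d i)\<^sup>2) = (LINT \<beta>|?M. ?V i \<beta>) / pi ^ (p - 3)" for i
    proof -
      have "(LINT \<beta>|?M. ?V i \<beta>) = pi ^ (p - 3) * gauss_sum (bessel_integrand p l \<rho>) (\<lambda>t. t) ((d i)\<^sup>2)"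
        unfolding gauss_sum_bessel_integrand[OF p]
        by (rule gauss_angle_cube[OF \<rho> p]) (use d(2)[of i] in \<open>auto simp: numeral_2_eq_2\<close>)
      then show ?thesis by simp
    qed
    ultimately show ?thesis by (simp only:) (intro conjI tendsto_divide tendsto_const, auto)
  qed
  \<comment> \<open>The integrability does not refer to the sequence, so one instance settles
    it.\<close>
  have seq: "(\<lambda>i. 1 / real (Suc i)) \<longlonglongrightarrow> 0"
    using LIMSEQ_inverse_real_of_nat by (simp add: inverse_eq_divide)
  have "integrable ?M (\<lambda>\<beta>. ?F \<beta> / pi)" using main[OF seq] by simp
  then have "integrable ?M (\<lambda>\<beta>. pi * (?F \<beta> / pi))" by (rule integrable_mult_right)
  moreover have "pi * (?F \<beta> / pi) = ?F \<beta>" for \<beta> by simp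
  ultimately show "integrable ?M ?F" by (simp only:)
  have val: "(LINT \<beta>|?M. ?F \<beta> / pi) / pi ^ (p - 3) = 1 / pi ^ (p - 2) * (LINT \<beta>|?M. ?F \<beta>)"
  proof -
    have "p - 2 = Suc (p - 3)" using p by simp
    then show ?thesis by simp
  qed
  show "((\<lambda>\<epsilon>. gauss_sum (bessel_integrand p l \<rho>) (\<lambda>t. t) \<epsilon>) \<longlongrightarrow> 1 / pi ^ (p - 2) * (LINT \<beta>|?M. ?F \<beta>)) (at_right 0)"
    unfolding tendsto_at_iff_sequentially o_def
  proof (intro allI impI)
    \<comment> \<open>An arbitrary sequence of times becomes a sequence of lengths
      \<open>d = sqrt (X i)\<close>.\<close>
    fix X :: "nat \<Rightarrow> real" assume X: "\<forall>i. X i \<in> {0<..} - {0}" "X \<longlonglongrightarrow> 0"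
    have Xp: "0 < X i" for i using X(1) by auto
    have "(\<lambda>i. sqrt (X i)) \<longlonglongrightarrow> sqrt 0" by (intro tendsto_intros X)
    then have "(\<lambda>i. sqrt (X i)) \<longlonglongrightarrow> 0" by simp
    from main[OF this] Xp have "(\<lambda>i. gauss_sum (bessel_integrand p l \<rho>) (\<lambda>t. t) ((sqrt (X i))\<^sup>2)) \<longlonglongrightarrow> (LINT \<beta>|?M. ?F \<beta> / pi) / pi ^ (p - 3)"
      by simp
    moreover have "(sqrt (X i))\<^sup>2 = X i" for i using Xp[of i] by simp
    ultimately show "(\<lambda>i. gauss_sum (bessel_integrand p l \<rho>) (\<lambda>t. t) (X i)) \<longlonglongrightarrow> 1 / pi ^ (p - 2) * (LINT \<beta>|?M. ?F \<beta>)"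
      by (simp only: val)
  qed
qed

section \<open>From the Gaussian limit to the improper integral\<close>

lemma abs_bessel_integrand_le:
  assumes p: "4 \<le> p"
  shows "\<bar>bessel_integrand p l \<rho> x\<bar> \<le> 1 * \<bar>x\<bar>"
proof -
  have P: "\<bar>\<Prod>k=3..p - 1. bessel_J (l k) (\<rho> k * x)\<bar> \<le> 1"
    unfolding abs_prod by (rule prod_le_1) (auto simp: abs_bessel_J_le_1)
  have "\<bar>bessel_J (l 1) (\<rho> 1 * x) * bessel_J (l 2) (\<rho> 2 * x) *
     (bessel_J (\<Sum>i=1..p - 1. l i) (\<rho> p * x) * (\<Prod>k=3..p - 1. bessel_J (l k) (\<rho> k * x)))\<bar> \<le> 1"
    by (intro abs_bessel_mult_le abs_bessel_J_le_1 P)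
  then show ?thesis unfolding bessel_integrand_eq[OF p] abs_mult[of x] by (simp add: mult_left_le)
qed

text \<open>Four factors, those of the first three sides and of the last one, against the weight
  \<open>x\<close> give \<open>1 / x\<close>; the others are at most 1.\<close>

lemma bessel_integrand_decay:
  assumes \<rho>: "\<And>i. i \<in> {1..p} \<Longrightarrow> 0 < \<rho> i" and p: "4 \<le> p"
  obtains C where "0 < C" "\<And>x. 0 < x \<Longrightarrow> \<bar>bessel_integrand p l \<rho> x\<bar> \<le> C / x"
proof -
  let ?L = "\<Sum>i=1..p - 1. l i"
  have rp: "0 < \<rho> p" by (rule \<rho>) (use p in auto)
  have r: "\<And>k. k \<in> {1..3} \<Longrightarrow> 0 < \<rho> k" using \<rho> p by simp
  obtain K where K: "0 < K" "\<And>x. 0 < x \<Longrightarrow> \<bar>bessel_J ?L (\<rho> p * x)\<bar> \<le> K * (1 / sqrt x)"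
    using bessel_J_scaled_decay[OF rp] by blast
  obtain K' where K': "0 < K'" "\<And>x. 0 < x \<Longrightarrow> \<bar>\<Prod>k\<in>{1..3}. bessel_J (l k) (\<rho> k * x)\<bar> \<le> K' * (1 / sqrt x) ^ card {1..3 :: nat}"
    using bessel_J_prod_decay[where r = \<rho> and l = l, OF finite_atLeastAtMost r] by blast
  show ?thesis
  proof (rule that[of "K * K'"])
    show "0 < K * K'" using K K' by simp
    fix x :: real assume x: "0 < x"
    have "\<bar>\<Prod>k=1..p - 1. bessel_J (l k) (\<rho> k * x)\<bar> \<le> \<bar>\<Prod>k\<in>{1..3}. bessel_J (l k) (\<rho> k * x)\<bar>"
      by (rule abs_bessel_J_prod_le_subset) (use p in auto)
    also have "\<dots> \<le> K' * (1 / sqrt x) ^ card {1..3 :: nat}" by (rule K'(2)[OF x])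
    finally have P: "\<bar>\<Prod>k=1..p - 1. bessel_J (l k) (\<rho> k * x)\<bar> \<le> K' * (1 / sqrt x) ^ 3" by simp
    have "\<bar>bessel_integrand p l \<rho> x\<bar> = \<bar>bessel_J ?L (\<rho> p * x)\<bar> * \<bar>\<Prod>k=1..p - 1. bessel_J (l k) (\<rho> k * x)\<bar> * x"
      using x by (simp add: bessel_integrand_def abs_mult)
    also have "\<dots> \<le> (K * (1 / sqrt x)) * (K' * (1 / sqrt x) ^ 3) * x"
      using x K K' P by (intro mult_right_mono mult_mono) auto
    also have "\<dots> = K * K' * ((1 / sqrt x) ^ 4 * x)" by (simp add: power_numeral_reduce)
    also have "(1 / sqrt x) ^ 4 * x = 1 / x"
    proof -
      have "y ^ 4 = (y\<^sup>2)\<^sup>2" for y :: real by (simp flip: power_mult)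
      then have "(1 / sqrt x) ^ 4 = ((1 / sqrt x)\<^sup>2)\<^sup>2" .
      also have "(1 / sqrt x)\<^sup>2 = 1 / x" using x by (simp add: power_divide)
      finally have q: "(1 / sqrt x) ^ 4 = (1 / x)\<^sup>2" .
      show ?thesis unfolding q using x by (simp add: power2_eq_square)
    qed
    finally show "\<bar>bessel_integrand p l \<rho> x\<bar> \<le> K * K' / x" by simp
  qed
qed

lemma continuous_on_bessel_integrand: "continuous_on S (bessel_integrand p l \<rho>)"
  unfolding bessel_integrand_def by (intro continuous_intros)

lemma has_improper_integral_bessel_integrand:
  assumes \<rho>: "\<And>i. i \<in> {1..p} \<Longrightarrow> 0 < \<rho> i" and p: "4 \<le> p"
    and lim: "((\<lambda>\<epsilon>. gauss_sum (bessel_integrand p l \<rho>) (\<lambda>t. t) \<epsilon>) \<longlongrightarrow> I) (at_right 0)"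
  shows "has_improper_integral (bessel_integrand p l \<rho>) I"
  unfolding has_improper_integral_def
proof (intro conjI allI impI)
  let ?f = "bessel_integrand p l \<rho>"
  show "?f integrable_on {0..L}" for L
    by (intro integrable_continuous_real continuous_on_bessel_integrand)
  obtain C where C: "0 < C" "\<And>x. 0 < x \<Longrightarrow> \<bar>?f x\<bar> \<le> C / x"
    using bessel_integrand_decay[where \<rho> = \<rho> and l = l, OF \<rho> p] by blast
  have m: "?f \<in> borel_measurable borel"
    by (rule borel_measurable_continuous_onI) (rule continuous_on_bessel_integrand)
  have "integral {0..L} ?f = (LINT x|lborel. indicator {0..L} x * ?f x)" for L
  proof -
    have "set_integrable lborel {0..L} ?f"
      by (rule borel_integrable_atLeastAtMost') (rule continuous_on_bessel_integrand)
    then have "(LINT x:{0..L}|lborel. ?f x) = integral {0..L} ?f"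
      by (rule set_borel_integral_eq_integral)
    then show ?thesis by (simp add: set_lebesgue_integral_def)
  qed
  then show "((\<lambda>L. integral {0..L} ?f) \<longlongrightarrow> I) at_top"
    using gauss_summable_imp_improper_integral[OF m abs_bessel_integrand_le[OF p] C lim] by (simp only:)
qed

text \<open>Both base angles are \<open>(pi - t) / 2\<close>. For odd \<open>m - n\<close> the
  cosine of \<open>(m - n) pi / 2\<close> vanishes and a sine of \<open>(m - n) t / 2\<close> is
  left, of order \<open>t\<close>; the base \<open>2 a sin (t / 2)\<close> is at least
  \<open>a t / 2\<close>.\<close>

lemma isosceles_cos_bound:
  assumes a: "0 < a" and odd: "odd (m + n)" and t: "0 < t" "t < pi"
  shows "\<bar>cos (of_int m * tri_angle a a (tri_side a a t) - of_int n * tri_angle a a (tri_side a a t))\<bar>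
    \<le> \<bar>of_int (m - n)\<bar> / a * tri_side a a t"
proof -
  let ?A = "tri_angle a a (tri_side a a t)"
  have A: "?A = pi / 2 - t / 2" using tri_angle_sum[OF a a t] by simp
  have "odd (m - n)" using odd by simp
  then obtain k where k: "m - n = 2 * k + 1" by (elim oddE)
  have "of_int m * ?A - of_int n * ?A = of_int (m - n) * (pi / 2 - t / 2)"
    unfolding A by (simp add: left_diff_distrib)
  also have "\<dots> = of_int (m - n) * (pi / 2) - of_int (m - n) * (t / 2)" by (rule right_diff_distrib)
  finally have e: "of_int m * ?A - of_int n * ?A = of_int (m - n) * (pi / 2) - of_int (m - n) * (t / 2)" .
  have "of_int (m - n) * (pi / 2) = of_int k * pi + pi / 2" unfolding k by (simp add: ring_distribs)
  then have "cos (of_int (m - n) * (pi / 2)) = 0" by (simp only:) (simp add: cos_add sin_times_pi_eq_0)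
  then have "\<bar>cos (of_int m * ?A - of_int n * ?A)\<bar> = \<bar>sin (of_int (m - n) * (pi / 2))\<bar> * \<bar>sin (of_int (m - n) * (t / 2))\<bar>"
    unfolding e cos_diff by (simp add: abs_mult)
  also have "\<dots> \<le> 1 * \<bar>of_int (m - n) * (t / 2)\<bar>"
    by (intro mult_mono abs_sin_x_le_abs_x) auto
  also have "\<dots> = \<bar>of_int (m - n)\<bar> / a * (a * (t / 2))" using t a by (simp add: abs_mult)
  also have "\<dots> \<le> \<bar>of_int (m - n)\<bar> / a * tri_side a a t"
  proof (rule mult_left_mono)
    have "(tri_side a a t)\<^sup>2 = (2 * a * sin (t / 2))\<^sup>2"
      unfolding tri_side_sq_sin by (simp add: power_mult_distrib power2_eq_square)
    moreover have "0 \<le> 2 * a * sin (t / 2)" using a t by (intro mult_nonneg_nonneg sin_ge_zero) auto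
    ultimately have "tri_side a a t = 2 * a * sin (t / 2)"
      using power2_eq_imp_eq[OF _ tri_side_nonneg] by blast
    moreover have "t / 2 / 2 \<le> sin (t / 2)" using t by (intro sin_ge_half) auto
    then have "2 * a * (t / 2 / 2) \<le> 2 * a * sin (t / 2)" using a by (intro mult_left_mono) auto
    ultimately show "a * (t / 2) \<le> tri_side a a t" by simp
  qed (use a in simp)
  finally show ?thesis .
qed

section \<open>Four sides, and the conclusion\<close>

lemma nn_integral_diag_quadrilateral:
  assumes D: "D \<in> borel_measurable borel"
  shows "(\<integral>\<^sup>+\<beta>. ennreal (D (diag 4 \<rho> \<beta> 1)) \<partial>angle_cube {1..4 - 3}) =
    (\<integral>\<^sup>+t. ennreal (D (tri_side (\<rho> 3) (\<rho> 4) t)) * indicator {0<..<pi} t \<partial>lborel)"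
proof -
  interpret A: product_sigma_finite "\<lambda>_::nat. angle_interval" by (rule product_sigma_finite_angle)
  note [measurable] = D
  have "diag 4 \<rho> \<beta> 1 = tri_side (\<rho> 3) (\<rho> 4) (\<beta> 1)" for \<beta>
    using diag_step[of 1 4 \<rho> \<beta>] diag_last[of 4 2 \<rho> \<beta>] by (simp add: numeral_2_eq_2 numeral_3_eq_3)
  then have "(\<integral>\<^sup>+\<beta>. ennreal (D (diag 4 \<rho> \<beta> 1)) \<partial>angle_cube {1..4 - 3}) =
     (\<integral>\<^sup>+\<beta>. ennreal (D (tri_side (\<rho> 3) (\<rho> 4) (\<beta> 1))) \<partial>angle_cube {1})"
    by simp
  also have "\<dots> = (\<integral>\<^sup>+t. ennreal (D (tri_side (\<rho> 3) (\<rho> 4) t)) \<partial>angle_interval)"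
    by (rule A.product_nn_integral_singleton) measurable
  also have "\<dots> = (\<integral>\<^sup>+t. ennreal (D (tri_side (\<rho> 3) (\<rho> 4) t)) * indicator {0<..<pi} t \<partial>lborel)"
    by (rule nn_integral_angle_interval) measurable
  finally show ?thesis .
qed

lemma integrable_quadrilateral:
  assumes int: "integrable (angle_cube {1..4 - 3}) (multilateral_integrand 4 l \<rho>)"
  shows "integrable angle_interval (\<lambda>t. tri_density (l 1) (l 2) (\<rho> 1) (\<rho> 2) (tri_side (\<rho> 3) (\<rho> 4) t) *
    cos (of_int (l 1 + l 2) * tri_angle (\<rho> 3) (\<rho> 4) (tri_side (\<rho> 3) (\<rho> 4) t) - of_int (l 3) * t))"
proof -
  interpret A: product_sigma_finite "\<lambda>_::nat. angle_interval" by (rule product_sigma_finite_angle)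
  let ?g = "\<lambda>t. tri_density (l 1) (l 2) (\<rho> 1) (\<rho> 2) (tri_side (\<rho> 3) (\<rho> 4) t) *
    cos (of_int (l 1 + l 2) * tri_angle (\<rho> 3) (\<rho> 4) (tri_side (\<rho> 3) (\<rho> 4) t) - of_int (l 3) * t)"
  have d1: "diag 4 \<rho> \<beta> 1 = tri_side (\<rho> 3) (\<rho> 4) (\<beta> 1)" and d2: "diag 4 \<rho> \<beta> 2 = \<rho> 4" for \<beta>
    using diag_step[of 1 4 \<rho> \<beta>] diag_last[of 4 2 \<rho> \<beta>] by (simp_all add: numeral_2_eq_2 numeral_3_eq_3)
  have f: "angle_factor 4 l \<rho> 1 \<beta> = cos (of_int (l 1 + l 2) * tri_angle (\<rho> 3) (\<rho> 4) (diag 4 \<rho> \<beta> 1) - of_int (l 3) * \<beta> 1)" for \<beta>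
  proof -
    have S: "{1 + 1..4 - 2 :: nat} = {2}" by auto
    have L: "(\<Sum>i=1..2. l i) = l 1 + l 2" by (simp add: numeral_2_eq_2)
    have n: "2 + 1 = (3 :: nat)" "2 - 1 = (1 :: nat)" by simp_all
    have "angle_factor 4 l \<rho> 1 \<beta> = cos (tri_angle (\<rho> (2 + 1)) (diag 4 \<rho> \<beta> (2 - 1)) (diag 4 \<rho> \<beta> 2) * of_int (\<Sum>i=1..2. l i)
        - of_int (l (2 + 1)) * \<beta> (2 - 1))"
      unfolding angle_factor_def S by simp
    then show ?thesis
      unfolding L n d2 tri_angle_commute[of "\<rho> 3" "diag 4 \<rho> \<beta> 1" "\<rho> 4"] by (simp only: mult.commute)
  qed
  have "multilateral_integrand 4 l \<rho> = (\<lambda>\<beta>. ?g (\<beta> 1))"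
    unfolding multilateral_integrand_eq[abs_def] f d1 by simp
  with int have "integrable (angle_cube {1}) (\<lambda>\<beta>. ?g (\<beta> 1))" by simp
  moreover have "(\<integral>\<^sup>+\<beta>. ennreal (norm (?g (\<beta> 1))) \<partial>angle_cube {1}) = (\<integral>\<^sup>+t. ennreal (norm (?g t)) \<partial>angle_interval)"
    by (rule A.product_nn_integral_singleton) measurable
  ultimately show ?thesis unfolding integrable_iff_bounded by auto
qed

theorem theorem3:
  fixes p :: nat and l :: "nat \<Rightarrow> int" and \<rho> :: "nat \<Rightarrow> real"
  assumes "p \<ge> 4"
    and "\<And>k. k \<in> {1..p} \<Longrightarrow> \<rho> k > 0"
    and "\<exists>\<kappa>. is_multilateral p \<rho> \<kappa>"
    and "p = 4 \<Longrightarrow>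
      set_integrable (angle_measure p) (angle_domain p) (multilateral_integrand p l \<rho>)"
  shows "set_integrable (angle_measure p) (angle_domain p) (multilateral_integrand p l \<rho>) \<and>
    has_improper_integral (bessel_integrand p l \<rho>)
      (1 / pi ^ (p - 2) *
        set_lebesgue_integral (angle_measure p) (angle_domain p) (multilateral_integrand p l \<rho>))"
proof -
  let ?a = "\<rho> 1" and ?b = "\<rho> 2"
  note p = assms(1) and \<rho> = assms(2)
  have ab: "0 < ?a" "0 < ?b" using \<rho> p by auto
  have m1: "(\<lambda>t. cos (of_int (l 1) * tri_angle ?b ?a (tri_side ?a ?b t) - of_int (l 2) * tri_angle ?a ?b (tri_side ?a ?b t))) \<in> borel_measurable borel"
    by measurable
  \<comment> \<open>The three cases (at least five sides, four sides without coincidence, the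
    exceptional quadrilateral) differ only in the majorant \<open>D\<close> and its
    finiteness.\<close>
  have "\<exists>C D. 0 \<le> C \<and> D \<in> borel_measurable borel \<and> (\<forall>s. 0 \<le> D s) \<and>
     (\<integral>\<^sup>+\<beta>. ennreal (D (diag p \<rho> \<beta> 1)) \<partial>angle_cube {1..p - 3}) < \<infinity> \<and>
     (\<forall>d s. 0 < d \<longrightarrow> 0 < s \<longrightarrow> s \<noteq> ?a + ?b \<longrightarrow> s \<noteq> \<bar>?a - ?b\<bar> \<longrightarrow>
        \<bar>triple_mean (l 1) (l 2) ?a ?b (d\<^sup>2) s\<bar> \<le> C * D s)"
  proof -
    obtain C where C: "0 \<le> C"
      "\<And>c \<nu> d s. c \<in> borel_measurable borel \<Longrightarrow> (\<And>t. \<bar>c t\<bar> \<le> 1) \<Longrightarrow> 0 < d \<Longrightarrow> 0 < s \<Longrightarrow> s \<notin> {?a + ?b, \<bar>?a - ?b\<bar>} \<Longrightarrow>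
        \<bar>LINT t|angle_interval. c t * heat_kernel \<nu> (d\<^sup>2) (tri_side ?a ?b t) s\<bar> \<le> C * (isq s * (isq (s - (?a + ?b)) + isq (s - \<bar>?a - ?b\<bar>)))"
      using heat_kernel_dominated[OF ab] by blast
    have bd: "\<bar>triple_mean (l 1) (l 2) ?a ?b (d\<^sup>2) s\<bar> \<le> C / pi * side_majorant ?a ?b s"
      if "0 < d" "0 < s" "s \<noteq> ?a + ?b" "s \<noteq> \<bar>?a - ?b\<bar>" for d s
    proof -
      have d2: "0 < d\<^sup>2" using that by simp
      show ?thesis unfolding triple_mean_eq[OF d2 ab] abs_divide side_majorant_def
        using C(2)[OF m1 _ that(1,2), of "l 1 + l 2"] that by (simp add: divide_right_mono)
    qed
    have generic: ?thesis
      if "(\<integral>\<^sup>+\<beta>. ennreal (side_majorant ?a ?b (diag p \<rho> \<beta> 1)) \<partial>angle_cube {1..p - 3}) < \<infinity>"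
      by (intro exI[of _ "C / pi"] exI[of _ "side_majorant ?a ?b"] conjI allI impI bd that)
        (use C in \<open>auto simp: side_majorant_def isq_nonneg\<close>)
    show ?thesis
    proof (cases "p = 4")
      case False
      then show ?thesis using p by (intro generic nn_integral_side_majorant_finite[OF \<rho> _ ab]) auto
    next
      case True
      let ?c = "\<rho> 3" and ?e = "\<rho> 4"
      have ce: "0 < ?c" "0 < ?e" using \<rho> True by auto
      obtain \<kappa> where "is_multilateral p \<rho> \<kappa>" using assms(3) by blast
      then have tri: "is_triangle ?a ?b (\<kappa> 1)" "is_triangle (\<kappa> 1) ?c ?e"
        using True by (auto simp: is_multilateral_def numeral_2_eq_2 numeral_3_eq_3)
      \<comment> \<open>The diagonal of the given quadrilateral lies strictly inside the ranges of
        both triangles, so the ranges overlap.\<close>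
      have quad: "\<bar>?c - ?e\<bar> < ?a + ?b" "\<bar>?a - ?b\<bar> < ?c + ?e"
        using tri by (auto simp: is_triangle_def)
      have "integrable (angle_cube {1..4 - 3}) (multilateral_integrand 4 l \<rho>)"
        using assms(4) True multilateral_integrand_angle_cube(1)[of 4 l \<rho>] by simp
      from quadrilateral_coincidence[OF ab ce integrable_quadrilateral[OF this] quad]
      have ne1: "?a + ?b \<noteq> ?c + ?e" and ne2: "\<bar>?a - ?b\<bar> \<noteq> \<bar>?c - ?e\<bar> \<or> ?a = ?b \<and> ?c = ?e \<and> odd (l 1 + l 2)"
        by auto
      have fin: "(\<integral>\<^sup>+t. ennreal (isq (tri_side ?c ?e t) * isq (tri_side ?c ?e t - q)) * indicator {0<..<pi} t \<partial>lborel) < \<infinity>"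
        if "q \<noteq> ?c + ?e" "q \<noteq> \<bar>?c - ?e\<bar>" for q
        by (rule nn_integral_tri_side_isq_finite[OF ce that])
      show ?thesis
      proof (cases "\<bar>?a - ?b\<bar> = \<bar>?c - ?e\<bar>")
        case False
        let ?f = "\<lambda>q t. ennreal (isq (tri_side ?c ?e t) * isq (tri_side ?c ?e t - q)) * indicator {0<..<pi} t"
        have "(\<integral>\<^sup>+\<beta>. ennreal (side_majorant ?a ?b (diag 4 \<rho> \<beta> 1)) \<partial>angle_cube {1..4 - 3}) =
            (\<integral>\<^sup>+t. ennreal (side_majorant ?a ?b (tri_side ?c ?e t)) * indicator {0<..<pi} t \<partial>lborel)"
          by (rule nn_integral_diag_quadrilateral) measurable
        also have "\<dots> = (\<integral>\<^sup>+t. ?f (?a + ?b) t + ?f \<bar>?a - ?b\<bar> t \<partial>lborel)"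
        proof (rule nn_integral_cong)
          fix t
          have "side_majorant ?a ?b (tri_side ?c ?e t) = isq (tri_side ?c ?e t) * isq (tri_side ?c ?e t - (?a + ?b)) + isq (tri_side ?c ?e t) * isq (tri_side ?c ?e t - \<bar>?a - ?b\<bar>)"
            by (simp add: side_majorant_def distrib_left)
          then show "ennreal (side_majorant ?a ?b (tri_side ?c ?e t)) * indicator {0<..<pi} t = ?f (?a + ?b) t + ?f \<bar>?a - ?b\<bar> t"
            by (simp add: ennreal_plus isq_nonneg distrib_right)
        qed
        also have "\<dots> = (\<integral>\<^sup>+t. ?f (?a + ?b) t \<partial>lborel) + (\<integral>\<^sup>+t. ?f \<bar>?a - ?b\<bar> t \<partial>lborel)"
          by (rule nn_integral_add) auto
        also have "\<dots> < \<infinity>"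
          using fin[of "?a + ?b"] fin[of "\<bar>?a - ?b\<bar>"] ne1 False quad by simp
        finally show ?thesis using True by (intro generic) simp
      next
        \<comment> \<open>The general majorant would have the square of an inverse root at 0. By
          \<open>isosceles_cos_bound\<close> the weight vanishes there, and only the singularity at
          \<open>2 a\<close> remains in addition to \<open>isq s\<close>; it is neither of the
          extreme values 0 and \<open>2 c\<close> of the diagonal.\<close>
        case eq: True
        then have abe: "?a = ?b" "?c = ?e" "odd (l 1 + l 2)" using ne2 by auto
        let ?Mo = "\<bar>of_int (l 1 - l 2)\<bar> / ?a"
        have Mo: "0 \<le> ?Mo" using ab by simp
        obtain C' where C': "0 \<le> C'"
          "\<And>c \<nu> d s. c \<in> borel_measurable borel \<Longrightarrow> (\<And>t. \<bar>c t\<bar> \<le> 1) \<Longrightarrow>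
            (\<And>t. 0 < t \<Longrightarrow> t < pi \<Longrightarrow> \<bar>c t\<bar> \<le> ?Mo * tri_side ?a ?a t) \<Longrightarrow> 0 < d \<Longrightarrow> 0 < s \<Longrightarrow> s \<noteq> ?a + ?a \<Longrightarrow>
            \<bar>LINT t|angle_interval. c t * heat_kernel \<nu> (d\<^sup>2) (tri_side ?a ?a t) s\<bar> \<le> C' * (isq s * isq (s - (?a + ?a)))"
          using heat_kernel_dominated_isosceles[OF ab(1) Mo] by blast
        let ?D = "\<lambda>s. isq s * isq (s - (?a + ?a))"
        have bd': "\<bar>triple_mean (l 1) (l 2) ?a ?b (d\<^sup>2) s\<bar> \<le> C' / pi * ?D s"
          if "0 < d" "0 < s" "s \<noteq> ?a + ?b" for d s
        proof -
          have d2: "0 < d\<^sup>2" using that by simp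
          have "\<bar>LINT t|angle_interval. cos (of_int (l 1) * tri_angle ?a ?a (tri_side ?a ?a t) - of_int (l 2) * tri_angle ?a ?a (tri_side ?a ?a t))
              * heat_kernel (l 1 + l 2) (d\<^sup>2) (tri_side ?a ?a t) s\<bar> \<le> C' * ?D s"
            by (rule C'(2)) (use that abe isosceles_cos_bound[OF ab(1) abe(3)] in auto)
          then have "\<bar>triple_mean (l 1) (l 2) ?a ?a (d\<^sup>2) s\<bar> \<le> C' * ?D s / pi"
            unfolding triple_mean_eq[OF d2 ab(1) ab(1)] abs_divide by (simp add: divide_right_mono)
          then show ?thesis by (simp only: abe(1)[symmetric] times_divide_eq_left)
        qed
        have "(\<integral>\<^sup>+\<beta>. ennreal (?D (diag 4 \<rho> \<beta> 1)) \<partial>angle_cube {1..4 - 3}) =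
            (\<integral>\<^sup>+t. ennreal (?D (tri_side ?c ?e t)) * indicator {0<..<pi} t \<partial>lborel)"
          by (rule nn_integral_diag_quadrilateral) measurable
        also have "\<dots> < \<infinity>" by (rule fin) (use ne1 abe ab in auto)
        finally have "(\<integral>\<^sup>+\<beta>. ennreal (?D (diag p \<rho> \<beta> 1)) \<partial>angle_cube {1..p - 3}) < \<infinity>" using True by simp
        then show ?thesis
          by (intro exI[of _ "C' / pi"] exI[of _ ?D] conjI allI impI bd')
            (use C' in \<open>auto simp: isq_nonneg\<close>)
      qed
    qed
  qed
  then obtain C D where CD: "0 \<le> C" "D \<in> borel_measurable borel" "\<And>s. 0 \<le> D s"
     "(\<integral>\<^sup>+\<beta>. ennreal (D (diag p \<rho> \<beta> 1)) \<partial>angle_cube {1..p - 3}) < \<infinity>"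
     "\<And>d s. 0 < d \<Longrightarrow> 0 < s \<Longrightarrow> s \<noteq> ?a + ?b \<Longrightarrow> s \<noteq> \<bar>?a - ?b\<bar> \<Longrightarrow>
        \<bar>triple_mean (l 1) (l 2) ?a ?b (d\<^sup>2) s\<bar> \<le> C * D s"
    by blast
  show ?thesis
    unfolding multilateral_integrand_angle_cube
    using gauss_sum_tendsto_multilateral(1)[OF \<rho> p CD]
      has_improper_integral_bessel_integrand[OF \<rho> p gauss_sum_tendsto_multilateral(2)[OF \<rho> p CD]]
    by blast
qed

end
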